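(* Let $N\in\mathbb{N}$, $p,q>1$, $a,b>0$, and let $G_1,G_2\in C^1(\mathbb{R})$ satisfy $G_1(0)=G_2(0)=0$, $G_1(s)\ge a|s|^q$ and $G_2(\sigma)\ge b|\sigma|^p$ for all $s,\sigma\in\mathbb{R}$. Let $f_1,g_1,f_2,g_2\in C_c^\infty(\mathbb{R}^N)$ with $\int_{\mathbb{R}^N}g_1\,dx>0$ and $\int_{\mathbb{R}^N}g_2\,dx>0$, and put $r_0=\sup\{|x|\;;\;x\in\operatorname{supp}(f_1,f_2,g_1,g_2)\}$. Assume $$\Gamma_{SG}(N,p,q)=\max\{F_{SG,1}(N,p,q),F_{SG,2}(N,p,q)\}\ge0.$$ Then there exist constants $\varepsilon_0>0$ and $C>0$, independent of $\varepsilon$, such that the following holds for every $\varepsilon\in(0,\varepsilon_0]$: if $(u,v)$ is a weak solution in $(0,T)$ of $$\begin{cases}\partial_t^2u-\Delta u=G_1(v),\quad\partial_t^2v-\Delta v=G_2(\partial_tu)&\text{in }\mathbb{R}^N\times(0,T),\\ u(0)=\varepsilon f_1,\ \partial_tu(0)=\varepsilon g_1,\ v(0)=\varepsilon f_2,\ \partial_tv(0)=\varepsilon g_2\end{cases}$$ satisfying $\operatorname{supp}(u,v)\subset\{(x,t)\in\mathbb{R}^N\times[0,T)\;;\;|x|\le r_0+t\}$, then $$T\le\begin{cases}C\varepsilon^{-\Gamma_{SG}(N,p,q)^{-1}}&\text{if }\Gamma_{SG}(N,p,q)>0,\\ \exp(C\varepsilon^{-p(pq-1)})&\text{if }F_{SG,1}(N,p,q)=0>F_{SG,2}(N,p,q),\\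 \exp(C\varepsilon^{-q(pq-1)})&\text{if }F_{SG,1}(N,p,q)<0=F_{SG,2}(N,p,q),\\ \exp(C\varepsilon^{-(pq-1)})&\text{if }F_{SG,1}(N,p,q)=0=F_{SG,2}(N,p,q).\end{cases}$$
   Context: Set $$F_{SG,1}(N,p,q)=\Big(\frac1p+1+q\Big)(pq-1)^{-1}-\frac{N-1}{2},\qquad F_{SG,2}(N,p,q)=\Big(2+\frac1q\Big)(pq-1)^{-1}-\frac{N-1}{2}.$$ Weak solution in $(0,T)$: a pair $(u,v)\in C([0,T);(H^1(\mathbb{R}^N))^2)\cap C^1([0,T);(L^2(\mathbb{R}^N))^2)$ with $G_2(\partial_tu),G_1(v)\in L^1(0,T;L^1(\mathbb{R}^N))$, $(u,v)(0)=(\varepsilon f_1,\varepsilon f_2)$, $(\partial_tu,\partial_tv)(0)=(\varepsilon g_1,\varepsilon g_2)$, such that for every $\Psi\in C_c^\infty(\mathbb{R}^N\times[0,T))$, $$\varepsilon\int_{\mathbb{R}^N}g_1\Psi(x,0)\,dx+\int_0^T\!\!\int_{\mathbb{R}^N}G_1(v)\Psi\,dx\,dt=\int_0^T\!\!\int_{\mathbb{R}^N}(-\partial_tu\,\partial_t\Psi+\nabla u\cdot\nabla\Psi)\,dx\,dt,$$ $$\varepsilon\int_{\mathbb{R}^N}g_2\Psi(x,0)\,dx+\int_0^T\!\!\int_{\mathbb{R}^N}G_2(\partial_tu)\Psi\,dx\,dt=\int_0^T\!\!\int_{\mathbb{R}^N}(-\partial_tv\,\partial_t\Psi+\nabla v\cdot\nabla\Psi)\,dx\,dt.$$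 *)

theory Defs
  imports "HOL-Analysis.Analysis"
begin

definition F_SG1 :: "nat \<Rightarrow> real \<Rightarrow> real \<Rightarrow> real" where
  "F_SG1 N p q = (1 / p + 1 + q) * inverse (p * q - 1) - (real N - 1) / 2"

definition F_SG2 :: "nat \<Rightarrow> real \<Rightarrow> real \<Rightarrow> real" where
  "F_SG2 N p q = (2 + 1 / q) * inverse (p * q - 1) - (real N - 1) / 2"

definition Gamma_SG :: "nat \<Rightarrow> real \<Rightarrow> real \<Rightarrow> real" where
  "Gamma_SG N p q = max (F_SG1 N p q) (F_SG2 N p q)"


section \<open>Smooth functions and test functions\<close>

definition supp :: "('a::topological_space \<Rightarrow> 'b::zero) \<Rightarrow> 'a set" where
  "supp f = closure {x. f x \<noteq> 0}"

fun Ck :: "nat \<Rightarrow> ('a::euclidean_space \<Rightarrow> real) \<Rightarrow> bool" where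
  "Ck 0 f \<longleftrightarrow> continuous_on UNIV f"
| "Ck (Suc k) f \<longleftrightarrow> (\<forall>x. f differentiable (at x)) \<and>
     (\<forall>h. Ck k (\<lambda>x. frechet_derivative f (at x) h))"

definition smooth :: "('a::euclidean_space \<Rightarrow> real) \<Rightarrow> bool" where
  "smooth f \<longleftrightarrow> (\<forall>k. Ck k f)"

definition Cc_infinity :: "('a::euclidean_space \<Rightarrow> real) set" where
  "Cc_infinity = {f. smooth f \<and> compact (supp f)}"

definition grad :: "('a::euclidean_space \<Rightarrow> real) \<Rightarrow> 'a \<Rightarrow> 'a" where
  "grad f x = (\<Sum>b\<in>Basis. frechet_derivative f (at x) b *\<^sub>R b)"

text \<open>The interval \<open>[0,T)\<close>, where \<open>T = \<infinity>\<close> is allowed. The open interval \<open>(0,T)\<close> is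
  the library's \<open>einterval 0 T\<close>.\<close>

definition time_dom :: "ereal \<Rightarrow> real set" where
  "time_dom T = {t. 0 \<le> t \<and> ereal t < T}"

text \<open>Test functions of class \<open>C\<^sub>c\<^sup>\<infinity>\<close> on \<open>\<real>\<^sup>N \<times> [0,T)\<close>, smooth up to and not required to vanish
  at \<open>t = 0\<close>. They are represented by smooth extensions to negative times; only the values at
  \<open>t \<ge> 0\<close> are used in the weak formulation.\<close>

definition test_functions :: "ereal \<Rightarrow> ('a::euclidean_space \<times> real \<Rightarrow> real) set" where
  "test_functions T = {\<Psi> \<in> Cc_infinity. supp \<Psi> \<subseteq> {(x, t). ereal t < T}}"


section \<open>Square integrable functions and the Sobolev space\<close>

text \<open>Elements of Lebesgue and Sobolev spaces are represented by functions defined everywhere;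
  no notion below depends on the choice of representatives.\<close>

definition L2 :: "('a::euclidean_space \<Rightarrow> 'b::euclidean_space) set" where
  "L2 = {f. f \<in> borel_measurable lebesgue \<and> integrable lebesgue (\<lambda>x. (norm (f x))\<^sup>2)}"

definition L2_norm :: "('a::euclidean_space \<Rightarrow> 'b::euclidean_space) \<Rightarrow> real" where
  "L2_norm f = sqrt (LINT x|lebesgue. (norm (f x))\<^sup>2)"

definition is_weak_grad :: "('a::euclidean_space \<Rightarrow> real) \<Rightarrow> ('a \<Rightarrow> 'a) \<Rightarrow> bool" where
  "is_weak_grad f g \<longleftrightarrow> (\<forall>\<phi>\<in>Cc_infinity.
     (LINT x|lebesgue. f x *\<^sub>R grad \<phi> x) = - (LINT x|lebesgue. \<phi> x *\<^sub>R g x))"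

definition H1 :: "('a::euclidean_space \<Rightarrow> real) set" where
  "H1 = {f \<in> L2. \<exists>g\<in>L2. is_weak_grad f g}"

text \<open>The weak gradient of \<open>f \<in> H1\<close>, unique up to null sets.\<close>

definition weak_grad :: "('a::euclidean_space \<Rightarrow> real) \<Rightarrow> 'a \<Rightarrow> 'a" where
  "weak_grad f = (SOME g. g \<in> L2 \<and> is_weak_grad f g)"

definition H1_norm :: "('a::euclidean_space \<Rightarrow> real) \<Rightarrow> real" where
  "H1_norm f = sqrt ((L2_norm f)\<^sup>2 + (L2_norm (weak_grad f))\<^sup>2)"


section \<open>Functions of time with values in function spaces\<close>

definition C_L2 :: "ereal \<Rightarrow> (real \<Rightarrow> 'a::euclidean_space \<Rightarrow> real) set" where
  "C_L2 T = {w. \<forall>t\<in>time_dom T. w t \<in> L2 \<and>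
     ((\<lambda>s. L2_norm (\<lambda>x. w s x - w t x)) \<longlongrightarrow> 0) (at t within time_dom T)}"

definition C_H1 :: "ereal \<Rightarrow> (real \<Rightarrow> 'a::euclidean_space \<Rightarrow> real) set" where
  "C_H1 T = {w. \<forall>t\<in>time_dom T. w t \<in> H1 \<and>
     ((\<lambda>s. H1_norm (\<lambda>x. w s x - w t x)) \<longlongrightarrow> 0) (at t within time_dom T)}"

definition has_L2_derivative ::
  "ereal \<Rightarrow> (real \<Rightarrow> 'a::euclidean_space \<Rightarrow> real) \<Rightarrow> ('a \<Rightarrow> real) \<Rightarrow> real \<Rightarrow> bool" where
  "has_L2_derivative T w w' t \<longleftrightarrow> w' \<in> L2 \<and>
     ((\<lambda>s. L2_norm (\<lambda>x. (w s x - w t x) / (s - t) - w' x)) \<longlongrightarrow> 0) (at t within time_dom T)"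

definition time_deriv ::
  "ereal \<Rightarrow> (real \<Rightarrow> 'a::euclidean_space \<Rightarrow> real) \<Rightarrow> real \<Rightarrow> 'a \<Rightarrow> real" where
  "time_deriv T w t = (SOME w'. has_L2_derivative T w w' t)"

definition C1_L2 :: "ereal \<Rightarrow> (real \<Rightarrow> 'a::euclidean_space \<Rightarrow> real) set" where
  "C1_L2 T = {w \<in> C_L2 T. (\<forall>t\<in>time_dom T. \<exists>w'. has_L2_derivative T w w' t) \<and>
     time_deriv T w \<in> C_L2 T}"

text \<open>The Bochner space \<open>L\<^sup>1(0,T; L\<^sup>1)\<close>: almost everywhere limits of simple functions with
  values in \<open>L\<^sup>1\<close> (strong measurability), with integrable norm.\<close>

definition simple_L1_valued :: "(real \<Rightarrow> 'a::euclidean_space \<Rightarrow> real) set" where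
  "simple_L1_valued = {s. \<exists>(k::nat) A h.
     (\<forall>i<k. A i \<in> sets lebesgue \<and> integrable lebesgue (h i)) \<and>
     s = (\<lambda>t x. \<Sum>i<k. indicator (A i) t * h i x)}"

definition L1_L1 :: "ereal \<Rightarrow> (real \<Rightarrow> 'a::euclidean_space \<Rightarrow> real) set" where
  "L1_L1 T = {w.
     (AE t in lebesgue. t \<in> einterval 0 T \<longrightarrow> integrable lebesgue (w t)) \<and>
     (\<exists>s. (\<forall>n. s n \<in> simple_L1_valued) \<and>
        (AE t in lebesgue. t \<in> einterval 0 T \<longrightarrow>
          (\<lambda>n::nat. LINT x|lebesgue. \<bar>w t x - s n t x\<bar>) \<longlonglongrightarrow> 0)) \<and>
     set_integrable lebesgue (einterval 0 T) (\<lambda>t. LINT x|lebesgue. \<bar>w t x\<bar>)}"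

text \<open>The support, within \<open>\<real>\<^sup>N \<times> [0,T)\<close>, of a function defined up to null sets: the complement
  of the largest relatively open set on which it vanishes almost everywhere.\<close>

definition spacetime_supp ::
  "ereal \<Rightarrow> (real \<Rightarrow> 'a::euclidean_space \<Rightarrow> 'b::zero) \<Rightarrow> ('a \<times> real) set" where
  "spacetime_supp T w = {(x, t). t \<in> time_dom T \<and>
     \<not> (\<exists>W. open W \<and> (x, t) \<in> W \<and>
          (AE s in lebesgue. s \<in> time_dom T \<longrightarrow>
            (AE y in lebesgue. (y, s) \<in> W \<longrightarrow> w s y = 0)))}"


section \<open>Weak solutions\<close>

definition weak_identity ::
  "ereal \<Rightarrow> real \<Rightarrow> ('a::euclidean_space \<Rightarrow> real) \<Rightarrow> (real \<Rightarrow> 'a \<Rightarrow> real) \<Rightarrow>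
   (real \<Rightarrow> 'a \<Rightarrow> real) \<Rightarrow> ('a \<times> real \<Rightarrow> real) \<Rightarrow> bool" where
  "weak_identity T \<epsilon> g F w \<Psi> \<longleftrightarrow>
     \<epsilon> * (LINT x|lebesgue. g x * \<Psi> (x, 0)) +
     (LINT t:einterval 0 T|lebesgue. (LINT x|lebesgue. F t x * \<Psi> (x, t))) =
     (LINT t:einterval 0 T|lebesgue. (LINT x|lebesgue.
        - time_deriv T w t x * deriv (\<lambda>s. \<Psi> (x, s)) t +
        weak_grad (w t) x \<bullet> grad (\<lambda>y. \<Psi> (y, t)) x))"

definition weak_solution ::
  "(real \<Rightarrow> real) \<Rightarrow> (real \<Rightarrow> real) \<Rightarrow>
   ('a::euclidean_space \<Rightarrow> real) \<Rightarrow> ('a \<Rightarrow> real) \<Rightarrow> ('a \<Rightarrow> real) \<Rightarrow> ('a \<Rightarrow> real) \<Rightarrow> real \<Rightarrow> ereal \<Rightarrow>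
   (real \<Rightarrow> 'a \<Rightarrow> real) \<Rightarrow> (real \<Rightarrow> 'a \<Rightarrow> real) \<Rightarrow> bool" where
  "weak_solution G1 G2 f1 g1 f2 g2 \<epsilon> T u v \<longleftrightarrow>
     u \<in> C_H1 T \<and> v \<in> C_H1 T \<and> u \<in> C1_L2 T \<and> v \<in> C1_L2 T \<and>
     (\<lambda>t x. G2 (time_deriv T u t x)) \<in> L1_L1 T \<and>
     (\<lambda>t x. G1 (v t x)) \<in> L1_L1 T \<and>
     (AE x in lebesgue. u 0 x = \<epsilon> * f1 x) \<and>
     (AE x in lebesgue. v 0 x = \<epsilon> * f2 x) \<and>
     (AE x in lebesgue. time_deriv T u 0 x = \<epsilon> * g1 x) \<and>
     (AE x in lebesgue. time_deriv T v 0 x = \<epsilon> * g2 x) \<and>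
     (\<forall>\<Psi>\<in>test_functions T.
        weak_identity T \<epsilon> g1 (\<lambda>t x. G1 (v t x)) u \<Psi> \<and>
        weak_identity T \<epsilon> g2 (\<lambda>t x. G2 (time_deriv T u t x)) v \<Psi>)"

end

theory Submission
  imports Defs
begin

text \<open>For \<open>\<tau> = \<sigma> + t\<close> and suitable power series \<open>F\<close> the functions
  \<open>phi \<sigma> \<beta> (x, t) = \<tau> powr -\<beta> * F (\<bar>x\<bar>\<^sup>2 / \<tau>\<^sup>2)\<close> solve the wave equation in the light cone \<open>\<bar>x\<bar> < \<tau>\<close>, and
  differentiating in \<open>t\<close> maps \<open>phi \<sigma> \<beta>\<close> to \<open>-\<beta> phi \<sigma> (\<beta> + 1)\<close>. Testing the two equations with
  products of a cutoff in \<open>\<tau>\<close> and powers of \<open>\<tau>\<close> or functions \<open>phi\<close>, and applying Hoelder's inequality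
  in the cone, one bounds the weighted integrals \<open>X\<close> of \<open>G1 (v)\<close> and \<open>Y\<close> of \<open>G2 (\<partial>\<^sub>t u)\<close> by
  \<open>X \<le> C a1 Y powr (1/p)\<close> and \<open>Y \<le> C a2 X powr (1/q)\<close>. For \<open>\<sigma>\<close> large the initial data enter with a
  positive sign, which gives \<open>\<epsilon> \<le> C a3 Y powr (1/p)\<close>; eliminating \<open>X\<close> and \<open>Y\<close> bounds a power of \<open>\<epsilon>\<close> by
  \<open>a1 powr (1/q) * a2 * a3 powr (p - 1/q)\<close> (or the same with the two equations exchanged). With a
  cutoff between \<open>R/2\<close> and \<open>R\<close> this product is a power of \<open>R\<close> with exponent proportional to \<open>-F\<close>. In the
  critical cases the powers of \<open>R\<close> cancel, and a cutoff between \<open>\<surd>R\<close> and \<open>R\<close> that is smooth in \<open>ln \<tau>\<close>,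
  with weights of the critical decay, leaves a negative power of \<open>ln R\<close>.\<close>

section \<open>Smooth functions\<close>

text \<open>The second nonlinearity controls only \<open>\<partial>\<^sub>t u\<close>, never
  \<open>u\<close>. Hence the first equation is tested either with a time derivative, whose
  Laplacian is moved back by an integration by parts in time, or with a function of time alone; in
  both ways \<open>u\<close> disappears from the space-time integrals. With n = (N - 1) / 2 and
  \<beta> > n, \<open>phi\<close> grows near the light cone at most like \<tau>^-n (\<tau> - |x|)^(n
  - \<beta>). Taking \<sigma> \<ge> r0 + 2 keeps \<tau> - |x| \<ge> 2 on the support of the
  solution, so the singularity does no harm, yet it concentrates the weight near the boundary. Each
  Hoelder estimate integrates (\<tau> - |x|)^-\<nu> over a ball of radius \<tau> - 1: \<nu> = 0
  gives \<tau>^N, \<nu> \<ge> 2 gives \<tau>^(N - 1), and the borderline \<nu> = 1 gives an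
  additional logarithm. The dyadic argument lives on the first two. In the critical cases the
  borderline weight is what closes the loop between X and Y; it costs a logarithm, while a
  derivative of the logarithmic cutoff, of first or second order, gains one.\<close>

fun Ck_on :: "nat \<Rightarrow> 'a::euclidean_space set \<Rightarrow> ('a \<Rightarrow> real) \<Rightarrow> bool" where
  "Ck_on 0 S f \<longleftrightarrow> continuous_on S f"
| "Ck_on (Suc k) S f \<longleftrightarrow> (\<forall>x\<in>S. f differentiable (at x)) \<and>
     (\<forall>h. Ck_on k S (\<lambda>x. frechet_derivative f (at x) h))"

text \<open>A local notion is needed because powers, the logarithm and \<open>phi\<close> are smooth
  only on open sets such as the half-line or the light cone, whereas \<open>smooth\<close> speaks of
  the whole space.\<close>

definition smooth_on :: "'a::euclidean_space set \<Rightarrow> ('a \<Rightarrow> real) \<Rightarrow> bool" where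
  "smooth_on S f \<longleftrightarrow> (\<forall>k. Ck_on k S f)"

lemma Ck_iff_Ck_on: "Ck k f \<longleftrightarrow> Ck_on k UNIV f"
  by (induction k arbitrary: f) auto

lemma smooth_iff_smooth_on: "smooth f \<longleftrightarrow> smooth_on UNIV f"
  by (simp add: smooth_def smooth_on_def Ck_iff_Ck_on)

text \<open>The set of possible derivatives at \<open>x\<close> depends only on the germ of the
  function, so the choice made by \<open>frechet_derivative\<close> is the same for \<open>f\<close>
  and \<open>g\<close>, whether or not they are differentiable there.\<close>

lemma frechet_derivative_cong_open:
  assumes "open S" "x \<in> S" "\<And>y. y \<in> S \<Longrightarrow> f y = g y"
  shows "frechet_derivative f (at x) = frechet_derivative g (at x)"
proof -
  have "(f has_derivative D) (at x) \<longleftrightarrow> (g has_derivative D) (at x)" for D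
    using has_derivative_transform_within_open[OF _ assms(1,2), of f D UNIV g]
      has_derivative_transform_within_open[OF _ assms(1,2), of g D UNIV f] assms(3) by auto
  then show ?thesis by (simp add: frechet_derivative_def)
qed

lemma Ck_on_cong:
  assumes "open S" "\<And>y. y \<in> S \<Longrightarrow> f y = g y"
  shows "Ck_on k S f \<longleftrightarrow> Ck_on k S g"
  using assms(2)
proof (induction k arbitrary: f g)
  case 0
  then show ?case by (auto intro: continuous_on_eq)
next
  case (Suc k)
  have 1: "frechet_derivative f (at x) = frechet_derivative g (at x)" if "x \<in> S" for x
    by (rule frechet_derivative_cong_open[OF assms(1) that]) (use Suc.prems in auto)
  have 2: "f differentiable (at x) \<longleftrightarrow> g differentiable (at x)" if "x \<in> S" for x
    using has_derivative_transform_within_open[OF _ assms(1) that, of f _ UNIV g]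
      has_derivative_transform_within_open[OF _ assms(1) that, of g _ UNIV f] Suc.prems
    unfolding differentiable_def by metis
  have "Ck_on k S (\<lambda>x. frechet_derivative f (at x) h) \<longleftrightarrow>
        Ck_on k S (\<lambda>x. frechet_derivative g (at x) h)" for h
    by (rule Suc.IH) (simp add: 1)
  then show ?case by (simp add: 2)
qed

text \<open>Lets an explicit formula replace the choice term \<open>frechet_derivative\<close> on an
  open set; the smoothness inductions below pass through it.\<close>

lemma Ck_on_SucI:
  assumes "open S" "\<And>x. x \<in> S \<Longrightarrow> (f has_derivative f' x) (at x)" "\<And>h. Ck_on k S (\<lambda>x. f' x h)"
  shows "Ck_on (Suc k) S f"
proof -
  have "Ck_on k S (\<lambda>x. frechet_derivative f (at x) h)" for h
    using Ck_on_cong[OF assms(1), of "\<lambda>x. frechet_derivative f (at x) h" "\<lambda>x. f' x h"]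
      frechet_derivative_at[OF assms(2)] assms(3)[of h] by fastforce
  then show ?thesis using assms(2) by (auto simp: differentiable_def)
qed

lemma Ck_on_SucD: "Ck_on (Suc k) S f \<Longrightarrow> Ck_on k S f"
proof (induction k arbitrary: f)
  case 0
  then show ?case
    by (auto intro!: continuous_at_imp_continuous_on differentiable_imp_continuous_within)
next
  case (Suc k)
  then show ?case by (metis Ck_on.simps(2))
qed

lemma Ck_on_Suc_has_derivative:
  "Ck_on (Suc k) S f \<Longrightarrow> x \<in> S \<Longrightarrow> (f has_derivative frechet_derivative f (at x)) (at x)"
  by (auto simp: frechet_derivative_works)

lemma Ck_on_const: "Ck_on k S (\<lambda>x. c)"
  by (induction k arbitrary: c) auto

lemma Ck_on_add: "open S \<Longrightarrow> Ck_on k S f \<Longrightarrow> Ck_on k S g \<Longrightarrow> Ck_on k S (\<lambda>x. f x + g x)"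
proof (induction k arbitrary: f g)
  case 0 then show ?case by (simp add: continuous_on_add)
next
  case (Suc k)
  show ?case
    by (rule Ck_on_SucI[OF Suc.prems(1) has_derivative_add[OF Ck_on_Suc_has_derivative[OF Suc.prems(2)]
            Ck_on_Suc_has_derivative[OF Suc.prems(3)]]])
      (use Suc in simp_all)
qed

lemma Ck_on_mult: "open S \<Longrightarrow> Ck_on k S f \<Longrightarrow> Ck_on k S g \<Longrightarrow> Ck_on k S (\<lambda>x. f x * g x)"
proof (induction k arbitrary: f g)
  case 0 then show ?case by (simp add: continuous_on_mult)
next
  case (Suc k)
  note D = Ck_on_Suc_has_derivative[OF Suc.prems(2)] Ck_on_Suc_has_derivative[OF Suc.prems(3)]
  have "Ck_on k S (\<lambda>x. frechet_derivative f (at x) h)" "Ck_on k S (\<lambda>x. frechet_derivative g (at x) h)" for h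
    using Suc.prems by simp_all
  then have "Ck_on k S (\<lambda>x. f x * frechet_derivative g (at x) h + frechet_derivative f (at x) h * g x)" for h
    by (intro Ck_on_add Suc.IH Suc.prems(1) Ck_on_SucD[OF Suc.prems(2)] Ck_on_SucD[OF Suc.prems(3)])
  moreover have "((\<lambda>x. f x * g x) has_derivative
      (\<lambda>h. f x * frechet_derivative g (at x) h + frechet_derivative f (at x) h * g x)) (at x)"
    if "x \<in> S" for x
    using that by (intro has_derivative_mult D)
  ultimately show ?case
    by (intro Ck_on_SucI[OF Suc.prems(1)])
qed

lemma frechet_derivative_real:
  fixes g :: "real \<Rightarrow> real"
  assumes "g differentiable (at y)"
  shows "frechet_derivative g (at y) h = h * frechet_derivative g (at y) 1"
proof -
  have "linear (frechet_derivative g (at y))"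
    using assms frechet_derivative_works has_derivative_linear by blast
  from linear_scale[OF this, of h 1] show ?thesis by simp
qed

text \<open>For a real-valued inner function the chain rule gives a product of two scalar functions,
  so the induction closes with \<open>Ck_on_mult\<close> and no vector-valued notion of smoothness
  is required.\<close>

lemma Ck_on_compose:
  assumes "open S" "open U" "\<And>x. x \<in> S \<Longrightarrow> f x \<in> U"
  shows "Ck_on k U g \<Longrightarrow> Ck_on k S f \<Longrightarrow> Ck_on k S (\<lambda>x. g (f x :: real))"
proof (induction k arbitrary: g)
  case 0
  have "f ` S \<subseteq> U" using assms(3) by blast
  then have "continuous_on S (\<lambda>x. g (f x))"
    using 0 continuous_on_compose2[of U g S f] by simp
  then show ?case by simp
next
  case (Suc k)
  show ?case
  proof (rule Ck_on_SucI[OF assms(1)])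
    fix x assume x: "x \<in> S"
    have g: "(g has_derivative frechet_derivative g (at (f x))) (at (f x))"
      using Ck_on_Suc_has_derivative[OF Suc.prems(1) assms(3)[OF x]] .
    have "g differentiable (at (f x))"
      using g by (rule differentiableI)
    then have "frechet_derivative g (at (f x)) = (\<lambda>h. h * frechet_derivative g (at (f x)) 1)"
      by (intro ext frechet_derivative_real)
    with g have "(g has_derivative (\<lambda>h. h * frechet_derivative g (at (f x)) 1)) (at (f x))"
      by (rule has_derivative_eq_rhs)
    from has_derivative_compose[OF Ck_on_Suc_has_derivative[OF Suc.prems(2) x] this]
    show "((\<lambda>x. g (f x)) has_derivative
       (\<lambda>h. frechet_derivative f (at x) h * frechet_derivative g (at (f x)) 1)) (at x)" .
  next
    fix h
    have "Ck_on k S (\<lambda>x. frechet_derivative f (at x) h)"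
      using Suc.prems(2) unfolding Ck_on.simps by blast
    moreover have "Ck_on k U (\<lambda>x. frechet_derivative g (at x) 1)"
      using Suc.prems(1) unfolding Ck_on.simps by blast
    from Suc.IH[OF this Ck_on_SucD[OF Suc.prems(2)]]
    have "Ck_on k S (\<lambda>x. frechet_derivative g (at (f x)) 1)" .
    ultimately show "Ck_on k S (\<lambda>x. frechet_derivative f (at x) h * frechet_derivative g (at (f x)) 1)"
      by (rule Ck_on_mult[OF assms(1)])
  qed
qed

lemma smooth_on_cong: "open S \<Longrightarrow> (\<And>y. y \<in> S \<Longrightarrow> f y = g y) \<Longrightarrow> smooth_on S f \<longleftrightarrow> smooth_on S g"
  using Ck_on_cong unfolding smooth_on_def by blast

lemma smooth_on_const [simp]: "smooth_on S (\<lambda>x. c)"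
  by (simp add: smooth_on_def Ck_on_const)

lemma smooth_on_add: "open S \<Longrightarrow> smooth_on S f \<Longrightarrow> smooth_on S g \<Longrightarrow> smooth_on S (\<lambda>x. f x + g x)"
  by (simp add: smooth_on_def Ck_on_add)

lemma smooth_on_mult: "open S \<Longrightarrow> smooth_on S f \<Longrightarrow> smooth_on S g \<Longrightarrow> smooth_on S (\<lambda>x. f x * g x)"
  by (simp add: smooth_on_def Ck_on_mult)

lemma smooth_on_diff: "open S \<Longrightarrow> smooth_on S f \<Longrightarrow> smooth_on S g \<Longrightarrow> smooth_on S (\<lambda>x. f x - g x)"
  using smooth_on_add[of S f "\<lambda>x. -1 * g x"] smooth_on_mult[of S "\<lambda>x. -1" g] by simp

lemma smooth_on_sum: "open S \<Longrightarrow> (\<And>i. i \<in> I \<Longrightarrow> smooth_on S (f i)) \<Longrightarrow> smooth_on S (\<lambda>x. \<Sum>i\<in>I. f i x)"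
  by (induction I rule: infinite_finite_induct) (auto intro: smooth_on_add)

lemma smooth_on_power: "open S \<Longrightarrow> smooth_on S f \<Longrightarrow> smooth_on S (\<lambda>x. f x ^ k)"
  by (induction k) (auto intro: smooth_on_mult)

lemma smooth_on_compose:
  "open S \<Longrightarrow> open U \<Longrightarrow> smooth_on U g \<Longrightarrow> smooth_on S f \<Longrightarrow> (\<And>x. x \<in> S \<Longrightarrow> f x \<in> U) \<Longrightarrow>
    smooth_on S (\<lambda>x. g (f x :: real))"
  using Ck_on_compose unfolding smooth_on_def by blast

lemma smooth_on_Un:
  assumes "open S" "open T" "smooth_on S f" "smooth_on T f"
  shows "smooth_on (S \<union> T) f"
proof -
  have "Ck_on k S f \<Longrightarrow> Ck_on k T f \<Longrightarrow> Ck_on k (S \<union> T) f" for k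
    by (induction k arbitrary: f) (auto intro: continuous_on_open_Un assms(1,2))
  then show ?thesis using assms by (auto simp: smooth_on_def)
qed

lemma smooth_on_bounded_linear: "bounded_linear f \<Longrightarrow> open S \<Longrightarrow> smooth_on S f"
  unfolding smooth_on_def
proof
  fix k assume f: "bounded_linear f" "open S"
  show "Ck_on k S f"
  proof (cases k)
    case 0 then show ?thesis using f by (simp add: linear_continuous_on)
  next
    case (Suc m)
    then show ?thesis
      using Ck_on_SucI[OF f(2), of f "\<lambda>_. f"] f bounded_linear_imp_has_derivative Ck_on_const by blast
  qed
qed

lemma smooth_on_has_derivative:
  "smooth_on S f \<Longrightarrow> x \<in> S \<Longrightarrow> (f has_derivative frechet_derivative f (at x)) (at x)"
  by (auto simp: smooth_on_def intro: Ck_on_Suc_has_derivative[of 0])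

lemma smooth_on_frechet_derivative:
  "smooth_on S f \<Longrightarrow> smooth_on S (\<lambda>x. frechet_derivative f (at x) h)"
  unfolding smooth_on_def by (metis Ck_on.simps(2))

lemma smooth_on_continuous_on: "smooth_on S f \<Longrightarrow> continuous_on S f"
  unfolding smooth_on_def by (metis Ck_on.simps(1))

text \<open>The induction on the order runs over the whole family at once, so being closed under
  differentiation is enough. It is applied to multiples of powers, to the functions
  \<open>flat p\<close> and to power series.\<close>

lemma smooth_on_derivative_family:
  fixes P :: "(real \<Rightarrow> real) set"
  assumes "open U" "\<And>g. g \<in> P \<Longrightarrow> \<exists>g'\<in>P. \<forall>y\<in>U. (g has_field_derivative g' y) (at y)"
    and "g \<in> P"
  shows "smooth_on U g"
proof -
  have "\<forall>g\<in>P. Ck_on k U g" for k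
  proof (induction k)
    case 0
    show ?case
    proof
      fix g assume "g \<in> P"
      then obtain g' where "\<And>y. y \<in> U \<Longrightarrow> (g has_field_derivative g' y) (at y)"
        using assms(2) by blast
      then show "Ck_on 0 U g"
        by (auto intro!: continuous_at_imp_continuous_on DERIV_isCont)
    qed
  next
    case (Suc k)
    show ?case
    proof
      fix g assume "g \<in> P"
      then obtain g' where g': "g' \<in> P" "\<And>y. y \<in> U \<Longrightarrow> (g has_field_derivative g' y) (at y)"
        using assms(2) by blast
      show "Ck_on (Suc k) U g"
      proof (rule Ck_on_SucI[OF assms(1)])
        show "(g has_derivative (*) (g' y)) (at y)" if "y \<in> U" for y
          using g'(2)[OF that] by (simp add: has_field_derivative_def)
        show "Ck_on k U (\<lambda>x. g' x * h)" for h
          using Suc g'(1) by (intro Ck_on_mult assms Ck_on_const) auto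
      qed
    qed
  qed
  then show ?thesis using assms(3) by (simp add: smooth_on_def)
qed

lemma smooth_on_powr: "smooth_on {0<..} (\<lambda>x. x powr a)"
proof (rule smooth_on_derivative_family[where P="range (\<lambda>(c,a) x. c * x powr a)"])
  show "\<exists>g'\<in>range (\<lambda>(c, a) x. c * x powr a). \<forall>y\<in>{0<..}. (g has_real_derivative g' y) (at y)"
    if g_in: "g \<in> range (\<lambda>(c, a) x. c * x powr a)" for g
  proof -
    obtain c a where g: "g = (\<lambda>x. c * x powr a)"
      using g_in by auto
    have "\<forall>y\<in>{0<..}. (g has_real_derivative (\<lambda>(c,a) x. c * x powr a) (c*a, a-1) y) (at y)"
      unfolding g by (auto intro!: derivative_eq_intros)
    then show ?thesis by blast
  qed
  show "(\<lambda>x. x powr a) \<in> range (\<lambda>(c, a) x. c * x powr a)"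
    by (rule image_eqI[where x="(1,a)"]) auto
qed auto

lemma smooth_on_ln: "smooth_on {0<..} (ln :: real \<Rightarrow> real)"
proof -
  have "Ck_on k {0<..} (ln :: real \<Rightarrow> real)" for k
  proof (cases k)
    case 0 then show ?thesis by (auto intro!: continuous_intros)
  next
    case (Suc m)
    have "Ck_on m {0<..} (\<lambda>x. h * x powr -1)" for h
      using smooth_on_mult[OF _ smooth_on_const smooth_on_powr, of h "-1"] by (auto simp: smooth_on_def)
    moreover have "(ln has_derivative (\<lambda>h. h * x powr -1)) (at x)" if "x \<in> {0<..}" for x :: real
      using that by (auto intro!: derivative_eq_intros simp: powr_minus_divide divide_inverse)
    ultimately show ?thesis unfolding Suc
      using Ck_on_SucI[of "{0<..}" ln "\<lambda>x h. h * x powr -1" m] open_greaterThan by blast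
  qed
  then show ?thesis by (simp add: smooth_on_def)
qed

text \<open>Gluing with zero: the function is smooth on \<open>S\<close> and vanishes on the open
  complement of \<open>C\<close>, and these two open sets cover the space.\<close>

lemma smooth_on_mult_cutoff:
  assumes "open S" "closed C" "C \<subseteq> S" "smooth_on S f" "\<And>x. x \<notin> C \<Longrightarrow> f x = 0"
  shows "smooth f"
proof -
  have "smooth_on (-C) f"
    using smooth_on_cong[of "-C" f "\<lambda>_. 0"] assms by auto
  then have "smooth_on (S \<union> (-C)) f" using assms by (intro smooth_on_Un) auto
  moreover have "S \<union> (-C) = UNIV" using assms by auto
  ultimately show ?thesis by (simp add: smooth_iff_smooth_on)
qed

section \<open>Cutoff functions\<close>

lemma poly_div_exp_tendsto_0:
  fixes p :: "real poly"
  shows "((\<lambda>x. poly p x / exp x) \<longlongrightarrow> 0) at_top"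
proof -
  have "((\<lambda>x. \<Sum>i\<le>degree p. coeff p i * (x ^ i / exp x)) \<longlongrightarrow> (\<Sum>i\<le>degree p. coeff p i * 0)) at_top"
    by (intro tendsto_intros tendsto_power_div_exp_0)
  then show ?thesis by (simp add: poly_altdef sum_divide_distrib)
qed

text \<open>The classical flat function exp (-1/x), multiplied by a polynomial in 1/x: this is the
  smallest natural class containing it that is closed under differentiation.\<close>

definition flat :: "real poly \<Rightarrow> real \<Rightarrow> real" where
  "flat p x = (if x > 0 then poly p (1 / x) / exp (1 / x) else 0)"

text \<open>Differentiating p(1/x) exp(-1/x) gives x^-2 (p - p')(1/x) exp(-1/x), and
  \<open>[:0, 0, 1:]\<close> is the polynomial X^2. Only the origin requires a limit.\<close>

lemma flat_has_derivative:
  "(flat p has_field_derivative flat ([:0, 0, 1:] * (p - pderiv p)) x) (at x)"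
proof (cases x "0::real" rule: linorder_cases)
  case less
  have "((\<lambda>_. 0) has_field_derivative 0) (at x)" by simp
  then have "(flat p has_field_derivative 0) (at x)"
    by (rule has_field_derivative_transform_within_open[where S="{..<0}"]) (use less in \<open>auto simp: flat_def\<close>)
  then show ?thesis using less by (simp add: flat_def)
next
  case greater
  have "((\<lambda>x. poly p (1 / x) / exp (1 / x)) has_field_derivative
      flat ([:0, 0, 1:] * (p - pderiv p)) x) (at x)"
    using greater by (auto intro!: derivative_eq_intros DERIV_chain'[OF _ poly_DERIV]
        simp: flat_def field_simps power2_eq_square)
  then show ?thesis
    by (rule has_field_derivative_transform_within_open[where S="{0<..}"]) (use greater in \<open>auto simp: flat_def\<close>)
next
  case equal
  have l: "((\<lambda>h. (flat p (0 + h) - flat p 0) / h) \<longlongrightarrow> 0) (at_left 0)"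
    by (rule tendsto_eventually) (auto simp: flat_def eventually_at_filter)
  \<comment> \<open>With y = 1/h the difference quotient at 0 becomes y p(y) / exp y, and
    \<open>pCons 0 p\<close> is the polynomial y p(y).\<close>
  have "((\<lambda>h. poly (pCons 0 p) (inverse h) / exp (inverse h)) \<longlongrightarrow> 0) (at_right 0)"
    by (rule filterlim_compose[OF poly_div_exp_tendsto_0 filterlim_inverse_at_top_right])
  then have r: "((\<lambda>h. (flat p (0 + h) - flat p 0) / h) \<longlongrightarrow> 0) (at_right 0)"
    by (rule Lim_transform_eventually) (auto simp: flat_def eventually_at_filter field_simps)
  show ?thesis unfolding equal
    using filterlim_split_at[OF l r] by (simp add: DERIV_def flat_def)
qed

lemma smooth_on_flat: "smooth_on UNIV (flat p)"
proof (rule smooth_on_derivative_family[where P="range flat"])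
  show "\<exists>g'\<in>range flat. \<forall>y\<in>UNIV. (g has_real_derivative g' y) (at y)"
    if g_in: "g \<in> range flat" for g
    using g_in flat_has_derivative by blast
qed auto

lemma smooth_on_real_has_derivative:
  fixes f :: "real \<Rightarrow> real"
  assumes "smooth_on S f" "x \<in> S"
  shows "(f has_field_derivative frechet_derivative f (at x) 1) (at x)"
proof -
  have d: "(f has_derivative frechet_derivative f (at x)) (at x)"
    using assms by (rule smooth_on_has_derivative)
  then have "frechet_derivative f (at x) = (\<lambda>h. h * frechet_derivative f (at x) 1)"
    by (intro ext frechet_derivative_real differentiableI)
  with d have "(f has_derivative (\<lambda>h. h * frechet_derivative f (at x) 1)) (at x)"
    by (rule has_derivative_eq_rhs)
  then show ?thesis unfolding has_field_derivative_def
    by (rule has_derivative_eq_rhs) (simp add: fun_eq_iff mult.commute)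
qed

lemma DERIV_nonpos_antimono:
  fixes f :: "real \<Rightarrow> real"
  assumes "antimono f" "(f has_field_derivative l) (at x)"
  shows "l \<le> 0"
proof (rule ccontr)
  assume "\<not> l \<le> 0"
  then obtain d where "d > 0" "\<forall>h>0. h < d \<longrightarrow> f x < f (x + h)"
    using DERIV_pos_inc_right[OF assms(2)] by auto
  then have "f x < f (x + d / 2)" by auto
  moreover have "f (x + d / 2) \<le> f x" using assms(1) \<open>d > 0\<close> by (auto simp: antimono_def)
  ultimately show False by simp
qed

lemma DERIV_unique_const_open:
  fixes f :: "real \<Rightarrow> real"
  assumes "(f has_field_derivative l) (at x)" "open S" "x \<in> S" "\<And>y. y \<in> S \<Longrightarrow> f y = c"
  shows "l = 0"
proof -
  have "((\<lambda>_. c) has_field_derivative l) (at x)"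
    by (rule has_field_derivative_transform_within_open[OF assms(1-3)]) (simp add: assms(4))
  then show ?thesis using DERIV_unique DERIV_const by blast
qed

lemma bounded_if_zero_outside:
  fixes f :: "real \<Rightarrow> real"
  assumes "continuous_on UNIV f" "\<And>x. x < 0 \<or> x > 1 \<Longrightarrow> f x = 0"
  obtains M where "M > 0" "\<And>x. \<bar>f x\<bar> \<le> M"
proof -
  have "compact (f ` {0..1})"
    using assms(1) by (intro compact_continuous_image) (auto intro: continuous_on_subset)
  then obtain M where M: "M > 0" "\<forall>y\<in>f ` {0..1}. norm y \<le> M"
    using compact_imp_bounded bounded_pos by blast
  show thesis
  proof (rule that[OF M(1)])
    fix x show "\<bar>f x\<bar> \<le> M"
    proof (cases "x < 0 \<or> x > 1")
      case True then show ?thesis using assms(2)[OF True] M(1) by simp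
    next
      case False
      then have "x \<in> {0..1}" by auto
      then show ?thesis using M(2) by auto
    qed
  qed
qed

text \<open>The step is e(1 - x) / (e(x) + e(1 - x)) with the flat function e; the denominator never
  vanishes because x and 1 - x are not both nonpositive.\<close>

lemma smooth_step_exists:
  obtains \<zeta> \<zeta>1 \<zeta>2 :: "real \<Rightarrow> real" and M where "smooth_on UNIV \<zeta>" "M > 0"
    "\<And>x. (\<zeta> has_field_derivative \<zeta>1 x) (at x)" "\<And>x. (\<zeta>1 has_field_derivative \<zeta>2 x) (at x)"
    "\<And>x. 0 \<le> \<zeta> x" "\<And>x. \<zeta> x \<le> 1" "\<And>x. \<zeta>1 x \<le> 0" "\<And>x. \<bar>\<zeta>1 x\<bar> \<le> M" "\<And>x. \<bar>\<zeta>2 x\<bar> \<le> M"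
    "\<And>x. x \<le> 0 \<Longrightarrow> \<zeta> x = 1" "\<And>x. x \<ge> 1 \<Longrightarrow> \<zeta> x = 0"
    "\<And>x. x < 0 \<or> x > 1 \<Longrightarrow> \<zeta>1 x = 0" "\<And>x. x < 0 \<or> x > 1 \<Longrightarrow> \<zeta>2 x = 0"
proof -
  define e where "e = flat 1"
  have e0: "0 \<le> e x" for x by (auto simp: e_def flat_def)
  have epos: "x > 0 \<Longrightarrow> 0 < e x" for x by (auto simp: e_def flat_def)
  have ezero: "x \<le> 0 \<Longrightarrow> e x = 0" for x by (auto simp: e_def flat_def)
  have emono: "x \<le> y \<Longrightarrow> e x \<le> e y" for x y
    by (auto simp: e_def flat_def field_simps)
  have D: "e x + e (1 - x) > 0" for x
    using epos[of x] epos[of "1 - x"] e0[of x] e0[of "1-x"] by (cases "x > 0") auto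
  \<comment> \<open>The quotient is written with \<open>powr -1\<close> so that its smoothness is
    that of a product and a composition.\<close>
  define \<zeta> where "\<zeta> x = e (1 - x) * (e x + e (1 - x)) powr -1" for x
  have \<zeta>: "\<zeta> x = e (1 - x) / (e x + e (1 - x))" for x
    using D[of x] by (simp add: \<zeta>_def powr_minus divide_inverse)
  have s1: "smooth_on UNIV e" unfolding e_def by (rule smooth_on_flat)
  have s2: "smooth_on UNIV (\<lambda>x. e (1 - x))"
    by (rule smooth_on_compose[OF _ _ s1 smooth_on_diff[OF _ smooth_on_const smooth_on_bounded_linear]])
      (simp_all add: bounded_linear_ident)
  have sm: "smooth_on UNIV \<zeta>" unfolding \<zeta>_def
    by (intro smooth_on_mult smooth_on_compose[OF _ _ smooth_on_powr] smooth_on_add s1 s2)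
      (use D in auto)
  define \<zeta>1 where "\<zeta>1 x = frechet_derivative \<zeta> (at x) 1" for x
  have sm1: "smooth_on UNIV \<zeta>1" unfolding \<zeta>1_def by (rule smooth_on_frechet_derivative[OF sm])
  define \<zeta>2 where "\<zeta>2 x = frechet_derivative \<zeta>1 (at x) 1" for x
  have sm2: "smooth_on UNIV \<zeta>2" unfolding \<zeta>2_def by (rule smooth_on_frechet_derivative[OF sm1])
  have d1: "(\<zeta> has_field_derivative \<zeta>1 x) (at x)" for x
    unfolding \<zeta>1_def by (rule smooth_on_real_has_derivative[OF sm]) simp
  have d2: "(\<zeta>1 has_field_derivative \<zeta>2 x) (at x)" for x
    unfolding \<zeta>2_def by (rule smooth_on_real_has_derivative[OF sm1]) simp
  have am: "antimono \<zeta>"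
  proof (rule antimonoI)
    fix x y :: real assume "x \<le> y"
    \<comment> \<open>After cross multiplication the common term e(1 - x) e(1 - y) cancels and this
      is all that remains.\<close>
    then have "e (1 - y) * e x \<le> e (1 - x) * e y"
      by (intro mult_mono emono e0) auto
    then show "\<zeta> y \<le> \<zeta> x" unfolding \<zeta> using D[of x] D[of y]
      by (simp add: field_simps)
  qed
  have one: "\<zeta> x = 1" if "x \<le> 0" for x using that D[of x] ezero[of x] by (simp add: \<zeta>)
  have zero: "\<zeta> x = 0" if "x \<ge> 1" for x using that ezero[of "1 - x"] by (simp add: \<zeta>)
  have z1: "\<zeta>1 x = 0" if "x < 0 \<or> x > 1" for x
    using that DERIV_unique_const_open[OF d1[of x], of "{..<0}" 1] DERIV_unique_const_open[OF d1[of x], of "{1<..}" 0]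
    one zero by force
  have z2: "\<zeta>2 x = 0" if "x < 0 \<or> x > 1" for x
    using that DERIV_unique_const_open[OF d2[of x], of "{..<0}" 0] DERIV_unique_const_open[OF d2[of x], of "{1<..}" 0]
    z1 by force
  obtain M1 where M1: "M1 > 0" "\<And>x. \<bar>\<zeta>1 x\<bar> \<le> M1"
    using bounded_if_zero_outside[OF smooth_on_continuous_on[OF sm1] z1] by blast
  obtain M2 where M2: "M2 > 0" "\<And>x. \<bar>\<zeta>2 x\<bar> \<le> M2"
    using bounded_if_zero_outside[OF smooth_on_continuous_on[OF sm2] z2] by blast
  show thesis
  proof (rule that[OF sm _ d1 d2 _ _ _ _ _ one zero z1 z2])
    show "max M1 M2 > 0" using M1 by auto
    show "\<zeta> x \<ge> 0" for x using D[of x] e0[of "1-x"] by (simp add: \<zeta>)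
    show "\<zeta> x \<le> 1" for x using D[of x] e0[of "x"] by (simp add: \<zeta>)
    show "\<zeta>1 x \<le> 0" for x using DERIV_nonpos_antimono[OF am d1] .
    show "\<bar>\<zeta>1 x\<bar> \<le> max M1 M2" for x using M1(2)[of x] by auto
    show "\<bar>\<zeta>2 x\<bar> \<le> max M1 M2" for x using M2(2)[of x] by auto
  qed auto
qed

text \<open>The function \<open>\<eta>\<close> is a high power of a smooth step.\<close>

lemma smooth_step_powr_exists:
  assumes "\<theta> < 1"
  obtains \<eta> \<eta>1 \<eta>2 :: "real \<Rightarrow> real" and M where "smooth_on UNIV \<eta>" "M > 0"
    "\<And>x. (\<eta> has_field_derivative \<eta>1 x) (at x)" "\<And>x. (\<eta>1 has_field_derivative \<eta>2 x) (at x)"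
    "\<And>x. 0 \<le> \<eta> x" "\<And>x. \<eta> x \<le> 1" "\<And>x. \<eta>1 x \<le> 0"
    "\<And>x. \<bar>\<eta>1 x\<bar> \<le> M * \<eta> x powr \<theta>" "\<And>x. \<bar>\<eta>2 x\<bar> \<le> M * \<eta> x powr \<theta>"
    "\<And>x. x \<le> 0 \<Longrightarrow> \<eta> x = 1" "\<And>x. x \<ge> 1 \<Longrightarrow> \<eta> x = 0"
    "\<And>x. x < 0 \<or> x > 1 \<Longrightarrow> \<eta>1 x = 0" "\<And>x. x < 0 \<or> x > 1 \<Longrightarrow> \<eta>2 x = 0"
proof -
  obtain \<zeta> \<zeta>1 \<zeta>2 :: "real \<Rightarrow> real" and M where \<zeta>: "smooth_on UNIV \<zeta>" "M > 0"
    "\<And>x. (\<zeta> has_field_derivative \<zeta>1 x) (at x)" "\<And>x. (\<zeta>1 has_field_derivative \<zeta>2 x) (at x)"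
    "\<And>x. 0 \<le> \<zeta> x" "\<And>x. \<zeta> x \<le> 1" "\<And>x. \<zeta>1 x \<le> 0" "\<And>x. \<bar>\<zeta>1 x\<bar> \<le> M" "\<And>x. \<bar>\<zeta>2 x\<bar> \<le> M"
    "\<And>x. x \<le> 0 \<Longrightarrow> \<zeta> x = 1" "\<And>x. x \<ge> 1 \<Longrightarrow> \<zeta> x = 0"
    "\<And>x. x < 0 \<or> x > 1 \<Longrightarrow> \<zeta>1 x = 0" "\<And>x. x < 0 \<or> x > 1 \<Longrightarrow> \<zeta>2 x = 0"
    by (rule smooth_step_exists, rule that)
  \<comment> \<open>Two derivatives of the m-th power cost two factors of the step. The choice of
    \<open>l\<close> makes m \<theta> \<le> m - 2, so the remaining power m - 2 = l + 1 is still
    dominated by the \<theta>-th power of the cutoff, the step being at most 1.\<close>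
  obtain l :: nat where l: "real l > 2 / (1 - \<theta>)" using reals_Archimedean2 by blast
  define m where "m = l + 3"
  have m: "real m * \<theta> \<le> real m - 2"
  proof -
    have "real m > 2 / (1 - \<theta>)" using l by (simp add: m_def)
    then show ?thesis using assms by (simp add: field_simps)
  qed
  have pow: "\<zeta> x ^ (l + 1) \<le> (\<zeta> x ^ m) powr \<theta>" for x
  proof (cases "\<zeta> x = 0")
    case True then show ?thesis by (simp add: m_def)
  next
    case False
    then have z: "\<zeta> x > 0" using \<zeta>(5)[of x] by linarith
    have "(\<zeta> x ^ m) powr \<theta> = \<zeta> x powr (real m * \<theta>)"
      using z by (simp add: powr_powr flip: powr_realpow)
    also have "\<dots> \<ge> \<zeta> x powr (real m - 2)"
      using z \<zeta>(6)[of x] m by (intro powr_mono') auto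
    also have "\<zeta> x powr (real m - 2) = \<zeta> x ^ (l + 1)"
      using z powr_realpow[of "\<zeta> x" "l + 1"] by (simp add: m_def add.commute)
    finally show ?thesis .
  qed
  have pow': "\<zeta> x ^ (l + 2) \<le> (\<zeta> x ^ m) powr \<theta>" for x
    by (rule order.trans[OF power_decreasing[of "l+1" "l+2" "\<zeta> x"] pow]) (use \<zeta>(5,6) in auto)
  define \<eta>1 where "\<eta>1 x = real m * \<zeta> x ^ (l + 2) * \<zeta>1 x" for x
  define \<eta>2 where "\<eta>2 x = real m * (real (l + 2) * \<zeta> x ^ (l + 1) * \<zeta>1 x * \<zeta>1 x + \<zeta> x ^ (l + 2) * \<zeta>2 x)" for x
  define K where "K = real m * (real (l + 2) * M * M + M)"
  have K: "real m * M \<le> K" "real m > 0"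
    using mult_nonneg_nonneg[of "real m * real (l + 2)" "M * M"] \<zeta>(2)
    by (simp_all add: K_def m_def algebra_simps)
  show thesis
  proof (rule that[of "\<lambda>x. \<zeta> x ^ m" K \<eta>1 \<eta>2])
    show "smooth_on UNIV (\<lambda>x. \<zeta> x ^ m)" by (rule smooth_on_power[OF _ \<zeta>(1)]) simp
    show "K > 0" using K \<zeta>(2) by (smt (verit) mult_pos_pos)
    show "((\<lambda>x. \<zeta> x ^ m) has_field_derivative \<eta>1 x) (at x)" for x
      unfolding \<eta>1_def m_def by (auto intro!: derivative_eq_intros \<zeta>(3))
    show "(\<eta>1 has_field_derivative \<eta>2 x) (at x)" for x
      unfolding \<eta>1_def \<eta>2_def
      by (rule derivative_eq_intros \<zeta>(3,4) refl)+ (simp add: algebra_simps)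
    show "\<eta>1 x \<le> 0" for x
      unfolding \<eta>1_def using \<zeta>(5,7)[of x] by (simp add: mult_nonneg_nonpos)
    show "\<bar>\<eta>1 x\<bar> \<le> K * (\<zeta> x ^ m) powr \<theta>" for x
    proof -
      have "\<bar>\<eta>1 x\<bar> = real m * \<bar>\<zeta>1 x\<bar> * \<zeta> x ^ (l + 2)"
        using \<zeta>(5)[of x] by (simp add: \<eta>1_def abs_mult power_abs)
      also have "\<dots> \<le> real m * M * (\<zeta> x ^ m) powr \<theta>"
        using \<zeta>(2,5,8) by (intro mult_mono pow' mult_left_mono) auto
      also have "\<dots> \<le> K * (\<zeta> x ^ m) powr \<theta>" using K by (intro mult_right_mono) auto
      finally show ?thesis .
    qed
    show "\<bar>\<eta>2 x\<bar> \<le> K * (\<zeta> x ^ m) powr \<theta>" for x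
    proof -
      have "\<bar>\<eta>2 x\<bar> = real m * \<bar>real (l + 2) * \<zeta> x ^ (l + 1) * \<zeta>1 x * \<zeta>1 x + \<zeta> x ^ (l + 2) * \<zeta>2 x\<bar>"
        by (simp only: \<eta>2_def abs_mult abs_of_nat)
      also have "\<dots> \<le> real m * (\<bar>real (l + 2) * \<zeta> x ^ (l + 1) * \<zeta>1 x * \<zeta>1 x\<bar> + \<bar>\<zeta> x ^ (l + 2) * \<zeta>2 x\<bar>)"
        by (intro mult_left_mono abs_triangle_ineq) simp
      also have "\<dots> = real m * (real (l + 2) * (\<bar>\<zeta>1 x\<bar> * \<bar>\<zeta>1 x\<bar>) * \<zeta> x ^ (l + 1) + \<bar>\<zeta>2 x\<bar> * \<zeta> x ^ (l + 2))"
        unfolding abs_mult power_abs abs_of_nat using \<zeta>(5)[of x] by (simp add: mult_ac)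
      also have "\<dots> \<le> real m * (real (l + 2) * (M * M) * (\<zeta> x ^ m) powr \<theta> + M * (\<zeta> x ^ m) powr \<theta>)"
        using \<zeta>(2,5,8,9) by (intro mult_mono add_mono pow pow' mult_left_mono) auto
      also have "\<dots> = K * (\<zeta> x ^ m) powr \<theta>" by (simp add: K_def algebra_simps)
      finally show ?thesis .
    qed
    show "\<zeta> x ^ m \<le> 1" for x using \<zeta>(5,6)[of x] by (simp add: power_le_one)
  qed (use \<zeta> in \<open>auto simp: \<eta>1_def \<eta>2_def m_def\<close>)
qed

text \<open>The argument of \<eta> is ln \<tau> rescaled to run from 0 at \<open>R1\<close> to 1 at
  \<open>R2\<close>, so a derivative in \<tau> brings a factor 1 / (\<tau> ln (R2 / R1)). The second
  derivative gains only one such logarithm, because it can fall on 1/\<tau>. The same cutoff with a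
  fixed ratio \<open>R2 / R1\<close> serves as the dyadic one; \<open>M\<close> does not depend on
  the radii.\<close>

lemma log_cutoff_exists:
  assumes "\<theta> < 1"
  obtains M :: real where "M > 0"
    "\<And>R1 R2. 0 < R1 \<Longrightarrow> 2 * R1 \<le> R2 \<Longrightarrow> \<exists>\<phi> \<phi>1 \<phi>2 :: real \<Rightarrow> real. smooth_on {0<..} \<phi> \<and>
      (\<forall>\<tau>>0. (\<phi> has_field_derivative \<phi>1 \<tau>) (at \<tau>) \<and> (\<phi>1 has_field_derivative \<phi>2 \<tau>) (at \<tau>) \<and>
        0 \<le> \<phi> \<tau> \<and> \<phi> \<tau> \<le> 1 \<and> \<phi>1 \<tau> \<le> 0 \<and>
        \<bar>\<phi>1 \<tau>\<bar> \<le> M / ln (R2 / R1) / \<tau> * \<phi> \<tau> powr \<theta> \<and>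
        \<bar>\<phi>2 \<tau>\<bar> \<le> M / ln (R2 / R1) / \<tau>\<^sup>2 * \<phi> \<tau> powr \<theta> \<and>
        (\<tau> \<le> R1 \<longrightarrow> \<phi> \<tau> = 1) \<and> (\<tau> \<ge> R2 \<longrightarrow> \<phi> \<tau> = 0) \<and>
        (\<tau> < R1 \<or> \<tau> > R2 \<longrightarrow> \<phi>1 \<tau> = 0 \<and> \<phi>2 \<tau> = 0))"
proof -
  obtain \<eta> \<eta>1 \<eta>2 :: "real \<Rightarrow> real" and M where \<eta>: "smooth_on UNIV \<eta>" "M > 0"
    "\<And>x. (\<eta> has_field_derivative \<eta>1 x) (at x)" "\<And>x. (\<eta>1 has_field_derivative \<eta>2 x) (at x)"
    "\<And>x. 0 \<le> \<eta> x" "\<And>x. \<eta> x \<le> 1" "\<And>x. \<eta>1 x \<le> 0"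
    "\<And>x. \<bar>\<eta>1 x\<bar> \<le> M * \<eta> x powr \<theta>" "\<And>x. \<bar>\<eta>2 x\<bar> \<le> M * \<eta> x powr \<theta>"
    "\<And>x. x \<le> 0 \<Longrightarrow> \<eta> x = 1" "\<And>x. x \<ge> 1 \<Longrightarrow> \<eta> x = 0"
    "\<And>x. x < 0 \<or> x > 1 \<Longrightarrow> \<eta>1 x = 0" "\<And>x. x < 0 \<or> x > 1 \<Longrightarrow> \<eta>2 x = 0"
    by (rule smooth_step_powr_exists[OF assms], rule that)
  show thesis
  proof (rule that[of "4 * M"])
    show "4 * M > 0" using \<eta>(2) by simp
    fix R1 R2 :: real assume R: "0 < R1" "2 * R1 \<le> R2"
    define \<Lambda> where "\<Lambda> = ln (R2 / R1)"
    \<comment> \<open>The assumption \<open>2 * R1 \<le> R2\<close> keeps \<Lambda> away from 0, so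
      that a product of two factors 1/\<Lambda> is at most twice one of them.\<close>
    have "ln 2 \<le> \<Lambda>" unfolding \<Lambda>_def using R by (subst ln_le_cancel_iff) (auto simp: field_simps)
    moreover have "ln 2 \<ge> (1/2 :: real)" using ln2_ge_two_thirds by simp
    ultimately have \<Lambda>: "\<Lambda> \<ge> 1/2" by simp
    define z where "z \<tau> = (ln \<tau> + - ln R1) * (1 / \<Lambda>)" for \<tau> :: real
    have dz: "\<tau> > 0 \<Longrightarrow> (z has_field_derivative 1 / (\<Lambda> * \<tau>)) (at \<tau>)" for \<tau>
      unfolding z_def using \<Lambda> by (auto intro!: derivative_eq_intros simp: field_simps)
    define \<phi>1 where "\<phi>1 \<tau> = \<eta>1 (z \<tau>) * (1 / (\<Lambda> * \<tau>))" for \<tau>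
    define \<phi>2 where "\<phi>2 \<tau> = \<eta>2 (z \<tau>) * (1 / (\<Lambda> * \<tau>)) * (1 / (\<Lambda> * \<tau>)) + \<eta>1 (z \<tau>) * (- 1 / (\<Lambda> * \<tau>\<^sup>2))" for \<tau>
    have z0: "\<tau> \<le> R1 \<Longrightarrow> z \<tau> \<le> 0" if "\<tau> > 0" for \<tau>
      unfolding z_def using that R \<Lambda> by (simp add: divide_simps)
    have z0': "\<tau> < R1 \<Longrightarrow> z \<tau> < 0" if "\<tau> > 0" for \<tau>
      unfolding z_def using that R \<Lambda> by (simp add: divide_simps)
    have z1: "\<tau> \<ge> R2 \<Longrightarrow> z \<tau> \<ge> 1" if "\<tau> > 0" for \<tau>
      unfolding z_def using that R \<Lambda> by (simp add: \<Lambda>_def divide_simps ln_div)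
    have z1': "\<tau> > R2 \<Longrightarrow> z \<tau> > 1" if "\<tau> > 0" for \<tau>
      unfolding z_def using that R \<Lambda> by (simp add: \<Lambda>_def divide_simps ln_div)
    show "\<exists>\<phi> \<phi>1 \<phi>2 :: real \<Rightarrow> real. smooth_on {0<..} \<phi> \<and>
      (\<forall>\<tau>>0. (\<phi> has_field_derivative \<phi>1 \<tau>) (at \<tau>) \<and> (\<phi>1 has_field_derivative \<phi>2 \<tau>) (at \<tau>) \<and>
        0 \<le> \<phi> \<tau> \<and> \<phi> \<tau> \<le> 1 \<and> \<phi>1 \<tau> \<le> 0 \<and>
        \<bar>\<phi>1 \<tau>\<bar> \<le> (4 * M) / ln (R2 / R1) / \<tau> * \<phi> \<tau> powr \<theta> \<and>
        \<bar>\<phi>2 \<tau>\<bar> \<le> (4 * M) / ln (R2 / R1) / \<tau>\<^sup>2 * \<phi> \<tau> powr \<theta> \<and>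
        (\<tau> \<le> R1 \<longrightarrow> \<phi> \<tau> = 1) \<and> (\<tau> \<ge> R2 \<longrightarrow> \<phi> \<tau> = 0) \<and>
        (\<tau> < R1 \<or> \<tau> > R2 \<longrightarrow> \<phi>1 \<tau> = 0 \<and> \<phi>2 \<tau> = 0))"
    proof (rule exI[of _ "\<lambda>\<tau>. \<eta> (z \<tau>)"], rule exI[of _ \<phi>1], rule exI[of _ \<phi>2], intro conjI allI impI)
      show "smooth_on {0<..} (\<lambda>\<tau>. \<eta> (z \<tau>))" unfolding z_def
        by (intro smooth_on_compose[OF _ _ \<eta>(1)] smooth_on_mult smooth_on_add smooth_on_ln) auto
      fix \<tau> :: real assume \<tau>: "0 < \<tau>"
      have L: "\<Lambda> > 0" "1 / \<Lambda> \<le> 2" using \<Lambda> by (auto simp: field_simps)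
      show "((\<lambda>\<tau>. \<eta> (z \<tau>)) has_field_derivative \<phi>1 \<tau>) (at \<tau>)"
        unfolding \<phi>1_def using DERIV_chain2[OF \<eta>(3) dz[OF \<tau>]] by simp
      show "(\<phi>1 has_field_derivative \<phi>2 \<tau>) (at \<tau>)"
        unfolding \<phi>1_def \<phi>2_def using \<tau> L
        by (auto intro!: derivative_eq_intros DERIV_chain2[OF \<eta>(4) dz[OF \<tau>]] simp: field_simps power2_eq_square)
      show "\<bar>\<phi>1 \<tau>\<bar> \<le> (4 * M) / ln (R2 / R1) / \<tau> * \<eta> (z \<tau>) powr \<theta>"
      proof -
        have "\<bar>\<phi>1 \<tau>\<bar> = \<bar>\<eta>1 (z \<tau>)\<bar> * (1 / (\<Lambda> * \<tau>))" using \<tau> L by (simp add: \<phi>1_def abs_mult)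
        also have "\<dots> \<le> (4 * (M * \<eta> (z \<tau>) powr \<theta>)) * (1 / (\<Lambda> * \<tau>))"
          using \<eta>(8)[of "z \<tau>"] \<tau> L by (intro mult_right_mono) (auto intro: order.trans)
        finally show ?thesis by (simp add: \<Lambda>_def mult_ac)
      qed
      show "\<bar>\<phi>2 \<tau>\<bar> \<le> (4 * M) / ln (R2 / R1) / \<tau>\<^sup>2 * \<eta> (z \<tau>) powr \<theta>"
      proof -
        define E where "E = M * \<eta> (z \<tau>) powr \<theta> / (\<Lambda> * \<tau>\<^sup>2)"
        have E0: "E \<ge> 0" using \<eta>(2) L by (simp add: E_def)
        have "\<bar>\<phi>2 \<tau>\<bar> \<le> \<bar>\<eta>2 (z \<tau>)\<bar> * (1 / \<Lambda>) * (1 / (\<Lambda> * \<tau>\<^sup>2)) + \<bar>\<eta>1 (z \<tau>)\<bar> * (1 / (\<Lambda> * \<tau>\<^sup>2))"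
          unfolding \<phi>2_def using \<tau> L
          by (intro order.trans[OF abs_triangle_ineq]) (auto simp: abs_mult power2_eq_square mult_ac)
        also have "\<dots> \<le> (M * \<eta> (z \<tau>) powr \<theta>) * 2 * (1 / (\<Lambda> * \<tau>\<^sup>2)) + (M * \<eta> (z \<tau>) powr \<theta>) * (1 / (\<Lambda> * \<tau>\<^sup>2))"
          using \<eta>(8,9)[of "z \<tau>"] \<tau> L \<eta>(2) by (intro add_mono mult_mono) auto
        also have "\<dots> = 3 * E" by (simp add: E_def)
        also have "\<dots> \<le> 4 * E" using E0 by simp
        finally show ?thesis by (simp add: E_def \<Lambda>_def mult_ac)
      qed
      show "\<phi>1 \<tau> \<le> 0"
        using \<eta>(7)[of "z \<tau>"] L \<tau> by (simp add: \<phi>1_def divide_nonpos_pos)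
      show "0 \<le> \<eta> (z \<tau>)" "\<eta> (z \<tau>) \<le> 1" by (rule \<eta>)+
      show "\<eta> (z \<tau>) = 1" if "\<tau> \<le> R1" using \<eta>(10) z0[OF \<tau> that] .
      show "\<eta> (z \<tau>) = 0" if "\<tau> \<ge> R2" using \<eta>(11) z1[OF \<tau> that] .
      show "\<phi>1 \<tau> = 0" "\<phi>2 \<tau> = 0" if "\<tau> < R1 \<or> \<tau> > R2"
        using \<eta>(12,13)[of "z \<tau>"] z0'[OF \<tau>] z1'[OF \<tau>] that by (auto simp: \<phi>1_def \<phi>2_def)
    qed
  qed
qed

section \<open>Weak identities against test functions\<close>

definition D\<^sub>t :: "('a::euclidean_space \<times> real \<Rightarrow> real) \<Rightarrow> 'a \<times> real \<Rightarrow> real" where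
  "D\<^sub>t \<Psi> z = frechet_derivative \<Psi> (at z) (0, 1)"

definition D\<^sub>x :: "'a \<Rightarrow> ('a::euclidean_space \<times> real \<Rightarrow> real) \<Rightarrow> 'a \<times> real \<Rightarrow> real" where
  "D\<^sub>x b \<Psi> z = frechet_derivative \<Psi> (at z) (b, 0)"

definition Lap :: "('a::euclidean_space \<times> real \<Rightarrow> real) \<Rightarrow> 'a \<times> real \<Rightarrow> real" where
  "Lap \<Psi> z = (\<Sum>b\<in>Basis. D\<^sub>x b (D\<^sub>x b \<Psi>) z)"

text \<open>Vanishing outside a ball is the form of compact support that derivatives, sums and
  slices inherit directly.\<close>

lemma Cc_infinity_iff:
  "\<Psi> \<in> Cc_infinity \<longleftrightarrow> smooth_on UNIV \<Psi> \<and> (\<exists>r. \<forall>z. norm z > r \<longrightarrow> \<Psi> z = 0)"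
proof -
  have "compact (supp \<Psi>) \<longleftrightarrow> (\<exists>r. \<forall>z. norm z > r \<longrightarrow> \<Psi> z = 0)"
  proof
    assume "compact (supp \<Psi>)"
    then obtain r where "\<forall>z\<in>supp \<Psi>. norm z \<le> r" using compact_imp_bounded bounded_iff by blast
    moreover have "z \<in> supp \<Psi>" if "\<Psi> z \<noteq> 0" for z
      using that closure_subset[of "{x. \<Psi> x \<noteq> 0}"] by (auto simp: supp_def)
    ultimately show "\<exists>r. \<forall>z. norm z > r \<longrightarrow> \<Psi> z = 0" by (meson linorder_not_le)
  next
    assume "\<exists>r. \<forall>z. norm z > r \<longrightarrow> \<Psi> z = 0"
    then have "bounded {x. \<Psi> x \<noteq> 0}" unfolding bounded_iff by (metis mem_Collect_eq linorder_not_le)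
    then show "compact (supp \<Psi>)" by (simp add: supp_def compact_closure)
  qed
  then show ?thesis by (simp add: Cc_infinity_def smooth_iff_smooth_on)
qed

lemma Cc_infinity_frechet_derivative:
  assumes "\<Psi> \<in> Cc_infinity"
  shows "(\<lambda>z. frechet_derivative \<Psi> (at z) h) \<in> Cc_infinity"
proof -
  obtain r where s: "smooth_on UNIV \<Psi>" and r: "\<And>z. norm z > r \<Longrightarrow> \<Psi> z = 0"
    using assms by (auto simp: Cc_infinity_iff)
  have "frechet_derivative \<Psi> (at z) h = 0" if z: "norm z > r" for z
  proof -
    have "frechet_derivative \<Psi> (at z) = frechet_derivative (\<lambda>_. 0) (at z)"
      using z r by (intro frechet_derivative_cong_open[of "- cball 0 r"]) auto
    then show ?thesis by simp
  qed
  with s show ?thesis by (auto simp: Cc_infinity_iff intro: smooth_on_frechet_derivative)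
qed

lemma Cc_infinity_D\<^sub>t: "\<Psi> \<in> Cc_infinity \<Longrightarrow> D\<^sub>t \<Psi> \<in> Cc_infinity"
  using Cc_infinity_frechet_derivative[of \<Psi> "(0, 1)"] by (simp add: D\<^sub>t_def[abs_def])

lemma Cc_infinity_D\<^sub>x: "\<Psi> \<in> Cc_infinity \<Longrightarrow> D\<^sub>x b \<Psi> \<in> Cc_infinity"
  using Cc_infinity_frechet_derivative[of \<Psi> "(b, 0)"] by (simp add: D\<^sub>x_def[abs_def])

lemma Cc_infinity_Lap: "\<Psi> \<in> Cc_infinity \<Longrightarrow> Lap \<Psi> \<in> Cc_infinity"
proof -
  assume \<Psi>: "\<Psi> \<in> Cc_infinity"
  have add: "(\<lambda>z. f z + g z) \<in> Cc_infinity" if fg: "f \<in> Cc_infinity" "g \<in> Cc_infinity"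
    for f g :: "'a \<times> real \<Rightarrow> real"
  proof -
    obtain r where "\<And>z. norm z > r \<Longrightarrow> f z = 0" using fg(1) unfolding Cc_infinity_iff by blast
    moreover obtain r' where "\<And>z. norm z > r' \<Longrightarrow> g z = 0" using fg(2) unfolding Cc_infinity_iff by blast
    ultimately have "norm z > max r r' \<Longrightarrow> f z + g z = 0" for z by simp
    then show ?thesis using fg unfolding Cc_infinity_iff by (blast intro: smooth_on_add)
  qed
  have "(\<lambda>z. \<Sum>b\<in>B. D\<^sub>x b (D\<^sub>x b \<Psi>) z) \<in> Cc_infinity" if "finite B" for B
    using that
  proof induction
    case empty
    then show ?case by (simp add: Cc_infinity_iff)
  next
    case (insert b B)
    then show ?case using add[OF Cc_infinity_D\<^sub>x[OF Cc_infinity_D\<^sub>x[OF \<Psi>], of b] insert.IH] by simp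
  qed
  from this[OF finite_Basis] show ?thesis by (simp add: Lap_def[abs_def])
qed

lemma smooth_slice:
  fixes \<Psi> :: "'a::euclidean_space \<times> real \<Rightarrow> real"
  assumes "smooth_on UNIV \<Psi>"
  shows "smooth_on UNIV (\<lambda>y. \<Psi> (y, t))"
    and "((\<lambda>y. \<Psi> (y, t)) has_derivative (\<lambda>h. frechet_derivative \<Psi> (at (x, t)) (h, 0))) (at x)"
    and "((\<lambda>s. \<Psi> (x, s)) has_field_derivative D\<^sub>t \<Psi> (x, t)) (at t)"
proof -
  have d: "((\<lambda>y. \<Phi> (y, t)) has_derivative (\<lambda>h. frechet_derivative \<Phi> (at (x, t)) (h, 0))) (at x)"
    if "(\<Phi> has_derivative frechet_derivative \<Phi> (at (x, t))) (at (x, t))" for \<Phi> :: "'a \<times> real \<Rightarrow> real" and x t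
    by (rule has_derivative_compose[of "\<lambda>y. (y, t)" "\<lambda>h. (h, 0)" x UNIV \<Phi>, OF _ that])
      (intro has_derivative_Pair has_derivative_ident has_derivative_const)
  show "((\<lambda>y. \<Psi> (y, t)) has_derivative (\<lambda>h. frechet_derivative \<Psi> (at (x, t)) (h, 0))) (at x)"
    using smooth_on_has_derivative[OF assms] by (intro d) simp
  have "Ck_on k UNIV \<Phi> \<Longrightarrow> Ck_on k UNIV (\<lambda>y. \<Phi> (y, t))" for k and \<Phi> :: "'a \<times> real \<Rightarrow> real"
  proof (induction k arbitrary: \<Phi>)
    case 0
    then have "continuous_on UNIV \<Phi>" by simp
    then have "continuous_on UNIV (\<lambda>y. \<Phi> (y, t))"
      by (rule continuous_on_compose2) (auto intro!: continuous_intros)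
    then show ?case by simp
  next
    case (Suc k)
    show ?case
    proof (rule Ck_on_SucI)
      show "((\<lambda>y. \<Phi> (y, t)) has_derivative (\<lambda>h. frechet_derivative \<Phi> (at (x, t)) (h, 0))) (at x)" for x
        by (intro d Ck_on_Suc_has_derivative[OF Suc.prems]) simp
      show "Ck_on k UNIV (\<lambda>x. frechet_derivative \<Phi> (at (x, t)) (h, 0))" for h
        using Suc.IH[of "\<lambda>z. frechet_derivative \<Phi> (at z) (h, 0)"] Suc.prems by simp
    qed simp
  qed
  then show "smooth_on UNIV (\<lambda>y. \<Psi> (y, t))" using assms by (auto simp: smooth_on_def)
  have "(\<Psi> has_derivative frechet_derivative \<Psi> (at (x, t))) (at (x, t))"
    by (rule smooth_on_has_derivative[OF assms]) simp
  from has_derivative_compose[of "\<lambda>s. (x, s)" "\<lambda>h. (0, h)" t UNIV \<Psi>, OF _ this]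
  have *: "((\<lambda>s. \<Psi> (x, s)) has_derivative (\<lambda>h. frechet_derivative \<Psi> (at (x, t)) (0, h))) (at t)"
    by (simp add: has_derivative_Pair)
  have lin: "linear (frechet_derivative \<Psi> (at (x, t)))"
    using smooth_on_has_derivative[OF assms] has_derivative_linear by blast
  have "frechet_derivative \<Psi> (at (x, t)) (0, h) = D\<^sub>t \<Psi> (x, t) * h" for h
    using linear_scale[OF lin, of h "(0, 1)"] by (simp add: D\<^sub>t_def)
  with * show "((\<lambda>s. \<Psi> (x, s)) has_field_derivative D\<^sub>t \<Psi> (x, t)) (at t)"
    by (simp add: has_field_derivative_def)
qed

lemma Cc_infinity_slice:
  fixes \<Psi> :: "'a::euclidean_space \<times> real \<Rightarrow> real"
  assumes "\<Psi> \<in> Cc_infinity"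
  shows "(\<lambda>y. \<Psi> (y, t)) \<in> Cc_infinity"
proof -
  obtain r where s: "smooth_on UNIV \<Psi>" and r: "\<And>z. norm z > r \<Longrightarrow> \<Psi> z = 0"
    using assms by (auto simp: Cc_infinity_iff)
  have "norm y > r \<Longrightarrow> \<Psi> (y, t) = 0" for y
    by (rule r) (use norm_fst_le[of y t] in simp)
  with smooth_slice(1)[OF s] show ?thesis by (auto simp: Cc_infinity_iff)
qed

lemma Cc_infinity_bounded:
  fixes \<Psi> :: "'a::euclidean_space \<times> real \<Rightarrow> real"
  assumes "\<Psi> \<in> Cc_infinity"
  obtains K r where "K > 0" "r > 0" "\<And>x t. \<bar>\<Psi> (x, t)\<bar> \<le> K * indicator (cball 0 r) x"
proof -
  obtain r where s: "smooth_on UNIV \<Psi>" and r: "\<And>z. norm z > r \<Longrightarrow> \<Psi> z = 0"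
    using assms by (auto simp: Cc_infinity_iff)
  have "compact (\<Psi> ` cball 0 r)"
    using smooth_on_continuous_on[OF s] by (intro compact_continuous_image) (auto intro: continuous_on_subset)
  then obtain K where K: "K > 0" "\<forall>y\<in>\<Psi> ` cball 0 r. norm y \<le> K"
    using compact_imp_bounded bounded_pos by blast
  have "\<bar>\<Psi> (x, t)\<bar> \<le> K * indicator (cball 0 (max r 1)) x" for x t
  proof (cases "norm (x, t) > r")
    case True then show ?thesis using r[OF True] K(1) by simp
  next
    case False
    then have "norm x \<le> r" using norm_fst_le[of x t] by simp
    moreover have "\<bar>\<Psi> (x, t)\<bar> \<le> K" using K(2) False by auto
    ultimately show ?thesis by simp
  qed
  from that[OF K(1) _ this] show thesis by simp
qed

lemma Cc_infinity_slice_measurable: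
  fixes \<Psi> :: "'a::euclidean_space \<times> real \<Rightarrow> real"
  shows "\<Psi> \<in> Cc_infinity \<Longrightarrow> (\<lambda>x. \<Psi> (x, t)) \<in> borel_measurable lebesgue"
  using Cc_infinity_slice[of \<Psi> t] smooth_on_continuous_on
  by (auto simp: Cc_infinity_iff intro!: measurable_completion borel_measurable_continuous_onI)

section \<open>Pairing of square integrable functions with test functions\<close>

lemma L2_norm_nonneg: "L2_norm w \<ge> 0"
  by (simp add: L2_norm_def)

lemma L2_norm_power2: "(L2_norm w)\<^sup>2 = (LINT x|lebesgue. (norm (w x))\<^sup>2)"
  by (simp add: L2_norm_def)

lemma integrable_indicator_cball [simp]:
  "integrable lebesgue (indicator (cball (a::'a::euclidean_space) r) :: 'a \<Rightarrow> real)"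
  using lmeasurable_cball[of a r] by (simp add: integrable_indicator_iff fmeasurable_def)

lemma L2_mult_bounded_integrable:
  fixes w \<phi> :: "'a::euclidean_space \<Rightarrow> real"
  assumes "w \<in> L2" "\<phi> \<in> borel_measurable lebesgue" "\<And>x. \<bar>\<phi> x\<bar> \<le> K * indicator (cball 0 r) x"
  shows "integrable lebesgue (\<lambda>x. w x * \<phi> x)"
proof (rule Bochner_Integration.integrable_bound)
  show "integrable lebesgue (\<lambda>x. \<bar>K\<bar> * ((norm (w x))\<^sup>2 + indicator (cball 0 r) x))"
    using assms(1) by (auto simp: L2_def)
  show "(\<lambda>x. w x * \<phi> x) \<in> borel_measurable lebesgue" using assms by (auto simp: L2_def)
  show "AE x in lebesgue. norm (w x * \<phi> x) \<le> norm (\<bar>K\<bar> * ((norm (w x))\<^sup>2 + indicator (cball 0 r) x))"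
  proof (rule AE_I2)
    fix x
    have "\<bar>w x\<bar> * \<bar>\<phi> x\<bar> \<le> \<bar>K\<bar> * ((w x)\<^sup>2 + indicator (cball 0 r) x)"
    proof (cases "x \<in> cball 0 r")
      case True
      have "\<bar>w x\<bar> * \<bar>\<phi> x\<bar> \<le> ((w x)\<^sup>2 + 1) * \<bar>K\<bar>"
      proof (intro mult_mono)
        show "\<bar>w x\<bar> \<le> (w x)\<^sup>2 + 1"
          using zero_le_power2[of "\<bar>w x\<bar> - 1"] by (simp add: power2_diff)
        show "\<bar>\<phi> x\<bar> \<le> \<bar>K\<bar>" using assms(3)[of x] True by auto
      qed auto
      then show ?thesis using True by (simp add: mult.commute)
    next
      case False then show ?thesis using assms(3)[of x] by auto
    qed
    then show "norm (w x * \<phi> x) \<le> norm (\<bar>K\<bar> * ((norm (w x))\<^sup>2 + indicator (cball 0 r) x))"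
      by (simp add: abs_mult)
  qed
qed

text \<open>A Cauchy-Schwarz estimate on a ball, obtained from |w| \<le> \<delta> + w^2 / \<delta>
  by taking for \<delta> the norm of \<open>w\<close>; if that norm is 0, one lets \<delta> tend to
  0.\<close>

lemma L2_mult_bounded_le:
  fixes w \<phi> :: "'a::euclidean_space \<Rightarrow> real"
  assumes "w \<in> L2" "\<phi> \<in> borel_measurable lebesgue" "\<And>x. \<bar>\<phi> x\<bar> \<le> K * indicator (cball 0 r) x"
    and "K \<ge> 0"
  shows "\<bar>LINT x|lebesgue. w x * \<phi> x\<bar> \<le> (measure lebesgue (cball (0::'a) r) + 1) * K * L2_norm w"
proof -
  define V where "V = measure lebesgue (cball (0::'a) r)"
  have V: "V \<ge> 0" by (simp add: V_def)
  have main: "\<bar>LINT x|lebesgue. w x * \<phi> x\<bar> \<le> K * (\<delta> * V + (L2_norm w)\<^sup>2 / \<delta>)" if "\<delta> > 0" for \<delta>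
  proof -
    have "\<bar>LINT x|lebesgue. w x * \<phi> x\<bar> \<le> (LINT x|lebesgue. \<bar>w x * \<phi> x\<bar>)"
      by (rule integral_abs_bound)
    also have "\<dots> \<le> (LINT x|lebesgue. K * (\<delta> * indicator (cball 0 r) x + (norm (w x))\<^sup>2 / \<delta>))"
    proof (rule integral_mono')
      show "integrable lebesgue (\<lambda>x. K * (\<delta> * indicator (cball 0 r) x + (norm (w x))\<^sup>2 / \<delta>))"
        using assms(1) by (auto simp: L2_def)
      show "0 \<le> K * (\<delta> * indicator (cball 0 r) x + (norm (w x))\<^sup>2 / \<delta>)" for x
        using that assms(4) by (intro mult_nonneg_nonneg add_nonneg_nonneg divide_nonneg_nonneg) auto
      show "\<bar>w x * \<phi> x\<bar> \<le> K * (\<delta> * indicator (cball 0 r) x + (norm (w x))\<^sup>2 / \<delta>)" for x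
      proof (cases "x \<in> cball 0 r")
        case True
        have "2 * \<bar>w x\<bar> * \<delta> \<le> \<delta>\<^sup>2 + (w x)\<^sup>2"
          using zero_le_power2[of "\<bar>w x\<bar> - \<delta>"] by (simp add: power2_diff)
        then have "\<bar>w x\<bar> * \<delta> \<le> \<delta>\<^sup>2 + (w x)\<^sup>2" using mult_nonneg_nonneg[of "\<bar>w x\<bar>" \<delta>] that by linarith
        then have "\<bar>w x\<bar> \<le> \<delta> + (w x)\<^sup>2 / \<delta>" using that by (simp add: field_simps power2_eq_square)
        moreover have "\<bar>\<phi> x\<bar> \<le> K" using assms(3)[of x] True by auto
        ultimately have "\<bar>w x\<bar> * \<bar>\<phi> x\<bar> \<le> (\<delta> + (w x)\<^sup>2 / \<delta>) * K"
          by (intro mult_mono) auto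
        then show ?thesis using True by (simp add: abs_mult mult.commute)
      next
        case False then show ?thesis using assms(3)[of x] assms(4) that by auto
      qed
    qed
    also have "\<dots> = K * (\<delta> * V + (L2_norm w)\<^sup>2 / \<delta>)"
      using assms(1) by (simp add: L2_def V_def L2_norm_power2)
    finally show ?thesis .
  qed
  show ?thesis
  proof (cases "L2_norm w = 0")
    case True
    have "((\<lambda>\<delta>. K * (\<delta> * V)) \<longlongrightarrow> K * (0 * V)) (at_right 0)"
      by (intro tendsto_intros)
    then have "\<bar>LINT x|lebesgue. w x * \<phi> x\<bar> \<le> K * (0 * V)"
      using main True by (intro tendsto_lowerbound[where F="at_right (0::real)"])
        (auto simp: eventually_at_filter)
    then show ?thesis using True by simp
  next
    case False
    then have "L2_norm w > 0" using L2_norm_nonneg[of w] by linarith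
    from main[OF this] show ?thesis
      using False by (simp add: V_def power2_eq_square algebra_simps)
  qed
qed

lemma L2_diff: "f \<in> L2 \<Longrightarrow> g \<in> L2 \<Longrightarrow> (\<lambda>x. f x - g x :: real) \<in> L2"
proof -
  assume fg: "f \<in> L2" "g \<in> L2"
  have "integrable lebesgue (\<lambda>x. (norm (f x - g x))\<^sup>2)"
  proof (rule Bochner_Integration.integrable_bound)
    show "integrable lebesgue (\<lambda>x. 2 * (norm (f x))\<^sup>2 + 2 * (norm (g x))\<^sup>2)"
      using fg by (auto simp: L2_def)
    show "(\<lambda>x. (norm (f x - g x))\<^sup>2) \<in> borel_measurable lebesgue"
      using fg by (auto simp: L2_def)
    show "AE x in lebesgue. norm ((norm (f x - g x))\<^sup>2) \<le> norm (2 * (norm (f x))\<^sup>2 + 2 * (norm (g x))\<^sup>2)"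
    proof (rule AE_I2)
      fix x
      show "norm ((norm (f x - g x))\<^sup>2) \<le> norm (2 * (norm (f x))\<^sup>2 + 2 * (norm (g x))\<^sup>2)"
      proof -
        have "(f x - g x)\<^sup>2 + (f x + g x)\<^sup>2 = 2 * (f x)\<^sup>2 + 2 * (g x)\<^sup>2"
          by (simp add: power2_sum power2_diff)
        then have "(f x - g x)\<^sup>2 \<le> 2 * (f x)\<^sup>2 + 2 * (g x)\<^sup>2"
          using zero_le_power2[of "f x + g x"] by linarith
        then show ?thesis by simp
      qed
    qed
  qed
  then show ?thesis using fg by (auto simp: L2_def)
qed

lemma L2_scale: "f \<in> L2 \<Longrightarrow> (\<lambda>x. f x / c :: real) \<in> L2"
  by (auto simp: L2_def power_divide)

text \<open>Along sequences this is dominated convergence: \<open>w\<close> is square integrable and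
  the bound on \<open>q\<close> lives in a fixed ball, so their product is integrable.\<close>

lemma L2_test_dominated:
  fixes w :: "'a::euclidean_space \<Rightarrow> real"
  assumes "w \<in> L2" "\<And>s. q s \<in> borel_measurable lebesgue" "q0 \<in> borel_measurable lebesgue"
    and "\<And>s x. s \<in> S \<Longrightarrow> \<bar>q s x\<bar> \<le> K * indicator (cball 0 r) x"
    and "\<And>x. ((\<lambda>s. q s x) \<longlongrightarrow> q0 x) (at t within S)"
  shows "((\<lambda>s. LINT x|lebesgue. w x * q s x) \<longlongrightarrow> (LINT x|lebesgue. w x * q0 x)) (at (t::real) within S)"
  unfolding tendsto_at_iff_sequentially o_def
proof (intro allI impI)
  fix X assume X: "\<forall>i::nat. X i \<in> S - {t}" "X \<longlonglongrightarrow> t"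
  show "(\<lambda>i. LINT x|lebesgue. w x * q (X i) x) \<longlonglongrightarrow> (LINT x|lebesgue. w x * q0 x)"
  proof (rule integral_dominated_convergence)
    show "integrable lebesgue (\<lambda>x. \<bar>w x * (K * indicator (cball 0 r) x)\<bar>)"
      by (intro integrable_abs L2_mult_bounded_integrable[where K="\<bar>K\<bar>" and r=r] assms(1))
        (auto simp: abs_mult intro!: borel_measurable_times borel_measurable_indicator)
    show "AE x in lebesgue. (\<lambda>i. w x * q (X i) x) \<longlonglongrightarrow> w x * q0 x"
      using assms(5) X unfolding tendsto_at_iff_sequentially o_def by (auto intro!: tendsto_intros)
    show "AE x in lebesgue. norm (w x * q (X i) x) \<le> \<bar>w x * (K * indicator (cball 0 r) x)\<bar>" for i
    proof (rule AE_I2)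
      fix x
      have "\<bar>q (X i) x\<bar> \<le> \<bar>K * indicator (cball 0 r) x\<bar>"
        using assms(4)[of "X i" x] X(1) by force
      then show "norm (w x * q (X i) x) \<le> \<bar>w x * (K * indicator (cball 0 r) x)\<bar>"
        unfolding real_norm_def abs_mult[of "w x"] by (rule mult_left_mono) simp
    qed
  qed (use assms(1-3) in \<open>auto simp: L2_def\<close>)
qed

lemma einterval_0_iff: "t \<in> einterval 0 T \<longleftrightarrow> 0 < t \<and> ereal t < T"
  by (simp add: einterval_iff zero_ereal_def)

lemma sets_einterval [measurable]: "einterval a b \<in> sets lebesgue"
  using open_einterval[of a b] by (simp add: borel_open)

text \<open>The increment splits into (w(s) - w(t)) \<Psi>(s), small in the L2 norm, and w(t)
  (\<Psi>(s) - \<Psi>(t)), small by dominated convergence.\<close>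

lemma L2_pairing_continuous:
  fixes w :: "real \<Rightarrow> 'a::euclidean_space \<Rightarrow> real"
  assumes w: "w \<in> C_L2 T" and \<Psi>: "\<Psi> \<in> Cc_infinity"
  shows "continuous_on (time_dom T) (\<lambda>t. LINT x|lebesgue. w t x * \<Psi> (x, t))"
  unfolding continuous_on_def
proof
  fix t assume t: "t \<in> time_dom T"
  obtain K r where K: "K > 0" "r > 0" "\<And>x t. \<bar>\<Psi> (x, t)\<bar> \<le> K * indicator (cball 0 r) x"
    using Cc_infinity_bounded[OF \<Psi>] by blast
  have wt: "w s \<in> L2" if "s \<in> time_dom T" for s using w that by (simp add: C_L2_def)
  have int: "integrable lebesgue (\<lambda>x. f x * \<Psi> (x, s))" if "f \<in> L2" for f s
    by (rule L2_mult_bounded_integrable[OF that Cc_infinity_slice_measurable[OF \<Psi>] K(3)])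
  have lim1: "((\<lambda>s. LINT x|lebesgue. (w s x - w t x) * \<Psi> (x, s)) \<longlongrightarrow> 0) (at t within time_dom T)"
  proof (rule Lim_null_comparison)
    define C where "C = (measure lebesgue (cball (0::'a) r) + 1) * K"
    show "((\<lambda>s. C * L2_norm (\<lambda>x. w s x - w t x)) \<longlongrightarrow> 0) (at t within time_dom T)"
      using w t by (auto simp: C_L2_def intro!: tendsto_mult_right_zero)
    show "\<forall>\<^sub>F s in at t within time_dom T. norm (LINT x|lebesgue. (w s x - w t x) * \<Psi> (x, s))
        \<le> C * L2_norm (\<lambda>x. w s x - w t x)"
      unfolding eventually_at_filter
    proof (rule always_eventually, intro allI impI)
      fix s assume "s \<in> time_dom T"
      then show "norm (LINT x|lebesgue. (w s x - w t x) * \<Psi> (x, s)) \<le> C * L2_norm (\<lambda>x. w s x - w t x)"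
        unfolding C_def real_norm_def using K
        by (intro L2_mult_bounded_le[OF L2_diff[OF wt wt[OF t]] Cc_infinity_slice_measurable[OF \<Psi>] K(3)]) auto
    qed
  qed
  have cont: "continuous_on UNIV \<Psi>" using \<Psi> smooth_on_continuous_on by (auto simp: Cc_infinity_iff)
  have lim2: "((\<lambda>s. LINT x|lebesgue. w t x * \<Psi> (x, s)) \<longlongrightarrow> (LINT x|lebesgue. w t x * \<Psi> (x, t)))
      (at t within time_dom T)"
  proof (rule L2_test_dominated[OF wt[OF t] _ _ K(3)])
    fix x
    have "continuous_on UNIV (\<lambda>s. \<Psi> (x, s))"
      by (rule continuous_on_compose2[OF cont]) (auto intro!: continuous_intros)
    then show "((\<lambda>s. \<Psi> (x, s)) \<longlongrightarrow> \<Psi> (x, t)) (at t within time_dom T)"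
      by (auto simp: continuous_on_def intro: tendsto_within_subset)
  qed (rule Cc_infinity_slice_measurable[OF \<Psi>])+
  have "((\<lambda>s. (LINT x|lebesgue. (w s x - w t x) * \<Psi> (x, s)) + (LINT x|lebesgue. w t x * \<Psi> (x, s))) \<longlongrightarrow>
      0 + (LINT x|lebesgue. w t x * \<Psi> (x, t))) (at t within time_dom T)"
    by (intro tendsto_add lim1 lim2)
  moreover have "(LINT x|lebesgue. (w s x - w t x) * \<Psi> (x, s)) + (LINT x|lebesgue. w t x * \<Psi> (x, s))
      = (LINT x|lebesgue. w s x * \<Psi> (x, s))" if "s \<in> time_dom T" for s
    by (subst Bochner_Integration.integral_add[symmetric])
      (auto intro!: int L2_diff wt that t simp: algebra_simps)
  ultimately show "((\<lambda>s. LINT x|lebesgue. w s x * \<Psi> (x, s)) \<longlongrightarrow> (LINT x|lebesgue. w t x * \<Psi> (x, t)))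
      (at t within time_dom T)"
    by (rule_tac Lim_transform_eventually) (auto simp: eventually_at_filter)
qed

text \<open>A product rule. The difference quotient is the sum of three pairings: the error of the
  L2 difference quotient against \<Psi>(s), the derivative \<open>D\<close> against \<Psi>(s), and
  w(t) against the difference quotient of \<Psi>.\<close>

lemma L2_pairing_has_derivative:
  fixes w :: "real \<Rightarrow> 'a::euclidean_space \<Rightarrow> real"
  assumes w: "w \<in> C1_L2 T" and \<Psi>: "\<Psi> \<in> Cc_infinity" and t: "t \<in> time_dom T"
  shows "((\<lambda>t. LINT x|lebesgue. w t x * \<Psi> (x, t)) has_field_derivative
     (LINT x|lebesgue. time_deriv T w t x * \<Psi> (x, t)) + (LINT x|lebesgue. w t x * D\<^sub>t \<Psi> (x, t)))
     (at t within time_dom T)"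
proof -
  define D where "D = time_deriv T w t"
  have D: "has_L2_derivative T w D t"
    unfolding D_def time_deriv_def using w t by (intro someI_ex[of "\<lambda>w'. has_L2_derivative T w w' t"]) (auto simp: C1_L2_def)
  have wt: "w s \<in> L2" if "s \<in> time_dom T" for s using w that by (auto simp: C1_L2_def C_L2_def)
  have DL2: "D \<in> L2" using D by (simp add: has_L2_derivative_def)
  obtain K r where K: "K > 0" "r > 0" "\<And>x t. \<bar>\<Psi> (x, t)\<bar> \<le> K * indicator (cball 0 r) x"
    using Cc_infinity_bounded[OF \<Psi>] by blast
  obtain K' r' where K': "K' > 0" "r' > 0" "\<And>x t. \<bar>D\<^sub>t \<Psi> (x, t)\<bar> \<le> K' * indicator (cball 0 r') x"
    using Cc_infinity_bounded[OF Cc_infinity_D\<^sub>t[OF \<Psi>]] by blast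
  have sm: "smooth_on UNIV \<Psi>" using \<Psi> by (simp add: Cc_infinity_iff)
  have int: "integrable lebesgue (\<lambda>x. f x * \<Psi> (x, s))" if "f \<in> L2" for f s
    by (rule L2_mult_bounded_integrable[OF that Cc_infinity_slice_measurable[OF \<Psi>] K(3)])
  have lim1: "((\<lambda>s. LINT x|lebesgue. ((w s x - w t x) / (s - t) - D x) * \<Psi> (x, s)) \<longlongrightarrow> 0) (at t within time_dom T)"
  proof (rule Lim_null_comparison)
    define C where "C = (measure lebesgue (cball (0::'a) r) + 1) * K"
    show "((\<lambda>s. C * L2_norm (\<lambda>x. (w s x - w t x) / (s - t) - D x)) \<longlongrightarrow> 0) (at t within time_dom T)"
      using D by (auto simp: has_L2_derivative_def intro!: tendsto_mult_right_zero)
    show "\<forall>\<^sub>F s in at t within time_dom T. norm (LINT x|lebesgue. ((w s x - w t x) / (s - t) - D x) * \<Psi> (x, s))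
        \<le> C * L2_norm (\<lambda>x. (w s x - w t x) / (s - t) - D x)"
      unfolding eventually_at_filter
    proof (rule always_eventually, intro allI impI)
      fix s assume s: "s \<in> time_dom T"
      show "norm (LINT x|lebesgue. ((w s x - w t x) / (s - t) - D x) * \<Psi> (x, s))
        \<le> C * L2_norm (\<lambda>x. (w s x - w t x) / (s - t) - D x)"
        unfolding C_def real_norm_def using K(1)
        by (intro L2_mult_bounded_le[OF L2_diff[OF L2_scale[OF L2_diff[OF wt[OF s] wt[OF t]]] DL2]
              Cc_infinity_slice_measurable[OF \<Psi>] K(3)]) auto
    qed
  qed
  have cont: "continuous_on UNIV \<Psi>" using sm smooth_on_continuous_on by blast
  have lim2: "((\<lambda>s. LINT x|lebesgue. D x * \<Psi> (x, s)) \<longlongrightarrow> (LINT x|lebesgue. D x * \<Psi> (x, t)))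
      (at t within time_dom T)"
  proof (rule L2_test_dominated[OF DL2 _ _ K(3)])
    fix x
    have "continuous_on UNIV (\<lambda>s. \<Psi> (x, s))"
      by (rule continuous_on_compose2[OF cont]) (auto intro!: continuous_intros)
    then show "((\<lambda>s. \<Psi> (x, s)) \<longlongrightarrow> \<Psi> (x, t)) (at t within time_dom T)"
      by (auto simp: continuous_on_def intro: tendsto_within_subset)
  qed (rule Cc_infinity_slice_measurable[OF \<Psi>])+
  have lim3: "((\<lambda>s. LINT x|lebesgue. w t x * ((\<Psi> (x, s) - \<Psi> (x, t)) / (s - t))) \<longlongrightarrow> (LINT x|lebesgue. w t x * D\<^sub>t \<Psi> (x, t)))
      (at t within time_dom T)"
  proof (rule L2_test_dominated[OF wt[OF t]])
    show "\<bar>(\<Psi> (x, s) - \<Psi> (x, t)) / (s - t)\<bar> \<le> K' * indicator (cball 0 r') x" for s x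
    proof -
      \<comment> \<open>The mean value inequality turns the bound on \<open>D\<^sub>t \<Psi>\<close>
        into a bound on the difference quotients that is uniform in s and supported in a
        ball.\<close>
      have "norm (\<Psi> (x, s) - \<Psi> (x, t)) \<le> K' * indicator (cball 0 r') x * norm (s - t)"
      proof (rule field_differentiable_bound[where S=UNIV])
        show "((\<lambda>s. \<Psi> (x, s)) has_field_derivative D\<^sub>t \<Psi> (x, z)) (at z within UNIV)" for z
          using smooth_slice(3)[OF sm] by simp
        show "norm (D\<^sub>t \<Psi> (x, z)) \<le> K' * indicator (cball 0 r') x" for z using K'(3) by simp
      qed auto
      then show ?thesis using K'(1) by (cases "s = t") (auto simp: field_simps)
    qed
    show "((\<lambda>s. (\<Psi> (x, s) - \<Psi> (x, t)) / (s - t)) \<longlongrightarrow> D\<^sub>t \<Psi> (x, t)) (at t within time_dom T)" for x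
      using smooth_slice(3)[OF sm, of x t] by (auto simp: has_field_derivative_iff intro: tendsto_within_subset)
    show "(\<lambda>x. (\<Psi> (x, s) - \<Psi> (x, t)) / (s - t)) \<in> borel_measurable lebesgue" for s
      by (intro borel_measurable_divide borel_measurable_diff Cc_infinity_slice_measurable[OF \<Psi>]) auto
  qed (rule Cc_infinity_slice_measurable[OF Cc_infinity_D\<^sub>t[OF \<Psi>]])
  have "((\<lambda>s. (LINT x|lebesgue. ((w s x - w t x) / (s - t) - D x) * \<Psi> (x, s)) + (LINT x|lebesgue. D x * \<Psi> (x, s))
       + (LINT x|lebesgue. w t x * ((\<Psi> (x, s) - \<Psi> (x, t)) / (s - t)))) \<longlongrightarrow>
      0 + (LINT x|lebesgue. D x * \<Psi> (x, t)) + (LINT x|lebesgue. w t x * D\<^sub>t \<Psi> (x, t))) (at t within time_dom T)"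
    by (intro tendsto_add lim1 lim2 lim3)
  moreover have "(LINT x|lebesgue. ((w s x - w t x) / (s - t) - D x) * \<Psi> (x, s)) + (LINT x|lebesgue. D x * \<Psi> (x, s))
       + (LINT x|lebesgue. w t x * ((\<Psi> (x, s) - \<Psi> (x, t)) / (s - t)))
      = ((LINT x|lebesgue. w s x * \<Psi> (x, s)) - (LINT x|lebesgue. w t x * \<Psi> (x, t))) / (s - t)"
    if s: "s \<in> time_dom T" "s \<noteq> t" for s
  proof -
    have "(LINT x|lebesgue. ((w s x - w t x) / (s - t) - D x) * \<Psi> (x, s)) + (LINT x|lebesgue. D x * \<Psi> (x, s))
      = (LINT x|lebesgue. ((w s x - w t x) / (s - t) - D x) * \<Psi> (x, s) + D x * \<Psi> (x, s))"
      by (rule Bochner_Integration.integral_add[symmetric, OF int[OF L2_diff[OF L2_scale[OF L2_diff[OF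
                  wt[OF s(1)] wt[OF t]]] DL2]] int[OF DL2]])
    also have "\<dots> = (LINT x|lebesgue. ((w s x - w t x) / (s - t)) * \<Psi> (x, s))"
      by (simp add: algebra_simps)
    also have "\<dots> = (LINT x|lebesgue. (w s x * \<Psi> (x, s) - w t x * \<Psi> (x, s)) / (s - t))"
      by (simp add: algebra_simps)
    also have "\<dots> = ((LINT x|lebesgue. w s x * \<Psi> (x, s)) - (LINT x|lebesgue. w t x * \<Psi> (x, s))) / (s - t)"
      by (subst integral_divide_zero, subst Bochner_Integration.integral_diff) (auto intro!: int wt s t)
    finally have 1: "(LINT x|lebesgue. ((w s x - w t x) / (s - t) - D x) * \<Psi> (x, s)) + (LINT x|lebesgue. D x * \<Psi> (x, s))
      = ((LINT x|lebesgue. w s x * \<Psi> (x, s)) - (LINT x|lebesgue. w t x * \<Psi> (x, s))) / (s - t)" .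
    have "(LINT x|lebesgue. w t x * ((\<Psi> (x, s) - \<Psi> (x, t)) / (s - t))) =
       (LINT x|lebesgue. (w t x * \<Psi> (x, s) - w t x * \<Psi> (x, t)) / (s - t))"
      by (simp add: algebra_simps)
    also have "\<dots> = ((LINT x|lebesgue. w t x * \<Psi> (x, s)) - (LINT x|lebesgue. w t x * \<Psi> (x, t))) / (s - t)"
      by (subst integral_divide_zero, subst Bochner_Integration.integral_diff) (auto intro!: int wt s t)
    finally have 2: "(LINT x|lebesgue. w t x * ((\<Psi> (x, s) - \<Psi> (x, t)) / (s - t))) =
      ((LINT x|lebesgue. w t x * \<Psi> (x, s)) - (LINT x|lebesgue. w t x * \<Psi> (x, t))) / (s - t)" .
    show ?thesis unfolding 1 2 add_divide_distrib[symmetric] by simp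
  qed
  ultimately show ?thesis
    unfolding has_field_derivative_iff D_def[symmetric]
    by (rule_tac Lim_transform_eventually[rotated]) (auto simp: eventually_at_filter)
qed

section \<open>Integration by parts in time and in space\<close>

text \<open>T may be infinite and nothing is known near T; vanishing after some b < T moves
  everything to a compact interval, where continuous functions are integrable and the fundamental
  theorem applies.\<close>

lemma vanishing_set_integrable:
  fixes f :: "real \<Rightarrow> real"
  assumes "continuous_on (time_dom T) f" "\<And>t. t \<ge> b \<Longrightarrow> f t = 0" "0 < b" "ereal b < T"
  shows "set_integrable lebesgue (einterval 0 T) f"
    and "(LINT t:einterval 0 T|lebesgue. f t) = integral {0..b} f"
proof -
  have sub: "{0..b} \<subseteq> time_dom T" using assms(4)
    by (auto simp: time_dom_def intro: le_less_trans[of _ "ereal b"])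
  have i: "set_integrable lebesgue {0..b} f"
    by (rule absolutely_integrable_continuous_real) (rule continuous_on_subset[OF assms(1) sub])
  \<comment> \<open>Where \<open>f\<close> can be nonzero the two intervals differ only in the point
    0.\<close>
  have eq: "AE t in lebesgue. indicator (einterval 0 T) t *\<^sub>R f t = indicator {0..b} t *\<^sub>R f t"
  proof -
    have "AE t in lebesgue. t \<noteq> (0::real)" by (rule AE_completion[OF AE_lborel_singleton])
    then show ?thesis
    proof eventually_elim
      case (elim t)
      show ?case
      proof (cases "t \<ge> b")
        case True then show ?thesis using assms(2) by simp
      next
        case False
        then have "ereal t < T" using assms(4) by (auto intro: less_trans[of _ "ereal b"])
        then show ?thesis using elim False by (auto simp: indicator_def einterval_0_iff)
      qed
    qed
  qed
  have m: "(\<lambda>t. indicator (einterval 0 T) t *\<^sub>R f t) \<in> borel_measurable lebesgue"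
  proof (rule borel_measurable_AE)
    show "(\<lambda>t. indicator {0..b} t *\<^sub>R f t) \<in> borel_measurable lebesgue"
      using i by (simp add: set_integrable_def)
    show "AE t in lebesgue. indicator {0..b} t *\<^sub>R f t = indicator (einterval 0 T) t *\<^sub>R f t" using eq by auto
  qed
  have m': "(\<lambda>t. indicator {0..b} t *\<^sub>R f t) \<in> borel_measurable lebesgue"
    using i by (simp add: set_integrable_def)
  show "set_integrable lebesgue (einterval 0 T) f"
    using i unfolding set_integrable_def by (subst integrable_cong_AE[OF m m' eq])
  have "(LINT t:einterval 0 T|lebesgue. f t) = (LINT t:{0..b}|lebesgue. f t)"
    unfolding set_lebesgue_integral_def by (rule integral_cong_AE[OF m m' eq])
  then show "(LINT t:einterval 0 T|lebesgue. f t) = integral {0..b} f"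
    using set_lebesgue_integral_eq_integral(2)[OF i] by simp
qed

text \<open>After \<open>b\<close> the function vanishes in a neighbourhood; at \<open>b\<close>
  itself the value is the limit from the right, by continuity of the derivative.\<close>

lemma D\<^sub>t_vanish:
  assumes "\<Psi> \<in> Cc_infinity" "\<And>x t. t \<ge> b \<Longrightarrow> \<Psi> (x, t) = 0" "t \<ge> b"
  shows "D\<^sub>t \<Psi> (x, t) = 0"
proof -
  have *: "D\<^sub>t \<Psi> (x, s) = 0" if "s > b" for s
  proof -
    have "frechet_derivative \<Psi> (at (x, s)) = frechet_derivative (\<lambda>_. 0) (at (x, s))"
      using that assms(2) by (intro frechet_derivative_cong_open[of "UNIV \<times> {b<..}"]) (auto intro!: open_Times)
    then show ?thesis by (simp add: D\<^sub>t_def)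
  qed
  have "continuous_on UNIV (D\<^sub>t \<Psi>)"
    using Cc_infinity_D\<^sub>t[OF assms(1)] smooth_on_continuous_on by (auto simp: Cc_infinity_iff)
  then have "continuous_on UNIV (\<lambda>s. D\<^sub>t \<Psi> (x, s))"
    by (rule continuous_on_compose2) (auto intro!: continuous_intros)
  then have "((\<lambda>s. D\<^sub>t \<Psi> (x, s)) \<longlongrightarrow> D\<^sub>t \<Psi> (x, t)) (at_right t)"
    by (auto simp: continuous_on_def intro: tendsto_within_subset)
  moreover have "\<forall>\<^sub>F s in at_right t. D\<^sub>t \<Psi> (x, s) = 0"
    using * assms(3) by (auto simp: eventually_at_filter)
  ultimately show ?thesis
    by (metis tendsto_unique tendsto_eventually trivial_limit_at_right_real)
qed

lemma time_integration_by_parts: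
  fixes w :: "real \<Rightarrow> 'a::euclidean_space \<Rightarrow> real"
  assumes w: "w \<in> C1_L2 T" and \<Psi>: "\<Psi> \<in> Cc_infinity" "\<And>x t. t \<ge> b \<Longrightarrow> \<Psi> (x, t) = 0" "0 < b" "ereal b < T"
  shows "set_integrable lebesgue (einterval 0 T) (\<lambda>t. LINT x|lebesgue. time_deriv T w t x * \<Psi> (x, t))"
    and "set_integrable lebesgue (einterval 0 T) (\<lambda>t. LINT x|lebesgue. w t x * \<Psi> (x, t))"
    and "(LINT t:einterval 0 T|lebesgue. LINT x|lebesgue. time_deriv T w t x * \<Psi> (x, t)) =
      - (LINT x|lebesgue. w 0 x * \<Psi> (x, 0)) -
      (LINT t:einterval 0 T|lebesgue. LINT x|lebesgue. w t x * D\<^sub>t \<Psi> (x, t))"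
proof -
  define P where "P t = (LINT x|lebesgue. w t x * \<Psi> (x, t))" for t
  define P1 where "P1 t = (LINT x|lebesgue. time_deriv T w t x * \<Psi> (x, t))" for t
  define P2 where "P2 t = (LINT x|lebesgue. w t x * D\<^sub>t \<Psi> (x, t))" for t
  have c: "continuous_on (time_dom T) P" "continuous_on (time_dom T) P1" "continuous_on (time_dom T) P2"
    unfolding P_def P1_def P2_def using w \<Psi>(1)
    by (auto intro!: L2_pairing_continuous Cc_infinity_D\<^sub>t simp: C1_L2_def)
  have z: "P t = 0" "P1 t = 0" "P2 t = 0" if "t \<ge> b" for t
    unfolding P_def P1_def P2_def using D\<^sub>t_vanish[OF \<Psi>(1,2) that] \<Psi>(2)[OF that] by auto
  note v = vanishing_set_integrable[OF c(1) z(1) \<Psi>(3,4)] vanishing_set_integrable[OF c(2) z(2) \<Psi>(3,4)]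
    vanishing_set_integrable[OF c(3) z(3) \<Psi>(3,4)]
  show "set_integrable lebesgue (einterval 0 T) P1" "set_integrable lebesgue (einterval 0 T) P"
    using v by auto
  have sub: "{0..b} \<subseteq> time_dom T" using \<Psi>(4)
    by (auto simp: time_dom_def intro: le_less_trans[of _ "ereal b"])
  have "((\<lambda>t. P1 t + P2 t) has_integral P b - P 0) {0..b}"
  proof (rule fundamental_theorem_of_calculus)
    fix t assume "t \<in> {0..b}"
    then have "(P has_field_derivative P1 t + P2 t) (at t within time_dom T)"
      unfolding P_def P1_def P2_def using sub by (intro L2_pairing_has_derivative w \<Psi>(1)) auto
    then show "(P has_vector_derivative P1 t + P2 t) (at t within {0..b})"
      using DERIV_subset sub has_real_derivative_iff_has_vector_derivative by blast
  qed (use \<Psi>(3) in simp)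
  then have "integral {0..b} (\<lambda>t. P1 t + P2 t) = - P 0" using z by (simp add: integral_unique)
  moreover have "integral {0..b} (\<lambda>t. P1 t + P2 t) = integral {0..b} P1 + integral {0..b} P2"
    using c sub by (intro Henstock_Kurzweil_Integration.integral_add integrable_continuous_real continuous_on_subset[OF _ sub])
  ultimately show "(LINT t:einterval 0 T|lebesgue. P1 t) = - P 0 - (LINT t:einterval 0 T|lebesgue. P2 t)"
    using v by simp
qed

text \<open>For each basis vector b, the defining identity of the weak gradient is applied to the
  slice of \<open>D\<^sub>x b \<Psi>\<close> and only its b-component is kept; summing over b
  produces the Laplacian.\<close>

lemma weak_grad_pairing:
  fixes f :: "'a::euclidean_space \<Rightarrow> real"
  assumes f: "f \<in> H1" and \<Psi>: "\<Psi> \<in> Cc_infinity"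
  shows "integrable lebesgue (\<lambda>x. weak_grad f x \<bullet> grad (\<lambda>y. \<Psi> (y, t)) x)"
    and "(LINT x|lebesgue. weak_grad f x \<bullet> grad (\<lambda>y. \<Psi> (y, t)) x) = - (LINT x|lebesgue. f x * Lap \<Psi> (x, t))"
proof -
  define g where "g = weak_grad f"
  have g: "g \<in> L2" "is_weak_grad f g"
    using someI_ex[of "\<lambda>g. g \<in> L2 \<and> is_weak_grad f g"] f by (auto simp: g_def weak_grad_def H1_def)
  have fL2: "f \<in> L2" using f by (simp add: H1_def)
  have gb: "(\<lambda>x. g x \<bullet> b) \<in> L2" if "b \<in> Basis" for b
  proof -
    have "integrable lebesgue (\<lambda>x. (norm (g x \<bullet> b))\<^sup>2)"
    proof (rule Bochner_Integration.integrable_bound)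
      show "integrable lebesgue (\<lambda>x. (norm (g x))\<^sup>2)" using g by (simp add: L2_def)
      show "AE x in lebesgue. norm ((norm (g x \<bullet> b))\<^sup>2) \<le> norm ((norm (g x))\<^sup>2)"
        using power_mono[OF Basis_le_norm[OF that], of "g x" 2 for x] by (intro AE_I2) simp
      show "(\<lambda>x. (norm (g x \<bullet> b))\<^sup>2) \<in> borel_measurable lebesgue" using g by (auto simp: L2_def)
    qed
    then show ?thesis using g by (auto simp: L2_def)
  qed
  have fd: "frechet_derivative (\<lambda>y. \<Phi> (y, t)) (at x) h = frechet_derivative \<Phi> (at (x, t)) (h, 0)"
    if "\<Phi> \<in> Cc_infinity" for x h and \<Phi> :: "'a \<times> real \<Rightarrow> real"
    using frechet_derivative_at[OF smooth_slice(2)[of \<Phi> t x]] that by (metis Cc_infinity_iff)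
  have gr: "grad (\<lambda>y. \<Phi> (y, t)) x = (\<Sum>b\<in>Basis. D\<^sub>x b \<Phi> (x, t) *\<^sub>R b)"
    if "\<Phi> \<in> Cc_infinity" for x and \<Phi> :: "'a \<times> real \<Rightarrow> real"
    using fd[OF that] by (simp add: grad_def D\<^sub>x_def)
  have eq: "g x \<bullet> grad (\<lambda>y. \<Psi> (y, t)) x = (\<Sum>b\<in>Basis. (g x \<bullet> b) * D\<^sub>x b \<Psi> (x, t))" for x
    by (simp add: gr[OF \<Psi>] inner_sum_right mult.commute)
  have int: "integrable lebesgue (\<lambda>x. h x * \<Phi> (x, t))" if \<Phi>: "\<Phi> \<in> Cc_infinity" and "h \<in> L2"
    for h and \<Phi> :: "'a \<times> real \<Rightarrow> real"
  proof -
    obtain K r where K: "K > 0" "r > 0" "\<And>x t. \<bar>\<Phi> (x, t)\<bar> \<le> K * indicator (cball 0 r) x"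
      using Cc_infinity_bounded[OF \<Phi>] by blast
    show ?thesis
      by (rule L2_mult_bounded_integrable[OF that(2) Cc_infinity_slice_measurable[OF \<Phi>] K(3)])
  qed
  have i1: "integrable lebesgue (\<lambda>x. (g x \<bullet> b) * D\<^sub>x b \<Psi> (x, t))" if "b \<in> Basis" for b
    by (rule int[OF Cc_infinity_D\<^sub>x[OF \<Psi>] gb[OF that]])
  show "integrable lebesgue (\<lambda>x. weak_grad f x \<bullet> grad (\<lambda>y. \<Psi> (y, t)) x)"
    unfolding g_def[symmetric] eq by (rule Bochner_Integration.integrable_sum) (rule i1)
  have b: "(LINT x|lebesgue. (g x \<bullet> b) * D\<^sub>x b \<Psi> (x, t)) = - (LINT x|lebesgue. f x * D\<^sub>x b (D\<^sub>x b \<Psi>) (x, t))"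
    if b: "b \<in> Basis" for b
  proof -
    define \<phi> where "\<phi> y = D\<^sub>x b \<Psi> (y, t)" for y
    have \<phi>: "\<phi> \<in> Cc_infinity" unfolding \<phi>_def by (rule Cc_infinity_slice[OF Cc_infinity_D\<^sub>x[OF \<Psi>]])
    have grb: "grad \<phi> x = (\<Sum>c\<in>Basis. D\<^sub>x c (D\<^sub>x b \<Psi>) (x, t) *\<^sub>R c)" for x
      unfolding \<phi>_def by (rule gr[OF Cc_infinity_D\<^sub>x[OF \<Psi>]])
    have "(LINT x|lebesgue. f x *\<^sub>R grad \<phi> x) \<bullet> b = (- (LINT x|lebesgue. \<phi> x *\<^sub>R g x)) \<bullet> b"
      using g(2) \<phi> by (simp add: is_weak_grad_def)
    moreover have "integrable lebesgue (\<lambda>x. f x *\<^sub>R grad \<phi> x)"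
      unfolding grb scaleR_sum_right scaleR_scaleR
      by (intro Bochner_Integration.integrable_sum integrable_scaleR_left int Cc_infinity_D\<^sub>x \<Psi> fL2)
    then have "(LINT x|lebesgue. f x *\<^sub>R grad \<phi> x) \<bullet> b = (LINT x|lebesgue. f x * D\<^sub>x b (D\<^sub>x b \<Psi>) (x, t))"
      by (subst integral_inner_left[symmetric])
        (auto simp: grb inner_sum_left_Basis b)
    moreover have "integrable lebesgue (\<lambda>x. \<phi> x *\<^sub>R g x)"
    proof -
      have "integrable lebesgue (\<lambda>x. \<Sum>c\<in>Basis. ((g x \<bullet> c) * \<phi> x) *\<^sub>R c)"
        unfolding \<phi>_def by (intro Bochner_Integration.integrable_sum integrable_scaleR_left int Cc_infinity_D\<^sub>x \<Psi> gb)
      moreover have "(\<Sum>c\<in>Basis. ((g x \<bullet> c) * \<phi> x) *\<^sub>R c) = \<phi> x *\<^sub>R g x" for x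
        by (subst (2) euclidean_representation[symmetric]) (simp add: scaleR_sum_right mult.commute)
      ultimately show ?thesis by simp
    qed
    then have "(LINT x|lebesgue. \<phi> x *\<^sub>R g x) \<bullet> b = (LINT x|lebesgue. (g x \<bullet> b) * D\<^sub>x b \<Psi> (x, t))"
      by (subst integral_inner_left[symmetric]) (auto simp: \<phi>_def mult.commute)
    ultimately show ?thesis by (simp add: inner_minus_left)
  qed
  have "(LINT x|lebesgue. g x \<bullet> grad (\<lambda>y. \<Psi> (y, t)) x) = (\<Sum>b\<in>Basis. LINT x|lebesgue. (g x \<bullet> b) * D\<^sub>x b \<Psi> (x, t))"
    unfolding eq by (rule Bochner_Integration.integral_sum) (rule i1)
  also have "\<dots> = - (\<Sum>b\<in>Basis. LINT x|lebesgue. f x * D\<^sub>x b (D\<^sub>x b \<Psi>) (x, t))"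
    by (simp add: b sum_negf)
  also have "(\<Sum>b\<in>Basis. LINT x|lebesgue. f x * D\<^sub>x b (D\<^sub>x b \<Psi>) (x, t)) = (LINT x|lebesgue. f x * Lap \<Psi> (x, t))"
    unfolding Lap_def sum_distrib_left
    by (rule Bochner_Integration.integral_sum[symmetric]) (intro int Cc_infinity_D\<^sub>x \<Psi> fL2)
  finally show "(LINT x|lebesgue. weak_grad f x \<bullet> grad (\<lambda>y. \<Psi> (y, t)) x) = - (LINT x|lebesgue. f x * Lap \<Psi> (x, t))"
    by (simp add: g_def)
qed

section \<open>Finite speed of propagation almost everywhere\<close>

text \<open>Lebesgue measure is complete, so measurability passes from one function to the other; if
  neither is integrable, both integrals are 0 by convention.\<close>

lemma lebesgue_integral_cong_AE:
  fixes f g :: "'a::euclidean_space \<Rightarrow> real"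
  assumes "AE x in lebesgue. f x = g x"
  shows "(LINT x|lebesgue. f x) = (LINT x|lebesgue. g x)"
    and "integrable lebesgue f \<longleftrightarrow> integrable lebesgue g"
proof -
  have assms': "AE x in lebesgue. g x = f x" using assms by eventually_elim simp
  have m: "f \<in> borel_measurable lebesgue \<longleftrightarrow> g \<in> borel_measurable lebesgue"
    using borel_measurable_AE[OF _ assms] borel_measurable_AE[OF _ assms'] by blast
  show i: "integrable lebesgue f \<longleftrightarrow> integrable lebesgue g"
  proof (cases "f \<in> borel_measurable lebesgue")
    case True
    then show ?thesis using integrable_cong_AE[OF _ _ assms] m by blast
  next
    case False
    then have "\<not> integrable lebesgue f" "\<not> integrable lebesgue g"
      using m by (auto dest: borel_measurable_integrable)
    then show ?thesis by blast
  qed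
  show "(LINT x|lebesgue. f x) = (LINT x|lebesgue. g x)"
  proof (cases "f \<in> borel_measurable lebesgue")
    case True
    then show ?thesis using integral_cong_AE[OF _ _ assms] m by blast
  next
    case False
    then have "\<not> integrable lebesgue f" "\<not> integrable lebesgue g"
      using m by (auto dest: borel_measurable_integrable)
    then show ?thesis by (simp add: not_integrable_integral_eq)
  qed
qed

lemma set_lebesgue_integral_cong_AE_einterval:
  fixes f g :: "real \<Rightarrow> real"
  assumes "AE t in lebesgue. t \<in> A \<longrightarrow> f t = g t"
  shows "(LINT t:A|lebesgue. f t) = (LINT t:A|lebesgue. g t)"
    and "set_integrable lebesgue A f \<longleftrightarrow> set_integrable lebesgue A g"
proof -
  have "AE t in lebesgue. indicator A t *\<^sub>R f t = indicator A t *\<^sub>R g t"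
    using assms by eventually_elim (auto simp: indicator_def)
  from lebesgue_integral_cong_AE[OF this]
  show "(LINT t:A|lebesgue. f t) = (LINT t:A|lebesgue. g t)"
    "set_integrable lebesgue A f \<longleftrightarrow> set_integrable lebesgue A g"
    by (simp_all add: set_lebesgue_integral_def set_integrable_def)
qed

lemma AE_lebesgue_dense:
  fixes P :: "real \<Rightarrow> bool"
  assumes "AE s in lebesgue. P s" "a < b"
  shows "\<exists>s\<in>{a<..<b}. P s"
proof (rule ccontr)
  assume "\<not> (\<exists>s\<in>{a<..<b}. P s)"
  moreover obtain N where "negligible N" "{x. \<not> P x} \<subseteq> N"
    using assms(1) by (auto simp: eventually_ae_filter_negligible)
  ultimately have "negligible {a<..<b}"
    by (auto intro: negligible_subset)
  then show False using open_not_negligible[of "{a<..<b}"] assms(2) by auto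
qed

text \<open>The support is defined through open sets, each with its own null set of times; a
  countable subcover makes one null set suffice for \<open>u\<close> and \<open>v\<close>. The time
  derivative at a good time t is reached through good times s < t: the ball of radius r0 + s is
  smaller, so u(s) and u(t) both vanish beyond r0 + t and the difference quotient says the
  derivative does too.\<close>

lemma cone_support:
  fixes u v :: "real \<Rightarrow> 'a::euclidean_space \<Rightarrow> real"
  assumes u: "u \<in> C1_L2 T"
    and supp: "spacetime_supp T (\<lambda>t x. (u t x, v t x)) \<subseteq> {(x, t). t \<in> time_dom T \<and> norm x \<le> r0 + t}"
  shows "AE t in lebesgue. t \<in> einterval 0 T \<longrightarrow>
    (AE x in lebesgue. norm x > r0 + t \<longrightarrow> u t x = 0 \<and> v t x = 0 \<and> time_deriv T u t x = 0)"
proof -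
  define P where "P W \<longleftrightarrow> (AE s in lebesgue. s \<in> time_dom T \<longrightarrow>
            (AE y in lebesgue. (y, s) \<in> W \<longrightarrow> (u s y, v s y) = 0))" for W
  define F where "F = {W. open W \<and> P W}"
  obtain F' where F': "F' \<subseteq> F" "countable F'" "\<Union>F' = \<Union>F"
    using Lindelof[of F] by (auto simp: F_def)
  have cover: "(x, t) \<in> \<Union>F'" if xt: "t \<in> time_dom T" "norm x > r0 + t" for x t
  proof -
    have "(x, t) \<notin> spacetime_supp T (\<lambda>t x. (u t x, v t x))" using supp xt by auto
    then obtain W where "open W" "(x, t) \<in> W" "P W"
      using xt(1) by (auto simp: spacetime_supp_def P_def)
    then show ?thesis using F'(3) by (auto simp: F_def)
  qed
  have "AE s in lebesgue. \<forall>W\<in>F'. s \<in> time_dom T \<longrightarrow>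
            (AE y in lebesgue. (y, s) \<in> W \<longrightarrow> (u s y, v s y) = 0)"
    using F' by (subst AE_ball_countable) (auto simp: F_def P_def)
  then have good: "AE s in lebesgue. s \<in> time_dom T \<longrightarrow>
            (AE y in lebesgue. norm y > r0 + s \<longrightarrow> u s y = 0 \<and> v s y = 0)"
  proof eventually_elim
    case (elim s)
    show ?case
    proof
      assume s: "s \<in> time_dom T"
      then have "AE y in lebesgue. \<forall>W\<in>F'. (y, s) \<in> W \<longrightarrow> (u s y, v s y) = 0"
        using F'(2) elim by (subst AE_ball_countable) auto
      then show "AE y in lebesgue. norm y > r0 + s \<longrightarrow> u s y = 0 \<and> v s y = 0"
      proof eventually_elim
        case (elim y)
        then show ?case using cover[OF s, of y] by (auto simp: zero_prod_def)
      qed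
    qed
  qed
  define G where "G s \<longleftrightarrow> (s \<in> time_dom T \<longrightarrow>
            (AE y in lebesgue. norm y > r0 + s \<longrightarrow> u s y = 0 \<and> v s y = 0))" for s
  from good have AEG: "AE s in lebesgue. G s" by (simp add: G_def)
  then show ?thesis
  proof eventually_elim
    case (elim t)
    show ?case
    proof
      assume "t \<in> einterval 0 T"
      then have t: "0 < t" "ereal t < T" "t \<in> time_dom T" by (auto simp: einterval_0_iff time_dom_def)
      define D where "D = time_deriv T u t"
      have D: "has_L2_derivative T u D t"
        unfolding D_def time_deriv_def using u t(3)
        by (intro someI_ex[of "\<lambda>w'. has_L2_derivative T u w' t"]) (auto simp: C1_L2_def)
      have uL2: "u s \<in> L2" if "s \<in> time_dom T" for s using u that by (auto simp: C1_L2_def C_L2_def)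
      have DL2: "D \<in> L2" using D by (simp add: has_L2_derivative_def)
      have ut: "AE y in lebesgue. norm y > r0 + t \<longrightarrow> u t y = 0 \<and> v t y = 0"
        using elim t(3) by (simp add: G_def)
      define A where "A = {y::'a. norm y > r0 + t}"
      have "open A" unfolding A_def by (intro open_Collect_less continuous_intros)
      then have A: "A \<in> sets lebesgue" by (simp add: borel_open)
      have i: "integrable lebesgue (\<lambda>y. indicator A y * (norm (D y))\<^sup>2)"
      proof (rule Bochner_Integration.integrable_bound)
        show "integrable lebesgue (\<lambda>y. (norm (D y))\<^sup>2)" using DL2 by (simp add: L2_def)
        show "(\<lambda>y. indicator A y * (norm (D y))\<^sup>2) \<in> borel_measurable lebesgue"
          using DL2 A by (auto simp: L2_def intro!: borel_measurable_times borel_measurable_indicator)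
      qed (auto simp: indicator_def)
      define I where "I = (LINT y|lebesgue. indicator A y * (norm (D y))\<^sup>2)"
      define Q where "Q s = L2_norm (\<lambda>x. (u s x - u t x) / (s - t) - D x)" for s
      \<comment> \<open>On \<open>A\<close> the difference quotient is 0, so there the integrand of
        \<open>Q s\<close> squared is exactly that of \<open>I\<close>.\<close>
      have le: "I \<le> (Q s)\<^sup>2" if s: "s \<in> {0<..<t}" "G s" for s
      proof -
        have st: "s \<in> time_dom T" using s(1) t(2) by (auto simp: time_dom_def intro: less_trans[of _ "ereal t"])
        have us: "AE y in lebesgue. norm y > r0 + s \<longrightarrow> u s y = 0 \<and> v s y = 0"
          using s(2) st by (simp add: G_def)
        show ?thesis unfolding I_def Q_def L2_norm_power2
        proof (rule integral_mono_AE')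
          show "integrable lebesgue (\<lambda>x. (norm ((u s x - u t x) / (s - t) - D x))\<^sup>2)"
            using L2_diff[OF L2_scale[OF L2_diff[OF uL2[OF st] uL2[OF t(3)]]] DL2] by (simp add: L2_def)
          show "AE x in lebesgue. indicator A x * (norm (D x))\<^sup>2 \<le> (norm ((u s x - u t x) / (s - t) - D x))\<^sup>2"
            using us ut
          proof eventually_elim
            case (elim x)
            then show ?case using s(1) by (auto simp: A_def indicator_def)
          qed
        qed auto
      qed
      have "I \<le> 0"
      proof (rule ccontr)
        assume "\<not> I \<le> 0"
        then have I: "I > 0" by simp
        have "(Q \<longlongrightarrow> 0) (at t within time_dom T)" using D by (simp add: has_L2_derivative_def Q_def[abs_def])
        moreover have "sqrt I > 0" using I by simp
        ultimately have "\<forall>\<^sub>F s in at t within time_dom T. dist (Q s) 0 < sqrt I"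
          by (rule tendstoD)
        then obtain d where d: "d > 0" "\<And>s. s \<in> time_dom T \<Longrightarrow> s \<noteq> t \<Longrightarrow> dist s t < d \<Longrightarrow> dist (Q s) 0 < sqrt I"
          unfolding eventually_at by blast
        \<comment> \<open>The approximating time must be close to t and also avoid the exceptional
          null set, which contains no interval.\<close>
        obtain s where s: "s \<in> {max 0 (t - d)<..<t}" "G s"
          using AE_lebesgue_dense[OF AEG, of "max 0 (t - d)" t] d(1) t(1) by auto
        have "s \<in> time_dom T" using s(1) t(2) by (auto simp: time_dom_def intro: less_trans[of _ "ereal t"])
        then have "dist (Q s) 0 < sqrt I" using s by (intro d(2)) (auto simp: dist_real_def)
        then have "Q s < sqrt I" by simp
        moreover have "Q s \<ge> 0" by (simp add: Q_def L2_norm_nonneg)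
        ultimately have "(Q s)\<^sup>2 < I" using power_strict_mono[of "Q s" "sqrt I" 2] I by simp
        then show False using le[of s] s by auto
      qed
      moreover have "I \<ge> 0" unfolding I_def by (rule integral_nonneg_AE) auto
      ultimately have "I = 0" by simp
      then have "AE y in lebesgue. indicator A y * (norm (D y))\<^sup>2 = 0"
        unfolding I_def by (subst (asm) integral_nonneg_eq_0_iff_AE[OF i]) auto
      with ut show "AE x in lebesgue. norm x > r0 + t \<longrightarrow> u t x = 0 \<and> v t x = 0 \<and> time_deriv T u t x = 0"
        unfolding D_def by eventually_elim (auto simp: A_def indicator_def)
    qed
  qed
qed

section \<open>Pairing of the nonlinear terms with test functions\<close>

text \<open>Integrability of each slice does not make the pairing measurable in time; this is what
  strong measurability is for. Pairing a simple function gives a finite sum of indicators times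
  continuous functions of t, and these sums converge to the pairing for almost every t.\<close>

lemma L1_L1_pairing:
  fixes F :: "real \<Rightarrow> 'a::euclidean_space \<Rightarrow> real"
  assumes F: "F \<in> L1_L1 T" and \<Psi>: "\<Psi> \<in> Cc_infinity"
  shows "AE t in lebesgue. t \<in> einterval 0 T \<longrightarrow> integrable lebesgue (\<lambda>x. F t x * \<Psi> (x, t))"
    and "set_integrable lebesgue (einterval 0 T) (\<lambda>t. LINT x|lebesgue. F t x * \<Psi> (x, t))"
proof -
  obtain K r where K: "K > 0" "r > 0" "\<And>x t. \<bar>\<Psi> (x, t)\<bar> \<le> K * indicator (cball 0 r) x"
    using Cc_infinity_bounded[OF \<Psi>] by blast
  have Kle: "\<bar>\<Psi> (x, t)\<bar> \<le> K" for x t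
    using K(1) by (intro order.trans[OF K(3)]) (auto simp: indicator_def)
  have Kle': "\<bar>c * \<Psi> (x, t)\<bar> \<le> \<bar>K * c\<bar>" for c x t
    using mult_left_mono[OF Kle[of x t] abs_ge_zero[of c]] K(1) by (simp add: abs_mult mult.commute)
  have cont: "continuous_on UNIV \<Psi>" using \<Psi> smooth_on_continuous_on by (auto simp: Cc_infinity_iff)
  have int: "integrable lebesgue (\<lambda>x. f x * \<Psi> (x, t))" if "integrable lebesgue f" for f t
  proof (rule Bochner_Integration.integrable_bound)
    show "integrable lebesgue (\<lambda>x. K * f x)" using that by simp
    show "(\<lambda>x. f x * \<Psi> (x, t)) \<in> borel_measurable lebesgue"
      using that Cc_infinity_slice_measurable[OF \<Psi>] by auto
    show "AE x in lebesgue. norm (f x * \<Psi> (x, t)) \<le> norm (K * f x)"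
      using Kle'[of "f x" x t for x] by simp
  qed
  have F1: "AE t in lebesgue. t \<in> einterval 0 T \<longrightarrow> integrable lebesgue (F t)"
    using F by (simp add: L1_L1_def)
  then show "AE t in lebesgue. t \<in> einterval 0 T \<longrightarrow> integrable lebesgue (\<lambda>x. F t x * \<Psi> (x, t))"
    by eventually_elim (auto intro: int)
  obtain s where s: "\<And>n. s n \<in> simple_L1_valued" and
    lim: "AE t in lebesgue. t \<in> einterval 0 T \<longrightarrow> (\<lambda>n::nat. LINT x|lebesgue. \<bar>F t x - s n t x\<bar>) \<longlonglongrightarrow> 0"
    using F by (auto simp: L1_L1_def)
  have cont_pair: "continuous_on UNIV (\<lambda>t. LINT x|lebesgue. h x * \<Psi> (x, t))" if h: "integrable lebesgue h" for h
    unfolding continuous_on_def tendsto_at_iff_sequentially o_def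
  proof (intro ballI allI impI)
    fix t :: real and X :: "nat \<Rightarrow> real" assume X: "X \<longlonglongrightarrow> t"
    show "(\<lambda>i. LINT x|lebesgue. h x * \<Psi> (x, X i)) \<longlonglongrightarrow> (LINT x|lebesgue. h x * \<Psi> (x, t))"
    proof (rule integral_dominated_convergence)
      show "integrable lebesgue (\<lambda>x. \<bar>K * h x\<bar>)" using h by simp
      show "AE x in lebesgue. (\<lambda>i. h x * \<Psi> (x, X i)) \<longlonglongrightarrow> h x * \<Psi> (x, t)"
        by (intro AE_I2 tendsto_mult tendsto_const continuous_on_tendsto_compose[OF cont] tendsto_Pair X) auto
      show "AE x in lebesgue. norm (h x * \<Psi> (x, X i)) \<le> \<bar>K * h x\<bar>" for i
        using Kle'[of "h x" x "X i" for x] by simp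
    qed (use int[OF h] in auto)
  qed
  have sint: "integrable lebesgue (s n t)" for n t
  proof -
    obtain k A h where "\<And>i. i < k \<Longrightarrow> integrable lebesgue (h i)"
      "s n = (\<lambda>t x. \<Sum>i<(k::nat). indicator (A i) t * h i x)"
      using s[of n] by (auto simp: simple_L1_valued_def)
    then show ?thesis
      by (simp only:) (intro Bochner_Integration.integrable_sum integrable_mult_right, auto)
  qed
  have meas_s: "(\<lambda>t. LINT x|lebesgue. s n t x * \<Psi> (x, t)) \<in> borel_measurable lebesgue" for n
  proof -
    obtain k A h where *: "\<And>i. i < k \<Longrightarrow> A i \<in> sets lebesgue" "\<And>i. i < k \<Longrightarrow> integrable lebesgue (h i)"
      "s n = (\<lambda>t x. \<Sum>i<(k::nat). indicator (A i) t * h i x)"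
      using s[of n] by (auto simp: simple_L1_valued_def)
    have "(LINT x|lebesgue. s n t x * \<Psi> (x, t)) = (\<Sum>i<k. indicator (A i) t * (LINT x|lebesgue. h i x * \<Psi> (x, t)))" for t
    proof -
      have "(LINT x|lebesgue. s n t x * \<Psi> (x, t)) = (LINT x|lebesgue. (\<Sum>i<k. indicator (A i) t * (h i x * \<Psi> (x, t))))"
        by (simp add: *(3) sum_distrib_right mult.assoc)
      also have "\<dots> = (\<Sum>i<k. LINT x|lebesgue. indicator (A i) t * (h i x * \<Psi> (x, t)))"
        by (rule Bochner_Integration.integral_sum) (auto intro!: int *(2))
      finally show ?thesis by simp
    qed
    moreover have "(\<lambda>t. \<Sum>i<k. indicator (A i) t * (LINT x|lebesgue. h i x * \<Psi> (x, t))) \<in> borel_measurable lebesgue"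
      using * cont_pair
      by (intro borel_measurable_sum borel_measurable_times borel_measurable_indicator measurable_completion[of _ lborel]
            borel_measurable_continuous_onI)
        (auto simp: measurable_lborel1 intro!: measurable_completion borel_measurable_continuous_onI)
    ultimately show ?thesis by simp
  qed
  obtain N where N: "negligible N" "{t. \<not> (t \<in> einterval 0 T \<longrightarrow> integrable lebesgue (F t) \<and>
      (\<lambda>n::nat. LINT x|lebesgue. \<bar>F t x - s n t x\<bar>) \<longlonglongrightarrow> 0)} \<subseteq> N"
  proof -
    have "AE t in lebesgue. t \<in> einterval 0 T \<longrightarrow> integrable lebesgue (F t) \<and>
      (\<lambda>n::nat. LINT x|lebesgue. \<bar>F t x - s n t x\<bar>) \<longlonglongrightarrow> 0"
      using F1 lim by eventually_elim auto
    then show thesis using that by (auto simp: eventually_ae_filter_negligible)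
  qed
  \<comment> \<open>With the null set removed the convergence holds at every point of
    \<open>A\<close>, and multiplying by its indicator gives convergence on the whole line.\<close>
  define A where "A = einterval 0 T - N"
  have A: "A \<in> sets lebesgue" unfolding A_def by (rule sets.Diff[OF sets_einterval negligible_imp_sets[OF N(1)]])
  have conv: "(\<lambda>n. LINT x|lebesgue. s n t x * \<Psi> (x, t)) \<longlonglongrightarrow> (LINT x|lebesgue. F t x * \<Psi> (x, t))" if t: "t \<in> A" for t
  proof -
    have Ft: "integrable lebesgue (F t)" and lt: "(\<lambda>n::nat. LINT x|lebesgue. \<bar>F t x - s n t x\<bar>) \<longlonglongrightarrow> 0"
      using N(2) t by (auto simp: A_def)
    have "(\<lambda>n. (LINT x|lebesgue. s n t x * \<Psi> (x, t)) - (LINT x|lebesgue. F t x * \<Psi> (x, t))) \<longlonglongrightarrow> 0"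
    proof (rule Lim_null_comparison[OF always_eventually])
      show "(\<lambda>n. K * (LINT x|lebesgue. \<bar>F t x - s n t x\<bar>)) \<longlonglongrightarrow> 0"
        using tendsto_mult_right_zero[OF lt] .
      show "\<forall>n. norm ((LINT x|lebesgue. s n t x * \<Psi> (x, t)) - (LINT x|lebesgue. F t x * \<Psi> (x, t)))
        \<le> K * (LINT x|lebesgue. \<bar>F t x - s n t x\<bar>)"
      proof
        fix n
        have "(LINT x|lebesgue. s n t x * \<Psi> (x, t)) - (LINT x|lebesgue. F t x * \<Psi> (x, t))
          = (LINT x|lebesgue. s n t x * \<Psi> (x, t) - F t x * \<Psi> (x, t))"
          by (rule Bochner_Integration.integral_diff[symmetric]) (intro int sint Ft)+
        also have "norm \<dots> \<le> (LINT x|lebesgue. norm (s n t x * \<Psi> (x, t) - F t x * \<Psi> (x, t)))"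
          by (rule integral_norm_bound)
        also have "\<dots> \<le> (LINT x|lebesgue. K * \<bar>F t x - s n t x\<bar>)"
        proof (rule integral_mono)
          show "integrable lebesgue (\<lambda>x. norm (s n t x * \<Psi> (x, t) - F t x * \<Psi> (x, t)))"
            by (intro integrable_norm Bochner_Integration.integrable_diff int sint Ft)
          show "integrable lebesgue (\<lambda>x. K * \<bar>F t x - s n t x\<bar>)"
            by (intro integrable_mult_right integrable_abs Bochner_Integration.integrable_diff sint Ft)
          fix x
          have "norm (s n t x * \<Psi> (x, t) - F t x * \<Psi> (x, t)) = \<bar>F t x - s n t x\<bar> * \<bar>\<Psi> (x, t)\<bar>"
            by (simp add: left_diff_distrib[symmetric] abs_mult abs_minus_commute)
          also have "\<dots> \<le> \<bar>F t x - s n t x\<bar> * K" by (intro mult_left_mono Kle) auto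
          finally show "norm (s n t x * \<Psi> (x, t) - F t x * \<Psi> (x, t)) \<le> K * \<bar>F t x - s n t x\<bar>"
            by (simp add: mult.commute)
        qed
        finally show "norm ((LINT x|lebesgue. s n t x * \<Psi> (x, t)) - (LINT x|lebesgue. F t x * \<Psi> (x, t)))
          \<le> K * (LINT x|lebesgue. \<bar>F t x - s n t x\<bar>)" by simp
      qed
    qed
    then show ?thesis by (simp add: LIM_zero_iff)
  qed
  have mA: "(\<lambda>t. indicator A t * (LINT x|lebesgue. F t x * \<Psi> (x, t))) \<in> borel_measurable lebesgue"
  proof (rule borel_measurable_LIMSEQ_real)
    show "(\<lambda>n. indicator A t * (LINT x|lebesgue. s n t x * \<Psi> (x, t))) \<longlonglongrightarrow> indicator A t * (LINT x|lebesgue. F t x * \<Psi> (x, t))"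
      for t using conv[of t] by (auto simp: indicator_def)
    show "(\<lambda>t. indicator A t * (LINT x|lebesgue. s n t x * \<Psi> (x, t))) \<in> borel_measurable lebesgue" for n
      by (intro borel_measurable_times borel_measurable_indicator A meas_s)
  qed
  have AEA: "AE t in lebesgue. t \<notin> N"
    using N(1) by (auto simp: eventually_ae_filter_negligible)
  have m: "(\<lambda>t. indicator (einterval 0 T) t *\<^sub>R (LINT x|lebesgue. F t x * \<Psi> (x, t))) \<in> borel_measurable lebesgue"
    by (rule borel_measurable_AE[OF mA], use AEA in eventually_elim) (auto simp: A_def indicator_def)
  show "set_integrable lebesgue (einterval 0 T) (\<lambda>t. LINT x|lebesgue. F t x * \<Psi> (x, t))"
    unfolding set_integrable_def
  proof (rule Bochner_Integration.integrable_bound)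
    show "integrable lebesgue (\<lambda>t. K * (indicator (einterval 0 T) t *\<^sub>R (LINT x|lebesgue. \<bar>F t x\<bar>)))"
      using F by (auto simp: L1_L1_def set_integrable_def)
    show "AE t in lebesgue. norm (indicator (einterval 0 T) t *\<^sub>R (LINT x|lebesgue. F t x * \<Psi> (x, t)))
       \<le> norm (K * (indicator (einterval 0 T) t *\<^sub>R (LINT x|lebesgue. \<bar>F t x\<bar>)))"
      using F1
    proof eventually_elim
      case (elim t)
      show ?case
      proof (cases "t \<in> einterval 0 T")
        case True
        with elim have Ft: "integrable lebesgue (F t)" by simp
        have "norm (LINT x|lebesgue. F t x * \<Psi> (x, t)) \<le> (LINT x|lebesgue. norm (F t x * \<Psi> (x, t)))"
          by (rule integral_norm_bound)
        also have "\<dots> \<le> (LINT x|lebesgue. K * \<bar>F t x\<bar>)"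
        proof (rule integral_mono)
          show "integrable lebesgue (\<lambda>x. norm (F t x * \<Psi> (x, t)))" by (intro integrable_norm int Ft)
          show "integrable lebesgue (\<lambda>x. K * \<bar>F t x\<bar>)" using Ft by simp
          show "norm (F t x * \<Psi> (x, t)) \<le> K * \<bar>F t x\<bar>" for x
            using Kle'[of "F t x" x t] K(1) by (simp add: abs_mult)
        qed
        finally show ?thesis using True K(1) by simp
      qed simp
    qed
  qed (rule m)
qed

section \<open>Three forms of the weak identity\<close>

lemma D\<^sub>x_vanish:
  fixes \<Psi> :: "'a::euclidean_space \<times> real \<Rightarrow> real"
  assumes "\<Psi> \<in> Cc_infinity" "\<And>x. \<Psi> (x, t) = 0"
  shows "D\<^sub>x b \<Psi> (x, t) = 0"
proof -
  have "((\<lambda>y. \<Psi> (y, t)) has_derivative (\<lambda>h. frechet_derivative \<Psi> (at (x, t)) (h, 0))) (at x)"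
    using assms(1) by (intro smooth_slice(2)) (simp add: Cc_infinity_iff)
  then have "(\<lambda>h. frechet_derivative \<Psi> (at (x, t)) (h, 0)) = (\<lambda>h. 0)"
    unfolding assms(2) by (intro has_derivative_unique[of "\<lambda>_. 0"]) auto
  then show ?thesis unfolding D\<^sub>x_def by (rule fun_cong)
qed

lemma Lap_vanish:
  fixes \<Psi> :: "'a::euclidean_space \<times> real \<Rightarrow> real"
  assumes "\<Psi> \<in> Cc_infinity" "\<And>x. \<Psi> (x, t) = 0"
  shows "Lap \<Psi> (x, t) = 0"
  unfolding Lap_def using D\<^sub>x_vanish[OF Cc_infinity_D\<^sub>x[OF assms(1)] D\<^sub>x_vanish[OF assms]] by simp

lemma Cc_infinity_test_function:
  fixes \<Psi> :: "'a::euclidean_space \<times> real \<Rightarrow> real"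
  assumes "\<Psi> \<in> Cc_infinity" "\<And>x t. t \<ge> b \<Longrightarrow> \<Psi> (x, t) = 0" "ereal b < T"
  shows "\<Psi> \<in> test_functions T"
proof -
  have "supp \<Psi> \<subseteq> {z. snd z \<le> b}"
    unfolding supp_def
  proof (rule closure_minimal)
    show "{x. \<Psi> x \<noteq> 0} \<subseteq> {z. snd z \<le> b}"
    proof
      fix z assume "z \<in> {x. \<Psi> x \<noteq> 0}"
      then show "z \<in> {z. snd z \<le> b}" using assms(2)[of "snd z" "fst z"] by fastforce
    qed
    show "closed {z :: 'a \<times> real. snd z \<le> b}" by (intro closed_Collect_le continuous_intros)
  qed
  moreover have "ereal t < T" if "t \<le> b" for t
    using that assms(3) by (auto intro: le_less_trans[of _ "ereal b"])
  ultimately show ?thesis using assms(1) by (auto simp: test_functions_def)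
qed

lemma set_integrable_minus:
  fixes f :: "'a \<Rightarrow> real"
  shows "set_integrable M A f \<Longrightarrow> set_integrable M A (\<lambda>x. - f x)"
  by (simp add: set_integrable_def)

text \<open>Only the gradient is moved onto the test function. The time derivative is left on
  \<open>w\<close> because the two identities derived from this one go in opposite directions from
  here.\<close>

lemma weak_identity_by_parts:
  fixes w :: "real \<Rightarrow> 'a::euclidean_space \<Rightarrow> real"
  assumes w: "w \<in> C_H1 T" "w \<in> C1_L2 T"
    and \<Psi>: "\<Psi> \<in> Cc_infinity" "\<And>x t. t \<ge> b \<Longrightarrow> \<Psi> (x, t) = 0" "0 < b" "ereal b < T"
    and weak: "weak_identity T \<epsilon> g F w \<Psi>"
  shows "\<epsilon> * (LINT x|lebesgue. g x * \<Psi> (x, 0)) +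
     (LINT t:einterval 0 T|lebesgue. (LINT x|lebesgue. F t x * \<Psi> (x, t))) =
     - (LINT t:einterval 0 T|lebesgue. LINT x|lebesgue. time_deriv T w t x * D\<^sub>t \<Psi> (x, t))
     - (LINT t:einterval 0 T|lebesgue. LINT x|lebesgue. w t x * Lap \<Psi> (x, t))"
proof -
  have sm: "smooth_on UNIV \<Psi>" using \<Psi>(1) by (simp add: Cc_infinity_iff)
  have dt: "deriv (\<lambda>s. \<Psi> (x, s)) t = D\<^sub>t \<Psi> (x, t)" for x t
    using smooth_slice(3)[OF sm] by (rule DERIV_imp_deriv)
  have inner: "(LINT x|lebesgue. - time_deriv T w t x * D\<^sub>t \<Psi> (x, t) +
        weak_grad (w t) x \<bullet> grad (\<lambda>y. \<Psi> (y, t)) x) =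
      - (LINT x|lebesgue. time_deriv T w t x * D\<^sub>t \<Psi> (x, t)) - (LINT x|lebesgue. w t x * Lap \<Psi> (x, t))"
    if t: "t \<in> einterval 0 T" for t
  proof -
    have td: "t \<in> time_dom T" using t by (auto simp: einterval_0_iff time_dom_def)
    then have "time_deriv T w t \<in> L2" "w t \<in> H1" using w by (auto simp: C1_L2_def C_L2_def C_H1_def)
    obtain K r where K: "K > 0" "r > 0" "\<And>x t. \<bar>D\<^sub>t \<Psi> (x, t)\<bar> \<le> K * indicator (cball 0 r) x"
      using Cc_infinity_bounded[OF Cc_infinity_D\<^sub>t[OF \<Psi>(1)]] by blast
    have i: "integrable lebesgue (\<lambda>x. - (time_deriv T w t x * D\<^sub>t \<Psi> (x, t)))"
      by (intro integrable_minus L2_mult_bounded_integrable[OF \<open>time_deriv T w t \<in> L2\<close>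
            Cc_infinity_slice_measurable[OF Cc_infinity_D\<^sub>t[OF \<Psi>(1)]] K(3)])
    show ?thesis
      using Bochner_Integration.integral_add[OF i weak_grad_pairing(1)[OF \<open>w t \<in> H1\<close> \<Psi>(1)]]
        weak_grad_pairing(2)[OF \<open>w t \<in> H1\<close> \<Psi>(1)] by simp
  qed
  have "t \<ge> b \<Longrightarrow> D\<^sub>t \<Psi> (x, t) = 0" "t \<ge> b \<Longrightarrow> Lap \<Psi> (x, t) = 0" for x t
    using D\<^sub>t_vanish[OF \<Psi>(1,2)] Lap_vanish[OF \<Psi>(1,2)] by auto
  then have z1: "t \<ge> b \<Longrightarrow> (LINT x|lebesgue. time_deriv T w t x * D\<^sub>t \<Psi> (x, t)) = 0"
    and z2: "t \<ge> b \<Longrightarrow> (LINT x|lebesgue. w t x * Lap \<Psi> (x, t)) = 0" for t by simp_all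
  have "w \<in> C_L2 T" "time_deriv T w \<in> C_L2 T" using w(2) by (auto simp: C1_L2_def)
  note c = vanishing_set_integrable(1)[OF L2_pairing_continuous[OF \<open>time_deriv T w \<in> C_L2 T\<close> Cc_infinity_D\<^sub>t[OF \<Psi>(1)]] z1 \<Psi>(3,4)]
    vanishing_set_integrable(1)[OF L2_pairing_continuous[OF \<open>w \<in> C_L2 T\<close> Cc_infinity_Lap[OF \<Psi>(1)]] z2 \<Psi>(3,4)]
  have "(LINT t:einterval 0 T|lebesgue. (LINT x|lebesgue.
        - time_deriv T w t x * deriv (\<lambda>s. \<Psi> (x, s)) t +
        weak_grad (w t) x \<bullet> grad (\<lambda>y. \<Psi> (y, t)) x)) =
      (LINT t:einterval 0 T|lebesgue. - (LINT x|lebesgue. time_deriv T w t x * D\<^sub>t \<Psi> (x, t))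
        - (LINT x|lebesgue. w t x * Lap \<Psi> (x, t)))"
    unfolding dt by (rule set_lebesgue_integral_cong_AE_einterval) (intro AE_I2 impI inner)
  also have "\<dots> = - (LINT t:einterval 0 T|lebesgue. LINT x|lebesgue. time_deriv T w t x * D\<^sub>t \<Psi> (x, t))
     - (LINT t:einterval 0 T|lebesgue. LINT x|lebesgue. w t x * Lap \<Psi> (x, t))"
    using set_integral_diff(2)[OF c(1)[THEN set_integrable_minus] c(2)] set_integral_uminus[OF c(1)]
    by simp
  finally show ?thesis using weak by (simp add: weak_identity_def)
qed

text \<open>A second integration by parts, forward in time: the wave operator falls on the test
  function and \<open>w\<close> stands alone, at the price of a term with the initial value of
  \<open>w\<close>.\<close>

lemma weak_identity_position:
  fixes w :: "real \<Rightarrow> 'a::euclidean_space \<Rightarrow> real"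
  assumes w: "w \<in> C_H1 T" "w \<in> C1_L2 T"
    and \<Psi>: "\<Psi> \<in> Cc_infinity" "\<And>x t. t \<ge> b \<Longrightarrow> \<Psi> (x, t) = 0" "0 < b" "ereal b < T"
    and weak: "weak_identity T \<epsilon> g F w \<Psi>"
  shows "\<epsilon> * (LINT x|lebesgue. g x * \<Psi> (x, 0)) - (LINT x|lebesgue. w 0 x * D\<^sub>t \<Psi> (x, 0)) +
     (LINT t:einterval 0 T|lebesgue. (LINT x|lebesgue. F t x * \<Psi> (x, t))) =
     (LINT t:einterval 0 T|lebesgue. LINT x|lebesgue. w t x * (D\<^sub>t (D\<^sub>t \<Psi>) (x, t) - Lap \<Psi> (x, t)))"
proof -
  have v: "t \<ge> b \<Longrightarrow> D\<^sub>t \<Psi> (x, t) = 0" "t \<ge> b \<Longrightarrow> Lap \<Psi> (x, t) = 0" "t \<ge> b \<Longrightarrow> D\<^sub>t (D\<^sub>t \<Psi>) (x, t) = 0" for x t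
    using D\<^sub>t_vanish[OF \<Psi>(1,2)] Lap_vanish[OF \<Psi>(1,2)]
      D\<^sub>t_vanish[OF Cc_infinity_D\<^sub>t[OF \<Psi>(1)] D\<^sub>t_vanish[OF \<Psi>(1,2)]] by auto
  note C = Cc_infinity_D\<^sub>t[OF \<Psi>(1)] Cc_infinity_Lap[OF \<Psi>(1)] Cc_infinity_D\<^sub>t[OF Cc_infinity_D\<^sub>t[OF \<Psi>(1)]]
  note a = time_integration_by_parts(3)[OF w(2) C(1) v(1) \<Psi>(3,4)]
  note i = time_integration_by_parts(2)[OF w(2) C(3) v(3) \<Psi>(3,4)]
    time_integration_by_parts(2)[OF w(2) C(2) v(2) \<Psi>(3,4)]
  have int: "integrable lebesgue (\<lambda>x. w t x * \<Phi> (x, t))" if \<Phi>: "\<Phi> \<in> Cc_infinity" "t \<in> einterval 0 T"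
    for t and \<Phi> :: "'a \<times> real \<Rightarrow> real"
  proof -
    have "w t \<in> L2" using \<Phi>(2) w(2) by (auto simp: C1_L2_def C_L2_def einterval_0_iff time_dom_def)
    moreover obtain K r where "K > 0" "r > 0" "\<And>x t. \<bar>\<Phi> (x, t)\<bar> \<le> K * indicator (cball 0 r) x"
      using Cc_infinity_bounded[OF \<Phi>(1)] by blast
    ultimately show ?thesis
      using L2_mult_bounded_integrable Cc_infinity_slice_measurable[OF \<Phi>(1)] by blast
  qed
  have "(LINT t:einterval 0 T|lebesgue. LINT x|lebesgue. w t x * (D\<^sub>t (D\<^sub>t \<Psi>) (x, t) - Lap \<Psi> (x, t))) =
    (LINT t:einterval 0 T|lebesgue. (LINT x|lebesgue. w t x * D\<^sub>t (D\<^sub>t \<Psi>) (x, t)) - (LINT x|lebesgue. w t x * Lap \<Psi> (x, t)))"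
    using int C by (intro set_lebesgue_integral_cong_AE_einterval) (auto simp: right_diff_distrib)
  also have "\<dots> = (LINT t:einterval 0 T|lebesgue. LINT x|lebesgue. w t x * D\<^sub>t (D\<^sub>t \<Psi>) (x, t)) -
     (LINT t:einterval 0 T|lebesgue. LINT x|lebesgue. w t x * Lap \<Psi> (x, t))"
    by (rule set_integral_diff(2)[OF i])
  finally show ?thesis using weak_identity_by_parts[OF w \<Psi> weak] a by simp
qed

text \<open>This is what allows extensions of the weights outside the cone to be arbitrary: formulas
  are needed only where the solution lives.\<close>

lemma cone_integral_cong:
  fixes w :: "real \<Rightarrow> 'a::euclidean_space \<Rightarrow> real"
  assumes "AE t in lebesgue. t \<in> einterval 0 T \<longrightarrow> (AE x in lebesgue. norm x > r0 + t \<longrightarrow> w t x = 0)"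
    and "\<And>x t. 0 < t \<Longrightarrow> norm x \<le> r0 + t \<Longrightarrow> A (x, t) = B (x, t)"
  shows "(LINT t:einterval 0 T|lebesgue. LINT x|lebesgue. w t x * A (x, t)) =
    (LINT t:einterval 0 T|lebesgue. LINT x|lebesgue. w t x * B (x, t))"
    and "set_integrable lebesgue (einterval 0 T) (\<lambda>t. LINT x|lebesgue. w t x * A (x, t)) \<longleftrightarrow>
      set_integrable lebesgue (einterval 0 T) (\<lambda>t. LINT x|lebesgue. w t x * B (x, t))"
proof -
  have "AE t in lebesgue. t \<in> einterval 0 T \<longrightarrow>
    (LINT x|lebesgue. w t x * A (x, t)) = (LINT x|lebesgue. w t x * B (x, t))"
    using assms(1)
  proof eventually_elim
    case (elim t)
    show ?case
    proof
      assume t: "t \<in> einterval 0 T"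
      show "(LINT x|lebesgue. w t x * A (x, t)) = (LINT x|lebesgue. w t x * B (x, t))"
      proof (rule lebesgue_integral_cong_AE)
        show "AE x in lebesgue. w t x * A (x, t) = w t x * B (x, t)"
          using elim[rule_format, OF t]
        proof eventually_elim
          case (elim x)
          then show ?case using assms(2)[of t x] t by (cases "norm x > r0 + t") (auto simp: einterval_0_iff)
        qed
      qed
    qed
  qed
  from set_lebesgue_integral_cong_AE_einterval[OF this]
  show "(LINT t:einterval 0 T|lebesgue. LINT x|lebesgue. w t x * A (x, t)) =
    (LINT t:einterval 0 T|lebesgue. LINT x|lebesgue. w t x * B (x, t))"
    "set_integrable lebesgue (einterval 0 T) (\<lambda>t. LINT x|lebesgue. w t x * A (x, t)) \<longleftrightarrow>
      set_integrable lebesgue (einterval 0 T) (\<lambda>t. LINT x|lebesgue. w t x * B (x, t))" .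
qed

text \<open>With a time derivative as test function, the Laplace term is w times a time derivative
  of \<open>Lap X\<close> inside the cone and can be integrated by parts backwards, onto
  \<open>\<partial>\<^sub>t w\<close>. The initial value of \<open>w\<close> then meets
  \<open>Lap X\<close>. Commutation is asked for only in the cone, where it is read off from
  explicit formulas.\<close>

lemma weak_identity_velocity:
  fixes w :: "real \<Rightarrow> 'a::euclidean_space \<Rightarrow> real"
  assumes w: "w \<in> C_H1 T" "w \<in> C1_L2 T"
    and X: "X \<in> Cc_infinity" "\<And>x t. t \<ge> b \<Longrightarrow> X (x, t) = 0" "0 < b" "ereal b < T"
    and weak: "weak_identity T \<epsilon> g F w (D\<^sub>t X)"
    and cone: "AE t in lebesgue. t \<in> einterval 0 T \<longrightarrow> (AE x in lebesgue. norm x > r0 + t \<longrightarrow> w t x = 0)"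
    and comm: "\<And>x t. 0 < t \<Longrightarrow> norm x \<le> r0 + t \<Longrightarrow> Lap (D\<^sub>t X) (x, t) = D\<^sub>t (Lap X) (x, t)"
  shows "\<epsilon> * (LINT x|lebesgue. g x * D\<^sub>t X (x, 0)) - (LINT x|lebesgue. w 0 x * Lap X (x, 0)) +
     (LINT t:einterval 0 T|lebesgue. (LINT x|lebesgue. F t x * D\<^sub>t X (x, t))) =
     (LINT t:einterval 0 T|lebesgue. LINT x|lebesgue. time_deriv T w t x * (Lap X (x, t) - D\<^sub>t (D\<^sub>t X) (x, t)))"
proof -
  have v: "t \<ge> b \<Longrightarrow> D\<^sub>t X (x, t) = 0" "t \<ge> b \<Longrightarrow> Lap X (x, t) = 0" "t \<ge> b \<Longrightarrow> D\<^sub>t (D\<^sub>t X) (x, t) = 0" for x t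
    using D\<^sub>t_vanish[OF X(1,2)] Lap_vanish[OF X(1,2)]
      D\<^sub>t_vanish[OF Cc_infinity_D\<^sub>t[OF X(1)] D\<^sub>t_vanish[OF X(1,2)]] by auto
  note C = Cc_infinity_D\<^sub>t[OF X(1)] Cc_infinity_Lap[OF X(1)] Cc_infinity_D\<^sub>t[OF Cc_infinity_D\<^sub>t[OF X(1)]]
  note a = time_integration_by_parts(3)[OF w(2) C(2) v(2) X(3,4)]
  note i = time_integration_by_parts(1)[OF w(2) C(2) v(2) X(3,4)]
    time_integration_by_parts(1)[OF w(2) C(3) v(3) X(3,4)]
  have int: "integrable lebesgue (\<lambda>x. time_deriv T w t x * \<Phi> (x, t))" if \<Phi>: "\<Phi> \<in> Cc_infinity" "t \<in> einterval 0 T"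
    for t and \<Phi> :: "'a \<times> real \<Rightarrow> real"
  proof -
    have "time_deriv T w t \<in> L2" using \<Phi>(2) w(2) by (auto simp: C1_L2_def C_L2_def einterval_0_iff time_dom_def)
    moreover obtain K r where "K > 0" "r > 0" "\<And>x t. \<bar>\<Phi> (x, t)\<bar> \<le> K * indicator (cball 0 r) x"
      using Cc_infinity_bounded[OF \<Phi>(1)] by blast
    ultimately show ?thesis
      using L2_mult_bounded_integrable Cc_infinity_slice_measurable[OF \<Phi>(1)] by blast
  qed
  have "(LINT t:einterval 0 T|lebesgue. LINT x|lebesgue. time_deriv T w t x * (Lap X (x, t) - D\<^sub>t (D\<^sub>t X) (x, t))) =
    (LINT t:einterval 0 T|lebesgue. (LINT x|lebesgue. time_deriv T w t x * Lap X (x, t))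
       - (LINT x|lebesgue. time_deriv T w t x * D\<^sub>t (D\<^sub>t X) (x, t)))"
    using int C by (intro set_lebesgue_integral_cong_AE_einterval) (auto simp: right_diff_distrib)
  also have "\<dots> = (LINT t:einterval 0 T|lebesgue. LINT x|lebesgue. time_deriv T w t x * Lap X (x, t)) -
     (LINT t:einterval 0 T|lebesgue. LINT x|lebesgue. time_deriv T w t x * D\<^sub>t (D\<^sub>t X) (x, t))"
    by (rule set_integral_diff(2)[OF i])
  finally show ?thesis
    using weak_identity_by_parts[OF w C(1) v(1) X(3,4) weak] a
      cone_integral_cong(1)[where A="Lap (D\<^sub>t X)" and B="D\<^sub>t (Lap X)", OF cone comm] by simp
qed

section \<open>Test functions from functions defined in a light cone\<close>

definition light_cone :: "real \<Rightarrow> ('a::euclidean_space \<times> real) set" where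
  "light_cone \<sigma> = {(x, t). norm x < \<sigma> + t}"

lemma open_light_cone: "open (light_cone \<sigma>)"
proof -
  have *: "light_cone \<sigma> = {z. norm (fst z) < \<sigma> + snd z}" by (auto simp: light_cone_def)
  show ?thesis unfolding * by (intro open_Collect_less continuous_intros)
qed

lemma smooth_on_time: "open S \<Longrightarrow> smooth_on S (\<lambda>z. \<sigma> + snd z)"
  by (intro smooth_on_add smooth_on_const smooth_on_bounded_linear bounded_linear_snd)

lemma smooth_on_norm_power2: "open S \<Longrightarrow> smooth_on S (\<lambda>z :: 'a::euclidean_space \<times> real. (norm (fst z))\<^sup>2)"
proof -
  assume S: "open S"
  have "smooth_on S (\<lambda>z :: 'a \<times> real. \<Sum>b\<in>Basis. (fst z \<bullet> b) * (fst z \<bullet> b))"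
    by (intro smooth_on_sum smooth_on_mult S smooth_on_bounded_linear
        bounded_linear_inner_left_comp bounded_linear_fst)
  then show ?thesis by (simp add: power2_norm_eq_inner euclidean_inner[symmetric])
qed

lemma smooth_on_ratio:
  "smooth_on (light_cone \<sigma>) (\<lambda>z. (norm (fst z))\<^sup>2 * (\<sigma> + snd z) powr -2)"
  by (intro smooth_on_mult open_light_cone smooth_on_norm_power2 smooth_on_compose[OF _ _ smooth_on_powr] smooth_on_time)
    (auto simp: light_cone_def intro: le_less_trans[OF norm_ge_zero])

text \<open>Two cutoffs keep the support of the extension away from the boundary of the light cone:
  one in t below 0, one in |x|^2 / \<tau>^2 below 1. The second leaves the solution untouched
  because |x| \<le> \<tau> - 2 there, and \<tau> \<le> R bounds the ratio away from 1.\<close>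

lemma cone_extension:
  fixes E :: "'a::euclidean_space \<times> real \<Rightarrow> real"
  assumes E: "smooth_on (light_cone \<sigma>) E" "\<And>x t. \<sigma> + t \<ge> R \<Longrightarrow> E (x, t) = 0"
    and \<sigma>: "\<sigma> \<ge> r0 + 2" "\<sigma> > 1" "R > \<sigma>"
  obtains \<Psi> U where "\<Psi> \<in> Cc_infinity" "\<And>x t. t \<ge> R - \<sigma> \<Longrightarrow> \<Psi> (x, t) = 0"
    "open U" "U \<subseteq> light_cone \<sigma>" "\<And>z. z \<in> U \<Longrightarrow> \<Psi> z = E z" "\<And>x t. 0 \<le> t \<Longrightarrow> norm x \<le> r0 + t \<Longrightarrow> (x, t) \<in> U"
proof -
  obtain \<zeta> \<zeta>1 \<zeta>2 :: "real \<Rightarrow> real" and M where \<zeta>: "smooth_on UNIV \<zeta>" "M > 0"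
    "\<And>x. (\<zeta> has_field_derivative \<zeta>1 x) (at x)" "\<And>x. (\<zeta>1 has_field_derivative \<zeta>2 x) (at x)"
    "\<And>x. 0 \<le> \<zeta> x" "\<And>x. \<zeta> x \<le> 1" "\<And>x. \<zeta>1 x \<le> 0" "\<And>x. \<bar>\<zeta>1 x\<bar> \<le> M" "\<And>x. \<bar>\<zeta>2 x\<bar> \<le> M"
    "\<And>x. x \<le> 0 \<Longrightarrow> \<zeta> x = 1" "\<And>x. x \<ge> 1 \<Longrightarrow> \<zeta> x = 0"
    "\<And>x. x < 0 \<or> x > 1 \<Longrightarrow> \<zeta>1 x = 0" "\<And>x. x < 0 \<or> x > 1 \<Longrightarrow> \<zeta>2 x = 0"
    by (rule smooth_step_exists, rule that)
  \<comment> \<open>If \<tau> \<le> R, then |x| \<le> \<tau> - 2 < (1 - 1/R) \<tau>, so the ratio of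
    squares on the support of the solution is below \<open>z0\<close>.\<close>
  define z0 where "z0 = (1 - 1 / R)\<^sup>2"
  define z1 where "z1 = (1 + z0) / 2"
  have R: "R > 1" using \<sigma> by simp
  have "0 < 1 - 1 / R" "1 - 1 / R < 1" using R by auto
  then have z0: "0 < z0" "z0 < 1" unfolding z0_def using power_strict_mono[of "1 - 1 / R" 1 2] by auto
  then have z1: "z0 < z1" "z1 < 1" "0 < z1" by (auto simp: z1_def)
  define q where "q z = (norm (fst z))\<^sup>2 * (\<sigma> + snd z) powr -2" for z :: "'a \<times> real"
  have q: "q (x, t) = (norm x)\<^sup>2 / (\<sigma> + t)\<^sup>2" if "\<sigma> + t > 0" for x t
    using that by (simp add: q_def powr_minus powr_numeral divide_inverse)
  \<comment> \<open>The first factor is 1 for t \<ge> -1/2 and 0 for t \<le> -1; the second is 1 up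
    to the ratio \<open>z0\<close> and 0 from \<open>z1\<close> on.\<close>
  define \<Psi> where "\<Psi> z = \<zeta> (- 2 * snd z + - 1) * \<zeta> ((q z + - z0) * (1 / (z1 - z0))) * E z" for z
  define C where "C = {z :: 'a \<times> real. -1 \<le> snd z \<and> \<sigma> + snd z \<le> R \<and> (norm (fst z))\<^sup>2 \<le> z1 * (\<sigma> + snd z)\<^sup>2}"
  have C: "closed C"
    unfolding C_def by (intro closed_Collect_conj closed_Collect_le continuous_intros)
  have Csub: "C \<subseteq> light_cone \<sigma>"
  proof
    fix z assume z: "z \<in> C"
    obtain x t where xt: "z = (x, t)" by (cases z)
    have t: "\<sigma> + t > 0" using z \<sigma>(2) by (auto simp: C_def xt)
    have "(norm x)\<^sup>2 \<le> z1 * (\<sigma> + t)\<^sup>2" using z by (simp add: C_def xt)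
    also have "\<dots> < 1 * (\<sigma> + t)\<^sup>2" using z1 t by (intro mult_strict_right_mono) auto
    finally have "norm x < \<sigma> + t" using t by (simp add: power2_less_imp_less)
    then show "z \<in> light_cone \<sigma>" by (simp add: light_cone_def xt)
  qed
  have zero: "\<Psi> z = 0" if z: "z \<notin> C" for z
  proof -
    obtain x t where xt: "z = (x, t)" by (cases z)
    consider "t < -1" | "\<sigma> + t > R" | "t \<ge> -1" "(norm x)\<^sup>2 > z1 * (\<sigma> + t)\<^sup>2"
      using z by (cases "t < -1") (auto simp: C_def xt not_le)
    then show ?thesis
    proof cases
      case 1 then show ?thesis using \<zeta>(11)[of "- 2 * t + - 1"] by (simp add: \<Psi>_def xt)
    next
      case 2 then show ?thesis using E(2)[of t x] by (simp add: \<Psi>_def xt)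
    next
      case 3
      then have t: "\<sigma> + t > 0" using \<sigma>(2) by simp
      then have "q z > z1" using 3 by (simp add: xt q field_simps)
      then have "(q z + - z0) * (1 / (z1 - z0)) \<ge> 1" using z1 by (simp add: field_simps)
      then show ?thesis using \<zeta>(11) by (simp add: \<Psi>_def)
    qed
  qed
  have "smooth_on (light_cone \<sigma>) \<Psi>"
    unfolding \<Psi>_def q_def
    by (intro smooth_on_mult open_light_cone E(1) smooth_on_compose[OF _ _ \<zeta>(1)] smooth_on_add smooth_on_ratio
        smooth_on_const smooth_on_bounded_linear bounded_linear_snd) auto
  then have sm: "smooth \<Psi>" by (rule smooth_on_mult_cutoff[OF open_light_cone C Csub]) (rule zero)
  have "\<Psi> z = 0" if z: "norm z > 2 * R + 2" for z
  proof (rule zero, rule notI)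
    assume zC: "z \<in> C"
    obtain x t where xt: "z = (x, t)" by (cases z)
    have "norm x < \<sigma> + t" using Csub zC by (auto simp: light_cone_def xt)
    moreover have "-1 \<le> t" "\<sigma> + t \<le> R" using zC by (auto simp: C_def xt)
    ultimately have "norm x + norm t \<le> 2 * R + 2" using \<sigma> R by auto
    then show False using z norm_Pair_le[of x t] by (simp add: xt)
  qed
  with sm have Cc: "\<Psi> \<in> Cc_infinity" by (auto simp: Cc_infinity_iff smooth_iff_smooth_on)
  \<comment> \<open>For \<tau> > R both functions vanish and the ratio needs no bound; adding this
    region makes \<open>U\<close> contain the whole cone of the solution, for all later
    times.\<close>
  define U where "U = {z :: 'a \<times> real. - (1/2) < snd z \<and> norm (fst z) < \<sigma> + snd z \<and>
     ((norm (fst z))\<^sup>2 < z0 * (\<sigma> + snd z)\<^sup>2 \<or> R < \<sigma> + snd z)}"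
  show thesis
  proof (rule that[OF Cc, of U])
    show "open U" unfolding U_def
      by (intro open_Collect_conj open_Collect_disj open_Collect_less continuous_intros)
    show "U \<subseteq> light_cone \<sigma>" by (auto simp: U_def light_cone_def)
    show "\<Psi> (x, t) = 0" if "t \<ge> R - \<sigma>" for x t using E(2)[of t x] that by (simp add: \<Psi>_def)
    show "\<Psi> z = E z" if z: "z \<in> U" for z
    proof -
      obtain x t where xt: "z = (x, t)" by (cases z)
      show ?thesis
      proof (cases "R < \<sigma> + t")
        case True then show ?thesis using E(2)[of t x] by (simp add: \<Psi>_def xt)
      next
        case False
        with z have "(norm x)\<^sup>2 < z0 * (\<sigma> + t)\<^sup>2" "norm x < \<sigma> + t" "- (1/2) < t" by (auto simp: U_def xt)
        moreover from this have t: "\<sigma> + t > 0" by (auto intro: le_less_trans[OF norm_ge_zero])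
        ultimately have "q z < z0" "- 2 * t + - 1 \<le> 0" by (simp_all add: xt q field_simps)
        moreover from this have "(q z + - z0) * (1 / (z1 - z0)) \<le> 0" using z1
          by (intro mult_nonpos_nonneg) auto
        ultimately show ?thesis using \<zeta>(10) by (simp add: \<Psi>_def xt)
      qed
    qed
    show "(x, t) \<in> U" if "0 \<le> t" "norm x \<le> r0 + t" for x t
    proof -
      have x: "norm x \<le> (\<sigma> + t) - 2" using that \<sigma>(1) by simp
      have "(norm x)\<^sup>2 < z0 * (\<sigma> + t)\<^sup>2" if "\<sigma> + t \<le> R"
      proof -
        have "(\<sigma> + t) / R \<le> 1" using that R by simp
        then have "norm x < (\<sigma> + t) - (\<sigma> + t) / R" using x by linarith
        also have "\<dots> = (1 - 1 / R) * (\<sigma> + t)" by (simp add: algebra_simps)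
        finally have "(norm x)\<^sup>2 < ((1 - 1 / R) * (\<sigma> + t))\<^sup>2"
          by (intro power_strict_mono) auto
        then show ?thesis by (simp add: z0_def power_mult_distrib)
      qed
      then show ?thesis using x that by (auto simp: U_def)
    qed
  qed
qed

section \<open>Self-similar solutions of the wave equation\<close>

text \<open>The coefficients of the power series \<open>F\<close> for which \<open>\<tau> powr -\<beta> * F (\<bar>x\<bar>\<^sup>2 / \<tau>\<^sup>2)\<close> solves the wave
  equation in \<open>N\<close> space dimensions.\<close>

definition wave_coeff :: "nat \<Rightarrow> real \<Rightarrow> nat \<Rightarrow> real" where
  "wave_coeff N \<beta> k = pochhammer \<beta> (2 * k) / (\<Prod>j<k. (2 * real j + 2) * (2 * real j + real N))"

text \<open>For N \<ge> 1 this is the hypergeometric function 2F1(\<beta>/2, (\<beta> + 1)/2; N/2;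
  z).\<close>

definition wave_series :: "nat \<Rightarrow> real \<Rightarrow> real \<Rightarrow> real" where
  "wave_series N \<beta> z = (\<Sum>k. wave_coeff N \<beta> k * z ^ k)"

lemma wave_coeff_0 [simp]: "wave_coeff N \<beta> 0 = 1"
  by (simp add: wave_coeff_def)

lemma wave_coeff_Suc:
  "N \<ge> 1 \<Longrightarrow> wave_coeff N \<beta> (Suc k) =
    wave_coeff N \<beta> k * ((\<beta> + 2 * real k) * (\<beta> + 2 * real k + 1) / ((2 * real k + 2) * (2 * real k + real N)))"
  by (simp add: wave_coeff_def pochhammer_Suc algebra_simps)

text \<open>Both sides contain the product \<beta> (\<beta> + 1) ... (\<beta> + 2k). It is the
  coefficient form of the statement that a time derivative raises \<beta> by one.\<close>

lemma wave_coeff_shift: "N \<ge> 1 \<Longrightarrow> (\<beta> + 2 * real k) * wave_coeff N \<beta> k = \<beta> * wave_coeff N (\<beta> + 1) k"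
proof -
  have "pochhammer \<beta> (2 * k) * (\<beta> + 2 * real k) = \<beta> * pochhammer (\<beta> + 1) (2 * k)"
    using pochhammer_Suc[of \<beta> "2 * k"] pochhammer_rec[of \<beta> "2 * k"] by simp
  then show ?thesis by (simp add: wave_coeff_def mult.commute)
qed

text \<open>Two applications of the shift; the coefficient form of the Laplacian raising \<beta> by
  two. The factor \<beta> (\<beta> + 1) is that of two time derivatives, which is why the wave
  equation holds.\<close>

lemma wave_coeff_shift2:
  "N \<ge> 1 \<Longrightarrow> (2 * real k + 2) * (2 * real k + real N) * wave_coeff N \<beta> (Suc k) = \<beta> * (\<beta> + 1) * wave_coeff N (\<beta> + 2) k"
proof -
  assume N: "N \<ge> 1"
  have "(2 * real k + 2) * (2 * real k + real N) * wave_coeff N \<beta> (Suc k) =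
    wave_coeff N \<beta> k * ((\<beta> + 2 * real k) * (\<beta> + 2 * real k + 1))"
    using N by (simp add: wave_coeff_Suc)
  also have "\<dots> = (\<beta> + 2 * real k + 1) * ((\<beta> + 2 * real k) * wave_coeff N \<beta> k)" by (simp only: mult_ac)
  also have "\<dots> = (\<beta> + 2 * real k + 1) * (\<beta> * wave_coeff N (\<beta> + 1) k)"
    by (simp only: wave_coeff_shift[OF N])
  also have "\<dots> = \<beta> * ((\<beta> + 1 + 2 * real k) * wave_coeff N (\<beta> + 1) k)" by (simp add: algebra_simps)
  also have "\<dots> = \<beta> * ((\<beta> + 1) * wave_coeff N (\<beta> + 1 + 1) k)"
    by (simp only: wave_coeff_shift[OF N])
  finally show ?thesis by (simp add: add.assoc)
qed

lemma wave_coeff_nonneg: "\<beta> \<ge> 0 \<Longrightarrow> wave_coeff N \<beta> k \<ge> 0"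
  by (auto simp: wave_coeff_def pochhammer_prod intro!: divide_nonneg_nonneg prod_nonneg)

lemma wave_summable:
  assumes "N \<ge> 1" "\<bar>z\<bar> < 1"
  shows "summable (\<lambda>k. wave_coeff N \<beta> k * z ^ k)"
proof (cases "z = 0")
  case True
  then show ?thesis by simp
next
  case False
  \<comment> \<open>The ratio of consecutive coefficients, written so that its limit 1 is
    visible.\<close>
  define \<rho> where "\<rho> k = (1 + (\<beta> - 2) / (2 * real k + 2)) * (1 + (\<beta> + 1 - real N) / (2 * real k + real N))" for k
  have rho: "wave_coeff N \<beta> (Suc k) = wave_coeff N \<beta> k * \<rho> k" for k
  proof -
    have "2 * real k + real N \<noteq> 0" using assms(1) by linarith
    then have "\<rho> k = (\<beta> + 2 * real k) / (2 * real k + 2) * ((\<beta> + 2 * real k + 1) / (2 * real k + real N))"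
      unfolding \<rho>_def by (simp add: field_simps)
    then show ?thesis using assms(1) by (simp add: wave_coeff_Suc)
  qed
  have f: "filterlim (\<lambda>k. 2 * real k + c) at_top sequentially" for c :: real
    using filterlim_tendsto_add_at_top[OF tendsto_const[of c]
        filterlim_tendsto_pos_mult_at_top[OF tendsto_const[of 2] _ filterlim_real_sequentially]]
    by (simp add: add.commute)
  have "(\<lambda>k. (\<beta> - 2) / (2 * real k + 2)) \<longlonglongrightarrow> 0" "(\<lambda>k. (\<beta> + 1 - real N) / (2 * real k + real N)) \<longlonglongrightarrow> 0"
    by (intro tendsto_divide_0[OF tendsto_const filterlim_at_top_imp_at_infinity[OF f]])+
  then have "\<rho> \<longlonglongrightarrow> (1 + 0) * (1 + 0)"
    unfolding \<rho>_def by (intro tendsto_intros)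
  then have "(\<lambda>k. \<bar>\<rho> k\<bar> * \<bar>z\<bar>) \<longlonglongrightarrow> \<bar>(1 + 0) * (1 + 0)\<bar> * \<bar>z\<bar>" by (intro tendsto_intros)
  then have "(\<lambda>k. \<bar>\<rho> k\<bar> * \<bar>z\<bar>) \<longlonglongrightarrow> \<bar>z\<bar>" by simp
  moreover have "\<bar>z\<bar> < (1 + \<bar>z\<bar>) / 2" using assms(2) by simp
  ultimately have "\<forall>\<^sub>F k in sequentially. \<bar>\<rho> k\<bar> * \<bar>z\<bar> < (1 + \<bar>z\<bar>) / 2" by (rule order_tendstoD)
  then obtain K where K: "\<And>k. k \<ge> K \<Longrightarrow> \<bar>\<rho> k\<bar> * \<bar>z\<bar> < (1 + \<bar>z\<bar>) / 2"
    by (auto simp: eventually_sequentially)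
  show ?thesis
  proof (rule summable_ratio_test)
    show "(1 + \<bar>z\<bar>) / 2 < 1" using assms(2) by simp
    fix k assume "K \<le> k"
    have "norm (wave_coeff N \<beta> (Suc k) * z ^ Suc k) = norm (wave_coeff N \<beta> k * z ^ k) * (\<bar>\<rho> k\<bar> * \<bar>z\<bar>)"
      by (simp add: rho abs_mult mult_ac)
    also have "\<dots> \<le> norm (wave_coeff N \<beta> k * z ^ k) * ((1 + \<bar>z\<bar>) / 2)"
      using K[OF \<open>K \<le> k\<close>] by (intro mult_left_mono) auto
    finally show "norm (wave_coeff N \<beta> (Suc k) * z ^ Suc k) \<le> (1 + \<bar>z\<bar>) / 2 * norm (wave_coeff N \<beta> k * z ^ k)"
      by (simp add: mult.commute)
  qed
qed

lemma power_series_DERIV: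
  fixes c :: "nat \<Rightarrow> real"
  assumes "\<And>z. \<bar>z\<bar> < 1 \<Longrightarrow> summable (\<lambda>k. c k * z ^ k)" "\<bar>z\<bar> < 1"
  shows "((\<lambda>z. \<Sum>k. c k * z ^ k) has_field_derivative (\<Sum>k. diffs c k * z ^ k)) (at z)"
    and "summable (\<lambda>k. diffs c k * z ^ k)"
proof -
  obtain K where K: "\<bar>z\<bar> < K" "K < 1" using assms(2) dense by blast
  then have "\<bar>K\<bar> < 1" by auto
  then show "((\<lambda>z. \<Sum>k. c k * z ^ k) has_field_derivative (\<Sum>k. diffs c k * z ^ k)) (at z)"
    using K by (intro termdiffs_strong[OF assms(1)[of K]]) auto
  show "summable (\<lambda>k. diffs c k * z ^ k)"
    using assms by (intro termdiff_converges[where K=1]) auto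
qed

definition wave_series' :: "nat \<Rightarrow> real \<Rightarrow> real \<Rightarrow> real" where
  "wave_series' N \<beta> z = (\<Sum>k. diffs (wave_coeff N \<beta>) k * z ^ k)"

definition wave_series'' :: "nat \<Rightarrow> real \<Rightarrow> real \<Rightarrow> real" where
  "wave_series'' N \<beta> z = (\<Sum>k. diffs (diffs (wave_coeff N \<beta>)) k * z ^ k)"

lemma wave_series_DERIV:
  assumes "N \<ge> 1" "\<bar>z\<bar> < 1"
  shows "(wave_series N \<beta> has_field_derivative wave_series' N \<beta> z) (at z)"
    and "(wave_series' N \<beta> has_field_derivative wave_series'' N \<beta> z) (at z)"
  unfolding wave_series_def[abs_def] wave_series'_def[abs_def] wave_series''_def
  using assms by (auto intro!: power_series_DERIV wave_summable)

lemma smooth_on_power_series: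
  fixes c :: "nat \<Rightarrow> real"
  assumes "\<And>z. \<bar>z\<bar> < 1 \<Longrightarrow> summable (\<lambda>k. c k * z ^ k)"
  shows "smooth_on {-1<..<1} (\<lambda>z. \<Sum>k. c k * z ^ k)"
proof (rule smooth_on_derivative_family[where
      P="(\<lambda>c z. \<Sum>k. c k * z ^ k) ` {c. \<forall>z. \<bar>z\<bar> < 1 \<longrightarrow> summable (\<lambda>k. c k * z ^ k)}"])
  fix g assume "g \<in> (\<lambda>c z. \<Sum>k. c k * z ^ k) ` {c :: nat \<Rightarrow> real. \<forall>z. \<bar>z\<bar> < 1 \<longrightarrow> summable (\<lambda>k. c k * z ^ k)}"
  then obtain d :: "nat \<Rightarrow> real" where d: "\<And>z. \<bar>z\<bar> < 1 \<Longrightarrow> summable (\<lambda>k. d k * z ^ k)"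
    and g: "g = (\<lambda>z. \<Sum>k. d k * z ^ k)" by auto
  show "\<exists>g'\<in>(\<lambda>c z. \<Sum>k. c k * z ^ k) ` {c. \<forall>z. \<bar>z\<bar> < 1 \<longrightarrow> summable (\<lambda>k. c k * z ^ k)}.
      \<forall>y\<in>{-1<..<1}. (g has_real_derivative g' y) (at y)"
  proof (rule bexI)
    show "\<forall>y\<in>{-1<..<1}. (g has_real_derivative (\<Sum>k. diffs d k * y ^ k)) (at y)"
      unfolding g using power_series_DERIV(1)[OF d] by auto
    show "(\<lambda>y. \<Sum>k. diffs d k * y ^ k) \<in> (\<lambda>c z. \<Sum>k. c k * z ^ k) ` {c. \<forall>z. \<bar>z\<bar> < 1 \<longrightarrow> summable (\<lambda>k. c k * z ^ k)}"
      using power_series_DERIV(2)[OF d] by (intro imageI) auto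
  qed
qed (use assms in auto)

lemma smooth_on_wave_series: "N \<ge> 1 \<Longrightarrow> smooth_on {-1<..<1} (wave_series N \<beta>)"
  unfolding wave_series_def[abs_def] by (intro smooth_on_power_series wave_summable)

lemma mult_diffs_sums:
  fixes c :: "nat \<Rightarrow> real"
  assumes "summable (\<lambda>k. diffs c k * z ^ k)"
  shows "(\<lambda>k. real k * c k * z ^ k) sums (z * (\<Sum>k. diffs c k * z ^ k))"
proof -
  have "(\<lambda>k. z * (real k * c k * z ^ (k - Suc 0))) sums (z * (\<Sum>k. diffs c k * z ^ k))"
    using diffs_equiv[OF assms] by (intro sums_mult) simp
  moreover have "z * (real k * c k * z ^ (k - Suc 0)) = real k * c k * z ^ k" for k
    by (cases k) auto
  ultimately show ?thesis by simp
qed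

text \<open>The time derivative of \<tau>^-\<beta> F(z) with z = |x|^2 / \<tau>^2, since z has time
  derivative -2 z / \<tau>.\<close>

lemma wave_series_time_ode:
  assumes "N \<ge> 1" "\<bar>z\<bar> < 1"
  shows "\<beta> * wave_series N \<beta> z + 2 * z * wave_series' N \<beta> z = \<beta> * wave_series N (\<beta> + 1) z"
proof -
  have 1: "(\<lambda>k. \<beta> * (wave_coeff N \<beta> k * z ^ k)) sums (\<beta> * wave_series N \<beta> z)"
    unfolding wave_series_def by (intro sums_mult summable_sums wave_summable assms)
  have "(\<lambda>k. real k * wave_coeff N \<beta> k * z ^ k) sums (z * wave_series' N \<beta> z)"
    unfolding wave_series'_def by (intro mult_diffs_sums power_series_DERIV(2) wave_summable assms)
  then have "(\<lambda>k. 2 * (real k * wave_coeff N \<beta> k * z ^ k)) sums (2 * (z * wave_series' N \<beta> z))"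
    by (rule sums_mult)
  from sums_add[OF 1 this]
  have "(\<lambda>k. (\<beta> + 2 * real k) * wave_coeff N \<beta> k * z ^ k) sums (\<beta> * wave_series N \<beta> z + 2 * z * wave_series' N \<beta> z)"
    by (simp add: algebra_simps)
  moreover have "(\<lambda>k. \<beta> * (wave_coeff N (\<beta> + 1) k * z ^ k)) sums (\<beta> * wave_series N (\<beta> + 1) z)"
    unfolding wave_series_def by (intro sums_mult summable_sums wave_summable assms)
  ultimately show ?thesis
    unfolding wave_coeff_shift[OF assms(1)] mult.assoc by (rule sums_unique2)
qed

text \<open>The Laplacian of F(|x|^2 / \<tau>^2) is \<tau>^-2 (2 N F' + 4 z F'').\<close>

lemma wave_series_space_ode:
  assumes "N \<ge> 1" "\<bar>z\<bar> < 1"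
  shows "2 * real N * wave_series' N \<beta> z + 4 * z * wave_series'' N \<beta> z = \<beta> * (\<beta> + 1) * wave_series N (\<beta> + 2) z"
proof -
  have s: "summable (\<lambda>k. diffs (wave_coeff N \<beta>) k * z ^ k)" if "\<bar>z\<bar> < 1" for z
    by (intro power_series_DERIV(2) wave_summable assms that)
  have 1: "(\<lambda>k. 2 * real N * (diffs (wave_coeff N \<beta>) k * z ^ k)) sums (2 * real N * wave_series' N \<beta> z)"
    unfolding wave_series'_def by (intro sums_mult summable_sums s assms)
  have "(\<lambda>k. real k * diffs (wave_coeff N \<beta>) k * z ^ k) sums (z * wave_series'' N \<beta> z)"
    unfolding wave_series''_def by (intro mult_diffs_sums power_series_DERIV(2) s assms)
  then have "(\<lambda>k. 4 * (real k * diffs (wave_coeff N \<beta>) k * z ^ k)) sums (4 * (z * wave_series'' N \<beta> z))"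
    by (rule sums_mult)
  from sums_add[OF 1 this]
  have "(\<lambda>k. (2 * real N + 4 * real k) * diffs (wave_coeff N \<beta>) k * z ^ k) sums
     (2 * real N * wave_series' N \<beta> z + 4 * z * wave_series'' N \<beta> z)"
    by (simp add: algebra_simps)
  moreover have "(2 * real N + 4 * real k) * diffs (wave_coeff N \<beta>) k = \<beta> * (\<beta> + 1) * wave_coeff N (\<beta> + 2) k" for k
    unfolding wave_coeff_shift2[OF assms(1), symmetric] diffs_def by (simp add: algebra_simps)
  ultimately have "(\<lambda>k. \<beta> * (\<beta> + 1) * wave_coeff N (\<beta> + 2) k * z ^ k) sums
     (2 * real N * wave_series' N \<beta> z + 4 * z * wave_series'' N \<beta> z)" by simp
  moreover have "(\<lambda>k. \<beta> * (\<beta> + 1) * (wave_coeff N (\<beta> + 2) k * z ^ k)) sums (\<beta> * (\<beta> + 1) * wave_series N (\<beta> + 2) z)"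
    unfolding wave_series_def by (intro sums_mult summable_sums wave_summable assms)
  ultimately show ?thesis unfolding mult.assoc by (rule sums_unique2)
qed

lemma wave_series_ge_1:
  assumes "N \<ge> 1" "0 \<le> z" "z < 1" "\<beta> \<ge> 0"
  shows "wave_series N \<beta> z \<ge> 1"
proof -
  have "summable (\<lambda>k. wave_coeff N \<beta> k * z ^ k)" using assms by (intro wave_summable) auto
  moreover have "0 \<le> wave_coeff N \<beta> k * z ^ k" for k
    using assms by (intro mult_nonneg_nonneg wave_coeff_nonneg) auto
  ultimately show ?thesis
    using sum_le_suminf[of "\<lambda>k. wave_coeff N \<beta> k * z ^ k" "{0}"] by (simp add: wave_series_def)
qed

text \<open>Comparison coefficient by coefficient: by \<open>wave_coeff_shift\<close> the quotient
  is \<beta> / (\<beta> + 2k), at most 1, and the larger coefficients are nonnegative as \<beta> + 1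
  > 0. It lets a term with \<open>phi \<sigma> \<beta>\<close> be absorbed by one with \<beta> +
  1.\<close>

lemma wave_series_mono:
  assumes "N \<ge> 1" "0 \<le> z" "z < 1" "\<beta> > -1"
  shows "wave_series N \<beta> z \<le> wave_series N (\<beta> + 1) z"
  unfolding wave_series_def
proof (rule suminf_le)
  show "summable (\<lambda>k. wave_coeff N \<beta> k * z ^ k)" "summable (\<lambda>k. wave_coeff N (\<beta> + 1) k * z ^ k)"
    using assms by (auto intro!: wave_summable)
  fix k
  have "wave_coeff N \<beta> k \<le> wave_coeff N (\<beta> + 1) k"
  proof (cases "k = 0")
    case False
    then have b: "\<beta> + 2 * real k > 0" using assms(4) by simp
    have "wave_coeff N \<beta> k = \<beta> / (\<beta> + 2 * real k) * wave_coeff N (\<beta> + 1) k"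
      using wave_coeff_shift[OF assms(1), of \<beta> k] b by (simp add: field_simps)
    also have "\<dots> \<le> 1 * wave_coeff N (\<beta> + 1) k"
      using b assms(4) by (intro mult_right_mono wave_coeff_nonneg) (auto simp: field_simps)
    finally show ?thesis by simp
  qed simp
  then show "wave_coeff N \<beta> k * z ^ k \<le> wave_coeff N (\<beta> + 1) k * z ^ k"
    using assms(2) by (intro mult_right_mono) auto
qed

text \<open>For \<open>-1 < \<beta> < 0\<close> all coefficients but the first are negative; up to a factor they are bounded by
  \<open>b (k - 1) - b k\<close>, where \<open>b k = (2 k choose k) / 4 ^ k\<close>.\<close>

lemma wave_series_ge_half:
  assumes "N \<ge> 2" "0 \<le> z" "z < 1" "-1 < \<beta>" "\<beta> < 0"
  shows "wave_series N \<beta> z \<ge> 1 / 2"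
proof -
  have N1: "N \<ge> 1" using assms(1) by simp
  define b where "b k = (\<Prod>j<k. (2 * real j + 1) / (2 * real j + 2))" for k
  have b0: "b k \<ge> 0" for k unfolding b_def by (intro prod_nonneg) auto
  have bSuc: "b (Suc k) = b k * ((2 * real k + 1) / (2 * real k + 2))" for k by (simp add: b_def)
  have c: "\<bar>wave_coeff N \<beta> (Suc k)\<bar> \<le> b (Suc k) / (2 * (real k + 1)) / 4" for k
  proof (induction k)
    case 0
    \<comment> \<open>The worst case \<beta> = -1/2, N = 2 gives equality at the start of the
      induction: the first coefficient has modulus 1/16, and so has the bound, with b 1 =
      1/2.\<close>
    have "- \<beta> * (\<beta> + 1) \<le> 1 / 4"
      using zero_le_power2[of "\<beta> + 1/2"] by (simp add: power2_eq_square algebra_simps)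
    moreover have "- \<beta> * (\<beta> + 1) \<ge> 0" using assms by (intro mult_nonneg_nonneg) auto
    ultimately have "\<bar>\<beta> * (\<beta> + 1)\<bar> \<le> 1 / 4" by (simp add: abs_if)
    then have "\<bar>\<beta> * (\<beta> + 1)\<bar> / (2 * real N) \<le> (1 / 4) / (2 * 2)"
      using assms(1) by (intro frac_le) auto
    then show ?case using N1 by (simp add: wave_coeff_Suc b_def abs_mult)
  next
    case (Suc k)
    define m where "m = real k + 1"
    have m: "m \<ge> 1" "real (Suc k) = m" by (auto simp: m_def)
    have num: "0 \<le> (\<beta> + 2 * m) * (\<beta> + 2 * m + 1)" "(\<beta> + 2 * m) * (\<beta> + 2 * m + 1) \<le> (2 * m) * (2 * m + 1)"
      using assms m by (auto intro!: mult_mono mult_nonneg_nonneg)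
    have den: "(2 * m + 2) * (2 * m + 2) \<le> (2 * m + 2) * (2 * m + real N)"
      using assms(1) m by (intro mult_left_mono) auto
    have "0 \<le> (\<beta> + 2 * m) * (\<beta> + 2 * m + 1) / ((2 * m + 2) * (2 * m + real N))"
      using m by (intro divide_nonneg_nonneg[OF num(1)] mult_nonneg_nonneg) auto
    then have "\<bar>wave_coeff N \<beta> (Suc (Suc k))\<bar> = \<bar>wave_coeff N \<beta> (Suc k)\<bar> *
        ((\<beta> + 2 * m) * (\<beta> + 2 * m + 1) / ((2 * m + 2) * (2 * m + real N)))"
      unfolding wave_coeff_Suc[OF N1, of \<beta> "Suc k"] m(2) abs_mult[of "wave_coeff N \<beta> (Suc k)"]
      by (simp only: abs_of_nonneg)
    also have "\<dots> \<le> (b (Suc k) / (2 * m) / 4) * ((2 * m) * (2 * m + 1) / ((2 * m + 2) * (2 * m + 2)))"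
    proof (rule mult_mono)
      show "\<bar>wave_coeff N \<beta> (Suc k)\<bar> \<le> b (Suc k) / (2 * m) / 4" using Suc.IH by (simp add: m_def)
      show "(\<beta> + 2 * m) * (\<beta> + 2 * m + 1) / ((2 * m + 2) * (2 * m + real N)) \<le> (2 * m) * (2 * m + 1) / ((2 * m + 2) * (2 * m + 2))"
        using num den m by (intro frac_le) auto
      show "0 \<le> (\<beta> + 2 * m) * (\<beta> + 2 * m + 1) / ((2 * m + 2) * (2 * m + real N))"
        using m by (intro divide_nonneg_nonneg[OF num(1)] mult_nonneg_nonneg) auto
      show "0 \<le> b (Suc k) / (2 * m) / 4" using b0[of "Suc k"] m by simp
    qed
    also have "\<dots> = b (Suc (Suc k)) / (2 * (real (Suc k) + 1)) / 4"
    proof -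
      have "x / (2 * m) / 4 * ((2 * m) * y / (z * z)) = x * (y / z) / z / 4" for x y z :: real
        using m by simp
      moreover have "2 * (m + 1) = 2 * m + 2" by simp
      ultimately show ?thesis unfolding bSuc[of "Suc k"] m(2) by metis
    qed
    finally show ?case .
  qed
  have diff: "b (Suc k) / (2 * (real k + 1)) \<le> b k - b (Suc k)" for k
  proof -
    have "b (Suc k) \<le> b k" unfolding bSuc using b0[of k] by (intro mult_left_le) auto
    moreover have "b k - b (Suc k) = b k / (2 * (real k + 1))" by (simp add: bSuc field_simps)
    ultimately show ?thesis by (simp add: divide_right_mono)
  qed
  \<comment> \<open>The moduli of the later terms are at most (b n - b (n + 1)) / 4, so their sum
    telescopes and takes at most 1/4 off the leading term 1.\<close>
  have part: "(\<Sum>k<Suc n. wave_coeff N \<beta> k * z ^ k) \<ge> 1 - (1 - b n) / 4" for n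
  proof (induction n)
    case 0 then show ?case by (simp add: b_def)
  next
    case (Suc n)
    have "\<bar>wave_coeff N \<beta> (Suc n) * z ^ Suc n\<bar> \<le> \<bar>wave_coeff N \<beta> (Suc n)\<bar> * 1"
      unfolding abs_mult using assms by (intro mult_left_mono) (auto simp: power_abs power_le_one simp del: power_Suc)
    also have "\<dots> \<le> (b n - b (Suc n)) / 4" unfolding mult_1_right by (rule order.trans[OF c divide_right_mono[OF diff]]) simp
    finally have "wave_coeff N \<beta> (Suc n) * z ^ Suc n \<ge> - ((b n - b (Suc n)) / 4)" by linarith
    then show ?case using Suc.IH by (simp del: power_Suc) (simp add: field_simps)
  qed
  have "(\<lambda>n. \<Sum>k<n. wave_coeff N \<beta> k * z ^ k) \<longlonglongrightarrow> wave_series N \<beta> z"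
    unfolding wave_series_def using assms N1 by (intro summable_LIMSEQ wave_summable) auto
  then have "(\<lambda>n. \<Sum>k<Suc n. wave_coeff N \<beta> k * z ^ k) \<longlonglongrightarrow> wave_series N \<beta> z"
    by (rule LIMSEQ_Suc)
  moreover have "1 / 2 \<le> (\<Sum>k<Suc n. wave_coeff N \<beta> k * z ^ k)" for n
    by (rule order.trans[OF _ part]) (use b0[of n] in simp)
  ultimately show ?thesis by (intro LIMSEQ_le_const) auto
qed

text \<open>Comparison of the coefficients with those of the binomial series of \<open>(1 - z)\<^sup>-\<^sup>\<delta>\<close>: the choice of \<open>\<delta>\<close>
  makes the quotients of consecutive ratios \<open>1 + O(k\<^sup>-\<^sup>2)\<close>.\<close>

lemma wave_series_le:
  assumes "N \<ge> 1" "\<beta> > (real N - 1) / 2"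
  obtains C where "C > 0" "\<And>z. 0 \<le> z \<Longrightarrow> z < 1 \<Longrightarrow>
    wave_series N \<beta> z \<le> C * (1 - z) powr ((real N - 1) / 2 - \<beta>)"
proof -
  define \<delta> where "\<delta> = \<beta> - (real N - 1) / 2"
  have \<delta>: "\<delta> > 0" using assms(2) by (simp add: \<delta>_def)
  have \<beta>: "\<beta> > 0" using assms by simp
  define d where "d k = pochhammer \<delta> k / fact k" for k
  have dpos: "d k > 0" for k unfolding d_def using \<delta> by (simp add: pochhammer_pos)
  have dSuc: "d (Suc k) = d k * ((\<delta> + real k) / (real k + 1))" for k
    by (simp add: d_def pochhammer_Suc field_simps)
  define M where "M = \<beta> * (\<beta> + 1) / 4"
  have M: "M \<ge> 0" using \<beta> by (simp add: M_def)
  define A where "A = wave_coeff N \<beta> 1 / d 1 * exp (2 * M)"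
  have A: "A \<ge> 0" unfolding A_def using \<beta> dpos[of 1] by (intro mult_nonneg_nonneg divide_nonneg_pos wave_coeff_nonneg) auto
  \<comment> \<open>The exponential strengthens the claim so that each step can absorb a factor 1 +
    M / m^2: as 1 / m^2 \<le> 2/m - 2/(m + 1), the product of these factors telescopes.\<close>
  have c: "wave_coeff N \<beta> (Suc k) \<le> A * exp (- 2 * M / (real k + 1)) * d (Suc k)" for k
  proof (induction k)
    case 0
    have "A * exp (- 2 * M) = wave_coeff N \<beta> 1 / d 1" by (simp add: A_def exp_minus)
    then show ?case using dpos[of 1] by simp
  next
    case (Suc k)
    define m where "m = real k + 1"
    have m: "m \<ge> 1" "real (Suc k) = m" by (auto simp: m_def)
    define Q where "Q = (\<beta> + 2 * m) * (\<beta> + 2 * m + 1) / ((2 * m + 2) * (2 * m + real N))"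
    define P where "P = (\<delta> + m) / (m + 1)"
    have P: "P > 0" unfolding P_def using \<delta> m by (intro divide_pos_pos) auto
    have QP: "Q \<le> (1 + M / m\<^sup>2) * P"
    proof -
      have N: "real N \<ge> 1" using assms(1) by simp
      have d': "\<delta> = \<beta> - real N / 2 + 1 / 2" by (simp add: \<delta>_def field_simps)
      have Nd: "0 \<le> real N * \<delta> / 2" using \<delta> by simp
      \<comment> \<open>The two quadratics in m agree in the linear coefficient; this is the
        property that determines \<delta>.\<close>
      have e1: "(\<beta> + 2 * m) * (\<beta> + 2 * m + 1) = 4 * (m\<^sup>2 + (\<beta> + 1/2) * m + M)"
        by (simp add: M_def power2_eq_square field_simps)
      have e2: "2 * (\<delta> + m) * (2 * m + real N) = 4 * (m\<^sup>2 + (\<beta> + 1/2) * m + real N * \<delta> / 2)"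
        by (simp add: d' power2_eq_square field_simps)
      have "m\<^sup>2 + (\<beta> + 1/2) * m + M \<le> (1 + M / m\<^sup>2) * (m\<^sup>2 + (\<beta> + 1/2) * m + real N * \<delta> / 2)"
      proof -
        have "(1 + M / m\<^sup>2) * (m\<^sup>2 + (\<beta> + 1/2) * m + real N * \<delta> / 2) =
          m\<^sup>2 + (\<beta> + 1/2) * m + real N * \<delta> / 2 + M + M / m\<^sup>2 * ((\<beta> + 1/2) * m + real N * \<delta> / 2)"
          using m by (simp add: field_simps)
        moreover have "0 \<le> M / m\<^sup>2 * ((\<beta> + 1/2) * m + real N * \<delta> / 2)"
          using M Nd \<beta> m by (intro mult_nonneg_nonneg add_nonneg_nonneg) auto
        ultimately show ?thesis using Nd by linarith
      qed
      then have "(\<beta> + 2 * m) * (\<beta> + 2 * m + 1) \<le> (1 + M / m\<^sup>2) * (2 * (\<delta> + m) * (2 * m + real N))"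
        unfolding e1 e2 by (metis mult.left_commute mult_left_mono zero_le_numeral)
      then have "Q \<le> (1 + M / m\<^sup>2) * (2 * (\<delta> + m) * (2 * m + real N)) / ((2 * m + 2) * (2 * m + real N))"
        unfolding Q_def using m N by (intro divide_right_mono) auto
      also have "\<dots> = (1 + M / m\<^sup>2) * P"
      proof -
        have "2 * m + real N \<noteq> 0" "m + 1 \<noteq> 0" using m N by auto
        then show ?thesis unfolding P_def by (simp add: divide_simps) (simp add: algebra_simps)
      qed
      finally show ?thesis .
    qed
    have "wave_coeff N \<beta> (Suc (Suc k)) = wave_coeff N \<beta> (Suc k) * Q"
      unfolding wave_coeff_Suc[OF assms(1), of \<beta> "Suc k"] m(2) Q_def by simp
    also have "\<dots> \<le> (A * exp (- 2 * M / m) * d (Suc k)) * (exp (M / m\<^sup>2) * P)"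
    proof (rule mult_mono)
      show "wave_coeff N \<beta> (Suc k) \<le> A * exp (- 2 * M / m) * d (Suc k)" using Suc.IH by (simp add: m_def)
      have "1 + M / m\<^sup>2 \<le> exp (M / m\<^sup>2)" by (rule exp_ge_add_one_self)
      then show "Q \<le> exp (M / m\<^sup>2) * P" using QP P by (meson mult_right_mono less_imp_le order.trans)
      show "0 \<le> A * exp (- 2 * M / m) * d (Suc k)" using A dpos[of "Suc k"] by simp
      show "0 \<le> Q" unfolding Q_def using \<beta> m by (intro divide_nonneg_nonneg mult_nonneg_nonneg) auto
    qed
    also have "\<dots> = A * exp (- 2 * M / m + M / m\<^sup>2) * d (Suc (Suc k))"
      unfolding dSuc[of "Suc k"] m(2) P_def exp_add by (simp add: mult_ac)
    also have "\<dots> \<le> A * exp (- 2 * M / (m + 1)) * d (Suc (Suc k))"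
    proof -
      have "1 / m\<^sup>2 \<le> 2 / m - 2 / (m + 1)"
      proof -
        have "m * (m + 1) \<le> 2 * m\<^sup>2"
          using mult_left_mono[of 1 m m] m by (simp add: power2_eq_square algebra_simps)
        then have "2 / (2 * m\<^sup>2) \<le> 2 / (m * (m + 1))" using m by (intro divide_left_mono) auto
        moreover have "2 / m - 2 / (m + 1) = 2 / (m * (m + 1))" using m by (simp add: field_simps)
        ultimately show ?thesis by simp
      qed
      then have "M * (1 / m\<^sup>2) \<le> M * (2 / m - 2 / (m + 1))" using M by (rule mult_left_mono)
      then have "- 2 * M / m + M / m\<^sup>2 \<le> - 2 * M / (m + 1)" by (simp add: algebra_simps)
      then show ?thesis using A dpos[of "Suc (Suc k)"] by (intro mult_right_mono mult_left_mono) auto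
    qed
    finally show ?case by (simp add: m_def add.commute)
  qed
  define C where "C = max A 1"
  have cC: "wave_coeff N \<beta> k \<le> C * d k" for k
  proof (cases k)
    case 0 then show ?thesis by (simp add: C_def d_def)
  next
    case (Suc l)
    have "A * exp (- 2 * M / (real l + 1)) \<le> A * 1"
      using A M by (intro mult_left_mono) auto
    also have "\<dots> \<le> C" by (simp add: C_def)
    finally show ?thesis using c[of l] dpos[of k] unfolding Suc by (meson mult_right_mono less_imp_le order.trans)
  qed
  show thesis
  proof (rule that[of C])
    show "C > 0" by (simp add: C_def)
    fix z :: real assume z: "0 \<le> z" "z < 1"
    have "(\<lambda>k. ((- \<delta>) gchoose k) * (- z) ^ k) sums (1 + (- z)) powr (- \<delta>)"
      using z by (intro gen_binomial_real) auto
    moreover have "((- \<delta>) gchoose k) * (- z) ^ k = d k * z ^ k" for k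
    proof -
      have "((- \<delta>) gchoose k) * (- z) ^ k = ((-1) ^ k * (-1) ^ k) * (d k * z ^ k)"
        by (simp add: gbinomial_pochhammer d_def power_minus[of z] mult_ac)
      also have "(-1) ^ k * (-1) ^ k = (1::real)" by (simp flip: power_mult_distrib)
      finally show ?thesis by simp
    qed
    ultimately have s: "(\<lambda>k. C * (d k * z ^ k)) sums (C * (1 - z) powr (- \<delta>))"
      by (intro sums_mult) simp
    have "wave_series N \<beta> z \<le> (\<Sum>k. C * (d k * z ^ k))"
      unfolding wave_series_def
    proof (rule suminf_le)
      show "wave_coeff N \<beta> k * z ^ k \<le> C * (d k * z ^ k)" for k
        using mult_right_mono[OF cC[of k], of "z ^ k"] z by (simp add: mult.assoc)
      show "summable (\<lambda>k. wave_coeff N \<beta> k * z ^ k)" using z assms(1) by (intro wave_summable) auto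
      show "summable (\<lambda>k. C * (d k * z ^ k))" using s by (rule sums_summable)
    qed
    then show "wave_series N \<beta> z \<le> C * (1 - z) powr ((real N - 1) / 2 - \<beta>)"
      using sums_unique[OF s] by (simp add: \<delta>_def)
  qed
qed

section \<open>The functions phi: wave equation and pointwise bounds\<close>

definition phi :: "real \<Rightarrow> real \<Rightarrow> 'a::euclidean_space \<times> real \<Rightarrow> real" where
  "phi \<sigma> \<beta> z = (\<sigma> + snd z) powr - \<beta> * wave_series DIM('a) \<beta> ((norm (fst z))\<^sup>2 / (\<sigma> + snd z)\<^sup>2)"

lemma DIM_ge_1: "1 \<le> DIM('a::euclidean_space)"
  using DIM_positive[where 'a='a] by linarith

lemma light_cone_ratio:
  assumes "(x, t) \<in> light_cone \<sigma>"
  shows "\<sigma> + t > 0" "\<bar>(norm x)\<^sup>2 / (\<sigma> + t)\<^sup>2\<bar> < 1" "(norm x)\<^sup>2 / (\<sigma> + t)\<^sup>2 \<ge> 0" "(norm x)\<^sup>2 / (\<sigma> + t)\<^sup>2 < 1"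
proof -
  have n: "norm x < \<sigma> + t" using assms by (simp add: light_cone_def)
  then show p: "\<sigma> + t > 0" by (rule le_less_trans[OF norm_ge_zero])
  have "(norm x)\<^sup>2 < (\<sigma> + t)\<^sup>2" using n by (intro power_strict_mono) auto
  then show "(norm x)\<^sup>2 / (\<sigma> + t)\<^sup>2 < 1" using p by simp
  then show "\<bar>(norm x)\<^sup>2 / (\<sigma> + t)\<^sup>2\<bar> < 1" "(norm x)\<^sup>2 / (\<sigma> + t)\<^sup>2 \<ge> 0" by auto
qed

lemma smooth_on_phi: "smooth_on (light_cone \<sigma>) (phi \<sigma> \<beta> :: 'a::euclidean_space \<times> real \<Rightarrow> real)"
proof -
  let ?q = "\<lambda>z :: 'a \<times> real. (norm (fst z))\<^sup>2 * (\<sigma> + snd z) powr -2"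
  have q: "?q z = (norm (fst z))\<^sup>2 / (\<sigma> + snd z)\<^sup>2" if "z \<in> light_cone \<sigma>" for z
    using light_cone_ratio(1)[of "fst z" "snd z" \<sigma>] that by (simp add: powr_minus powr_numeral divide_inverse)
  have "smooth_on (light_cone \<sigma>) (\<lambda>z :: 'a \<times> real. (\<sigma> + snd z) powr - \<beta> * wave_series DIM('a) \<beta> (?q z))"
  proof (intro smooth_on_mult open_light_cone smooth_on_compose[OF _ _ smooth_on_powr] smooth_on_time
      smooth_on_compose[OF _ _ smooth_on_wave_series] smooth_on_ratio)
    show "\<sigma> + snd z \<in> {0<..}" if "z \<in> light_cone \<sigma>" for z :: "'a \<times> real"
      using light_cone_ratio(1)[of "fst z" "snd z" \<sigma>] that by simp
    show "?q z \<in> {-1<..<1}" if z: "z \<in> light_cone \<sigma>" for z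
    proof -
      have "(fst z, snd z) \<in> light_cone \<sigma>" using z by simp
      from light_cone_ratio(3,4)[OF this] show ?thesis
        unfolding q[OF z] greaterThanLessThan_iff by linarith
    qed
  qed (auto simp: DIM_ge_1 intro: smooth_on_norm_power2 open_light_cone light_cone_ratio(1))
  then show ?thesis
    by (subst smooth_on_cong[OF open_light_cone, where g="\<lambda>z. (\<sigma> + snd z) powr - \<beta> * wave_series DIM('a) \<beta> (?q z)"])
      (auto simp: phi_def q)
qed

text \<open>Because of this, weights depending on time alone are the case \<beta> = 0 of products
  with \<open>phi\<close> and need no theory of their own.\<close>

lemma phi_0: "(x, t) \<in> light_cone \<sigma> \<Longrightarrow> phi \<sigma> 0 (x :: 'a::euclidean_space, t) = 1"
proof -
  assume "(x, t) \<in> light_cone \<sigma>"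
  then have "\<sigma> + t > 0" by (rule light_cone_ratio)
  moreover have "wave_series N 0 z = 1" for N z
  proof -
    have "wave_coeff N 0 k * z ^ k = (if k = 0 then 1 else 0)" for k
      by (cases k) (auto simp: wave_coeff_def pochhammer_0_left)
    then have "(\<lambda>k. wave_coeff N 0 k * z ^ k) = (\<lambda>k. if k = 0 then 1 else 0)" by (rule ext)
    then show ?thesis using sums_unique[OF sums_single[of 0 "\<lambda>_. 1::real"]] by (simp add: wave_series_def)
  qed
  ultimately show ?thesis by (simp add: phi_def)
qed

lemma phi_time_DERIV:
  assumes xt: "(x :: 'a::euclidean_space, t) \<in> light_cone \<sigma>"
  shows "((\<lambda>s. phi \<sigma> \<beta> (x, s)) has_field_derivative - \<beta> * phi \<sigma> (\<beta> + 1) (x, t)) (at t)"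
proof -
  define \<tau> where "\<tau> = \<sigma> + t"
  define z where "z = (norm x)\<^sup>2 / \<tau>\<^sup>2"
  have \<tau>: "\<tau> > 0" and z: "\<bar>z\<bar> < 1" using light_cone_ratio[OF xt] by (auto simp: \<tau>_def z_def)
  let ?N = "DIM('a)"
  have d1: "((\<lambda>s. (norm x)\<^sup>2 / (\<sigma> + s)\<^sup>2) has_field_derivative (- 2 * z / \<tau>)) (at t)"
  proof -
    have "((\<lambda>s. (norm x)\<^sup>2 / (\<sigma> + s)\<^sup>2) has_field_derivative - ((norm x)\<^sup>2 * (2 * \<tau>)) / (\<tau>\<^sup>2 * \<tau>\<^sup>2)) (at t)"
      using \<tau> unfolding \<tau>_def by (auto intro!: derivative_eq_intros)
    moreover have "- ((norm x)\<^sup>2 * (2 * \<tau>)) / (\<tau>\<^sup>2 * \<tau>\<^sup>2) = - 2 * z / \<tau>"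
      using \<tau> by (simp add: z_def power2_eq_square field_simps)
    ultimately show ?thesis by simp
  qed
  have d2: "((\<lambda>s. wave_series ?N \<beta> ((norm x)\<^sup>2 / (\<sigma> + s)\<^sup>2)) has_field_derivative
      wave_series' ?N \<beta> z * (- 2 * z / \<tau>)) (at t)"
    using DERIV_chain2[OF _ d1, of "wave_series ?N \<beta>"] wave_series_DERIV(1)[OF DIM_ge_1 z, where 'a1='a]
    by (simp add: z_def \<tau>_def)
  have d3: "((\<lambda>s. (\<sigma> + s) powr - \<beta>) has_field_derivative (- \<beta> * \<tau> powr (- \<beta> - 1))) (at t)"
    using \<tau> unfolding \<tau>_def by (auto intro!: derivative_eq_intros)
  have p: "\<tau> powr - \<beta> = \<tau> powr (- \<beta> - 1) * \<tau>" using \<tau> by (simp add: powr_diff)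
  have "((\<lambda>s. phi \<sigma> \<beta> (x, s)) has_field_derivative
     (- \<beta> * \<tau> powr (- \<beta> - 1)) * wave_series ?N \<beta> z + (wave_series' ?N \<beta> z * (- 2 * z / \<tau>)) * \<tau> powr - \<beta>) (at t)"
    unfolding phi_def fst_conv snd_conv using DERIV_mult[OF d3 d2] by (simp add: z_def \<tau>_def)
  also have "(- \<beta> * \<tau> powr (- \<beta> - 1)) * wave_series ?N \<beta> z + (wave_series' ?N \<beta> z * (- 2 * z / \<tau>)) * \<tau> powr - \<beta>
    = - (\<tau> powr (- \<beta> - 1)) * (\<beta> * wave_series ?N \<beta> z + 2 * z * wave_series' ?N \<beta> z)"
    unfolding p using \<tau> by (simp add: field_simps)
  also have "\<dots> = - \<beta> * (\<tau> powr - (\<beta> + 1) * wave_series ?N (\<beta> + 1) z)"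
    unfolding wave_series_time_ode[OF DIM_ge_1 z, where 'a1='a] by simp
  finally show ?thesis by (simp add: phi_def z_def \<tau>_def)
qed

text \<open>The spatial gradient of \<open>phi \<sigma> \<beta>\<close> is this scalar times
  x.\<close>

definition phi_grad :: "real \<Rightarrow> real \<Rightarrow> 'a::euclidean_space \<times> real \<Rightarrow> real" where
  "phi_grad \<sigma> \<beta> z = (\<sigma> + snd z) powr - \<beta> * (2 / (\<sigma> + snd z)\<^sup>2) *
     wave_series' DIM('a) \<beta> ((norm (fst z))\<^sup>2 / (\<sigma> + snd z)\<^sup>2)"

lemma ratio_has_derivative:
  "((\<lambda>y :: 'a::euclidean_space. (norm y)\<^sup>2 / c) has_derivative (\<lambda>h. 2 * (x \<bullet> h) / c)) (at x)"
  unfolding power2_norm_eq_inner divide_inverse by (auto intro!: derivative_eq_intros simp: inner_commute)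

lemma phi_space_derivative:
  assumes xt: "(x :: 'a::euclidean_space, t) \<in> light_cone \<sigma>"
  shows "((\<lambda>y. phi \<sigma> \<beta> (y, t)) has_derivative (\<lambda>h. phi_grad \<sigma> \<beta> (x, t) * (x \<bullet> h))) (at x)"
    and "((\<lambda>y. phi_grad \<sigma> \<beta> (y, t) * (y \<bullet> b)) has_derivative
      (\<lambda>h. (\<sigma> + t) powr - \<beta> * (4 / ((\<sigma> + t)\<^sup>2 * (\<sigma> + t)\<^sup>2)) *
        wave_series'' DIM('a) \<beta> ((norm x)\<^sup>2 / (\<sigma> + t)\<^sup>2) * (x \<bullet> h) * (x \<bullet> b) + phi_grad \<sigma> \<beta> (x, t) * (h \<bullet> b))) (at x)"
proof -
  define \<tau> where "\<tau> = \<sigma> + t"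
  define z where "z = (norm x)\<^sup>2 / \<tau>\<^sup>2"
  have \<tau>: "\<tau> > 0" and z: "\<bar>z\<bar> < 1" using light_cone_ratio[OF xt] by (auto simp: \<tau>_def z_def)
  let ?N = "DIM('a)"
  have d: "((\<lambda>y :: 'a. f ((norm y)\<^sup>2 / \<tau>\<^sup>2)) has_derivative (\<lambda>h. f' * (2 * (x \<bullet> h) / \<tau>\<^sup>2))) (at x)"
    if "(f has_field_derivative f') (at z)" for f f'
    using has_derivative_compose[OF ratio_has_derivative, of f "\<lambda>y. f' * y" x "\<tau>\<^sup>2"] that
    by (simp add: has_field_derivative_def z_def)
  have "((\<lambda>y. \<tau> powr - \<beta> * wave_series ?N \<beta> ((norm y)\<^sup>2 / \<tau>\<^sup>2)) has_derivative
     (\<lambda>h. \<tau> powr - \<beta> * (wave_series' ?N \<beta> z * (2 * (x \<bullet> h) / \<tau>\<^sup>2)))) (at x)"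
    by (intro has_derivative_mult_right d wave_series_DERIV DIM_ge_1 z)
  then show "((\<lambda>y. phi \<sigma> \<beta> (y, t)) has_derivative (\<lambda>h. phi_grad \<sigma> \<beta> (x, t) * (x \<bullet> h))) (at x)"
    by (simp add: phi_def phi_grad_def \<tau>_def z_def mult_ac)
  have "((\<lambda>y. \<tau> powr - \<beta> * (2 / \<tau>\<^sup>2) * wave_series' ?N \<beta> ((norm y)\<^sup>2 / \<tau>\<^sup>2)) has_derivative
     (\<lambda>h. \<tau> powr - \<beta> * (2 / \<tau>\<^sup>2) * (wave_series'' ?N \<beta> z * (2 * (x \<bullet> h) / \<tau>\<^sup>2)))) (at x)"
    by (intro has_derivative_mult_right d wave_series_DERIV DIM_ge_1 z)
  then have e: "((\<lambda>y. phi_grad \<sigma> \<beta> (y, t)) has_derivative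
     (\<lambda>h. \<tau> powr - \<beta> * (2 / \<tau>\<^sup>2) * (wave_series'' ?N \<beta> z * (2 * (x \<bullet> h) / \<tau>\<^sup>2)))) (at x)"
    by (simp add: phi_grad_def \<tau>_def)
  have "((\<lambda>y. y \<bullet> b) has_derivative (\<lambda>h. h \<bullet> b)) (at x)" by (auto intro!: derivative_eq_intros)
  from has_derivative_mult[OF e this]
  show "((\<lambda>y. phi_grad \<sigma> \<beta> (y, t) * (y \<bullet> b)) has_derivative
      (\<lambda>h. (\<sigma> + t) powr - \<beta> * (4 / ((\<sigma> + t)\<^sup>2 * (\<sigma> + t)\<^sup>2)) *
        wave_series'' DIM('a) \<beta> ((norm x)\<^sup>2 / (\<sigma> + t)\<^sup>2) * (x \<bullet> h) * (x \<bullet> b) + phi_grad \<sigma> \<beta> (x, t) * (h \<bullet> b))) (at x)"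
    by (rule has_derivative_eq_rhs) (simp add: fun_eq_iff \<tau>_def z_def field_simps)
qed

lemma phi_laplace:
  assumes xt: "(x :: 'a::euclidean_space, t) \<in> light_cone \<sigma>"
  shows "(\<Sum>b\<in>Basis. (\<sigma> + t) powr - \<beta> * (4 / ((\<sigma> + t)\<^sup>2 * (\<sigma> + t)\<^sup>2)) *
        wave_series'' DIM('a) \<beta> ((norm x)\<^sup>2 / (\<sigma> + t)\<^sup>2) * (x \<bullet> b) * (x \<bullet> b) + phi_grad \<sigma> \<beta> (x, t) * (b \<bullet> b))
    = \<beta> * (\<beta> + 1) * phi \<sigma> (\<beta> + 2) (x, t)"
proof -
  define \<tau> where "\<tau> = \<sigma> + t"
  define z where "z = (norm x)\<^sup>2 / \<tau>\<^sup>2"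
  have \<tau>: "\<tau> > 0" and z: "\<bar>z\<bar> < 1" using light_cone_ratio[OF xt] by (auto simp: \<tau>_def z_def)
  let ?N = "DIM('a)"
  have s: "(\<Sum>b\<in>Basis. (x \<bullet> b) * (x \<bullet> b)) = (norm x)\<^sup>2"
    by (simp add: power2_norm_eq_inner euclidean_inner[symmetric])
  have p: "\<tau> powr - (\<beta> + 2) = \<tau> powr - \<beta> / \<tau>\<^sup>2"
    using \<tau> by (simp add: powr_diff powr_numeral)
  have ring: "A * (4 / (T * T)) * w * (z * T) + m * (A * (2 / T) * w') = A / T * (2 * m * w' + 4 * z * w)"
    if "T \<noteq> 0" for T A w w' m :: real using that by (simp add: field_simps)
  have "(\<Sum>b\<in>Basis. \<tau> powr - \<beta> * (4 / (\<tau>\<^sup>2 * \<tau>\<^sup>2)) * wave_series'' ?N \<beta> z * (x \<bullet> b) * (x \<bullet> b) + phi_grad \<sigma> \<beta> (x, t) * (b \<bullet> b))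
    = (\<Sum>b\<in>Basis. \<tau> powr - \<beta> * (4 / (\<tau>\<^sup>2 * \<tau>\<^sup>2)) * wave_series'' ?N \<beta> z * ((x \<bullet> b) * (x \<bullet> b))) +
      (\<Sum>b\<in>(Basis::'a set). phi_grad \<sigma> \<beta> (x, t))"
    unfolding sum.distrib[symmetric] by (intro sum.cong) (auto simp: inner_Basis)
  also have "\<dots> = \<tau> powr - \<beta> * (4 / (\<tau>\<^sup>2 * \<tau>\<^sup>2)) * wave_series'' ?N \<beta> z * (norm x)\<^sup>2 + real ?N * phi_grad \<sigma> \<beta> (x, t)"
    unfolding s[symmetric] sum_distrib_left by simp
  also have "phi_grad \<sigma> \<beta> (x, t) = \<tau> powr - \<beta> * (2 / \<tau>\<^sup>2) * wave_series' ?N \<beta> z"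
    by (simp add: phi_grad_def \<tau>_def z_def)
  also have "(norm x)\<^sup>2 = z * \<tau>\<^sup>2" using \<tau> by (simp add: z_def)
  also have "\<tau> powr - \<beta> * (4 / (\<tau>\<^sup>2 * \<tau>\<^sup>2)) * wave_series'' ?N \<beta> z * (z * \<tau>\<^sup>2) + real ?N * (\<tau> powr - \<beta> * (2 / \<tau>\<^sup>2) * wave_series' ?N \<beta> z)
    = \<tau> powr - \<beta> / \<tau>\<^sup>2 * (2 * real ?N * wave_series' ?N \<beta> z + 4 * z * wave_series'' ?N \<beta> z)"
    using \<tau> by (intro ring) simp
  also have "\<dots> = \<beta> * (\<beta> + 1) * (\<tau> powr - (\<beta> + 2) * wave_series ?N (\<beta> + 2) z)"
    unfolding wave_series_space_ode[OF DIM_ge_1 z, where 'a1='a] p by simp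
  finally show ?thesis unfolding phi_def phi_grad_def fst_conv snd_conv \<tau>_def z_def .
qed

lemma D\<^sub>t_eqI:
  fixes \<Psi> :: "'a::euclidean_space \<times> real \<Rightarrow> real"
  assumes "\<Psi> \<in> Cc_infinity" "open U" "(x, t) \<in> U" "\<And>z. z \<in> U \<Longrightarrow> \<Psi> z = G z"
    "((\<lambda>s. G (x, s)) has_field_derivative d) (at t)"
  shows "D\<^sub>t \<Psi> (x, t) = d"
proof -
  have "((\<lambda>s. \<Psi> (x, s)) has_field_derivative D\<^sub>t \<Psi> (x, t)) (at t)"
    using assms(1) by (intro smooth_slice) (simp add: Cc_infinity_iff)
  moreover have "open ((\<lambda>s. (x, s)) -` U)" by (intro open_vimage assms(2) continuous_intros)
  ultimately have "((\<lambda>s. G (x, s)) has_field_derivative D\<^sub>t \<Psi> (x, t)) (at t)"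
    by (rule has_field_derivative_transform_within_open) (use assms in auto)
  with assms(5) show ?thesis using DERIV_unique by blast
qed

lemma D\<^sub>x_eqI:
  fixes \<Psi> :: "'a::euclidean_space \<times> real \<Rightarrow> real"
  assumes "\<Psi> \<in> Cc_infinity" "open U" "(x, t) \<in> U" "\<And>z. z \<in> U \<Longrightarrow> \<Psi> z = G z"
    "((\<lambda>y. G (y, t)) has_derivative g) (at x)"
  shows "D\<^sub>x b \<Psi> (x, t) = g b"
proof -
  have "((\<lambda>y. \<Psi> (y, t)) has_derivative (\<lambda>h. frechet_derivative \<Psi> (at (x, t)) (h, 0))) (at x)"
    using assms(1) by (intro smooth_slice) (simp add: Cc_infinity_iff)
  moreover have "open ((\<lambda>y. (y, t)) -` U)" by (intro open_vimage assms(2) continuous_intros)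
  ultimately have "((\<lambda>y. G (y, t)) has_derivative (\<lambda>h. frechet_derivative \<Psi> (at (x, t)) (h, 0))) (at x)"
    by (rule has_derivative_transform_within_open) (use assms in auto)
  with assms(5) have "g = (\<lambda>h. frechet_derivative \<Psi> (at (x, t)) (h, 0))" using has_derivative_unique by blast
  then show ?thesis by (simp add: D\<^sub>x_def)
qed

text \<open>Two summands, because the time derivative of one product h phi already has two; applied
  to a test function and again to its derivative, the lemma covers second order.\<close>

lemma D\<^sub>t_phi_combination:
  fixes \<Psi> :: "'a::euclidean_space \<times> real \<Rightarrow> real"
  assumes \<Psi>: "\<Psi> \<in> Cc_infinity" and U: "open U" "U \<subseteq> light_cone \<sigma>"
    and eq: "\<And>z. z \<in> U \<Longrightarrow> \<Psi> z = k (\<sigma> + snd z) * phi \<sigma> \<beta> z + l (\<sigma> + snd z) * phi \<sigma> \<gamma> z"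
    and d: "\<And>\<tau>. \<tau> > 0 \<Longrightarrow> (k has_field_derivative k' \<tau>) (at \<tau>)" "\<And>\<tau>. \<tau> > 0 \<Longrightarrow> (l has_field_derivative l' \<tau>) (at \<tau>)"
    and z: "z \<in> U"
  shows "D\<^sub>t \<Psi> z = k' (\<sigma> + snd z) * phi \<sigma> \<beta> z - \<beta> * k (\<sigma> + snd z) * phi \<sigma> (\<beta> + 1) z +
     (l' (\<sigma> + snd z) * phi \<sigma> \<gamma> z - \<gamma> * l (\<sigma> + snd z) * phi \<sigma> (\<gamma> + 1) z)"
proof -
  obtain x t where xt: "z = (x, t)" by (cases z)
  have c: "(x, t) \<in> light_cone \<sigma>" using z U xt by auto
  have \<tau>: "\<sigma> + t > 0" by (rule light_cone_ratio[OF c])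
  have s: "((\<lambda>s. f (\<sigma> + s)) has_field_derivative f') (at t)" if "(f has_field_derivative f') (at (\<sigma> + t))"
    for f :: "real \<Rightarrow> real" and f'
  proof -
    have "((\<lambda>s. \<sigma> + s) has_field_derivative 1) (at t)"
      using DERIV_add[OF DERIV_const[of \<sigma>] DERIV_ident] by simp
    from DERIV_chain2[where g="\<lambda>s. \<sigma> + s", OF that this] show ?thesis by simp
  qed
  have D: "((\<lambda>s. k (\<sigma> + snd (x, s)) * phi \<sigma> \<beta> (x, s) + l (\<sigma> + snd (x, s)) * phi \<sigma> \<gamma> (x, s)) has_field_derivative
    k' (\<sigma> + t) * phi \<sigma> \<beta> (x, t) + (- \<beta> * phi \<sigma> (\<beta> + 1) (x, t)) * k (\<sigma> + t) +
     (l' (\<sigma> + t) * phi \<sigma> \<gamma> (x, t) + (- \<gamma> * phi \<sigma> (\<gamma> + 1) (x, t)) * l (\<sigma> + t))) (at t)"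
    unfolding snd_conv by (intro DERIV_add DERIV_mult s d \<tau> phi_time_DERIV c)
  show ?thesis
    using D\<^sub>t_eqI[OF \<Psi> U(1) z[unfolded xt] eq D] by (simp add: xt mult_ac)
qed

lemma Lap_phi_combination:
  fixes \<Psi> :: "'a::euclidean_space \<times> real \<Rightarrow> real"
  assumes \<Psi>: "\<Psi> \<in> Cc_infinity" and U: "open U" "U \<subseteq> light_cone \<sigma>"
    and eq: "\<And>z. z \<in> U \<Longrightarrow> \<Psi> z = k (\<sigma> + snd z) * phi \<sigma> \<beta> z + l (\<sigma> + snd z) * phi \<sigma> \<gamma> z"
    and z: "z \<in> U"
  shows "Lap \<Psi> z = \<beta> * (\<beta> + 1) * k (\<sigma> + snd z) * phi \<sigma> (\<beta> + 2) z + \<gamma> * (\<gamma> + 1) * l (\<sigma> + snd z) * phi \<sigma> (\<gamma> + 2) z"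
proof -
  obtain x t where xt: "z = (x, t)" by (cases z)
  have c: "(y, s) \<in> light_cone \<sigma>" if "(y, s) \<in> U" for y s using that U by auto
  have D: "D\<^sub>x b \<Psi> w = k (\<sigma> + snd w) * (phi_grad \<sigma> \<beta> w * (fst w \<bullet> b)) + l (\<sigma> + snd w) * (phi_grad \<sigma> \<gamma> w * (fst w \<bullet> b))"
    if w: "w \<in> U" for w b
  proof -
    obtain y s where ys: "w = (y, s)" by (cases w)
    have "((\<lambda>y. k (\<sigma> + snd (y, s)) * phi \<sigma> \<beta> (y, s) + l (\<sigma> + snd (y, s)) * phi \<sigma> \<gamma> (y, s)) has_derivative
      (\<lambda>h. k (\<sigma> + s) * (phi_grad \<sigma> \<beta> (y, s) * (y \<bullet> h)) + l (\<sigma> + s) * (phi_grad \<sigma> \<gamma> (y, s) * (y \<bullet> h)))) (at y)"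
      unfolding snd_conv
      by (intro has_derivative_add has_derivative_mult_right phi_space_derivative c) (use w ys in auto)
    from D\<^sub>x_eqI[OF \<Psi> U(1) w[unfolded ys] eq this] show ?thesis unfolding ys by simp
  qed
  define q where "q \<beta> h b = (\<sigma> + t) powr - \<beta> * (4 / ((\<sigma> + t)\<^sup>2 * (\<sigma> + t)\<^sup>2)) *
        wave_series'' DIM('a) \<beta> ((norm x)\<^sup>2 / (\<sigma> + t)\<^sup>2) * (x \<bullet> h) * (x \<bullet> b) + phi_grad \<sigma> \<beta> (x, t) * (h \<bullet> b)" for \<beta> h b
  have "D\<^sub>x b (D\<^sub>x b \<Psi>) (x, t) = k (\<sigma> + t) * q \<beta> b b + l (\<sigma> + t) * q \<gamma> b b" for b
  proof -
    define G where "G w = k (\<sigma> + snd w) * (phi_grad \<sigma> \<beta> w * (fst w \<bullet> b)) + l (\<sigma> + snd w) * (phi_grad \<sigma> \<gamma> w * (fst w \<bullet> b))" for w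
    have "((\<lambda>y. G (y, t)) has_derivative (\<lambda>h. k (\<sigma> + t) * q \<beta> h b + l (\<sigma> + t) * q \<gamma> h b)) (at x)"
      unfolding q_def G_def fst_conv snd_conv
      by (intro has_derivative_add has_derivative_mult_right phi_space_derivative c) (use z xt in auto)
    from D\<^sub>x_eqI[OF Cc_infinity_D\<^sub>x[OF \<Psi>] U(1) z[unfolded xt] _ this] show ?thesis
      using D by (simp add: G_def)
  qed
  then have "Lap \<Psi> (x, t) = (\<Sum>b\<in>Basis. k (\<sigma> + t) * q \<beta> b b + l (\<sigma> + t) * q \<gamma> b b)" by (simp add: Lap_def)
  also have "\<dots> = k (\<sigma> + t) * (\<Sum>b\<in>Basis. q \<beta> b b) + l (\<sigma> + t) * (\<Sum>b\<in>Basis. q \<gamma> b b)"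
    by (simp add: sum.distrib sum_distrib_left)
  finally show ?thesis
    using phi_laplace[OF c[of x t], of \<beta>] phi_laplace[OF c[of x t], of \<gamma>] z xt by (simp add: q_def mult_ac)
qed

lemma phi_ge:
  assumes xt: "(x :: 'a::euclidean_space, t) \<in> light_cone \<sigma>" and \<beta>: "\<beta> > -1" "\<beta> \<ge> 0 \<or> DIM('a) \<ge> 2"
  shows "phi \<sigma> \<beta> (x, t) \<ge> 1 / 2 * (\<sigma> + t) powr - \<beta>"
proof -
  have "wave_series DIM('a) \<beta> ((norm x)\<^sup>2 / (\<sigma> + t)\<^sup>2) \<ge> 1 / 2"
  proof (cases "\<beta> \<ge> 0")
    case True
    then show ?thesis
      using wave_series_ge_1[OF DIM_ge_1[where 'a='a] light_cone_ratio(3,4)[OF xt], of \<beta>] by linarith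
  next
    case False
    then show ?thesis
      using \<beta> by (intro wave_series_ge_half light_cone_ratio(3,4)[OF xt]) auto
  qed
  then have "(\<sigma> + t) powr - \<beta> * (1 / 2) \<le> (\<sigma> + t) powr - \<beta> * wave_series DIM('a) \<beta> ((norm x)\<^sup>2 / (\<sigma> + t)\<^sup>2)"
    by (rule mult_left_mono) simp
  then show ?thesis by (simp add: phi_def mult.commute)
qed

lemma phi_le_Suc:
  assumes xt: "(x :: 'a::euclidean_space, t) \<in> light_cone \<sigma>" and \<beta>: "\<beta> > -1"
  shows "phi \<sigma> \<beta> (x, t) \<le> (\<sigma> + t) * phi \<sigma> (\<beta> + 1) (x, t)"
proof -
  have \<tau>: "\<sigma> + t > 0" by (rule light_cone_ratio[OF xt])
  have "(\<sigma> + t) * (\<sigma> + t) powr - (\<beta> + 1) = (\<sigma> + t) powr - \<beta>"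
    using \<tau> by (simp add: powr_diff)
  then have e: "(\<sigma> + t) * phi \<sigma> (\<beta> + 1) (x, t) = (\<sigma> + t) powr - \<beta> * wave_series DIM('a) (\<beta> + 1) ((norm x)\<^sup>2 / (\<sigma> + t)\<^sup>2)"
    unfolding phi_def fst_conv snd_conv mult.assoc[symmetric] by (simp only:)
  show ?thesis unfolding e unfolding phi_def fst_conv snd_conv
    by (intro mult_left_mono wave_series_mono DIM_ge_1 light_cone_ratio(3,4)[OF xt] \<beta>) simp
qed

lemma phi_nonneg:
  assumes "(x :: 'a::euclidean_space, t) \<in> light_cone \<sigma>" "\<beta> \<ge> 0"
  shows "phi \<sigma> \<beta> (x, t) \<ge> 0"
  by (rule order.trans[OF _ phi_ge[OF assms(1)]]) (use assms(2) in auto)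

text \<open>1 - |x|^2 / \<tau>^2 = (\<tau> - |x|) (\<tau> + |x|) / \<tau>^2 is at least (\<tau> -
  |x|) / \<tau>, and it is raised to a negative exponent. The constant is independent of
  \<sigma>.\<close>

lemma phi_le:
  assumes "\<beta> > (real DIM('a) - 1) / 2"
  obtains C where "C > 0" "\<And>\<sigma> (x :: 'a::euclidean_space) t. (x, t) \<in> light_cone \<sigma> \<Longrightarrow>
    phi \<sigma> \<beta> (x, t) \<le> C * (\<sigma> + t) powr - ((real DIM('a) - 1) / 2) * (\<sigma> + t - norm x) powr ((real DIM('a) - 1) / 2 - \<beta>)"
proof -
  define n where "n = (real DIM('a) - 1) / 2"
  obtain C where C: "C > 0" "\<And>z. 0 \<le> z \<Longrightarrow> z < 1 \<Longrightarrow> wave_series DIM('a) \<beta> z \<le> C * (1 - z) powr (n - \<beta>)"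
    using wave_series_le[OF DIM_ge_1 assms] unfolding n_def by blast
  show thesis
  proof (rule that[OF C(1)])
    fix \<sigma> t :: real and x :: 'a assume xt: "(x, t) \<in> light_cone \<sigma>"
    define \<tau> where "\<tau> = \<sigma> + t"
    have \<tau>: "\<tau> > 0" "norm x < \<tau>" using light_cone_ratio[OF xt] xt by (auto simp: \<tau>_def light_cone_def)
    have e: "1 - (norm x)\<^sup>2 / \<tau>\<^sup>2 = (\<tau> - norm x) * (\<tau> + norm x) / \<tau>\<^sup>2"
      using \<tau> by (simp add: field_simps power2_eq_square)
    have "(\<tau> - norm x) * \<tau> \<le> (\<tau> - norm x) * (\<tau> + norm x)" using \<tau> by (intro mult_left_mono) auto
    then have "(\<tau> - norm x) * \<tau> / \<tau>\<^sup>2 \<le> 1 - (norm x)\<^sup>2 / \<tau>\<^sup>2" unfolding e by (rule divide_right_mono) simp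
    then have le: "(\<tau> - norm x) / \<tau> \<le> 1 - (norm x)\<^sup>2 / \<tau>\<^sup>2" using \<tau> by (simp add: power2_eq_square)
    have "phi \<sigma> \<beta> (x, t) \<le> \<tau> powr - \<beta> * (C * (1 - (norm x)\<^sup>2 / \<tau>\<^sup>2) powr (n - \<beta>))"
      unfolding phi_def fst_conv snd_conv \<tau>_def
      by (intro mult_left_mono C(2) light_cone_ratio(3,4)[OF xt]) auto
    also have "\<dots> \<le> \<tau> powr - \<beta> * (C * ((\<tau> - norm x) / \<tau>) powr (n - \<beta>))"
      using C(1) \<tau> le assms by (intro mult_left_mono powr_mono2') (auto simp: n_def)
    also have "\<dots> = C * (\<tau> powr - \<beta> * \<tau> powr - (n - \<beta>)) * (\<tau> - norm x) powr (n - \<beta>)"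
    proof -
      have "((\<tau> - norm x) / \<tau>) powr (n - \<beta>) = (\<tau> - norm x) powr (n - \<beta>) * \<tau> powr - (n - \<beta>)"
        using \<tau> powr_divide[of "\<tau> - norm x" \<tau> "n - \<beta>"] powr_minus[of \<tau> "n - \<beta>"]
        by (simp add: divide_inverse del: minus_diff_eq)
      then show ?thesis by (simp only: mult_ac)
    qed
    also have "\<tau> powr - \<beta> * \<tau> powr - (n - \<beta>) = \<tau> powr - n"
      by (simp add: powr_add[symmetric])
    finally show "phi \<sigma> \<beta> (x, t) \<le> C * (\<sigma> + t) powr - ((real DIM('a) - 1) / 2) *
        (\<sigma> + t - norm x) powr ((real DIM('a) - 1) / 2 - \<beta>)"
      by (simp add: \<tau>_def n_def)
  qed
qed

section \<open>Initial data terms for a large time shift\<close>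

text \<open>At t = 0 the rescaled \<open>phi\<close> is the series at |x|^2 / \<sigma>^2, which
  tends to its value 1 at the origin on the fixed support of \<open>g\<close>.\<close>

lemma phi_initial_limit:
  fixes g :: "'a::euclidean_space \<Rightarrow> real"
  assumes g: "integrable lebesgue g" "\<And>x. norm x > r \<Longrightarrow> g x = 0"
  shows "((\<lambda>\<sigma>. \<sigma> powr \<beta> * (LINT x|lebesgue. g x * phi \<sigma> \<beta> (x, 0))) \<longlongrightarrow> (LINT x|lebesgue. g x)) at_top"
proof -
  define F where "F = wave_series DIM('a) \<beta>"
  have cont: "continuous_on {0..1/4} F"
    unfolding F_def
    by (rule continuous_on_subset[OF smooth_on_continuous_on[OF smooth_on_wave_series[OF DIM_ge_1]]]) auto
  then have "compact (F ` {0..1/4})" by (intro compact_continuous_image) auto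
  then obtain K where K: "K > 0" "\<forall>y\<in>F ` {0..1/4}. norm y \<le> K"
    using compact_imp_bounded bounded_pos by blast
  \<comment> \<open>Truncating the argument at 1/4 makes the series bounded and continuous for all
    x, as dominated convergence requires. For \<sigma> \<ge> 2 r the truncation is not felt on the
    support of \<open>g\<close>.\<close>
  define m where "m \<sigma> x = min ((norm x)\<^sup>2 / \<sigma>\<^sup>2) (1/4)" for \<sigma> and x :: 'a
  have m: "m \<sigma> x \<in> {0..1/4}" for \<sigma> x
    unfolding atLeastAtMost_iff m_def by (intro conjI min.cobounded2) auto
  have contm: "continuous_on UNIV (m \<sigma>)" for \<sigma>
    unfolding m_def divide_inverse by (intro continuous_intros)
  have meas: "(\<lambda>x. F (m \<sigma> x)) \<in> borel_measurable lebesgue" for \<sigma>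
    by (intro measurable_completion)
      (auto simp: measurable_lborel1 intro!: borel_measurable_continuous_onI continuous_on_compose2[OF cont contm] m)
  have "((\<lambda>\<sigma>. LINT x|lebesgue. g x * F (m \<sigma> x)) \<longlongrightarrow> (LINT x|lebesgue. g x)) at_top"
  proof (rule integral_dominated_convergence_at_top)
    show "integrable lebesgue (\<lambda>x. K * \<bar>g x\<bar>)" using g(1) by simp
    show "\<forall>\<^sub>F \<sigma> in at_top. AE x in lebesgue. norm (g x * F (m \<sigma> x)) \<le> K * \<bar>g x\<bar>"
    proof (intro always_eventually allI AE_I2)
      fix \<sigma> and x :: 'a
      have "\<bar>F (m \<sigma> x)\<bar> \<le> K" using K(2) m[of \<sigma> x] by auto
      then have "\<bar>F (m \<sigma> x)\<bar> * \<bar>g x\<bar> \<le> K * \<bar>g x\<bar>" by (rule mult_right_mono) simp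
      then show "norm (g x * F (m \<sigma> x)) \<le> K * \<bar>g x\<bar>" by (simp add: abs_mult mult.commute)
    qed
    show "AE x in lebesgue. ((\<lambda>\<sigma>. g x * F (m \<sigma> x)) \<longlongrightarrow> g x) at_top"
    proof (rule AE_I2)
      fix x :: 'a
      have "((\<lambda>\<sigma>. (norm x)\<^sup>2 / \<sigma>\<^sup>2) \<longlongrightarrow> 0) at_top"
        by (intro tendsto_divide_0[OF tendsto_const] filterlim_at_top_imp_at_infinity
            filterlim_pow_at_top filterlim_ident) auto
      then have "((\<lambda>\<sigma>. m \<sigma> x) \<longlongrightarrow> min 0 (1/4)) at_top" unfolding m_def by (intro tendsto_min tendsto_const)
      moreover have "isCont F 0"
        unfolding F_def using wave_series_DERIV(1)[OF DIM_ge_1, of 0] DERIV_isCont by auto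
      ultimately have "((\<lambda>\<sigma>. F (m \<sigma> x)) \<longlongrightarrow> F 0) at_top" using isCont_tendsto_compose[of 0 F] by simp
      then have "((\<lambda>\<sigma>. g x * F (m \<sigma> x)) \<longlongrightarrow> g x * F 0) at_top" by (intro tendsto_intros)
      moreover have "F 0 = 1" by (simp add: F_def wave_series_def)
      ultimately show "((\<lambda>\<sigma>. g x * F (m \<sigma> x)) \<longlongrightarrow> g x) at_top" by simp
    qed
  qed (use g(1) meas in auto)
  moreover have "\<forall>\<^sub>F \<sigma> in at_top. (LINT x|lebesgue. g x * F (m \<sigma> x)) = \<sigma> powr \<beta> * (LINT x|lebesgue. g x * phi \<sigma> \<beta> (x, 0))"
    using eventually_ge_at_top[of "max 1 (2 * r)"]
  proof eventually_elim
    case (elim \<sigma>)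
    have "g x * F (m \<sigma> x) = \<sigma> powr \<beta> * (g x * phi \<sigma> \<beta> (x, 0))" for x
    proof (cases "norm x > r")
      case False
      then have "norm x \<le> \<sigma> / 2" using elim by auto
      then have "(norm x)\<^sup>2 \<le> (\<sigma> / 2)\<^sup>2" by (intro power_mono) auto
      then have "m \<sigma> x = (norm x)\<^sup>2 / \<sigma>\<^sup>2" using elim by (simp add: m_def min_def field_simps)
      moreover have "\<sigma> powr \<beta> * \<sigma> powr - \<beta> = 1" using elim by (simp add: powr_add[symmetric])
      ultimately show ?thesis by (simp add: phi_def F_def mult_ac)
    qed (use g(2) in simp)
    then show ?case by (simp only: integral_mult_right_zero)
  qed
  ultimately show ?thesis by (rule Lim_transform_eventually)
qed

text \<open>As \<open>\<sigma> \<rightarrow> \<infinity>\<close>, the \<open>f\<close>-term is smaller than the \<open>g\<close>-term by a factor \<open>1/\<sigma>\<close>.\<close>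

lemma phi_initial_pos:
  fixes f g :: "'a::euclidean_space \<Rightarrow> real"
  assumes "integrable lebesgue g" "\<And>x. norm x > r \<Longrightarrow> g x = 0" "integrable lebesgue f" "\<And>x. norm x > r \<Longrightarrow> f x = 0"
    and "(LINT x|lebesgue. g x) > 0"
  shows "\<forall>\<^sub>F \<sigma> in at_top. (LINT x|lebesgue. g x * phi \<sigma> \<beta> (x, 0)) + c * (LINT x|lebesgue. f x * phi \<sigma> (\<beta> + 1) (x, 0)) > 0"
proof -
  have "((\<lambda>\<sigma>. \<sigma> powr \<beta> * (LINT x|lebesgue. g x * phi \<sigma> \<beta> (x, 0)) +
     c * (\<sigma> powr (\<beta> + 1) * (LINT x|lebesgue. f x * phi \<sigma> (\<beta> + 1) (x, 0))) * inverse \<sigma>) \<longlongrightarrow>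
     (LINT x|lebesgue. g x) + c * (LINT x|lebesgue. f x) * 0) at_top"
    by (intro tendsto_add tendsto_mult tendsto_const phi_initial_limit[of _ r] assms tendsto_inverse_0_at_top filterlim_ident)
  then have "\<forall>\<^sub>F \<sigma> in at_top. \<sigma> powr \<beta> * (LINT x|lebesgue. g x * phi \<sigma> \<beta> (x, 0)) +
     c * (\<sigma> powr (\<beta> + 1) * (LINT x|lebesgue. f x * phi \<sigma> (\<beta> + 1) (x, 0))) * inverse \<sigma> > 0"
    by (rule order_tendstoD) (use assms(5) in simp)
  then show ?thesis using eventually_gt_at_top[of 0]
  proof eventually_elim
    case (elim \<sigma>)
    have "\<sigma> powr (\<beta> + 1) * inverse \<sigma> = \<sigma> powr \<beta>" using elim(2) by (simp add: powr_add)
    then have "\<sigma> powr \<beta> * (LINT x|lebesgue. g x * phi \<sigma> \<beta> (x, 0)) +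
     c * (\<sigma> powr (\<beta> + 1) * (LINT x|lebesgue. f x * phi \<sigma> (\<beta> + 1) (x, 0))) * inverse \<sigma>
     = \<sigma> powr \<beta> * ((LINT x|lebesgue. g x * phi \<sigma> \<beta> (x, 0)) + c * (LINT x|lebesgue. f x * phi \<sigma> (\<beta> + 1) (x, 0)))"
      by (simp add: algebra_simps)
    with elim show ?case by (simp add: zero_less_mult_iff)
  qed
qed

section \<open>Weighted identities for solutions supported in a cone\<close>

definition time_weight :: "real \<Rightarrow> (real \<Rightarrow> real) \<Rightarrow> (real \<Rightarrow> real) \<Rightarrow> (real \<Rightarrow> real) \<Rightarrow> bool" where
  "time_weight R h h' h'' \<longleftrightarrow> smooth_on {0<..} h \<and>
     (\<forall>\<tau>>0. (h has_field_derivative h' \<tau>) (at \<tau>) \<and> (h' has_field_derivative h'' \<tau>) (at \<tau>)) \<and>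
     (\<forall>\<tau>\<ge>R. h \<tau> = 0)"

definition wave_weight :: "(real \<Rightarrow> real) \<Rightarrow> real \<Rightarrow> real \<Rightarrow> 'a::euclidean_space \<times> real \<Rightarrow> real" where
  "wave_weight h \<sigma> \<beta> z = h (\<sigma> + snd z) * phi \<sigma> \<beta> z"

text \<open>In the difference of second time derivative and Laplacian the terms with the
  undifferentiated h cancel; what remains lives where h varies. The last property comes from
  comparing the explicit formulas for the two mixed derivatives.\<close>

lemma wave_weight_extension:
  assumes h: "time_weight R h h' h''" and \<sigma>: "\<sigma> \<ge> r0 + 2" "\<sigma> > 1" "R > \<sigma>"
  obtains \<Psi> :: "'a::euclidean_space \<times> real \<Rightarrow> real" and U where
    "\<Psi> \<in> Cc_infinity" "\<And>x t. t \<ge> R - \<sigma> \<Longrightarrow> \<Psi> (x, t) = 0"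
    "\<And>x t. 0 \<le> t \<Longrightarrow> norm x \<le> r0 + t \<Longrightarrow> (x, t) \<in> U" "U \<subseteq> light_cone \<sigma>"
    "\<And>z. z \<in> U \<Longrightarrow> \<Psi> z = wave_weight h \<sigma> \<beta> z"
    "\<And>z. z \<in> U \<Longrightarrow> D\<^sub>t \<Psi> z = wave_weight h' \<sigma> \<beta> z - \<beta> * wave_weight h \<sigma> (\<beta> + 1) z"
    "\<And>z. z \<in> U \<Longrightarrow> D\<^sub>t (D\<^sub>t \<Psi>) z = wave_weight h'' \<sigma> \<beta> z - 2 * \<beta> * wave_weight h' \<sigma> (\<beta> + 1) z
      + \<beta> * (\<beta> + 1) * wave_weight h \<sigma> (\<beta> + 2) z"
    "\<And>z. z \<in> U \<Longrightarrow> Lap \<Psi> z = \<beta> * (\<beta> + 1) * wave_weight h \<sigma> (\<beta> + 2) z"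
    "\<And>z. z \<in> U \<Longrightarrow> Lap (D\<^sub>t \<Psi>) z = D\<^sub>t (Lap \<Psi>) z"
proof -
  have sm: "smooth_on {0<..} h" and d: "\<And>\<tau>. \<tau> > 0 \<Longrightarrow> (h has_field_derivative h' \<tau>) (at \<tau>)"
      "\<And>\<tau>. \<tau> > 0 \<Longrightarrow> (h' has_field_derivative h'' \<tau>) (at \<tau>)"
    and z: "\<And>\<tau>. \<tau> \<ge> R \<Longrightarrow> h \<tau> = 0"
    using h by (auto simp: time_weight_def)
  have E: "smooth_on (light_cone \<sigma>) (wave_weight h \<sigma> \<beta> :: 'a \<times> real \<Rightarrow> real)"
    unfolding wave_weight_def[abs_def]
  proof (intro smooth_on_mult open_light_cone smooth_on_phi smooth_on_compose[OF _ _ sm] smooth_on_time)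
    show "\<sigma> + snd z \<in> {0<..}" if "z \<in> light_cone \<sigma>" for z :: "'a \<times> real"
      using light_cone_ratio(1)[of "fst z" "snd z" \<sigma>] that by simp
  qed auto
  have Ez: "wave_weight h \<sigma> \<beta> (x, t) = 0" if "\<sigma> + t \<ge> R" for x :: 'a and t
    using z[OF that] by (simp add: wave_weight_def)
  obtain \<Psi> :: "'a \<times> real \<Rightarrow> real" and U where \<Psi>: "\<Psi> \<in> Cc_infinity" "\<And>x t. t \<ge> R - \<sigma> \<Longrightarrow> \<Psi> (x, t) = 0"
    and U: "open U" "U \<subseteq> light_cone \<sigma>" and eq: "\<And>z. z \<in> U \<Longrightarrow> \<Psi> z = wave_weight h \<sigma> \<beta> z"
    and cone: "\<And>x t. 0 \<le> t \<Longrightarrow> norm x \<le> r0 + t \<Longrightarrow> (x, t) \<in> U"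
    using cone_extension[OF E Ez \<sigma>] by blast
  note C1 = Cc_infinity_D\<^sub>t[OF \<Psi>(1)] and C2 = Cc_infinity_Lap[OF \<Psi>(1)]
  have eq0: "\<Psi> z = h (\<sigma> + snd z) * phi \<sigma> \<beta> z + 0 * phi \<sigma> 0 z" if "z \<in> U" for z
    using eq[OF that] by (simp add: wave_weight_def)
  have eq1: "D\<^sub>t \<Psi> z = h' (\<sigma> + snd z) * phi \<sigma> \<beta> z + (- \<beta> * h (\<sigma> + snd z)) * phi \<sigma> (\<beta> + 1) z" if "z \<in> U" for z
    using D\<^sub>t_phi_combination[OF \<Psi>(1) U eq0 d(1) DERIV_const that] by simp
  have eq2: "D\<^sub>t (D\<^sub>t \<Psi>) z = h'' (\<sigma> + snd z) * phi \<sigma> \<beta> z - \<beta> * h' (\<sigma> + snd z) * phi \<sigma> (\<beta> + 1) z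
      + (- \<beta> * h' (\<sigma> + snd z) * phi \<sigma> (\<beta> + 1) z - (\<beta> + 1) * (- \<beta> * h (\<sigma> + snd z)) * phi \<sigma> (\<beta> + 1 + 1) z)"
    if "z \<in> U" for z
    by (rule D\<^sub>t_phi_combination[where l="\<lambda>\<tau>. - \<beta> * h \<tau>" and l'="\<lambda>\<tau>. - \<beta> * h' \<tau>" and k=h', OF C1 U eq1 d(2) _ that])
      (assumption | rule DERIV_cmult[OF d(1)])+
  have eq3: "Lap \<Psi> z = (\<beta> * (\<beta> + 1) * h (\<sigma> + snd z)) * phi \<sigma> (\<beta> + 2) z + 0 * phi \<sigma> 0 z" if "z \<in> U" for z
    using Lap_phi_combination[where l="\<lambda>_. 0", OF \<Psi>(1) U eq0 that] by simp
  have eq4: "D\<^sub>t (Lap \<Psi>) z = (\<beta> * (\<beta> + 1) * h' (\<sigma> + snd z)) * phi \<sigma> (\<beta> + 2) z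
      - (\<beta> + 2) * (\<beta> * (\<beta> + 1) * h (\<sigma> + snd z)) * phi \<sigma> (\<beta> + 2 + 1) z" if "z \<in> U" for z
    using D\<^sub>t_phi_combination[where k="\<lambda>\<tau>. \<beta> * (\<beta> + 1) * h \<tau>" and k'="\<lambda>\<tau>. \<beta> * (\<beta> + 1) * h' \<tau>", OF C2 U eq3 _ DERIV_const that]
      DERIV_cmult[OF d(1)] by simp
  have eq5: "Lap (D\<^sub>t \<Psi>) z = \<beta> * (\<beta> + 1) * h' (\<sigma> + snd z) * phi \<sigma> (\<beta> + 2) z
      + (\<beta> + 1) * (\<beta> + 1 + 1) * (- \<beta> * h (\<sigma> + snd z)) * phi \<sigma> (\<beta> + 1 + 2) z" if "z \<in> U" for z
    by (rule Lap_phi_combination[where l="\<lambda>\<tau>. - \<beta> * h \<tau>" and k=h', OF C1 U eq1 that])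
  show thesis
  proof (rule that[OF \<Psi> cone U(2) eq])
    fix z assume z: "z \<in> U"
    show "D\<^sub>t \<Psi> z = wave_weight h' \<sigma> \<beta> z - \<beta> * wave_weight h \<sigma> (\<beta> + 1) z"
      using eq1[OF z] by (simp add: wave_weight_def)
    show "D\<^sub>t (D\<^sub>t \<Psi>) z = wave_weight h'' \<sigma> \<beta> z - 2 * \<beta> * wave_weight h' \<sigma> (\<beta> + 1) z
      + \<beta> * (\<beta> + 1) * wave_weight h \<sigma> (\<beta> + 2) z"
      using eq2[OF z] by (simp add: wave_weight_def add.assoc algebra_simps)
    show "Lap \<Psi> z = \<beta> * (\<beta> + 1) * wave_weight h \<sigma> (\<beta> + 2) z"
      using eq3[OF z] by (simp add: wave_weight_def)
    have "\<beta> + 1 + 2 = \<beta> + 2 + 1" by simp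
    then show "Lap (D\<^sub>t \<Psi>) z = D\<^sub>t (Lap \<Psi>) z"
      unfolding eq4[OF z] eq5[OF z] by (simp add: algebra_simps)
  qed
qed

lemma set_integral_mult_uminus:
  fixes A :: "'a \<times> 'b \<Rightarrow> real"
  shows "(LINT t:S|M. LINT x|N. w t x * (\<lambda>z. - A z) (x, t)) = - (LINT t:S|M. LINT x|N. w t x * A (x, t))"
  by (simp add: set_lebesgue_integral_def)

section \<open>Testing the two equations\<close>

locale cone_solution =
  fixes G1 G2 :: "real \<Rightarrow> real" and f1 g1 f2 g2 :: "'a::euclidean_space \<Rightarrow> real"
    and \<epsilon> r0 :: real and T :: ereal and u v :: "real \<Rightarrow> 'a \<Rightarrow> real"
  assumes weak_solution: "weak_solution G1 G2 f1 g1 f2 g2 \<epsilon> T u v"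
    and supp: "spacetime_supp T (\<lambda>t x. (u t x, v t x)) \<subseteq> {(x, t). t \<in> time_dom T \<and> norm x \<le> r0 + t}"
    and G_zero: "G1 0 = 0" "G2 0 = 0" and G_nonneg: "\<And>s. G1 s \<ge> 0" "\<And>s. G2 s \<ge> 0"
    and data_Cc: "f1 \<in> Cc_infinity" "g1 \<in> Cc_infinity" "f2 \<in> Cc_infinity" "g2 \<in> Cc_infinity"
    and data_zero: "\<And>x. norm x > r0 \<Longrightarrow> f1 x = 0" "\<And>x. norm x > r0 \<Longrightarrow> g1 x = 0"
      "\<And>x. norm x > r0 \<Longrightarrow> f2 x = 0" "\<And>x. norm x > r0 \<Longrightarrow> g2 x = 0"
begin

definition I1 :: "('a \<times> real \<Rightarrow> real) \<Rightarrow> real" where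
  "I1 H = (LINT t:einterval 0 T|lebesgue. LINT x|lebesgue. G1 (v t x) * H (x, t))"

definition I2 :: "('a \<times> real \<Rightarrow> real) \<Rightarrow> real" where
  "I2 H = (LINT t:einterval 0 T|lebesgue. LINT x|lebesgue. G2 (time_deriv T u t x) * H (x, t))"

text \<open>A weight need only agree with a test function on the cone of the solution: the
  integrands vanish almost everywhere outside it, so integrability carries over.\<close>

definition admissible :: "('a \<times> real \<Rightarrow> real) \<Rightarrow> bool" where
  "admissible H \<longleftrightarrow> (\<exists>\<Psi>\<in>Cc_infinity. \<forall>x t. 0 < t \<longrightarrow> norm x \<le> r0 + t \<longrightarrow> H (x, t) = \<Psi> (x, t))"

lemma sol:
  "u \<in> C_H1 T" "v \<in> C_H1 T" "u \<in> C1_L2 T" "v \<in> C1_L2 T"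
  "(\<lambda>t x. G2 (time_deriv T u t x)) \<in> L1_L1 T" "(\<lambda>t x. G1 (v t x)) \<in> L1_L1 T"
  "AE x in lebesgue. u 0 x = \<epsilon> * f1 x" "AE x in lebesgue. v 0 x = \<epsilon> * f2 x"
  "\<And>\<Psi>. \<Psi> \<in> test_functions T \<Longrightarrow> weak_identity T \<epsilon> g1 (\<lambda>t x. G1 (v t x)) u \<Psi>"
  "\<And>\<Psi>. \<Psi> \<in> test_functions T \<Longrightarrow> weak_identity T \<epsilon> g2 (\<lambda>t x. G2 (time_deriv T u t x)) v \<Psi>"
  using weak_solution by (auto simp: weak_solution_def)

lemma cone_zero: "AE t in lebesgue. t \<in> einterval 0 T \<longrightarrow>
    (AE x in lebesgue. norm x > r0 + t \<longrightarrow> u t x = 0 \<and> v t x = 0 \<and> time_deriv T u t x = 0)"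
  by (rule cone_support[OF sol(3) supp])

lemma cone_zero_each:
  "AE t in lebesgue. t \<in> einterval 0 T \<longrightarrow> (AE x in lebesgue. norm x > r0 + t \<longrightarrow> u t x = 0)"
  "AE t in lebesgue. t \<in> einterval 0 T \<longrightarrow> (AE x in lebesgue. norm x > r0 + t \<longrightarrow> v t x = 0)"
  "AE t in lebesgue. t \<in> einterval 0 T \<longrightarrow> (AE x in lebesgue. norm x > r0 + t \<longrightarrow> time_deriv T u t x = 0)"
  "AE t in lebesgue. t \<in> einterval 0 T \<longrightarrow> (AE x in lebesgue. norm x > r0 + t \<longrightarrow> G1 (v t x) = 0)"
  "AE t in lebesgue. t \<in> einterval 0 T \<longrightarrow> (AE x in lebesgue. norm x > r0 + t \<longrightarrow> G2 (time_deriv T u t x) = 0)"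
  by (rule eventually_mono[OF cone_zero], auto elim!: eventually_mono simp: G_zero)+

lemma I_cong:
  assumes "\<And>x t. 0 < t \<Longrightarrow> norm x \<le> r0 + t \<Longrightarrow> A (x, t) = B (x, t)"
  shows "I1 A = I1 B" "I2 A = I2 B"
  unfolding I1_def I2_def
  using cone_integral_cong(1)[where A=A and B=B, OF cone_zero_each(4) assms]
    cone_integral_cong(1)[where A=A and B=B, OF cone_zero_each(5) assms] by auto

lemma I_integrable:
  assumes "admissible H"
  shows "set_integrable lebesgue (einterval 0 T) (\<lambda>t. LINT x|lebesgue. G1 (v t x) * H (x, t))"
    "set_integrable lebesgue (einterval 0 T) (\<lambda>t. LINT x|lebesgue. G2 (time_deriv T u t x) * H (x, t))"
proof -
  obtain \<Psi> where \<Psi>: "\<Psi> \<in> Cc_infinity" and e: "\<And>x t. 0 < t \<Longrightarrow> norm x \<le> r0 + t \<Longrightarrow> H (x, t) = \<Psi> (x, t)"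
    using assms by (auto simp: admissible_def)
  show "set_integrable lebesgue (einterval 0 T) (\<lambda>t. LINT x|lebesgue. G1 (v t x) * H (x, t))"
    using cone_integral_cong(2)[where A=H and B=\<Psi>, OF cone_zero_each(4) e] L1_L1_pairing(2)[OF sol(6) \<Psi>] by simp
  show "set_integrable lebesgue (einterval 0 T) (\<lambda>t. LINT x|lebesgue. G2 (time_deriv T u t x) * H (x, t))"
    using cone_integral_cong(2)[where A=H and B=\<Psi>, OF cone_zero_each(5) e] L1_L1_pairing(2)[OF sol(5) \<Psi>] by simp
qed

lemma I_integrable_slice:
  assumes "admissible H"
  shows "AE t in lebesgue. t \<in> einterval 0 T \<longrightarrow> integrable lebesgue (\<lambda>x. G1 (v t x) * H (x, t))"
    "AE t in lebesgue. t \<in> einterval 0 T \<longrightarrow> integrable lebesgue (\<lambda>x. G2 (time_deriv T u t x) * H (x, t))"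
proof -
  obtain \<Psi> where \<Psi>: "\<Psi> \<in> Cc_infinity" and e: "\<And>x t. 0 < t \<Longrightarrow> norm x \<le> r0 + t \<Longrightarrow> H (x, t) = \<Psi> (x, t)"
    using assms by (auto simp: admissible_def)
  have *: "integrable lebesgue (\<lambda>x. w x * H (x, t))"
    if "integrable lebesgue (\<lambda>x. w x * \<Psi> (x, t))" "AE x in lebesgue. norm x > r0 + t \<longrightarrow> w x = 0" "t > 0" for w t
  proof -
    have "AE x in lebesgue. w x * H (x, t) = w x * \<Psi> (x, t)"
      using that(2)
    proof eventually_elim
      case (elim x)
      then show ?case using e[OF that(3), of x] by (cases "norm x > r0 + t") auto
    qed
    from lebesgue_integral_cong_AE(2)[OF this] that(1) show ?thesis by simp
  qed
  show "AE t in lebesgue. t \<in> einterval 0 T \<longrightarrow> integrable lebesgue (\<lambda>x. G1 (v t x) * H (x, t))"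
    using cone_zero_each(4) L1_L1_pairing(1)[OF sol(6) \<Psi>]
    by eventually_elim (auto simp: einterval_0_iff intro: *)
  show "AE t in lebesgue. t \<in> einterval 0 T \<longrightarrow> integrable lebesgue (\<lambda>x. G2 (time_deriv T u t x) * H (x, t))"
    using cone_zero_each(5) L1_L1_pairing(1)[OF sol(5) \<Psi>]
    by eventually_elim (auto simp: einterval_0_iff intro: *)
qed

lemma I1_mono:
  assumes "admissible A" "admissible B" "\<And>x t. 0 < t \<Longrightarrow> norm x \<le> r0 + t \<Longrightarrow> A (x, t) \<le> B (x, t)"
  shows "I1 A \<le> I1 B"
  unfolding I1_def
proof (rule set_integral_mono_AE)
  show "AE t\<in>einterval 0 T in lebesgue. (LINT x|lebesgue. G1 (v t x) * A (x, t)) \<le> (LINT x|lebesgue. G1 (v t x) * B (x, t))"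
    using cone_zero_each(4) I_integrable_slice(1)[OF assms(1)] I_integrable_slice(1)[OF assms(2)]
  proof eventually_elim
    case (elim t)
    show ?case
    proof
      assume t: "t \<in> einterval 0 T"
      have "AE x in lebesgue. norm x > r0 + t \<longrightarrow> G1 (v t x) = 0" using elim t by blast
      then have "AE x in lebesgue. G1 (v t x) * A (x, t) \<le> G1 (v t x) * B (x, t)"
      proof eventually_elim
        case (elim x)
        then show ?case using assms(3)[of t x] t G_nonneg(1)[of "v t x"]
          by (cases "norm x > r0 + t") (auto simp: einterval_0_iff intro: mult_left_mono)
      qed
      then show "(LINT x|lebesgue. G1 (v t x) * A (x, t)) \<le> (LINT x|lebesgue. G1 (v t x) * B (x, t))"
        using elim t by (intro integral_mono_AE) auto
    qed
  qed
qed (use I_integrable(1) assms in auto)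

text \<open>After the weight is set to 0 outside the cone the integrands are nonnegative everywhere;
  where they fail to be integrable the integrals are 0 by convention.\<close>

lemma I_nonneg:
  assumes "\<And>x t. 0 < t \<Longrightarrow> norm x \<le> r0 + t \<Longrightarrow> 0 \<le> A (x, t)"
  shows "0 \<le> I1 A" "0 \<le> I2 A"
proof -
  define B where "B z = (if 0 < snd z \<and> norm (fst z) \<le> r0 + snd z then A z else 0)" for z
  have "I1 A = I1 B" "I2 A = I2 B" by (rule I_cong, simp add: B_def)+
  moreover have "0 \<le> B z" for z using assms[of "snd z" "fst z"] by (auto simp: B_def)
  then have "0 \<le> I1 B" "0 \<le> I2 B"
    unfolding I1_def I2_def set_lebesgue_integral_def
    by (intro Bochner_Integration.integral_nonneg mult_nonneg_nonneg scaleR_nonneg_nonneg; simp add: G_nonneg)+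
  ultimately show "0 \<le> I1 A" "0 \<le> I2 A" by auto
qed

lemma I_scale: "I1 (\<lambda>z. c * H z) = c * I1 H" "I2 (\<lambda>z. c * H z) = c * I2 H"
  unfolding I1_def I2_def by (simp_all add: mult.left_commute[of _ c])

lemma data_integral_cong:
  assumes "\<And>x. norm x > r0 \<Longrightarrow> g x = 0" "\<And>x. norm x \<le> r0 \<Longrightarrow> A (x, 0) = B (x, 0)"
  shows "(LINT x|lebesgue. g x * A (x, 0 :: real)) = (LINT x|lebesgue. (g x :: real) * B (x, 0))"
proof (rule Bochner_Integration.integral_cong[OF refl])
  fix x show "g x * A (x, 0) = g x * B (x, 0)"
    using assms[of x] by (cases "norm x > r0") auto
qed

lemma data_phi_integrable:
  assumes f: "f \<in> Cc_infinity" "\<And>x. norm x > r0 \<Longrightarrow> f x = 0" and "\<sigma> > r0"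
  shows "integrable lebesgue (\<lambda>x. f x * phi \<sigma> \<beta> (x :: 'a, 0))"
proof -
  have "continuous_on (light_cone \<sigma>) (phi \<sigma> \<beta> :: 'a \<times> real \<Rightarrow> real)"
    by (rule smooth_on_continuous_on[OF smooth_on_phi])
  then have "continuous_on (cball 0 r0) (\<lambda>x. phi \<sigma> \<beta> (x :: 'a, 0))"
    by (rule continuous_on_compose2) (use assms(3) in \<open>auto intro!: continuous_intros simp: light_cone_def\<close>)
  moreover have "continuous_on (cball 0 r0) f"
    using f(1) smooth_on_continuous_on by (auto simp: Cc_infinity_iff intro: continuous_on_subset)
  ultimately have "continuous_on (cball 0 r0) (\<lambda>x. f x * phi \<sigma> \<beta> (x, 0))"
    by (intro continuous_intros)
  then have "integrable lborel (\<lambda>x. indicator (cball 0 r0) x *\<^sub>R (f x * phi \<sigma> \<beta> (x, 0)))"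
    by (intro borel_integrable_compact) auto
  moreover have "indicator (cball 0 r0) x *\<^sub>R (f x * phi \<sigma> \<beta> (x, 0)) = f x * phi \<sigma> \<beta> (x, 0)" for x
    using f(2)[of x] by (cases "norm x > r0") auto
  ultimately have "integrable lborel (\<lambda>x. f x * phi \<sigma> \<beta> (x, 0))" by (simp only:)
  then show ?thesis using integrable_completion[OF borel_measurable_integrable] by blast
qed

lemma data_integral_combination:
  assumes "f \<in> Cc_infinity" "\<And>x. norm x > r0 \<Longrightarrow> f x = 0" "\<sigma> > r0"
  shows "(LINT x|lebesgue. f x * (c * phi \<sigma> \<beta> (x :: 'a, 0) + d * phi \<sigma> \<gamma> (x, 0))) =
    c * (LINT x|lebesgue. f x * phi \<sigma> \<beta> (x, 0)) + d * (LINT x|lebesgue. f x * phi \<sigma> \<gamma> (x, 0))"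
proof -
  have "(LINT x|lebesgue. f x * (c * phi \<sigma> \<beta> (x :: 'a, 0) + d * phi \<sigma> \<gamma> (x, 0))) =
    (LINT x|lebesgue. c * (f x * phi \<sigma> \<beta> (x, 0)) + d * (f x * phi \<sigma> \<gamma> (x, 0)))"
    by (simp add: algebra_simps)
  also have "\<dots> = (LINT x|lebesgue. c * (f x * phi \<sigma> \<beta> (x, 0))) + (LINT x|lebesgue. d * (f x * phi \<sigma> \<gamma> (x, 0)))"
    by (intro Bochner_Integration.integral_add integrable_mult_right data_phi_integrable assms)
  finally show ?thesis by simp
qed

lemma admissible_wave_weight:
  assumes h: "time_weight R h h' h''" and \<sigma>: "\<sigma> \<ge> r0 + 2" "\<sigma> > 1" "R > \<sigma>"
  shows "admissible (wave_weight h \<sigma> \<beta>)"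
    and "admissible (\<lambda>z. wave_weight h' \<sigma> \<beta> z - \<beta> * wave_weight h \<sigma> (\<beta> + 1) z)"
proof -
  obtain \<Psi> :: "'a \<times> real \<Rightarrow> real" and U where \<Psi>:
    "\<Psi> \<in> Cc_infinity" "\<And>x t. 0 \<le> t \<Longrightarrow> norm x \<le> r0 + t \<Longrightarrow> (x, t) \<in> U"
    "\<And>z. z \<in> U \<Longrightarrow> \<Psi> z = wave_weight h \<sigma> \<beta> z"
    "\<And>z. z \<in> U \<Longrightarrow> D\<^sub>t \<Psi> z = wave_weight h' \<sigma> \<beta> z - \<beta> * wave_weight h \<sigma> (\<beta> + 1) z"
    using wave_weight_extension[OF assms, of \<beta>] by metis
  show "admissible (wave_weight h \<sigma> \<beta>)"
    unfolding admissible_def using \<Psi> by (intro bexI[of _ \<Psi>]) auto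
  show "admissible (\<lambda>z. wave_weight h' \<sigma> \<beta> z - \<beta> * wave_weight h \<sigma> (\<beta> + 1) z)"
    unfolding admissible_def using \<Psi> Cc_infinity_D\<^sub>t[OF \<Psi>(1)] by (intro bexI[of _ "D\<^sub>t \<Psi>"]) auto
qed

text \<open>In the cone the weight is a function of time alone, so its Laplacian is 0 there and one
  derivative on the cutoff suffices to express everything through
  \<open>\<partial>\<^sub>t u\<close>.\<close>

lemma time_test_u:
  assumes h: "time_weight R h h' h''" and \<sigma>: "\<sigma> \<ge> r0 + 2" "\<sigma> > 1" "R > \<sigma>" "ereal (R - \<sigma>) < T"
  shows "\<epsilon> * h \<sigma> * (LINT x|lebesgue. g1 x) + I1 (wave_weight h \<sigma> 0) =
    (LINT t:einterval 0 T|lebesgue. LINT x|lebesgue. time_deriv T u t x * (- h' (\<sigma> + t)))"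
proof -
  obtain \<Psi> :: "'a \<times> real \<Rightarrow> real" and U where \<Psi>:
    "\<Psi> \<in> Cc_infinity" "\<And>x t. t \<ge> R - \<sigma> \<Longrightarrow> \<Psi> (x, t) = 0"
    and U: "\<And>x t. 0 \<le> t \<Longrightarrow> norm x \<le> r0 + t \<Longrightarrow> (x, t) \<in> U" "U \<subseteq> light_cone \<sigma>"
    and e: "\<And>z. z \<in> U \<Longrightarrow> \<Psi> z = wave_weight h \<sigma> 0 z"
    "\<And>z. z \<in> U \<Longrightarrow> D\<^sub>t \<Psi> z = wave_weight h' \<sigma> 0 z - 0 * wave_weight h \<sigma> (0 + 1) z"
    "\<And>z. z \<in> U \<Longrightarrow> Lap \<Psi> z = 0 * (0 + 1) * wave_weight h \<sigma> (0 + 2) z"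
    by (rule wave_weight_extension[OF h \<sigma>(1-3), of 0], rule that)
  have p0: "phi \<sigma> 0 (x, t) = 1" if "0 \<le> t" "norm x \<le> r0 + t" for x :: 'a and t
    using U that by (intro phi_0) auto
  have "\<epsilon> * (LINT x|lebesgue. g1 x * \<Psi> (x, 0)) + I1 \<Psi> =
     - (LINT t:einterval 0 T|lebesgue. LINT x|lebesgue. time_deriv T u t x * D\<^sub>t \<Psi> (x, t))
     - (LINT t:einterval 0 T|lebesgue. LINT x|lebesgue. u t x * Lap \<Psi> (x, t))"
    unfolding I1_def using \<sigma>(3,4)
    by (intro weak_identity_by_parts[OF sol(1,3) \<Psi>] sol(9) Cc_infinity_test_function[OF \<Psi>]) auto
  moreover have "(LINT x|lebesgue. g1 x * \<Psi> (x, 0)) = (LINT x|lebesgue. g1 x * (\<lambda>_. h \<sigma>) (x, 0::real))"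
    by (rule data_integral_cong[OF data_zero(2)]) (use U e p0 in \<open>auto simp: wave_weight_def\<close>)
  moreover have "I1 \<Psi> = I1 (wave_weight h \<sigma> 0)" by (rule I_cong) (use U e in auto)
  moreover have "(LINT t:einterval 0 T|lebesgue. LINT x|lebesgue. time_deriv T u t x * D\<^sub>t \<Psi> (x, t)) =
     (LINT t:einterval 0 T|lebesgue. LINT x|lebesgue. time_deriv T u t x * (\<lambda>z. h' (\<sigma> + snd z)) (x, t))"
    by (rule cone_integral_cong(1)[OF cone_zero_each(3)]) (use U e p0 in \<open>auto simp: wave_weight_def\<close>)
  moreover have "(LINT t:einterval 0 T|lebesgue. LINT x|lebesgue. u t x * Lap \<Psi> (x, t)) =
     (LINT t:einterval 0 T|lebesgue. LINT x|lebesgue. u t x * (\<lambda>_. 0) (x, t))"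
    by (rule cone_integral_cong(1)[OF cone_zero_each(1)]) (use U e in auto)
  ultimately show ?thesis by (simp add: set_lebesgue_integral_def mult_ac)
qed

text \<open>Since \<open>phi\<close> solves the wave equation, \<open>v\<close> is paired only with
  derivatives of h; the data terms are those of phi_\<beta> and of its time derivative -\<beta>
  phi_(\<beta> + 1).\<close>

lemma wave_test_v:
  assumes h: "time_weight R h h' h''" and \<sigma>: "\<sigma> \<ge> r0 + 2" "\<sigma> > 1" "R > \<sigma>" "ereal (R - \<sigma>) < T"
  shows "\<epsilon> * (h \<sigma> * ((LINT x|lebesgue. g2 x * phi \<sigma> \<beta> (x, 0)) + \<beta> * (LINT x|lebesgue. f2 x * phi \<sigma> (\<beta> + 1) (x, 0)))
      - h' \<sigma> * (LINT x|lebesgue. f2 x * phi \<sigma> \<beta> (x, 0))) + I2 (wave_weight h \<sigma> \<beta>) =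
    (LINT t:einterval 0 T|lebesgue. LINT x|lebesgue. v t x *
      (wave_weight h'' \<sigma> \<beta> (x, t) - 2 * \<beta> * wave_weight h' \<sigma> (\<beta> + 1) (x, t)))"
proof -
  obtain \<Psi> :: "'a \<times> real \<Rightarrow> real" and U where \<Psi>:
    "\<Psi> \<in> Cc_infinity" "\<And>x t. t \<ge> R - \<sigma> \<Longrightarrow> \<Psi> (x, t) = 0"
    and U: "\<And>x t. 0 \<le> t \<Longrightarrow> norm x \<le> r0 + t \<Longrightarrow> (x, t) \<in> U" "U \<subseteq> light_cone \<sigma>"
    and e: "\<And>z. z \<in> U \<Longrightarrow> \<Psi> z = wave_weight h \<sigma> \<beta> z"
    "\<And>z. z \<in> U \<Longrightarrow> D\<^sub>t \<Psi> z = wave_weight h' \<sigma> \<beta> z - \<beta> * wave_weight h \<sigma> (\<beta> + 1) z"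
    "\<And>z. z \<in> U \<Longrightarrow> D\<^sub>t (D\<^sub>t \<Psi>) z = wave_weight h'' \<sigma> \<beta> z - 2 * \<beta> * wave_weight h' \<sigma> (\<beta> + 1) z
      + \<beta> * (\<beta> + 1) * wave_weight h \<sigma> (\<beta> + 2) z"
    "\<And>z. z \<in> U \<Longrightarrow> Lap \<Psi> z = \<beta> * (\<beta> + 1) * wave_weight h \<sigma> (\<beta> + 2) z"
    by (rule wave_weight_extension[OF h \<sigma>(1-3), of \<beta>], rule that)
  have r0: "\<sigma> > r0" using \<sigma>(1) by simp
  have "\<epsilon> * (LINT x|lebesgue. g2 x * \<Psi> (x, 0)) - (LINT x|lebesgue. v 0 x * D\<^sub>t \<Psi> (x, 0)) + I2 \<Psi> =
     (LINT t:einterval 0 T|lebesgue. LINT x|lebesgue. v t x * (D\<^sub>t (D\<^sub>t \<Psi>) (x, t) - Lap \<Psi> (x, t)))"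
    unfolding I2_def using \<sigma>(3,4)
    by (intro weak_identity_position[OF sol(2,4) \<Psi>] sol(10) Cc_infinity_test_function[OF \<Psi>]) auto
  moreover have "(LINT x|lebesgue. g2 x * \<Psi> (x, 0)) = h \<sigma> * (LINT x|lebesgue. g2 x * phi \<sigma> \<beta> (x, 0))"
  proof -
    have "(LINT x|lebesgue. g2 x * \<Psi> (x, 0)) = (LINT x|lebesgue. g2 x * (\<lambda>z. h \<sigma> * phi \<sigma> \<beta> z + 0 * phi \<sigma> \<beta> z) (x, 0))"
      by (rule data_integral_cong[OF data_zero(4)]) (use U e in \<open>auto simp: wave_weight_def\<close>)
    then show ?thesis using data_integral_combination[OF data_Cc(4) data_zero(4) r0, of "h \<sigma>" \<beta> 0 \<beta>] by simp
  qed
  moreover have "(LINT x|lebesgue. v 0 x * D\<^sub>t \<Psi> (x, 0)) =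
    \<epsilon> * (h' \<sigma> * (LINT x|lebesgue. f2 x * phi \<sigma> \<beta> (x, 0)) - \<beta> * h \<sigma> * (LINT x|lebesgue. f2 x * phi \<sigma> (\<beta> + 1) (x, 0)))"
  proof -
    have "(LINT x|lebesgue. v 0 x * D\<^sub>t \<Psi> (x, 0)) = (LINT x|lebesgue. \<epsilon> * (f2 x * D\<^sub>t \<Psi> (x, 0)))"
      by (rule lebesgue_integral_cong_AE(1), use sol(8) in eventually_elim) (simp add: mult.assoc)
    also have "\<dots> = \<epsilon> * (LINT x|lebesgue. f2 x * D\<^sub>t \<Psi> (x, 0))" by simp
    also have "(LINT x|lebesgue. f2 x * D\<^sub>t \<Psi> (x, 0)) =
       (LINT x|lebesgue. f2 x * (\<lambda>z. h' \<sigma> * phi \<sigma> \<beta> z + (- \<beta> * h \<sigma>) * phi \<sigma> (\<beta> + 1) z) (x, 0))"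
      by (rule data_integral_cong[OF data_zero(3)]) (use U e in \<open>auto simp: wave_weight_def\<close>)
    finally show ?thesis
      using data_integral_combination[OF data_Cc(3) data_zero(3) r0, of "h' \<sigma>" \<beta> "- \<beta> * h \<sigma>" "\<beta> + 1"] by simp
  qed
  moreover have "I2 \<Psi> = I2 (wave_weight h \<sigma> \<beta>)" by (rule I_cong) (use U e in auto)
  moreover have "(LINT t:einterval 0 T|lebesgue. LINT x|lebesgue. v t x * (\<lambda>z. D\<^sub>t (D\<^sub>t \<Psi>) z - Lap \<Psi> z) (x, t)) =
     (LINT t:einterval 0 T|lebesgue. LINT x|lebesgue. v t x *
      (\<lambda>z. wave_weight h'' \<sigma> \<beta> z - 2 * \<beta> * wave_weight h' \<sigma> (\<beta> + 1) z) (x, t))"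
    by (rule cone_integral_cong(1)[OF cone_zero_each(2)]) (use U e in auto)
  ultimately show ?thesis by (simp add: algebra_simps)
qed

text \<open>The test function is the time derivative of h phi_\<beta>, with sign reversed so that
  the weight of the nonlinearity is \<beta> h phi_(\<beta> + 1) - h' phi_\<beta>, nonnegative for a
  decreasing cutoff and \<beta> > 0. The condition h'(\<sigma>) = 0 leaves only terms with
  h(\<sigma>) at t = 0.\<close>

lemma wave_test_u:
  assumes h: "time_weight R h h' h''" and \<sigma>: "\<sigma> \<ge> r0 + 2" "\<sigma> > 1" "R > \<sigma>" "ereal (R - \<sigma>) < T"
    and h0: "h' \<sigma> = 0"
  shows "\<epsilon> * \<beta> * h \<sigma> * ((LINT x|lebesgue. g1 x * phi \<sigma> (\<beta> + 1) (x, 0)) + (\<beta> + 1) * (LINT x|lebesgue. f1 x * phi \<sigma> (\<beta> + 2) (x, 0)))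
     + I1 (\<lambda>z. \<beta> * wave_weight h \<sigma> (\<beta> + 1) z - wave_weight h' \<sigma> \<beta> z) =
    (LINT t:einterval 0 T|lebesgue. LINT x|lebesgue. time_deriv T u t x *
      (wave_weight h'' \<sigma> \<beta> (x, t) - 2 * \<beta> * wave_weight h' \<sigma> (\<beta> + 1) (x, t)))"
proof -
  obtain X :: "'a \<times> real \<Rightarrow> real" and U where X:
    "X \<in> Cc_infinity" "\<And>x t. t \<ge> R - \<sigma> \<Longrightarrow> X (x, t) = 0"
    and U: "\<And>x t. 0 \<le> t \<Longrightarrow> norm x \<le> r0 + t \<Longrightarrow> (x, t) \<in> U" "U \<subseteq> light_cone \<sigma>"
    and e: "\<And>z. z \<in> U \<Longrightarrow> X z = wave_weight h \<sigma> \<beta> z"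
    "\<And>z. z \<in> U \<Longrightarrow> D\<^sub>t X z = wave_weight h' \<sigma> \<beta> z - \<beta> * wave_weight h \<sigma> (\<beta> + 1) z"
    "\<And>z. z \<in> U \<Longrightarrow> D\<^sub>t (D\<^sub>t X) z = wave_weight h'' \<sigma> \<beta> z - 2 * \<beta> * wave_weight h' \<sigma> (\<beta> + 1) z
      + \<beta> * (\<beta> + 1) * wave_weight h \<sigma> (\<beta> + 2) z"
    "\<And>z. z \<in> U \<Longrightarrow> Lap X z = \<beta> * (\<beta> + 1) * wave_weight h \<sigma> (\<beta> + 2) z"
    "\<And>z. z \<in> U \<Longrightarrow> Lap (D\<^sub>t X) z = D\<^sub>t (Lap X) z"
    by (rule wave_weight_extension[OF h \<sigma>(1-3), of \<beta>], rule that)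
  have r0: "\<sigma> > r0" using \<sigma>(1) by simp
  have v: "t \<ge> R - \<sigma> \<Longrightarrow> D\<^sub>t X (x, t) = 0" for x t by (rule D\<^sub>t_vanish[OF X])
  have "\<epsilon> * (LINT x|lebesgue. g1 x * D\<^sub>t X (x, 0)) - (LINT x|lebesgue. u 0 x * Lap X (x, 0)) + I1 (D\<^sub>t X) =
     (LINT t:einterval 0 T|lebesgue. LINT x|lebesgue. time_deriv T u t x * (Lap X (x, t) - D\<^sub>t (D\<^sub>t X) (x, t)))"
    unfolding I1_def using \<sigma>(3,4) U e
    by (intro weak_identity_velocity[OF sol(1,3) X _ _ _ cone_zero_each(1)] sol(9)
        Cc_infinity_test_function[OF Cc_infinity_D\<^sub>t[OF X(1)] v]) auto
  moreover have "(LINT x|lebesgue. g1 x * D\<^sub>t X (x, 0)) = - \<beta> * h \<sigma> * (LINT x|lebesgue. g1 x * phi \<sigma> (\<beta> + 1) (x, 0))"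
  proof -
    have "(LINT x|lebesgue. g1 x * D\<^sub>t X (x, 0)) = (LINT x|lebesgue. g1 x * (\<lambda>z. (- \<beta> * h \<sigma>) * phi \<sigma> (\<beta> + 1) z + 0 * phi \<sigma> \<beta> z) (x, 0))"
      by (rule data_integral_cong[OF data_zero(2)]) (use U e h0 in \<open>auto simp: wave_weight_def\<close>)
    then show ?thesis using data_integral_combination[OF data_Cc(2) data_zero(2) r0, of "- \<beta> * h \<sigma>" "\<beta> + 1" 0 \<beta>] by simp
  qed
  moreover have "(LINT x|lebesgue. u 0 x * Lap X (x, 0)) =
    \<epsilon> * (\<beta> * (\<beta> + 1) * h \<sigma> * (LINT x|lebesgue. f1 x * phi \<sigma> (\<beta> + 2) (x, 0)))"
  proof -
    have "(LINT x|lebesgue. u 0 x * Lap X (x, 0)) = (LINT x|lebesgue. \<epsilon> * (f1 x * Lap X (x, 0)))"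
      by (rule lebesgue_integral_cong_AE(1), use sol(7) in eventually_elim) (simp add: mult.assoc)
    also have "\<dots> = \<epsilon> * (LINT x|lebesgue. f1 x * Lap X (x, 0))" by simp
    also have "(LINT x|lebesgue. f1 x * Lap X (x, 0)) =
       (LINT x|lebesgue. f1 x * (\<lambda>z. (\<beta> * (\<beta> + 1) * h \<sigma>) * phi \<sigma> (\<beta> + 2) z + 0 * phi \<sigma> \<beta> z) (x, 0))"
      by (rule data_integral_cong[OF data_zero(1)]) (use U e in \<open>auto simp: wave_weight_def\<close>)
    finally show ?thesis
      using data_integral_combination[OF data_Cc(1) data_zero(1) r0, of "\<beta> * (\<beta> + 1) * h \<sigma>" "\<beta> + 2" 0 \<beta>] by simp
  qed
  moreover have "I1 (D\<^sub>t X) = - I1 (\<lambda>z. \<beta> * wave_weight h \<sigma> (\<beta> + 1) z - wave_weight h' \<sigma> \<beta> z)"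
  proof -
    have "I1 (D\<^sub>t X) = I1 (\<lambda>z. (-1) * (\<beta> * wave_weight h \<sigma> (\<beta> + 1) z - wave_weight h' \<sigma> \<beta> z))"
      by (rule I_cong) (use U e in auto)
    then show ?thesis unfolding I_scale by simp
  qed
  moreover have "(LINT t:einterval 0 T|lebesgue. LINT x|lebesgue. time_deriv T u t x * (\<lambda>z. Lap X z - D\<^sub>t (D\<^sub>t X) z) (x, t)) =
     (LINT t:einterval 0 T|lebesgue. LINT x|lebesgue. time_deriv T u t x *
      (\<lambda>z. - (wave_weight h'' \<sigma> \<beta> z - 2 * \<beta> * wave_weight h' \<sigma> (\<beta> + 1) z)) (x, t))"
    by (rule cone_integral_cong(1)[OF cone_zero_each(3)]) (use U e in auto)
  moreover have "\<dots> = - (LINT t:einterval 0 T|lebesgue. LINT x|lebesgue. time_deriv T u t x *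
      (wave_weight h'' \<sigma> \<beta> (x, t) - 2 * \<beta> * wave_weight h' \<sigma> (\<beta> + 1) (x, t)))"
    by (rule set_integral_mult_uminus[where
          A="\<lambda>z. wave_weight h'' \<sigma> \<beta> z - 2 * \<beta> * wave_weight h' \<sigma> (\<beta> + 1) z"])
  ultimately show ?thesis by (simp add: algebra_simps)
qed

end

section \<open>Hoelder estimates in the cone\<close>

lemma power_diff_le:
  fixes a :: real
  assumes "a \<ge> 1" "N \<ge> 1"
  shows "a ^ N - (a - 1) ^ N \<le> real N * a ^ (N - 1)"
proof -
  have "1 + real N * (- 1 / a) \<le> (1 + (- 1 / a)) ^ N"
    using assms by (intro Bernoulli_inequality) auto
  then have "a ^ N * (1 + real N * (- 1 / a)) \<le> a ^ N * (1 + (- 1 / a)) ^ N"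
    using assms by (intro mult_left_mono) auto
  also have "\<dots> = (a - 1) ^ N"
    using assms by (simp add: power_mult_distrib[symmetric] algebra_simps)
  also have "a ^ N * (1 + real N * (- 1 / a)) = a ^ N - real N * a ^ (N - 1)"
    using assms by (cases N) (auto simp: field_simps)
  finally show ?thesis by simp
qed

text \<open>For \<rho> < 1 the inner ball is empty and the shell is a ball; otherwise the difference
  of two powers is estimated by Bernoulli's inequality.\<close>

lemma shell_measure_le:
  fixes \<tau> \<rho> :: real
  assumes "\<rho> \<le> \<tau>" "\<tau> \<ge> 1"
  shows "measure lebesgue (cball (0::'a::euclidean_space) \<rho> - cball 0 (\<rho> - 1)) \<le>
    unit_ball_vol DIM('a) * real DIM('a) * \<tau> powr (real DIM('a) - 1)"
proof -
  let ?N = "DIM('a)" and ?\<omega> = "unit_ball_vol DIM('a)"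
  have N: "?N \<ge> 1" by (rule DIM_ge_1)
  have \<omega>: "?\<omega> \<ge> 0" by simp
  have content: "measure lebesgue (cball (0::'a) r) = ?\<omega> * r ^ ?N" if "r \<ge> 0" for r
    using content_cball[OF that, of "0::'a"] by (simp add: measure_completion)
  have pw: "x ^ (?N - 1) \<le> \<tau> powr (real ?N - 1)" if "0 \<le> x" "x \<le> \<tau>" for x
  proof -
    have "x ^ (?N - 1) \<le> \<tau> ^ (?N - 1)" using that by (intro power_mono) auto
    also have "\<dots> = \<tau> powr (real ?N - 1)" using assms(2) N by (simp add: powr_realpow[symmetric] of_nat_diff)
    finally show ?thesis .
  qed
  consider "\<rho> < 0" | "0 \<le> \<rho>" "\<rho> < 1" | "1 \<le> \<rho>" by linarith
  then show ?thesis
  proof cases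
    case 1 then show ?thesis using \<omega> by simp
  next
    case 2
    then have "measure lebesgue (cball (0::'a) \<rho> - cball 0 (\<rho> - 1)) = ?\<omega> * \<rho> ^ ?N"
      using content[of \<rho>] by simp
    also have "\<dots> \<le> ?\<omega> * (1 * \<rho> ^ (?N - 1))"
      using 2 \<omega> N by (intro mult_left_mono) (cases ?N, auto intro: mult_left_le_one_le)
    also have "\<dots> \<le> ?\<omega> * (real ?N * \<tau> powr (real ?N - 1))"
      using 2 assms \<omega> N pw[of \<rho>] by (intro mult_left_mono mult_mono) auto
    finally show ?thesis by (simp add: mult_ac)
  next
    case 3
    have "measure lebesgue (cball (0::'a) \<rho> - cball 0 (\<rho> - 1)) = measure lebesgue (cball (0::'a) \<rho>) - measure lebesgue (cball (0::'a) (\<rho> - 1))"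
      by (rule measurable_measure_Diff) (use lmeasurable_cball in \<open>auto simp: fmeasurableD\<close>)
    also have "\<dots> = ?\<omega> * (\<rho> ^ ?N - (\<rho> - 1) ^ ?N)" using 3 content by (simp add: algebra_simps)
    also have "\<dots> \<le> ?\<omega> * (real ?N * \<rho> ^ (?N - 1))"
      using \<omega> N 3 by (intro mult_left_mono power_diff_le) auto
    also have "\<dots> \<le> ?\<omega> * (real ?N * \<tau> powr (real ?N - 1))"
      using 3 assms \<omega> pw[of \<rho>] by (intro mult_left_mono) auto
    finally show ?thesis by (simp add: mult_ac)
  qed
qed

text \<open>The ball is cut into the shells \<open>k \<le> \<tau> - \<bar>x\<bar> < k + 1\<close>.\<close>

lemma cone_section_integral_le:
  fixes \<nu> :: real
  assumes "\<nu> \<ge> 0" "\<tau> \<ge> 1"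
  defines "k \<equiv> \<lambda>x::'a::euclidean_space. indicator (cball 0 (\<tau> - 1)) x * (\<tau> - norm x) powr - \<nu>"
  shows "integrable lebesgue k"
    and "integral\<^sup>L lebesgue k \<le> unit_ball_vol DIM('a) * real DIM('a) * \<tau> powr (real DIM('a) - 1) *
      (\<Sum>j=1..nat \<lceil>\<tau>\<rceil>. real j powr - \<nu>)"
proof -
  define S where "S j = cball (0::'a) (\<tau> - real j) - cball 0 (\<tau> - real j - 1)" for j :: nat
  have S: "S j \<in> sets lebesgue" for j unfolding S_def by (intro sets.Diff) (auto simp: fmeasurableD)
  have iS: "integrable lebesgue (indicator (S j) :: 'a \<Rightarrow> real)" for j
  proof -
    have "S j \<in> lmeasurable" unfolding S_def by (intro fmeasurable.Diff lmeasurable_cball)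
    then have "S j \<in> sets lebesgue" "emeasure lebesgue (S j) < \<infinity>" unfolding fmeasurable_def by blast+
    then show ?thesis by (rule integrable_real_indicator)
  qed
  define K where "K x = (\<Sum>j=1..nat \<lceil>\<tau>\<rceil>. real j powr - \<nu> * indicator (S j) x)" for x
  have iK: "integrable lebesgue K" unfolding K_def by (intro Bochner_Integration.integrable_sum integrable_mult_right iS)
  have k0: "0 \<le> k x" for x by (simp add: k_def)
  have le: "k x \<le> K x" for x
  proof (cases "norm x \<le> \<tau> - 1")
    case True
    \<comment> \<open>The index of the shell containing x; it is at least 1 because |x| \<le> \<tau>
      - 1.\<close>
    define j where "j = nat \<lfloor>\<tau> - norm x\<rfloor>"
    have fl: "\<lfloor>\<tau> - norm x\<rfloor> \<ge> 1" using True by linarith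
    then have rj: "real j = of_int \<lfloor>\<tau> - norm x\<rfloor>" by (simp add: j_def)
    have "j \<ge> 1" using fl unfolding j_def by linarith
    then have j: "real j \<le> \<tau> - norm x" "\<tau> - norm x < real j + 1" "j \<ge> 1"
      unfolding rj by linarith+
    have "real j \<le> \<tau>" using j(1) norm_ge_zero[of x] by linarith
    then have jm: "j \<in> {1..nat \<lceil>\<tau>\<rceil>}" using j(3) by (simp add: le_nat_iff) linarith
    have "x \<in> S j" using j by (auto simp: S_def)
    have "k x = (\<tau> - norm x) powr - \<nu>" using True by (simp add: k_def)
    also have "\<dots> \<le> real j powr - \<nu>" using j assms(1) by (intro powr_mono2') auto
    also have "\<dots> = real j powr - \<nu> * indicator (S j) x" using \<open>x \<in> S j\<close> by simp
    also have "\<dots> \<le> K x" unfolding K_def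
      by (rule member_le_sum[OF jm, of "\<lambda>j. real j powr - \<nu> * indicator (S j) x"]) auto
    finally show ?thesis .
  next
    case False
    then have "k x = 0" by (simp add: k_def)
    also have "0 \<le> K x" unfolding K_def by (intro sum_nonneg) auto
    finally show ?thesis .
  qed
  have meas: "k \<in> borel_measurable lebesgue"
  proof -
    have "(\<lambda>x::'a. (\<tau> - norm x) powr - \<nu>) \<in> borel_measurable borel"
      by (intro powr_real_measurable borel_measurable_diff borel_measurable_norm) auto
    then have "k \<in> borel_measurable borel" unfolding k_def
      by (intro borel_measurable_times borel_measurable_indicator) auto
    then show ?thesis by (intro measurable_completion) simp
  qed
  show "integrable lebesgue k"
    by (rule Bochner_Integration.integrable_bound[OF iK meas])
      (use le k0 in \<open>auto intro!: AE_I2 order.trans[OF le] simp: abs_of_nonneg\<close>)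
  have "integral\<^sup>L lebesgue k \<le> integral\<^sup>L lebesgue K"
    using iK le k0 by (intro integral_mono') (auto intro: order.trans[OF k0 le])
  also have "\<dots> = (\<Sum>j=1..nat \<lceil>\<tau>\<rceil>. real j powr - \<nu> * measure lebesgue (S j))"
    unfolding K_def using iS S
    by (subst Bochner_Integration.integral_sum) auto
  also have "\<dots> \<le> (\<Sum>j=1..nat \<lceil>\<tau>\<rceil>. real j powr - \<nu> * (unit_ball_vol DIM('a) * real DIM('a) * \<tau> powr (real DIM('a) - 1)))"
    unfolding S_def using assms(2) by (intro sum_mono mult_left_mono shell_measure_le) auto
  finally show "integral\<^sup>L lebesgue k \<le> unit_ball_vol DIM('a) * real DIM('a) * \<tau> powr (real DIM('a) - 1) *
      (\<Sum>j=1..nat \<lceil>\<tau>\<rceil>. real j powr - \<nu>)"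
    by (simp add: sum_distrib_left mult_ac)
qed

text \<open>The three regimes for the sums over shells: full volume, the logarithmic borderline, and
  a convergent series compared with the telescoping sum of 1 / (k (k + 1)).\<close>

lemma sum_powr_le:
  shows "(\<Sum>j=1..m. real j powr - 0) \<le> real m"
    and "m \<ge> 1 \<Longrightarrow> (\<Sum>j=1..m. real j powr - 1) \<le> 1 + ln (real m)"
    and "\<nu> \<ge> 2 \<Longrightarrow> (\<Sum>j=1..m. real j powr - \<nu>) \<le> 2"
proof -
  show "(\<Sum>j=1..m. real j powr - 0) \<le> real m"
    using sum_mono[of "{1..m}" "\<lambda>j. real j powr - 0" "\<lambda>_. 1"] by simp
  show "(\<Sum>j=1..m. real j powr - 1) \<le> 1 + ln (real m)" if "m \<ge> 1"
    using that
  proof (induction m rule: dec_induct)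
    case base then show ?case by simp
  next
    case (step k)
    have "ln (real k / real (Suc k)) \<le> real k / real (Suc k) - 1"
      using step by (intro ln_le_minus_one) auto
    also have "\<dots> = - (1 / real (Suc k))" by (simp add: field_simps)
    finally have "1 / real (Suc k) \<le> ln (real (Suc k)) - ln (real k)" using step by (simp add: ln_div)
    then show ?case using step by (simp add: powr_minus_divide)
  qed
  show "(\<Sum>j=1..m. real j powr - \<nu>) \<le> 2" if \<nu>: "\<nu> \<ge> 2"
  proof -
    have "(\<Sum>j=1..m. real j powr - \<nu>) \<le> 2 - 1 / real m" if "m \<ge> 1"
      using that
    proof (induction m rule: dec_induct)
      case (step k)
      have "real (Suc k) powr - \<nu> \<le> real (Suc k) powr - 2" using \<nu> by (intro powr_mono) auto
      also have "\<dots> = 1 / (real (Suc k))\<^sup>2" by (simp add: powr_minus_divide powr_numeral)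
      also have "\<dots> \<le> 1 / (real k * real (Suc k))"
        using step by (intro divide_left_mono) (auto simp: power2_eq_square)
      also have "\<dots> = 1 / real k - 1 / real (Suc k)" using step by (simp add: field_simps)
      finally show ?case using step.IH by simp
    qed simp
    then show ?thesis by (cases "m = 0") (auto intro: order.trans)
  qed
qed

text \<open>All Hoelder estimates are normalized so that the time integrand is a constant times
  1/\<tau>; the logarithmic length of the interval where the test function varies is then the only
  quantity left.\<close>

lemma time_integral_inverse:
  assumes "0 < J1" "J1 \<le> J2" "0 \<le> c"
  shows "set_integrable lebesgue (einterval 0 T) (\<lambda>t. indicator {J1..J2} (\<sigma> + t) * (c / (\<sigma> + t)))"
    and "(LINT t:einterval 0 T|lebesgue. indicator {J1..J2} (\<sigma> + t) * (c / (\<sigma> + t))) \<le> c * ln (J2 / J1)"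
proof -
  have ind: "indicator {J1..J2} (\<sigma> + t) = (indicator {J1 - \<sigma>..J2 - \<sigma>} t :: real)" for t
    by (auto simp: indicator_def)
  have fi: "((\<lambda>t. c / (\<sigma> + t)) has_integral (c * ln (\<sigma> + (J2 - \<sigma>)) - c * ln (\<sigma> + (J1 - \<sigma>)))) {J1 - \<sigma>..J2 - \<sigma>}"
    using assms by (intro fundamental_theorem_of_calculus)
      (auto intro!: derivative_eq_intros simp: has_real_derivative_iff_has_vector_derivative[symmetric])
  have si: "set_integrable lebesgue {J1 - \<sigma>..J2 - \<sigma>} (\<lambda>t. c / (\<sigma> + t))"
    using assms by (intro absolutely_integrable_continuous_real continuous_intros) auto
  then have i: "integrable lebesgue (\<lambda>t. indicator {J1..J2} (\<sigma> + t) * (c / (\<sigma> + t)))"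
    unfolding ind by (simp add: set_integrable_def)
  then show si': "set_integrable lebesgue (einterval 0 T) (\<lambda>t. indicator {J1..J2} (\<sigma> + t) * (c / (\<sigma> + t)))"
    unfolding set_integrable_def by (rule integrable_mult_indicator[OF sets_einterval])
  have nn: "0 \<le> indicator {J1..J2} (\<sigma> + t) * (c / (\<sigma> + t))" for t
    using assms by (auto simp: indicator_def)
  have "(LINT t:einterval 0 T|lebesgue. indicator {J1..J2} (\<sigma> + t) * (c / (\<sigma> + t))) \<le>
     (LINT t|lebesgue. indicator {J1..J2} (\<sigma> + t) * (c / (\<sigma> + t)))"
    unfolding set_lebesgue_integral_def
    by (rule integral_mono'[OF i]) (use nn in \<open>auto simp: indicator_def[of "einterval 0 T"]\<close>)
  also have "\<dots> = (LINT t:{J1 - \<sigma>..J2 - \<sigma>}|lebesgue. c / (\<sigma> + t))"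
    unfolding ind by (simp add: set_lebesgue_integral_def)
  also have "\<dots> = c * ln J2 - c * ln J1"
    using set_lebesgue_integral_eq_integral(2)[OF si] integral_unique[OF fi] by simp
  also have "\<dots> = c * ln (J2 / J1)" using assms by (simp add: ln_div right_diff_distrib)
  finally show "(LINT t:einterval 0 T|lebesgue. indicator {J1..J2} (\<sigma> + t) * (c / (\<sigma> + t))) \<le> c * ln (J2 / J1)" .
qed

section \<open>Hoelder's inequality with weights\<close>

lemma young_scaled:
  fixes p \<mu> x y :: real
  assumes "p > 1" "\<mu> > 0" "x \<ge> 0" "y \<ge> 0"
  shows "x * y powr (1 - 1 / p) \<le> \<mu> * x powr p + \<mu> powr (- 1 / (p - 1)) * y"
proof -
  define q where "q = p / (p - 1)"
  have q: "q > 1" "1 / p + 1 / q = 1" "(1 - 1 / p) * q = 1" "(- 1 / p) * q = - 1 / (p - 1)"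
    using assms(1) by (auto simp: q_def field_simps)
  have "x * y powr (1 - 1 / p) = (\<mu> powr (1 / p) * x) * (\<mu> powr (- 1 / p) * y powr (1 - 1 / p))"
    using assms(2) by (simp add: powr_minus field_simps)
  also have "\<dots> \<le> (\<mu> powr (1 / p) * x) powr p / p + (\<mu> powr (- 1 / p) * y powr (1 - 1 / p)) powr q / q"
    using assms q by (intro Youngs_inequality) auto
  also have "\<dots> \<le> (\<mu> powr (1 / p) * x) powr p / 1 + (\<mu> powr (- 1 / p) * y powr (1 - 1 / p)) powr q / 1"
    using assms q by (intro add_mono divide_left_mono) auto
  also have "\<dots> = \<mu> * x powr p + \<mu> powr (- 1 / (p - 1)) * y"
    using assms q by (simp add: powr_mult powr_powr)
  finally show ?thesis .
qed

text \<open>The value \<mu> = (D / Z)^(1 - 1/p) makes both terms equal, whence the factor 2. For Z =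
  0 a large \<mu> makes the bound smaller than any positive S.\<close>

lemma young_optimized:
  fixes p S Z D :: real
  assumes p: "p > 1" and Z: "Z \<ge> 0" and D: "D > 0"
    and le: "\<And>\<mu>. \<mu> > 0 \<Longrightarrow> S \<le> \<mu> * Z + \<mu> powr (- 1 / (p - 1)) * D"
  shows "S \<le> 2 * Z powr (1 / p) * D powr (1 - 1 / p)"
proof (cases "Z = 0")
  case True
  have "S \<le> 0"
  proof (rule ccontr)
    assume "\<not> S \<le> 0"
    then have S: "S > 0" by simp
    define \<mu> where "\<mu> = (S / (2 * D)) powr (- (p - 1))"
    have "\<mu> > 0" using S D by (simp add: \<mu>_def)
    have "- (p - 1) * (- 1 / (p - 1)) = 1" using p by (simp add: field_simps)
    then have "\<mu> powr (- 1 / (p - 1)) = S / (2 * D)" unfolding \<mu>_def powr_powr using S D by simp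
    with le[OF \<open>\<mu> > 0\<close>] True D S show False by simp
  qed
  then show ?thesis using True by simp
next
  case False
  with Z have Z: "Z > 0" by simp
  define \<mu> where "\<mu> = (D / Z) powr (1 - 1 / p)"
  have \<mu>: "\<mu> > 0" using D Z by (simp add: \<mu>_def)
  have "\<mu> * Z = D powr (1 - 1 / p) * (Z powr 1 / Z powr (1 - 1 / p))"
    using D Z by (simp add: \<mu>_def powr_divide)
  also have "Z powr 1 / Z powr (1 - 1 / p) = Z powr (1 / p)" by (subst powr_diff[symmetric]) simp
  finally have 1: "\<mu> * Z = Z powr (1 / p) * D powr (1 - 1 / p)" by simp
  have e: "(1 - 1 / p) * (- 1 / (p - 1)) = - (1 / p)" using p by (simp add: field_simps)
  have "\<mu> powr (- 1 / (p - 1)) * D = (D powr - (1 / p) * D powr 1) * Z powr (1 / p)"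
    unfolding \<mu>_def powr_powr e using D Z by (simp add: powr_divide powr_minus field_simps)
  also have "D powr - (1 / p) * D powr 1 = D powr (1 - 1 / p)" by (subst powr_add[symmetric]) simp
  finally have 2: "\<mu> powr (- 1 / (p - 1)) * D = Z powr (1 / p) * D powr (1 - 1 / p)" by simp
  show ?thesis using le[OF \<mu>] unfolding 1 2 by simp
qed

text \<open>Young's inequality with a free parameter \<mu> is applied pointwise, integrated, and
  optimized only at the end. In this way just the upper bound has to be integrable. The splitting of
  \<open>A\<close> puts W^(1/p) next to |w|, so that its p-th power is controlled by F W /
  b.\<close>

lemma holder_cone:
  fixes w F :: "real \<Rightarrow> 'a::euclidean_space \<Rightarrow> real"
  assumes p: "p > 1" and b: "b > 0" and F: "\<And>t x. F t x \<ge> b * \<bar>w t x\<bar> powr p"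
    and W: "AE t in lebesgue. t \<in> einterval 0 T \<longrightarrow> integrable lebesgue (\<lambda>x. F t x * W (x, t))"
      "set_integrable lebesgue (einterval 0 T) (\<lambda>t. LINT x|lebesgue. F t x * W (x, t))"
    and zero: "AE t in lebesgue. t \<in> einterval 0 T \<longrightarrow> (AE x in lebesgue. norm x > r0 + t \<longrightarrow> w t x = 0)"
      "AE t in lebesgue. t \<in> einterval 0 T \<longrightarrow> (AE x in lebesgue. norm x > r0 + t \<longrightarrow> F t x = 0)"
    and cone: "\<And>x t. 0 < t \<Longrightarrow> norm x \<le> r0 + t \<Longrightarrow> 0 \<le> W (x, t) \<and> 0 \<le> k (x, t) \<and>
      \<bar>A (x, t)\<bar> \<le> k (x, t) powr (1 - 1 / p) * W (x, t) powr (1 / p)"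
    and k: "\<And>t. 0 < t \<Longrightarrow> integrable lebesgue (\<lambda>x. indicator (cball 0 (r0 + t)) x * k (x, t))"
      "\<And>t. 0 < t \<Longrightarrow> (LINT x|lebesgue. indicator (cball 0 (r0 + t)) x * k (x, t)) \<le> d t"
    and d: "set_integrable lebesgue (einterval 0 T) d" "(LINT t:einterval 0 T|lebesgue. d t) \<le> D" and D: "D > 0"
  shows "(LINT t:einterval 0 T|lebesgue. LINT x|lebesgue. w t x * A (x, t)) \<le>
     2 * b powr (- 1 / p) * (LINT t:einterval 0 T|lebesgue. LINT x|lebesgue. F t x * W (x, t)) powr (1 / p) * D powr (1 - 1 / p)"
proof -
  define Y where "Y = (LINT t:einterval 0 T|lebesgue. LINT x|lebesgue. F t x * W (x, t))"
  define S where "S = (LINT t:einterval 0 T|lebesgue. LINT x|lebesgue. w t x * A (x, t))"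
  have F0: "F t x \<ge> 0" for t x by (rule order.trans[OF _ F]) (use b in auto)
  have FW: "AE t in lebesgue. t \<in> einterval 0 T \<longrightarrow> (AE x in lebesgue. 0 \<le> F t x * W (x, t))"
    using zero(2)
  proof eventually_elim
    case (elim t)
    show ?case
    proof
      assume t: "t \<in> einterval 0 T"
      show "AE x in lebesgue. 0 \<le> F t x * W (x, t)"
        using elim[rule_format, OF t]
      proof eventually_elim
        case (elim x)
        then show ?case using cone[of t x] t F0[of t x]
          by (cases "norm x > r0 + t") (auto simp: einterval_0_iff)
      qed
    qed
  qed
  have Y: "Y \<ge> 0" unfolding Y_def set_lebesgue_integral_def
    by (rule integral_nonneg_AE, use FW in eventually_elim) (auto simp: indicator_def intro: integral_nonneg_AE)
  have d0: "d t \<ge> 0" if "t > 0" for t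
    by (rule order.trans[OF _ k(2)[OF that]], rule Bochner_Integration.integral_nonneg)
      (use cone[OF that] in \<open>auto simp: indicator_def\<close>)
  have main: "S \<le> \<mu> * (Y / b) + \<mu> powr (- 1 / (p - 1)) * D" if \<mu>: "\<mu> > 0" for \<mu>
  proof -
    define m where "m = \<mu> powr (- 1 / (p - 1))"
    have m: "m \<ge> 0" by (simp add: m_def)
    have inner: "AE t in lebesgue. t \<in> einterval 0 T \<longrightarrow>
      (LINT x|lebesgue. w t x * A (x, t)) \<le> \<mu> / b * (LINT x|lebesgue. F t x * W (x, t)) + m * d t"
      using W(1) zero FW
    proof eventually_elim
      case (elim t)
      show ?case
      proof
        assume t: "t \<in> einterval 0 T"
        then have t0: "t > 0" by (simp add: einterval_0_iff)
        have i: "integrable lebesgue (\<lambda>x. \<mu> / b * (F t x * W (x, t)) + m * (indicator (cball 0 (r0 + t)) x * k (x, t)))"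
          using elim t by (intro Bochner_Integration.integrable_add integrable_mult_right k(1)[OF t0]) auto
        have z: "AE x in lebesgue. norm x > r0 + t \<longrightarrow> w t x = 0" "AE x in lebesgue. norm x > r0 + t \<longrightarrow> F t x = 0"
          and fw: "AE x in lebesgue. 0 \<le> F t x * W (x, t)" using elim t by auto
        have "(LINT x|lebesgue. w t x * A (x, t)) \<le>
          (LINT x|lebesgue. \<mu> / b * (F t x * W (x, t)) + m * (indicator (cball 0 (r0 + t)) x * k (x, t)))"
        proof (rule integral_mono_AE'[OF i])
          show "AE x in lebesgue. w t x * A (x, t) \<le> \<mu> / b * (F t x * W (x, t)) + m * (indicator (cball 0 (r0 + t)) x * k (x, t))"
            using z
          proof eventually_elim
            case (elim x)
            show ?case
            proof (cases "norm x > r0 + t")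
              case False
              note c = cone[OF t0, of x]
              have c': "0 \<le> W (x, t)" "0 \<le> k (x, t)" "\<bar>A (x, t)\<bar> \<le> k (x, t) powr (1 - 1 / p) * W (x, t) powr (1 / p)"
                using c False by auto
              have "w t x * A (x, t) \<le> \<bar>w t x\<bar> * \<bar>A (x, t)\<bar>" by (simp add: abs_mult[symmetric])
              also have "\<dots> \<le> \<bar>w t x\<bar> * (k (x, t) powr (1 - 1 / p) * W (x, t) powr (1 / p))"
                using c' by (intro mult_left_mono) auto
              also have "\<dots> = (\<bar>w t x\<bar> * W (x, t) powr (1 / p)) * k (x, t) powr (1 - 1 / p)" by simp
              also have "\<dots> \<le> \<mu> * (\<bar>w t x\<bar> * W (x, t) powr (1 / p)) powr p + m * k (x, t)"
                unfolding m_def using c' by (intro young_scaled p \<mu>) auto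
              also have "(\<bar>w t x\<bar> * W (x, t) powr (1 / p)) powr p = \<bar>w t x\<bar> powr p * W (x, t)"
                using c' p by (simp add: powr_mult powr_powr)
              also have "\<mu> * (\<bar>w t x\<bar> powr p * W (x, t)) = \<mu> / b * ((b * \<bar>w t x\<bar> powr p) * W (x, t))" using b by simp
              also have "\<dots> \<le> \<mu> / b * (F t x * W (x, t))"
                using \<mu> b c' F[of t x] by (intro mult_left_mono mult_right_mono) auto
              finally show ?thesis using False by simp
            qed (use elim in auto)
          qed
          show "AE x in lebesgue. 0 \<le> \<mu> / b * (F t x * W (x, t)) + m * (indicator (cball 0 (r0 + t)) x * k (x, t))"
            using fw
          proof eventually_elim
            case (elim x)
            have "0 \<le> indicator (cball 0 (r0 + t)) x * k (x, t)"
              using cone[OF t0, of x] by (auto simp: indicator_def)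
            then have "0 \<le> m * (indicator (cball 0 (r0 + t)) x * k (x, t))" by (rule mult_nonneg_nonneg[OF m])
            moreover have "0 \<le> \<mu> / b * (F t x * W (x, t))" using elim \<mu> b by (intro mult_nonneg_nonneg[OF _ elim]) auto
            ultimately show ?case by (rule add_nonneg_nonneg[rotated])
          qed
        qed
        also have "\<dots> = \<mu> / b * (LINT x|lebesgue. F t x * W (x, t)) + m * (LINT x|lebesgue. indicator (cball 0 (r0 + t)) x * k (x, t))"
          using elim t by (subst Bochner_Integration.integral_add) (auto intro!: integrable_mult_right k(1)[OF t0])
        also have "\<dots> \<le> \<mu> / b * (LINT x|lebesgue. F t x * W (x, t)) + m * d t"
          using k(2)[OF t0] m by (intro add_left_mono mult_left_mono) auto
        finally show "(LINT x|lebesgue. w t x * A (x, t)) \<le> \<mu> / b * (LINT x|lebesgue. F t x * W (x, t)) + m * d t" .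
      qed
    qed
    have i: "set_integrable lebesgue (einterval 0 T) (\<lambda>t. \<mu> / b * (LINT x|lebesgue. F t x * W (x, t)) + m * d t)"
      by (intro set_integral_add set_integrable_mult_right W(2) d(1))
    have "S \<le> (LINT t:einterval 0 T|lebesgue. \<mu> / b * (LINT x|lebesgue. F t x * W (x, t)) + m * d t)"
      unfolding S_def set_lebesgue_integral_def
    proof (rule integral_mono_AE'[OF i[unfolded set_integrable_def]])
      show "AE t in lebesgue. indicator (einterval 0 T) t *\<^sub>R (LINT x|lebesgue. w t x * A (x, t)) \<le>
        indicator (einterval 0 T) t *\<^sub>R (\<mu> / b * (LINT x|lebesgue. F t x * W (x, t)) + m * d t)"
        using inner by eventually_elim (auto simp: indicator_def)
      show "AE t in lebesgue. 0 \<le> indicator (einterval 0 T) t *\<^sub>R (\<mu> / b * (LINT x|lebesgue. F t x * W (x, t)) + m * d t)"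
        using FW
      proof eventually_elim
        case (elim t)
        show ?case
        proof (cases "t \<in> einterval 0 T")
          case True
          then have "0 \<le> (LINT x|lebesgue. F t x * W (x, t))" using elim by (intro integral_nonneg_AE) auto
          then show ?thesis using True \<mu> b m d0[of t] by (simp add: einterval_0_iff)
        qed simp
      qed
    qed
    also have "\<dots> = \<mu> / b * Y + m * (LINT t:einterval 0 T|lebesgue. d t)"
      unfolding Y_def by (subst set_integral_add(2)) (auto intro!: set_integrable_mult_right W(2) d(1))
    also have "\<dots> \<le> \<mu> / b * Y + m * D" using m d(2) by (intro add_left_mono mult_left_mono) auto
    finally show ?thesis by (simp add: m_def)
  qed
  have "S \<le> 2 * (Y / b) powr (1 / p) * D powr (1 - 1 / p)"
    using Y b by (intro young_optimized p D main) auto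
  also have "(Y / b) powr (1 / p) = b powr (- 1 / p) * Y powr (1 / p)"
    using Y b by (simp add: powr_divide powr_minus_divide)
  finally show ?thesis by (simp add: S_def Y_def mult_ac)
qed

definition section_integral :: "'a::euclidean_space itself \<Rightarrow> real \<Rightarrow> real \<Rightarrow> real" where
  "section_integral _ \<nu> \<tau> = (LINT x|lebesgue. indicator (cball (0::'a) (\<tau> - 1)) x * (\<tau> - norm x) powr - \<nu>)"

lemma section_integral_bounds:
  obtains V where "V > 0"
    "\<And>\<tau>. \<tau> \<ge> 3 \<Longrightarrow> section_integral TYPE('a::euclidean_space) 0 \<tau> \<le> V * \<tau> powr real DIM('a)"
    "\<And>\<tau>. \<tau> \<ge> 3 \<Longrightarrow> section_integral TYPE('a) 1 \<tau> \<le> V * \<tau> powr (real DIM('a) - 1) * ln \<tau>"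
    "\<And>\<tau> \<nu>. \<tau> \<ge> 3 \<Longrightarrow> \<nu> \<ge> 2 \<Longrightarrow> section_integral TYPE('a) \<nu> \<tau> \<le> V * \<tau> powr (real DIM('a) - 1)"
proof -
  let ?N = "real DIM('a)"
  define c where "c = unit_ball_vol ?N * ?N"
  have c: "c > 0" by (simp add: c_def)
  have main: "section_integral TYPE('a) \<nu> \<tau> \<le> c * \<tau> powr (?N - 1) * (\<Sum>j=1..nat \<lceil>\<tau>\<rceil>. real j powr - \<nu>)"
    if "\<nu> \<ge> 0" "\<tau> \<ge> 3" for \<nu> \<tau>
    using cone_section_integral_le(2)[where 'a='a, of \<nu> \<tau>] that by (simp add: section_integral_def c_def)
  have m: "nat \<lceil>\<tau>\<rceil> \<ge> 1" "real (nat \<lceil>\<tau>\<rceil>) \<le> \<tau> + 1" if "\<tau> \<ge> 3" for \<tau> :: real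
    using that by linarith+
  show thesis
  proof (rule that[of "4 * c"])
    show "4 * c > 0" using c by simp
    fix \<tau> :: real assume \<tau>: "\<tau> \<ge> 3"
    have pw: "\<tau> powr ?N = \<tau> powr (?N - 1) * \<tau>" using \<tau> by (simp add: powr_diff)
    have "section_integral TYPE('a) 0 \<tau> \<le> c * \<tau> powr (?N - 1) * real (nat \<lceil>\<tau>\<rceil>)"
      using c by (intro order.trans[OF main[OF _ \<tau>]] mult_left_mono sum_powr_le) auto
    also have "\<dots> \<le> c * \<tau> powr (?N - 1) * (4 * \<tau>)"
      using c \<tau> by (intro mult_left_mono order.trans[OF m(2)[OF \<tau>]]) auto
    finally show "section_integral TYPE('a) 0 \<tau> \<le> 4 * c * \<tau> powr ?N" by (simp add: pw mult_ac)
    \<comment> \<open>The threshold 3 ensures ln \<tau> \<ge> 1, so that additive constants can be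
      absorbed into multiples of the logarithm.\<close>
    have "exp 1 \<le> (3::real)" by (rule exp_le)
    then have ln1: "ln \<tau> \<ge> 1" using \<tau> ln_le_cancel_iff[of "exp 1" \<tau>] by simp
    have "ln (real (nat \<lceil>\<tau>\<rceil>)) \<le> ln (\<tau> * \<tau>)"
    proof (subst ln_le_cancel_iff)
      have "3 * \<tau> \<le> \<tau> * \<tau>" using \<tau> by (intro mult_right_mono) auto
      then have "\<tau> + 1 \<le> \<tau> * \<tau>" using \<tau> by linarith
      then show "real (nat \<lceil>\<tau>\<rceil>) \<le> \<tau> * \<tau>" using m(2)[OF \<tau>] by simp
    qed (use \<tau> in auto)
    also have "\<dots> = 2 * ln \<tau>" using \<tau> by (simp add: ln_mult)
    finally have l: "1 + ln (real (nat \<lceil>\<tau>\<rceil>)) \<le> 4 * ln \<tau>" using ln1 by simp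
    have "section_integral TYPE('a) 1 \<tau> \<le> c * \<tau> powr (?N - 1) * (1 + ln (real (nat \<lceil>\<tau>\<rceil>)))"
      using c m(1)[OF \<tau>] by (intro order.trans[OF main[OF _ \<tau>]] mult_left_mono sum_powr_le) auto
    also have "\<dots> \<le> c * \<tau> powr (?N - 1) * (4 * ln \<tau>)"
      using c l by (intro mult_left_mono) auto
    finally show "section_integral TYPE('a) 1 \<tau> \<le> 4 * c * \<tau> powr (?N - 1) * ln \<tau>" by (simp add: mult_ac)
    fix \<nu> :: real assume \<nu>: "\<nu> \<ge> 2"
    have "section_integral TYPE('a) \<nu> \<tau> \<le> c * \<tau> powr (?N - 1) * 2"
      using c \<nu> by (intro order.trans[OF main[OF _ \<tau>]] mult_left_mono sum_powr_le) auto
    also have "\<dots> \<le> c * \<tau> powr (?N - 1) * 4" using c by (intro mult_left_mono) auto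
    finally show "section_integral TYPE('a) \<nu> \<tau> \<le> 4 * c * \<tau> powr (?N - 1)" by (simp add: mult_ac)
  qed
qed

text \<open>The cutoff enters \<open>A\<close> with the exponent 1/p and the lower bound for
  \<open>W\<close> with exponent 1, so it cancels in the dual weight; this is why the cutoffs were
  built with derivatives controlled by a power \<theta> \<ge> 1/p of themselves. What remains is
  \<tau>^((h + g/p) p/(p - 1)) (\<tau> - |x|)^-\<nu>, whose integral over a section is compared with
  e / \<tau>.\<close>

lemma weighted_holder:
  fixes w F :: "real \<Rightarrow> 'a::euclidean_space \<Rightarrow> real"
  assumes p: "p > 1" and b: "b > 0" and F: "\<And>t x. F t x \<ge> b * \<bar>w t x\<bar> powr p"
    and W: "AE t in lebesgue. t \<in> einterval 0 T \<longrightarrow> integrable lebesgue (\<lambda>x. F t x * W (x, t))"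
      "set_integrable lebesgue (einterval 0 T) (\<lambda>t. LINT x|lebesgue. F t x * W (x, t))"
    and zero: "AE t in lebesgue. t \<in> einterval 0 T \<longrightarrow> (AE x in lebesgue. norm x > r0 + t \<longrightarrow> w t x = 0)"
      "AE t in lebesgue. t \<in> einterval 0 T \<longrightarrow> (AE x in lebesgue. norm x > r0 + t \<longrightarrow> F t x = 0)"
    and \<sigma>: "\<sigma> \<ge> r0 + 2" "\<sigma> \<ge> 3"
    and c0: "c0 > 0" and WA: "\<And>x t. 0 < t \<Longrightarrow> norm x \<le> r0 + t \<Longrightarrow> 0 \<le> \<eta> (\<sigma> + t) \<and>
      c0 * \<eta> (\<sigma> + t) * (\<sigma> + t) powr - g \<le> W (x, t) \<and>
      \<bar>A (x, t)\<bar> \<le> K * (\<sigma> + t) powr h * (\<sigma> + t - norm x) powr - (\<nu> * (1 - 1 / p)) * \<eta> (\<sigma> + t) powr (1 / p) *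
        indicator {J1..J2} (\<sigma> + t)"
    and J: "0 < J1" "J1 \<le> J2" and K: "K > 0" and \<nu>: "\<nu> \<ge> 0" and e: "e > 0"
    and vol: "\<And>\<tau>. \<tau> \<ge> 3 \<Longrightarrow> J1 \<le> \<tau> \<Longrightarrow> \<tau> \<le> J2 \<Longrightarrow>
      \<tau> powr ((h + g / p) * (p / (p - 1))) * section_integral TYPE('a) \<nu> \<tau> \<le> e / \<tau>"
    and \<Lambda>: "ln (J2 / J1) \<le> \<Lambda>" "\<Lambda> > 0"
  shows "(LINT t:einterval 0 T|lebesgue. LINT x|lebesgue. w t x * A (x, t)) \<le>
     2 * (b * c0) powr (- 1 / p) * K *
     (LINT t:einterval 0 T|lebesgue. LINT x|lebesgue. F t x * W (x, t)) powr (1 / p) * (e * \<Lambda>) powr (1 - 1 / p)"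
proof -
  define q where "q = p / (p - 1)"
  have q: "q > 0" "q * (1 - 1 / p) = 1" "- (q / p) * (1 - 1 / p) = - (1 / p)"
    using p by (auto simp: q_def field_simps)
  have pp: "1 - 1 / p > 0" "1 / p > 0" using p by auto
  \<comment> \<open>Chosen such that its power 1 - 1/p is K c0^(-1/p), the quotient of the constants
    in the bounds for \<open>A\<close> and for W^(1/p).\<close>
  define C where "C = K powr q * c0 powr - (q / p)"
  have C: "C > 0" using K c0 by (simp add: C_def)
  have Cp: "C powr (1 - 1 / p) = K * c0 powr - (1 / p)"
    using K c0 q by (simp add: C_def powr_mult powr_powr)
  define m where "m = (h + g / p) * q"
  have mp: "m * (1 - 1 / p) = h + g / p"
    using q(2) unfolding m_def mult.assoc by simp
  define k where "k z = C * indicator {J1..J2} (\<sigma> + snd z) * (\<sigma> + snd z) powr m * (\<sigma> + snd z - norm (fst z)) powr - \<nu>" for z :: "'a \<times> real"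
  define d where "d t = indicator {J1..J2} (\<sigma> + t) * (C * e / (\<sigma> + t))" for t
  have Ce: "0 \<le> C * e" using C e by simp
  have k0: "0 \<le> k z" for z unfolding k_def using C by (intro mult_nonneg_nonneg) auto
  have bound: "0 \<le> W (x, t) \<and> 0 \<le> k (x, t) \<and> \<bar>A (x, t)\<bar> \<le> k (x, t) powr (1 - 1 / p) * W (x, t) powr (1 / p)"
    if t: "0 < t" and x: "norm x \<le> r0 + t" for x t
  proof -
    define \<tau> where "\<tau> = \<sigma> + t"
    have \<tau>: "\<tau> \<ge> 3" "\<tau> - norm x \<ge> 2" using \<sigma> t x by (auto simp: \<tau>_def)
    have wa: "0 \<le> \<eta> \<tau>" "c0 * \<eta> \<tau> * \<tau> powr - g \<le> W (x, t)"
      "\<bar>A (x, t)\<bar> \<le> K * \<tau> powr h * (\<tau> - norm x) powr - (\<nu> * (1 - 1 / p)) * \<eta> \<tau> powr (1 / p) * indicator {J1..J2} \<tau>"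
      using WA[OF t x] by (auto simp: \<tau>_def)
    have W0: "0 \<le> c0 * \<eta> \<tau> * \<tau> powr - g" using c0 wa(1) by (intro mult_nonneg_nonneg) auto
    have "\<bar>A (x, t)\<bar> \<le> k (x, t) powr (1 - 1 / p) * W (x, t) powr (1 / p)"
    proof (cases "\<tau> \<in> {J1..J2}")
      case False
      then have "\<bar>A (x, t)\<bar> \<le> 0" using wa(3) by simp
      also have "0 \<le> k (x, t) powr (1 - 1 / p) * W (x, t) powr (1 / p)" by simp
      finally show ?thesis .
    next
      case True
      have k1: "k (x, t) powr (1 - 1 / p) = C powr (1 - 1 / p) * \<tau> powr (h + g / p) * (\<tau> - norm x) powr - (\<nu> * (1 - 1 / p))"
        using True \<tau> C by (simp add: k_def \<tau>_def[symmetric] powr_mult powr_powr mp)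
      have "(c0 * \<eta> \<tau> * \<tau> powr - g) powr (1 / p) \<le> W (x, t) powr (1 / p)"
        using wa(2) W0 pp by (intro powr_mono2) auto
      moreover have "(c0 * \<eta> \<tau> * \<tau> powr - g) powr (1 / p) = c0 powr (1 / p) * \<eta> \<tau> powr (1 / p) * \<tau> powr - (g / p)"
        using c0 wa(1) by (simp add: powr_mult powr_powr)
      ultimately have W1: "c0 powr (1 / p) * \<eta> \<tau> powr (1 / p) * \<tau> powr - (g / p) \<le> W (x, t) powr (1 / p)" by simp
      have "\<bar>A (x, t)\<bar> \<le> K * \<tau> powr h * (\<tau> - norm x) powr - (\<nu> * (1 - 1 / p)) * \<eta> \<tau> powr (1 / p)"
        using wa(3) True by simp
      also have "\<dots> = k (x, t) powr (1 - 1 / p) * (c0 powr (1 / p) * \<eta> \<tau> powr (1 / p) * \<tau> powr - (g / p))"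
      proof -
        have "\<tau> powr (h + g / p) * \<tau> powr - (g / p) = \<tau> powr h" by (simp add: powr_add[symmetric])
        moreover have "c0 powr - (1 / p) * c0 powr (1 / p) = 1" using c0 by (simp add: powr_add[symmetric])
        moreover have "k (x, t) powr (1 - 1 / p) * (c0 powr (1 / p) * \<eta> \<tau> powr (1 / p) * \<tau> powr - (g / p)) =
          K * (c0 powr - (1 / p) * c0 powr (1 / p)) * (\<tau> powr (h + g / p) * \<tau> powr - (g / p)) *
            (\<tau> - norm x) powr - (\<nu> * (1 - 1 / p)) * \<eta> \<tau> powr (1 / p)"
          unfolding k1 Cp by (simp only: mult_ac)
        ultimately show ?thesis by (simp only: mult_1_right)
      qed
      also have "\<dots> \<le> k (x, t) powr (1 - 1 / p) * W (x, t) powr (1 / p)"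
        by (intro mult_left_mono W1) simp
      finally show ?thesis .
    qed
    then show ?thesis using k0 W0 wa(2) by auto
  qed
  have kint: "integrable lebesgue (\<lambda>x. indicator (cball 0 (r0 + t)) x * k (x, t))"
    "(LINT x|lebesgue. indicator (cball 0 (r0 + t)) x * k (x, t)) \<le> d t" if t: "0 < t" for t
  proof -
    define \<tau> where "\<tau> = \<sigma> + t"
    have \<tau>: "\<tau> \<ge> 3" "r0 + t \<le> \<tau> - 1" using \<sigma> t by (auto simp: \<tau>_def)
    define s where "s x = indicator (cball (0::'a) (\<tau> - 1)) x * (\<tau> - norm x) powr - \<nu>" for x
    have s: "integrable lebesgue s" "integral\<^sup>L lebesgue s = section_integral TYPE('a) \<nu> \<tau>"
      using cone_section_integral_le(1)[OF \<nu>, of \<tau>, where 'a='a] \<tau> by (auto simp: s_def[abs_def] section_integral_def)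
    have s0: "0 \<le> s x" for x by (simp add: s_def)
    have le: "indicator (cball 0 (r0 + t)) x * k (x, t) \<le> C * indicator {J1..J2} \<tau> * \<tau> powr m * s x" for x
      using \<tau>(2) C by (auto simp: k_def s_def \<tau>_def[symmetric] indicator_def)
    have i: "integrable lebesgue (\<lambda>x. C * indicator {J1..J2} \<tau> * \<tau> powr m * s x)" using s(1) by simp
    have meas: "(\<lambda>x. indicator (cball 0 (r0 + t)) x * k (x, t)) \<in> borel_measurable lebesgue"
    proof -
      have "(\<lambda>x::'a. (\<tau> - norm x) powr - \<nu>) \<in> borel_measurable borel"
        by (intro powr_real_measurable borel_measurable_diff borel_measurable_norm) auto
      then have "(\<lambda>x. indicator (cball 0 (r0 + t)) x * k (x, t)) \<in> borel_measurable borel"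
        unfolding k_def fst_conv snd_conv \<tau>_def[symmetric]
        by (intro borel_measurable_times borel_measurable_indicator) auto
      then show ?thesis by (intro measurable_completion) simp
    qed
    show "integrable lebesgue (\<lambda>x. indicator (cball 0 (r0 + t)) x * k (x, t))"
    proof (rule Bochner_Integration.integrable_bound[OF i meas], rule AE_I2)
      fix x
      have "0 \<le> indicator (cball 0 (r0 + t)) x * k (x, t)" using k0 by (auto simp: indicator_def)
      then show "norm (indicator (cball 0 (r0 + t)) x * k (x, t)) \<le> norm (C * indicator {J1..J2} \<tau> * \<tau> powr m * s x)"
        using le[of x] by (simp only: real_norm_def abs_of_nonneg)
    qed
    have "(LINT x|lebesgue. indicator (cball 0 (r0 + t)) x * k (x, t)) \<le> (LINT x|lebesgue. C * indicator {J1..J2} \<tau> * \<tau> powr m * s x)"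
      using C s0 by (intro integral_mono'[OF i] le) (auto simp: indicator_def intro!: mult_nonneg_nonneg)
    also have "\<dots> = C * indicator {J1..J2} \<tau> * (\<tau> powr m * section_integral TYPE('a) \<nu> \<tau>)" by (simp add: s(2))
    also have "\<dots> \<le> C * indicator {J1..J2} \<tau> * (e / \<tau>)"
    proof (cases "\<tau> \<in> {J1..J2}")
      case True
      then have "\<tau> powr m * section_integral TYPE('a) \<nu> \<tau> \<le> e / \<tau>"
        unfolding m_def q_def by (intro vol[OF \<tau>(1)]) auto
      then have "C * (\<tau> powr m * section_integral TYPE('a) \<nu> \<tau>) \<le> C * (e / \<tau>)"
        using C by (intro mult_left_mono) auto
      then show ?thesis using True by simp
    qed simp
    also have "\<dots> = d t" by (simp add: d_def \<tau>_def)
    finally show "(LINT x|lebesgue. indicator (cball 0 (r0 + t)) x * k (x, t)) \<le> d t" .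
  qed
  have D: "(LINT t:einterval 0 T|lebesgue. d t) \<le> C * (e * \<Lambda>)"
  proof -
    have "(LINT t:einterval 0 T|lebesgue. d t) \<le> C * e * ln (J2 / J1)"
      unfolding d_def by (rule time_integral_inverse(2)[OF J Ce])
    also have "\<dots> \<le> C * e * \<Lambda>" using Ce \<Lambda>(1) by (intro mult_left_mono)
    finally show ?thesis by (simp add: mult.assoc)
  qed
  have d: "set_integrable lebesgue (einterval 0 T) d"
    unfolding d_def[abs_def] by (rule time_integral_inverse(1)[OF J Ce])
  have "0 < C * (e * \<Lambda>)" using C e \<Lambda>(2) by simp
  from holder_cone[OF p b F W zero bound kint d D this]
  have "(LINT t:einterval 0 T|lebesgue. LINT x|lebesgue. w t x * A (x, t)) \<le>
     2 * b powr (- 1 / p) * (LINT t:einterval 0 T|lebesgue. LINT x|lebesgue. F t x * W (x, t)) powr (1 / p) * (C * (e * \<Lambda>)) powr (1 - 1 / p)" .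
  also have "(C * (e * \<Lambda>)) powr (1 - 1 / p) = K * c0 powr - (1 / p) * (e * \<Lambda>) powr (1 - 1 / p)"
    using C e \<Lambda>(2) Cp by (simp add: powr_mult)
  also have "(b * c0) powr (- 1 / p) = b powr (- 1 / p) * c0 powr - (1 / p)" using b c0 by (simp add: powr_mult)
  ultimately show ?thesis using b c0 by (simp add: powr_mult mult_ac)
qed

section \<open>Elimination of the two weighted integrals\<close>

text \<open>Eliminating \<open>X\<close> bounds Y^(1 - 1/(pq)), and the third inequality is raised
  to the power p - 1/q because (1/p) (p - 1/q) = 1 - 1/(pq). Dividing by a power of \<open>Y\<close>
  is legitimate: \<epsilon> > 0 forces Y > 0.\<close>

lemma scaling_conclusion:
  fixes p q :: real
  assumes p: "p > 1" and q: "q > 1" and pos: "\<epsilon> > 0" "X \<ge> 0" "Y \<ge> 0" "C1 > 0" "C2 > 0" "C3 > 0" "a1 > 0" "a2 > 0" "a3 > 0"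
    and X: "X \<le> C1 * a1 * Y powr (1 / p)" and Y: "Y \<le> C2 * a2 * X powr (1 / q)" and E: "\<epsilon> \<le> C3 * a3 * Y powr (1 / p)"
  shows "\<epsilon> powr (p - 1 / q) \<le> C1 powr (1 / q) * C2 * C3 powr (p - 1 / q) * (a1 powr (1 / q) * a2 * a3 powr (p - 1 / q))"
proof -
  have pq: "p - 1 / q > 0" "1 / q > 0" "1 / p > 0" using p q less_1_mult[OF p q] by (auto simp: field_simps)
  have Ypos: "Y > 0"
  proof (rule ccontr)
    assume "\<not> Y > 0"
    then have "Y = 0" using pos(3) by simp
    then show False using E pos(1) by simp
  qed
  have "X powr (1 / q) \<le> (C1 * a1 * Y powr (1 / p)) powr (1 / q)"
    using X pos pq by (intro powr_mono2) auto
  also have "\<dots> = C1 powr (1 / q) * a1 powr (1 / q) * Y powr (1 / (p * q))"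
    using pos by (simp add: powr_mult powr_powr)
  finally have "C2 * a2 * X powr (1 / q) \<le> C2 * a2 * (C1 powr (1 / q) * a1 powr (1 / q) * Y powr (1 / (p * q)))"
    using pos by (intro mult_left_mono) auto
  with Y have Y2: "Y \<le> C1 powr (1 / q) * C2 * (a1 powr (1 / q) * a2) * Y powr (1 / (p * q))"
    by (simp add: mult_ac)
  have "Y powr (1 - 1 / (p * q)) = Y / Y powr (1 / (p * q))" using Ypos by (simp add: powr_diff)
  also have "\<dots> \<le> C1 powr (1 / q) * C2 * (a1 powr (1 / q) * a2)" using Y2 Ypos by (simp add: divide_le_eq)
  finally have Y3: "Y powr (1 - 1 / (p * q)) \<le> C1 powr (1 / q) * C2 * (a1 powr (1 / q) * a2)" .
  have e: "1 / p * (p - 1 / q) = 1 - 1 / (p * q)" using p q by (simp add: field_simps)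
  have "\<epsilon> powr (p - 1 / q) \<le> (C3 * a3 * Y powr (1 / p)) powr (p - 1 / q)"
    using E pos pq by (intro powr_mono2) auto
  also have "\<dots> = C3 powr (p - 1 / q) * a3 powr (p - 1 / q) * Y powr (1 - 1 / (p * q))"
    using pos by (simp add: powr_mult powr_powr e del: times_divide_eq_left)
  also have "\<dots> \<le> C3 powr (p - 1 / q) * a3 powr (p - 1 / q) * (C1 powr (1 / q) * C2 * (a1 powr (1 / q) * a2))"
    by (intro mult_left_mono Y3) simp
  finally show ?thesis by (simp add: mult_ac)
qed

section \<open>Estimates for power nonlinearities\<close>

definition cutoff :: "real \<Rightarrow> real \<Rightarrow> real \<Rightarrow> real \<Rightarrow> (real \<Rightarrow> real) \<Rightarrow> (real \<Rightarrow> real) \<Rightarrow> (real \<Rightarrow> real) \<Rightarrow> bool" where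
  "cutoff M \<theta> R1 R2 h h' h'' \<longleftrightarrow> time_weight R2 h h' h'' \<and>
     (\<forall>\<tau>>0. 0 \<le> h \<tau> \<and> h \<tau> \<le> 1 \<and> h' \<tau> \<le> 0 \<and>
        \<bar>h' \<tau>\<bar> \<le> M / ln (R2 / R1) / \<tau> * h \<tau> powr \<theta> \<and>
        \<bar>h'' \<tau>\<bar> \<le> M / ln (R2 / R1) / \<tau>\<^sup>2 * h \<tau> powr \<theta> \<and>
        (\<tau> \<le> R1 \<longrightarrow> h \<tau> = 1) \<and> (\<tau> < R1 \<or> \<tau> > R2 \<longrightarrow> h' \<tau> = 0 \<and> h'' \<tau> = 0))"

lemma cutoff_exists:
  assumes "\<theta> < 1"
  obtains M where "M > 0" "\<And>R1 R2. 0 < R1 \<Longrightarrow> 2 * R1 \<le> R2 \<Longrightarrow> \<exists>h h' h''. cutoff M \<theta> R1 R2 h h' h''"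
proof -
  obtain M where M: "M > 0"
    "\<And>R1 R2. 0 < R1 \<Longrightarrow> 2 * R1 \<le> R2 \<Longrightarrow> \<exists>\<phi> \<phi>1 \<phi>2 :: real \<Rightarrow> real. smooth_on {0<..} \<phi> \<and>
      (\<forall>\<tau>>0. (\<phi> has_field_derivative \<phi>1 \<tau>) (at \<tau>) \<and> (\<phi>1 has_field_derivative \<phi>2 \<tau>) (at \<tau>) \<and>
        0 \<le> \<phi> \<tau> \<and> \<phi> \<tau> \<le> 1 \<and> \<phi>1 \<tau> \<le> 0 \<and>
        \<bar>\<phi>1 \<tau>\<bar> \<le> M / ln (R2 / R1) / \<tau> * \<phi> \<tau> powr \<theta> \<and>
        \<bar>\<phi>2 \<tau>\<bar> \<le> M / ln (R2 / R1) / \<tau>\<^sup>2 * \<phi> \<tau> powr \<theta> \<and>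
        (\<tau> \<le> R1 \<longrightarrow> \<phi> \<tau> = 1) \<and> (\<tau> \<ge> R2 \<longrightarrow> \<phi> \<tau> = 0) \<and>
        (\<tau> < R1 \<or> \<tau> > R2 \<longrightarrow> \<phi>1 \<tau> = 0 \<and> \<phi>2 \<tau> = 0))"
    by (rule log_cutoff_exists[OF assms], rule that)
  show thesis
  proof (rule that[OF M(1)])
    fix R1 R2 :: real assume R: "0 < R1" "2 * R1 \<le> R2"
    from M(2)[OF R] obtain h h' h'' where h: "smooth_on {0<..} h"
      "\<forall>\<tau>>0. (h has_field_derivative h' \<tau>) (at \<tau>) \<and> (h' has_field_derivative h'' \<tau>) (at \<tau>) \<and>
        0 \<le> h \<tau> \<and> h \<tau> \<le> 1 \<and> h' \<tau> \<le> 0 \<and>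
        \<bar>h' \<tau>\<bar> \<le> M / ln (R2 / R1) / \<tau> * h \<tau> powr \<theta> \<and>
        \<bar>h'' \<tau>\<bar> \<le> M / ln (R2 / R1) / \<tau>\<^sup>2 * h \<tau> powr \<theta> \<and>
        (\<tau> \<le> R1 \<longrightarrow> h \<tau> = 1) \<and> (\<tau> \<ge> R2 \<longrightarrow> h \<tau> = 0) \<and>
        (\<tau> < R1 \<or> \<tau> > R2 \<longrightarrow> h' \<tau> = 0 \<and> h'' \<tau> = 0)" by blast
    have "\<tau> \<ge> R2 \<Longrightarrow> \<tau> > 0" for \<tau> using R by linarith
    then have "cutoff M \<theta> R1 R2 h h' h''" unfolding cutoff_def time_weight_def
      using h by (intro conjI allI impI) blast+
    then show "\<exists>h h' h''. cutoff M \<theta> R1 R2 h h' h''" by blast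
  qed
qed

lemma powr_le_powr_exponent:
  fixes y :: real
  assumes "0 \<le> y" "y \<le> 1" "r \<le> s"
  shows "y powr s \<le> y powr r"
  using assms by (cases "y = 0") (auto intro: powr_mono')

text \<open>The second derivative of the cutoff carries one more factor 1/\<tau>, and
  \<open>phi_le_Suc\<close> trades it for raising \<beta> by one. Both terms are then of size
  \<tau>^-1 phi_(\<beta> + 1), with one gain of the logarithm.\<close>

lemma wave_term_bound:
  fixes x :: "'a::euclidean_space"
  defines "n \<equiv> (real DIM('a) - 1) / 2"
  assumes cut: "cutoff M \<theta> R1 R2 h h' h''" and M: "M > 0" and R: "0 < R1" "R1 < R2"
    and \<beta>: "\<beta> > -1" "\<beta> \<ge> 0 \<or> DIM('a) \<ge> 2" and \<theta>: "1 / p \<le> \<theta>" and C: "C > 0"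
    and phi: "\<And>\<sigma> (x :: 'a) t. (x, t) \<in> light_cone \<sigma> \<Longrightarrow>
      phi \<sigma> (\<beta> + 1) (x, t) \<le> C * (\<sigma> + t) powr - n * (\<sigma> + t - norm x) powr (n - (\<beta> + 1))"
    and \<nu>: "\<beta> + 1 - n = \<nu> * (1 - 1 / p)"
    and x: "(x, t) \<in> light_cone \<sigma>"
  shows "\<bar>wave_weight h'' \<sigma> \<beta> (x, t) - 2 * \<beta> * wave_weight h' \<sigma> (\<beta> + 1) (x, t)\<bar> \<le>
    M * (1 + 2 * \<bar>\<beta>\<bar>) * C / ln (R2 / R1) * (\<sigma> + t) powr (- 1 - n) *
      (\<sigma> + t - norm x) powr - (\<nu> * (1 - 1 / p)) * h (\<sigma> + t) powr (1 / p) * indicator {R1..R2} (\<sigma> + t)"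
proof -
  define \<tau> where "\<tau> = \<sigma> + t"
  define L where "L = M / ln (R2 / R1)"
  have L: "L > 0" unfolding L_def using M R by (intro divide_pos_pos ln_gt_zero) auto
  have \<tau>: "\<tau> > 0" unfolding \<tau>_def by (rule light_cone_ratio[OF x])
  have h: "0 \<le> h \<tau>" "h \<tau> \<le> 1" "\<bar>h' \<tau>\<bar> \<le> L / \<tau> * h \<tau> powr \<theta>" "\<bar>h'' \<tau>\<bar> \<le> L / \<tau>\<^sup>2 * h \<tau> powr \<theta>"
    "\<tau> < R1 \<or> \<tau> > R2 \<Longrightarrow> h' \<tau> = 0 \<and> h'' \<tau> = 0"
    using cut \<tau> by (auto simp: cutoff_def L_def)
  show ?thesis
  proof (cases "\<tau> \<in> {R1..R2}")
    case False
    then have "h' \<tau> = 0 \<and> h'' \<tau> = 0" by (intro h(5)) auto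
    then show ?thesis using False by (simp add: wave_weight_def \<tau>_def)
  next
    case True
    define P where "P = phi \<sigma> (\<beta> + 1) (x, t)"
    have P: "0 \<le> P" unfolding P_def using \<beta> by (intro phi_nonneg[OF x]) auto
    have P0: "0 \<le> phi \<sigma> \<beta> (x, t)" by (rule order.trans[OF _ phi_ge[OF x \<beta>]]) simp
    have P1: "phi \<sigma> \<beta> (x, t) \<le> \<tau> * P" unfolding P_def \<tau>_def by (rule phi_le_Suc[OF x \<beta>(1)])
    have "\<bar>h'' \<tau> * phi \<sigma> \<beta> (x, t)\<bar> \<le> (L / \<tau>\<^sup>2 * h \<tau> powr \<theta>) * (\<tau> * P)"
      unfolding abs_mult using h(4) P0 P1 by (intro mult_mono) auto
    also have "\<dots> = L / \<tau> * h \<tau> powr \<theta> * P" using \<tau> by (simp add: power2_eq_square)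
    finally have 1: "\<bar>h'' \<tau> * phi \<sigma> \<beta> (x, t)\<bar> \<le> L / \<tau> * h \<tau> powr \<theta> * P" .
    have "\<bar>2 * \<beta> * (h' \<tau> * P)\<bar> = 2 * \<bar>\<beta>\<bar> * (\<bar>h' \<tau>\<bar> * P)" using P by (simp add: abs_mult)
    also have "\<dots> \<le> 2 * \<bar>\<beta>\<bar> * (L / \<tau> * h \<tau> powr \<theta> * P)"
      using h(3) P by (intro mult_left_mono mult_right_mono) auto
    finally have 2: "\<bar>2 * \<beta> * (h' \<tau> * P)\<bar> \<le> 2 * \<bar>\<beta>\<bar> * (L / \<tau> * h \<tau> powr \<theta> * P)" .
    have "\<bar>wave_weight h'' \<sigma> \<beta> (x, t) - 2 * \<beta> * wave_weight h' \<sigma> (\<beta> + 1) (x, t)\<bar> =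
      \<bar>h'' \<tau> * phi \<sigma> \<beta> (x, t) - 2 * \<beta> * (h' \<tau> * P)\<bar>"
      by (simp add: wave_weight_def \<tau>_def P_def)
    also have "\<dots> \<le> \<bar>h'' \<tau> * phi \<sigma> \<beta> (x, t)\<bar> + \<bar>2 * \<beta> * (h' \<tau> * P)\<bar>" by (rule abs_triangle_ineq4)
    also have "\<dots> \<le> (1 + 2 * \<bar>\<beta>\<bar>) * (L / \<tau> * h \<tau> powr \<theta> * P)"
      by (rule order.trans[OF add_mono[OF 1 2]]) (simp only: distrib_right mult_1_left order.refl)
    also have "\<dots> \<le> (1 + 2 * \<bar>\<beta>\<bar>) * (L / \<tau> * h \<tau> powr (1 / p) * (C * \<tau> powr - n * (\<tau> - norm x) powr (n - (\<beta> + 1))))"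
      using L \<tau> P phi[OF x] unfolding P_def \<tau>_def[symmetric]
      by (intro mult_left_mono mult_mono powr_le_powr_exponent[OF h(1,2) \<theta>]) (auto simp: P_def)
    also have "n - (\<beta> + 1) = - (\<nu> * (1 - 1 / p))" using \<nu> by simp
    also have "\<tau> powr - n = \<tau> powr (- 1 - n) * \<tau>" using \<tau> by (simp add: powr_diff powr_minus_divide)
    finally show ?thesis using True \<tau> by (simp add: L_def \<tau>_def[symmetric] mult_ac)
  qed
qed

locale power_cone_solution = cone_solution G1 G2 f1 g1 f2 g2 \<epsilon> r0 T u v
  for G1 G2 :: "real \<Rightarrow> real" and f1 g1 f2 g2 :: "'a::euclidean_space \<Rightarrow> real"
    and \<epsilon> r0 :: real and T :: ereal and u v :: "real \<Rightarrow> 'a \<Rightarrow> real" +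
  fixes p q a b \<sigma> :: real
  assumes pq: "p > 1" "q > 1" and ab: "a > 0" "b > 0"
    and G_ge: "\<And>s. G1 s \<ge> a * \<bar>s\<bar> powr q" "\<And>s. G2 s \<ge> b * \<bar>s\<bar> powr p"
    and \<sigma>: "\<sigma> \<ge> r0 + 2" "\<sigma> \<ge> 3"
begin

lemma in_cone: "norm x \<le> r0 + t \<Longrightarrow> (x :: 'a, t) \<in> light_cone \<sigma>"
  using \<sigma> by (simp add: light_cone_def)

lemma admissible_scale: "admissible H \<Longrightarrow> admissible (\<lambda>z. c * H z)"
proof -
  assume "admissible H"
  then obtain \<Psi> where \<Psi>: "\<Psi> \<in> Cc_infinity" "\<And>x t. 0 < t \<Longrightarrow> norm x \<le> r0 + t \<Longrightarrow> H (x, t) = \<Psi> (x, t)"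
    by (auto simp: admissible_def)
  obtain r where "smooth_on UNIV \<Psi>" "\<And>z. norm z > r \<Longrightarrow> \<Psi> z = 0" using \<Psi>(1) unfolding Cc_infinity_iff by blast
  then have "(\<lambda>z. c * \<Psi> z) \<in> Cc_infinity"
    unfolding Cc_infinity_iff by (auto intro!: smooth_on_mult exI[of _ r])
  then show ?thesis unfolding admissible_def using \<Psi>(2) by (intro bexI[of _ "\<lambda>z. c * \<Psi> z"]) auto
qed

lemma holder_u:
  assumes "admissible W"
    and "c0 > 0" "\<And>x t. 0 < t \<Longrightarrow> norm x \<le> r0 + t \<Longrightarrow> 0 \<le> \<eta> (\<sigma> + t) \<and>
      c0 * \<eta> (\<sigma> + t) * (\<sigma> + t) powr - g \<le> W (x, t) \<and>
      \<bar>A (x, t)\<bar> \<le> K * (\<sigma> + t) powr h * (\<sigma> + t - norm x) powr - (\<nu> * (1 - 1 / p)) * \<eta> (\<sigma> + t) powr (1 / p) *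
        indicator {J1..J2} (\<sigma> + t)"
    and "0 < J1" "J1 \<le> J2" "K > 0" "\<nu> \<ge> 0" "e > 0"
    and "\<And>\<tau>. \<tau> \<ge> 3 \<Longrightarrow> J1 \<le> \<tau> \<Longrightarrow> \<tau> \<le> J2 \<Longrightarrow>
      \<tau> powr ((h + g / p) * (p / (p - 1))) * section_integral TYPE('a) \<nu> \<tau> \<le> e / \<tau>"
    and "ln (J2 / J1) \<le> \<Lambda>" "\<Lambda> > 0"
  shows "(LINT t:einterval 0 T|lebesgue. LINT x|lebesgue. time_deriv T u t x * A (x, t)) \<le>
     2 * (b * c0) powr (- 1 / p) * K * I2 W powr (1 / p) * (e * \<Lambda>) powr (1 - 1 / p)"
  unfolding I2_def
  by (rule weighted_holder[OF pq(1) ab(2) G_ge(2) I_integrable_slice(2)[OF assms(1)] I_integrable(2)[OF assms(1)]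
      cone_zero_each(3,5) \<sigma> assms(2-11)])

lemma holder_v:
  assumes "admissible W"
    and "c0 > 0" "\<And>x t. 0 < t \<Longrightarrow> norm x \<le> r0 + t \<Longrightarrow> 0 \<le> \<eta> (\<sigma> + t) \<and>
      c0 * \<eta> (\<sigma> + t) * (\<sigma> + t) powr - g \<le> W (x, t) \<and>
      \<bar>A (x, t)\<bar> \<le> K * (\<sigma> + t) powr h * (\<sigma> + t - norm x) powr - (\<nu> * (1 - 1 / q)) * \<eta> (\<sigma> + t) powr (1 / q) *
        indicator {J1..J2} (\<sigma> + t)"
    and "0 < J1" "J1 \<le> J2" "K > 0" "\<nu> \<ge> 0" "e > 0"
    and "\<And>\<tau>. \<tau> \<ge> 3 \<Longrightarrow> J1 \<le> \<tau> \<Longrightarrow> \<tau> \<le> J2 \<Longrightarrow>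
      \<tau> powr ((h + g / q) * (q / (q - 1))) * section_integral TYPE('a) \<nu> \<tau> \<le> e / \<tau>"
    and "ln (J2 / J1) \<le> \<Lambda>" "\<Lambda> > 0"
  shows "(LINT t:einterval 0 T|lebesgue. LINT x|lebesgue. v t x * A (x, t)) \<le>
     2 * (a * c0) powr (- 1 / q) * K * I1 W powr (1 / q) * (e * \<Lambda>) powr (1 - 1 / q)"
  unfolding I1_def
  by (rule weighted_holder[OF pq(2) ab(1) G_ge(1) I_integrable_slice(1)[OF assms(1)] I_integrable(1)[OF assms(1)]
      cone_zero_each(2,4) \<sigma> assms(2-11)])

lemma ineq_time_u:
  assumes H: "time_weight R2 H H' H''" and R: "\<sigma> < R2" "ereal (R2 - \<sigma>) < T"
    and W: "admissible W" and c0: "c0 > 0"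
    and WA: "\<And>x t. 0 < t \<Longrightarrow> norm x \<le> r0 + t \<Longrightarrow> 0 \<le> \<eta> (\<sigma> + t) \<and> c0 * \<eta> (\<sigma> + t) * (\<sigma> + t) powr - g \<le> W (x, t)"
    and A: "\<And>\<tau>. \<tau> > \<sigma> \<Longrightarrow> \<bar>H' \<tau>\<bar> \<le> K * \<tau> powr h * \<eta> \<tau> powr (1 / p) * indicator {J1..J2} \<tau>"
    and J: "0 < J1" "J1 \<le> J2" "K > 0" "e > 0"
    and vol: "\<And>\<tau>. \<tau> \<ge> 3 \<Longrightarrow> J1 \<le> \<tau> \<Longrightarrow> \<tau> \<le> J2 \<Longrightarrow>
      \<tau> powr ((h + g / p) * (p / (p - 1))) * section_integral TYPE('a) 0 \<tau> \<le> e / \<tau>"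
    and \<Lambda>: "ln (J2 / J1) \<le> \<Lambda>" "\<Lambda> > 0"
    and data: "0 \<le> \<epsilon> * H \<sigma> * (LINT x|lebesgue. g1 x)"
  shows "I1 (wave_weight H \<sigma> 0) \<le> 2 * (b * c0) powr (- 1 / p) * K * I2 W powr (1 / p) * (e * \<Lambda>) powr (1 - 1 / p)"
proof -
  have "I1 (wave_weight H \<sigma> 0) \<le> (LINT t:einterval 0 T|lebesgue. LINT x|lebesgue. time_deriv T u t x * (\<lambda>z. - H' (\<sigma> + snd z)) (x, t))"
    using time_test_u[OF H \<sigma>(1) _ R] \<sigma>(2) data by simp
  also have "\<dots> \<le> 2 * (b * c0) powr (- 1 / p) * K * I2 W powr (1 / p) * (e * \<Lambda>) powr (1 - 1 / p)"
  proof (rule holder_u[OF W c0 _ J(1-3) order.refl J(4) vol \<Lambda>])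
    fix x :: 'a and t :: real assume t: "0 < t" "norm x \<le> r0 + t"
    have pos: "\<sigma> + t > 0" "\<sigma> + t - norm x > 0" using t \<sigma> by auto
    show "0 \<le> \<eta> (\<sigma> + t) \<and> c0 * \<eta> (\<sigma> + t) * (\<sigma> + t) powr - g \<le> W (x, t) \<and>
      \<bar>(\<lambda>z. - H' (\<sigma> + snd z)) (x, t)\<bar> \<le> K * (\<sigma> + t) powr h * (\<sigma> + t - norm x) powr - (0 * (1 - 1 / p)) * \<eta> (\<sigma> + t) powr (1 / p) *
        indicator {J1..J2} (\<sigma> + t)"
      using WA[OF t] A[of "\<sigma> + t"] t(1) pos(2) by simp
  qed
  finally show ?thesis .
qed

text \<open>The case \<beta> = 0 of \<open>wave_test_v\<close>: only the second derivative of the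
  time weight survives. The data condition involves H'(\<sigma>), since a power weight is not
  constant near \<sigma>.\<close>

lemma ineq_time_v:
  assumes H: "time_weight R2 H H' H''" and R: "\<sigma> < R2" "ereal (R2 - \<sigma>) < T"
    and W: "admissible W" and c0: "c0 > 0"
    and WA: "\<And>x t. 0 < t \<Longrightarrow> norm x \<le> r0 + t \<Longrightarrow> 0 \<le> \<eta> (\<sigma> + t) \<and> c0 * \<eta> (\<sigma> + t) * (\<sigma> + t) powr - g \<le> W (x, t)"
    and A: "\<And>\<tau>. \<tau> > \<sigma> \<Longrightarrow> \<bar>H'' \<tau>\<bar> \<le> K * \<tau> powr h * \<eta> \<tau> powr (1 / q) * indicator {J1..J2} \<tau>"
    and J: "0 < J1" "J1 \<le> J2" "K > 0" "e > 0"
    and vol: "\<And>\<tau>. \<tau> \<ge> 3 \<Longrightarrow> J1 \<le> \<tau> \<Longrightarrow> \<tau> \<le> J2 \<Longrightarrow>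
      \<tau> powr ((h + g / q) * (q / (q - 1))) * section_integral TYPE('a) 0 \<tau> \<le> e / \<tau>"
    and \<Lambda>: "ln (J2 / J1) \<le> \<Lambda>" "\<Lambda> > 0"
    and data: "0 \<le> \<epsilon> * (H \<sigma> * (LINT x|lebesgue. g2 x) - H' \<sigma> * (LINT x|lebesgue. f2 x))"
  shows "I2 (wave_weight H \<sigma> 0) \<le> 2 * (a * c0) powr (- 1 / q) * K * I1 W powr (1 / q) * (e * \<Lambda>) powr (1 - 1 / q)"
proof -
  have p0: "phi \<sigma> 0 (x :: 'a, t) = 1" if "norm x \<le> r0 + t" for x t by (rule phi_0[OF in_cone[OF that]])
  have g: "(LINT x|lebesgue. g2 x * phi \<sigma> 0 (x, 0)) = (LINT x|lebesgue. g2 x)"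
    using data_integral_cong[where g=g2 and A="phi \<sigma> 0" and B="\<lambda>_. 1", OF data_zero(4)] p0[of _ 0] by simp
  have f: "(LINT x|lebesgue. f2 x * phi \<sigma> 0 (x, 0)) = (LINT x|lebesgue. f2 x)"
    using data_integral_cong[where g=f2 and A="phi \<sigma> 0" and B="\<lambda>_. 1", OF data_zero(3)] p0[of _ 0] by simp
  have "(LINT t:einterval 0 T|lebesgue. LINT x|lebesgue. v t x * (\<lambda>z. wave_weight H'' \<sigma> 0 z - 2 * 0 * wave_weight H' \<sigma> (0 + 1) z) (x, t)) =
    (LINT t:einterval 0 T|lebesgue. LINT x|lebesgue. v t x * (\<lambda>z. H'' (\<sigma> + snd z)) (x, t))"
    by (rule cone_integral_cong(1)[OF cone_zero_each(2)]) (simp add: wave_weight_def p0)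
  then have "I2 (wave_weight H \<sigma> 0) \<le> (LINT t:einterval 0 T|lebesgue. LINT x|lebesgue. v t x * (\<lambda>z. H'' (\<sigma> + snd z)) (x, t))"
    using wave_test_v[OF H \<sigma>(1) _ R, of 0] \<sigma>(2) data by (simp add: f g)
  also have "\<dots> \<le> 2 * (a * c0) powr (- 1 / q) * K * I1 W powr (1 / q) * (e * \<Lambda>) powr (1 - 1 / q)"
  proof (rule holder_v[OF W c0 _ J(1-3) order.refl J(4) vol \<Lambda>])
    fix x :: 'a and t :: real assume t: "0 < t" "norm x \<le> r0 + t"
    have pos: "\<sigma> + t > 0" "\<sigma> + t - norm x > 0" using t \<sigma> by auto
    show "0 \<le> \<eta> (\<sigma> + t) \<and> c0 * \<eta> (\<sigma> + t) * (\<sigma> + t) powr - g \<le> W (x, t) \<and>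
      \<bar>(\<lambda>z. H'' (\<sigma> + snd z)) (x, t)\<bar> \<le> K * (\<sigma> + t) powr h * (\<sigma> + t - norm x) powr - (0 * (1 - 1 / q)) * \<eta> (\<sigma> + t) powr (1 / q) *
        indicator {J1..J2} (\<sigma> + t)"
      using WA[OF t] A[of "\<sigma> + t"] t(1) pos(2) by simp
  qed
  finally show ?thesis .
qed

text \<open>As \<sigma> < R1, the cutoff is 1 with zero derivative at \<tau> = \<sigma>, so the data
  enter as if there were no cutoff.\<close>

lemma ineq_wave_v:
  defines "n \<equiv> (real DIM('a) - 1) / 2"
  assumes cut: "cutoff M \<theta> R1 R2 \<eta> \<eta>' \<eta>''" and M: "M > 0" and R: "\<sigma> < R1" "R1 < R2" "ereal (R2 - \<sigma>) < T"
    and \<beta>: "\<beta> > -1" "\<beta> \<ge> 0 \<or> DIM('a) \<ge> 2" and \<theta>: "1 / q \<le> \<theta>" and C: "C > 0"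
    and phi: "\<And>\<sigma> (x :: 'a) t. (x, t) \<in> light_cone \<sigma> \<Longrightarrow>
      phi \<sigma> (\<beta> + 1) (x, t) \<le> C * (\<sigma> + t) powr - n * (\<sigma> + t - norm x) powr (n - (\<beta> + 1))"
    and \<nu>: "\<beta> + 1 - n = \<nu> * (1 - 1 / q)" "\<nu> \<ge> 0"
    and W: "admissible W" and c0: "c0 > 0"
    and WA: "\<And>x t. 0 < t \<Longrightarrow> norm x \<le> r0 + t \<Longrightarrow> c0 * \<eta> (\<sigma> + t) * (\<sigma> + t) powr - g \<le> W (x, t)"
    and e: "e > 0" and vol: "\<And>\<tau>. \<tau> \<ge> 3 \<Longrightarrow> R1 \<le> \<tau> \<Longrightarrow> \<tau> \<le> R2 \<Longrightarrow>
      \<tau> powr ((- 1 - n + g / q) * (q / (q - 1))) * section_integral TYPE('a) \<nu> \<tau> \<le> e / \<tau>"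
  shows "\<epsilon> * ((LINT x|lebesgue. g2 x * phi \<sigma> \<beta> (x, 0)) + \<beta> * (LINT x|lebesgue. f2 x * phi \<sigma> (\<beta> + 1) (x, 0)))
      + I2 (wave_weight \<eta> \<sigma> \<beta>) \<le>
    2 * (a * c0) powr (- 1 / q) * (M * (1 + 2 * \<bar>\<beta>\<bar>) * C / ln (R2 / R1)) * I1 W powr (1 / q) * (e * ln (R2 / R1)) powr (1 - 1 / q)"
proof -
  have pos: "0 < R1" "0 < \<sigma>" "\<sigma> < R2" using R \<sigma> by auto
  have L: "ln (R2 / R1) > 0" using R pos by (intro ln_gt_zero) auto
  have tw: "time_weight R2 \<eta> \<eta>' \<eta>''" and \<eta>0: "\<And>\<tau>. \<tau> > 0 \<Longrightarrow> 0 \<le> \<eta> \<tau>" and s: "\<eta> \<sigma> = 1" "\<eta>' \<sigma> = 0"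
    using cut R(1) pos by (auto simp: cutoff_def)
  have "\<epsilon> * ((LINT x|lebesgue. g2 x * phi \<sigma> \<beta> (x, 0)) + \<beta> * (LINT x|lebesgue. f2 x * phi \<sigma> (\<beta> + 1) (x, 0)))
      + I2 (wave_weight \<eta> \<sigma> \<beta>) = (LINT t:einterval 0 T|lebesgue. LINT x|lebesgue. v t x *
      (\<lambda>z. wave_weight \<eta>'' \<sigma> \<beta> z - 2 * \<beta> * wave_weight \<eta>' \<sigma> (\<beta> + 1) z) (x, t))"
    using wave_test_v[OF tw \<sigma>(1) _ pos(3) R(3), of \<beta>] \<sigma>(2) s by simp
  also have "\<dots> \<le> 2 * (a * c0) powr (- 1 / q) * (M * (1 + 2 * \<bar>\<beta>\<bar>) * C / ln (R2 / R1)) * I1 W powr (1 / q) * (e * ln (R2 / R1)) powr (1 - 1 / q)"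
  proof (rule holder_v[where \<eta>=\<eta> and h="- 1 - n" and g=g and \<nu>=\<nu>, OF W c0 _ pos(1) _ _ \<nu>(2) e vol order.refl L])
    fix x :: 'a and t :: real assume t: "0 < t" "norm x \<le> r0 + t"
    have "\<sigma> + t > 0" using t \<sigma> by auto
    then show "0 \<le> \<eta> (\<sigma> + t) \<and> c0 * \<eta> (\<sigma> + t) * (\<sigma> + t) powr - g \<le> W (x, t) \<and>
      \<bar>(\<lambda>z. wave_weight \<eta>'' \<sigma> \<beta> z - 2 * \<beta> * wave_weight \<eta>' \<sigma> (\<beta> + 1) z) (x, t)\<bar> \<le>
        M * (1 + 2 * \<bar>\<beta>\<bar>) * C / ln (R2 / R1) * (\<sigma> + t) powr (- 1 - n) *
        (\<sigma> + t - norm x) powr - (\<nu> * (1 - 1 / q)) * \<eta> (\<sigma> + t) powr (1 / q) * indicator {R1..R2} (\<sigma> + t)"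
      using WA[OF t] \<eta>0 wave_term_bound[OF cut M pos(1) R(2) \<beta> \<theta> C phi[unfolded n_def] \<nu>(1)[unfolded n_def] in_cone[OF t(2)]]
      by (auto simp: n_def)
  qed (use R C M L in \<open>auto intro!: divide_pos_pos mult_pos_pos add_pos_nonneg\<close>)
  finally show ?thesis .
qed

text \<open>The weight produced by testing has the extra term -\<eta>' phi_\<beta>. It is
  nonnegative, since \<eta> decreases and \<beta> > 0, and may be dropped on the left-hand
  side.\<close>

lemma ineq_wave_u:
  defines "n \<equiv> (real DIM('a) - 1) / 2"
  assumes cut: "cutoff M \<theta> R1 R2 \<eta> \<eta>' \<eta>''" and M: "M > 0" and R: "\<sigma> < R1" "R1 < R2" "ereal (R2 - \<sigma>) < T"
    and \<beta>: "\<beta> > 0" and \<theta>: "1 / p \<le> \<theta>" and C: "C > 0"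
    and phi: "\<And>\<sigma> (x :: 'a) t. (x, t) \<in> light_cone \<sigma> \<Longrightarrow>
      phi \<sigma> (\<beta> + 1) (x, t) \<le> C * (\<sigma> + t) powr - n * (\<sigma> + t - norm x) powr (n - (\<beta> + 1))"
    and \<nu>: "\<beta> + 1 - n = \<nu> * (1 - 1 / p)" "\<nu> \<ge> 0"
    and W: "admissible W" and c0: "c0 > 0"
    and WA: "\<And>x t. 0 < t \<Longrightarrow> norm x \<le> r0 + t \<Longrightarrow> c0 * \<eta> (\<sigma> + t) * (\<sigma> + t) powr - g \<le> W (x, t)"
    and e: "e > 0" and vol: "\<And>\<tau>. \<tau> \<ge> 3 \<Longrightarrow> R1 \<le> \<tau> \<Longrightarrow> \<tau> \<le> R2 \<Longrightarrow>
      \<tau> powr ((- 1 - n + g / p) * (p / (p - 1))) * section_integral TYPE('a) \<nu> \<tau> \<le> e / \<tau>"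
  shows "\<beta> * (\<epsilon> * ((LINT x|lebesgue. g1 x * phi \<sigma> (\<beta> + 1) (x, 0)) + (\<beta> + 1) * (LINT x|lebesgue. f1 x * phi \<sigma> (\<beta> + 2) (x, 0)))
      + I1 (wave_weight \<eta> \<sigma> (\<beta> + 1))) \<le>
    2 * (b * c0) powr (- 1 / p) * (M * (1 + 2 * \<bar>\<beta>\<bar>) * C / ln (R2 / R1)) * I2 W powr (1 / p) * (e * ln (R2 / R1)) powr (1 - 1 / p)"
proof -
  have pos: "0 < R1" "0 < \<sigma>" "\<sigma> < R2" using R \<sigma> by auto
  have L: "ln (R2 / R1) > 0" using R pos by (intro ln_gt_zero) auto
  have tw: "time_weight R2 \<eta> \<eta>' \<eta>''" and \<eta>0: "\<And>\<tau>. \<tau> > 0 \<Longrightarrow> 0 \<le> \<eta> \<tau>" and s: "\<eta> \<sigma> = 1" "\<eta>' \<sigma> = 0"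
    and \<eta>1: "\<And>\<tau>. \<tau> > 0 \<Longrightarrow> \<eta>' \<tau> \<le> 0"
    using cut R(1) pos by (auto simp: cutoff_def)
  have \<sigma>1: "\<sigma> > 1" using \<sigma>(2) by simp
  have "I1 (\<lambda>z. \<beta> * wave_weight \<eta> \<sigma> (\<beta> + 1) z) \<le> I1 (\<lambda>z. \<beta> * wave_weight \<eta> \<sigma> (\<beta> + 1) z - wave_weight \<eta>' \<sigma> \<beta> z)"
  proof (rule I1_mono)
    show "admissible (\<lambda>z. \<beta> * wave_weight \<eta> \<sigma> (\<beta> + 1) z)"
      by (intro admissible_scale admissible_wave_weight(1)[OF tw \<sigma>(1) \<sigma>1 pos(3)])
    show "admissible (\<lambda>z. \<beta> * wave_weight \<eta> \<sigma> (\<beta> + 1) z - wave_weight \<eta>' \<sigma> \<beta> z)"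
      using admissible_scale[OF admissible_wave_weight(2)[OF tw \<sigma>(1) \<sigma>1 pos(3), of \<beta>], of "-1"] by simp
    fix x :: 'a and t :: real assume t: "0 < t" "norm x \<le> r0 + t"
    have "\<eta>' (\<sigma> + t) * phi \<sigma> \<beta> (x, t) \<le> 0"
      using t \<sigma> \<beta> by (intro mult_nonpos_nonneg \<eta>1 phi_nonneg in_cone) auto
    then show "\<beta> * wave_weight \<eta> \<sigma> (\<beta> + 1) (x, t) \<le> \<beta> * wave_weight \<eta> \<sigma> (\<beta> + 1) (x, t) - wave_weight \<eta>' \<sigma> \<beta> (x, t)"
      by (simp add: wave_weight_def)
  qed
  then have "\<beta> * (\<epsilon> * ((LINT x|lebesgue. g1 x * phi \<sigma> (\<beta> + 1) (x, 0)) + (\<beta> + 1) * (LINT x|lebesgue. f1 x * phi \<sigma> (\<beta> + 2) (x, 0)))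
      + I1 (wave_weight \<eta> \<sigma> (\<beta> + 1))) \<le> (LINT t:einterval 0 T|lebesgue. LINT x|lebesgue. time_deriv T u t x *
      (\<lambda>z. wave_weight \<eta>'' \<sigma> \<beta> z - 2 * \<beta> * wave_weight \<eta>' \<sigma> (\<beta> + 1) z) (x, t))"
    using wave_test_u[OF tw \<sigma>(1) \<sigma>1 pos(3) R(3) s(2), of \<beta>] s unfolding I_scale by (simp add: algebra_simps)
  also have "\<dots> \<le> 2 * (b * c0) powr (- 1 / p) * (M * (1 + 2 * \<bar>\<beta>\<bar>) * C / ln (R2 / R1)) * I2 W powr (1 / p) * (e * ln (R2 / R1)) powr (1 - 1 / p)"
  proof (rule holder_u[where \<eta>=\<eta> and h="- 1 - n" and g=g and \<nu>=\<nu>, OF W c0 _ pos(1) _ _ \<nu>(2) e vol order.refl L])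
    fix x :: 'a and t :: real assume t: "0 < t" "norm x \<le> r0 + t"
    have "\<sigma> + t > 0" "\<beta> > -1" using t \<sigma> \<beta> by auto
    then show "0 \<le> \<eta> (\<sigma> + t) \<and> c0 * \<eta> (\<sigma> + t) * (\<sigma> + t) powr - g \<le> W (x, t) \<and>
      \<bar>(\<lambda>z. wave_weight \<eta>'' \<sigma> \<beta> z - 2 * \<beta> * wave_weight \<eta>' \<sigma> (\<beta> + 1) z) (x, t)\<bar> \<le>
        M * (1 + 2 * \<bar>\<beta>\<bar>) * C / ln (R2 / R1) * (\<sigma> + t) powr (- 1 - n) *
        (\<sigma> + t - norm x) powr - (\<nu> * (1 - 1 / p)) * \<eta> (\<sigma> + t) powr (1 / p) * indicator {R1..R2} (\<sigma> + t)"
      using WA[OF t] \<eta>0 \<beta> wave_term_bound[OF cut M pos(1) R(2) _ _ \<theta> C phi[unfolded n_def] \<nu>(1)[unfolded n_def] in_cone[OF t(2)]]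
      by (auto simp: n_def)
  qed (use R C M L \<beta> in \<open>auto intro!: divide_pos_pos mult_pos_pos add_pos_nonneg\<close>)
  finally show ?thesis .
qed

end

section \<open>Constants, power weights and lifespan bounds\<close>

definition holder_constant :: "real \<Rightarrow> real \<Rightarrow> real \<Rightarrow> real \<Rightarrow> real" where
  "holder_constant b p K V = 2 * (b / 2) powr (- 1 / p) * K * V powr (1 - 1 / p)"

lemma holder_constant_pos: "b > 0 \<Longrightarrow> K > 0 \<Longrightarrow> V > 0 \<Longrightarrow> holder_constant b p K V > 0"
  by (simp add: holder_constant_def)

text \<open>A wave term gains 1/L from the cutoff and loses L^(1 - 1/p) from the time integral, in
  total L^(-1/p). A time term with a power weight has no such gain, as the derivative may fall on
  the power. The argument b/2 comes from the lower bound 1/2 in the weights.\<close>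

lemma holder_constant_rearrange:
  assumes "V > 0" "s > 0" "L > 0"
  shows "2 * (b * (1 / 2)) powr (- 1 / p) * (K / L) * Y * (V * s * L) powr (1 - 1 / p) =
    holder_constant b p K V * (s powr (1 - 1 / p) * L powr (- 1 / p)) * Y"
    "2 * (b * (1 / 2)) powr (- 1 / p) * K * Y * (V * s * L) powr (1 - 1 / p) =
    holder_constant b p K V * (s * L) powr (1 - 1 / p) * Y"
proof -
  have "L powr (- 1 / p) = L powr (1 - 1 / p) / L" using assms by (simp add: powr_diff powr_minus_divide)
  then show "2 * (b * (1 / 2)) powr (- 1 / p) * (K / L) * Y * (V * s * L) powr (1 - 1 / p) =
    holder_constant b p K V * (s powr (1 - 1 / p) * L powr (- 1 / p)) * Y"
    using assms by (simp add: holder_constant_def powr_mult mult_ac)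
  show "2 * (b * (1 / 2)) powr (- 1 / p) * K * Y * (V * s * L) powr (1 - 1 / p) =
    holder_constant b p K V * (s * L) powr (1 - 1 / p) * Y"
    using assms by (simp add: holder_constant_def powr_mult mult_ac)
qed

definition phi_bound :: "'a::euclidean_space itself \<Rightarrow> real \<Rightarrow> real \<Rightarrow> bool" where
  "phi_bound _ \<beta> C \<longleftrightarrow> C > 0 \<and> (\<forall>\<sigma> (x :: 'a) t. (x, t) \<in> light_cone \<sigma> \<longrightarrow>
    phi \<sigma> \<beta> (x, t) \<le> C * (\<sigma> + t) powr - ((real DIM('a) - 1) / 2) * (\<sigma> + t - norm x) powr ((real DIM('a) - 1) / 2 - \<beta>))"

lemma phi_bound_exists:
  assumes "\<beta> > (real DIM('a::euclidean_space) - 1) / 2"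
  obtains C where "phi_bound TYPE('a) \<beta> C"
  by (rule phi_le[OF assms], rule that, simp only: phi_bound_def, blast)

text \<open>The derivatives of the power are not confined to the transition zone of the cutoff,
  hence the indicator of {..R2} and no logarithmic gain. The formula before \<open>R1\<close> is
  needed for the data term at \<tau> = \<sigma>.\<close>

lemma cutoff_power_weight:
  assumes cut: "cutoff M \<theta> R1 R2 h h' h''" and M: "M > 0" and R: "0 < R1" "2 * R1 \<le> R2" and \<theta>: "\<theta> \<le> 1"
  obtains H' H'' where "time_weight R2 (\<lambda>\<tau>. \<tau> powr - w * h \<tau>) H' H''"
    "\<And>\<tau>. 0 < \<tau> \<Longrightarrow> \<bar>H' \<tau>\<bar> \<le> (M / ln 2 + \<bar>w\<bar>) * \<tau> powr (- w - 1) * h \<tau> powr \<theta> * indicator {..R2} \<tau>"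
    "\<And>\<tau>. 0 < \<tau> \<Longrightarrow> \<bar>H'' \<tau>\<bar> \<le> (M / ln 2 * (1 + 2 * \<bar>w\<bar>) + \<bar>w * (w + 1)\<bar>) * \<tau> powr (- w - 2) * h \<tau> powr \<theta> * indicator {..R2} \<tau>"
    "\<And>\<tau>. 0 < \<tau> \<Longrightarrow> \<tau> < R1 \<Longrightarrow> H' \<tau> = - w * \<tau> powr (- w - 1)"
proof -
  define m where "m = M / ln 2"
  have "R2 / R1 \<ge> 2" using R by (simp add: pos_le_divide_eq)
  then have "ln 2 \<le> ln (R2 / R1)" by simp
  then have L: "M / ln (R2 / R1) \<le> m"
    unfolding m_def using M by (intro frac_le) auto
  define H' where "H' \<tau> = \<tau> powr - w * h' \<tau> - w * \<tau> powr (- w - 1) * h \<tau>" for \<tau>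
  define H'' where "H'' \<tau> = \<tau> powr - w * h'' \<tau> - 2 * w * \<tau> powr (- w - 1) * h' \<tau> + w * (w + 1) * \<tau> powr (- w - 2) * h \<tau>" for \<tau>
  have tw: "smooth_on {0<..} h" "\<And>\<tau>. \<tau> > 0 \<Longrightarrow> (h has_field_derivative h' \<tau>) (at \<tau>)"
    "\<And>\<tau>. \<tau> > 0 \<Longrightarrow> (h' has_field_derivative h'' \<tau>) (at \<tau>)" "\<And>\<tau>. \<tau> \<ge> R2 \<Longrightarrow> h \<tau> = 0"
    using cut unfolding cutoff_def time_weight_def by blast+
  have h: "0 \<le> h \<tau>" "h \<tau> \<le> 1" "\<bar>h' \<tau>\<bar> \<le> m / \<tau> * h \<tau> powr \<theta>" "\<bar>h'' \<tau>\<bar> \<le> m / \<tau>\<^sup>2 * h \<tau> powr \<theta>" "h \<tau> \<le> h \<tau> powr \<theta>"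
    "\<tau> > R2 \<Longrightarrow> h' \<tau> = 0 \<and> h'' \<tau> = 0" "\<tau> < R1 \<Longrightarrow> h' \<tau> = 0" "\<tau> \<le> R1 \<Longrightarrow> h \<tau> = 1" if \<tau>: "\<tau> > 0" for \<tau>
  proof -
    show "0 \<le> h \<tau>" "h \<tau> \<le> 1" "\<tau> > R2 \<Longrightarrow> h' \<tau> = 0 \<and> h'' \<tau> = 0" "\<tau> < R1 \<Longrightarrow> h' \<tau> = 0" "\<tau> \<le> R1 \<Longrightarrow> h \<tau> = 1"
      using cut \<tau> by (auto simp: cutoff_def)
    then show "h \<tau> \<le> h \<tau> powr \<theta>" using powr_le_powr_exponent[of "h \<tau>" \<theta> 1] \<theta> by simp
    have "\<bar>h' \<tau>\<bar> \<le> M / ln (R2 / R1) / \<tau> * h \<tau> powr \<theta>" "\<bar>h'' \<tau>\<bar> \<le> M / ln (R2 / R1) / \<tau>\<^sup>2 * h \<tau> powr \<theta>"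
      using cut \<tau> by (auto simp: cutoff_def)
    moreover have "M / ln (R2 / R1) / \<tau> * h \<tau> powr \<theta> \<le> m / \<tau> * h \<tau> powr \<theta>"
      "M / ln (R2 / R1) / \<tau>\<^sup>2 * h \<tau> powr \<theta> \<le> m / \<tau>\<^sup>2 * h \<tau> powr \<theta>"
      by (rule mult_right_mono[OF divide_right_mono[OF L(1)]]; use \<tau> in simp)+
    ultimately show "\<bar>h' \<tau>\<bar> \<le> m / \<tau> * h \<tau> powr \<theta>" "\<bar>h'' \<tau>\<bar> \<le> m / \<tau>\<^sup>2 * h \<tau> powr \<theta>" by linarith+
  qed
  have powers: "\<tau> powr (- w - 1) = \<tau> powr - w / \<tau>" "\<tau> powr (- w - 2) = \<tau> powr - w / \<tau>\<^sup>2" if "\<tau> > 0" for \<tau>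
    using that by (simp_all add: powr_diff flip: powr_numeral)
  show thesis
  proof
    have "((\<lambda>\<tau>. \<tau> powr - w * h \<tau>) has_field_derivative H' \<tau>) (at \<tau>)" if "\<tau> > 0" for \<tau>
      using that by (auto intro!: derivative_eq_intros tw(2) simp: H'_def)
    moreover have "(H' has_field_derivative H'' \<tau>) (at \<tau>)" if "\<tau> > 0" for \<tau>
      unfolding H'_def using that
      by (auto intro!: derivative_eq_intros tw(2,3) simp: H''_def algebra_simps)
    ultimately show "time_weight R2 (\<lambda>\<tau>. \<tau> powr - w * h \<tau>) H' H''"
      unfolding time_weight_def using tw(1,4) by (auto intro!: smooth_on_mult smooth_on_powr)
    fix \<tau> :: real assume \<tau>: "0 < \<tau>"
    show "H' \<tau> = - w * \<tau> powr (- w - 1)" if "\<tau> < R1" using h(7,8)[OF \<tau>] that by (simp add: H'_def)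
    define P where "P = \<tau> powr - w * h \<tau> powr \<theta>"
    have P: "P \<ge> 0" "\<tau> powr - w * h \<tau> \<le> P" using h(5)[OF \<tau>] by (auto simp: P_def intro!: mult_left_mono)
    have P1: "\<tau> powr - w * \<bar>h' \<tau>\<bar> \<le> m / \<tau> * P"
      using mult_left_mono[OF h(3)[OF \<tau>], of "\<tau> powr - w"] by (simp add: P_def mult_ac)
    have P2: "\<tau> powr - w * \<bar>h'' \<tau>\<bar> \<le> m / \<tau>\<^sup>2 * P"
      using mult_left_mono[OF h(4)[OF \<tau>], of "\<tau> powr - w"] by (simp add: P_def mult_ac)
    have zero: "H' \<tau> = 0 \<and> H'' \<tau> = 0" if "\<tau> > R2"
      using h(6)[OF \<tau> that] tw(4)[of \<tau>] that by (simp add: H'_def H''_def)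
    have "\<bar>H' \<tau>\<bar> \<le> \<tau> powr - w * \<bar>h' \<tau>\<bar> + \<bar>w\<bar> / \<tau> * (\<tau> powr - w * h \<tau>)"
      using \<tau> h(1)[OF \<tau>] unfolding H'_def powers[OF \<tau>]
      by (intro order.trans[OF abs_triangle_ineq4]) (simp add: abs_mult)
    also have "\<dots> \<le> m / \<tau> * P + \<bar>w\<bar> / \<tau> * P"
      using P P1 \<tau> by (intro add_mono mult_left_mono) auto
    also have "\<dots> = (m + \<bar>w\<bar>) * \<tau> powr (- w - 1) * h \<tau> powr \<theta>"
      using \<tau> unfolding powers[OF \<tau>] by (simp add: P_def add_divide_distrib distrib_right)
    finally show "\<bar>H' \<tau>\<bar> \<le> (M / ln 2 + \<bar>w\<bar>) * \<tau> powr (- w - 1) * h \<tau> powr \<theta> * indicator {..R2} \<tau>"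
      using zero by (cases "\<tau> > R2") (auto simp: m_def)
    have "\<bar>H'' \<tau>\<bar> \<le> \<tau> powr - w * \<bar>h'' \<tau>\<bar> + 2 * \<bar>w\<bar> / \<tau> * (\<tau> powr - w * \<bar>h' \<tau>\<bar>) + \<bar>w * (w + 1)\<bar> / \<tau>\<^sup>2 * (\<tau> powr - w * h \<tau>)"
      using \<tau> h(1)[OF \<tau>] unfolding H''_def powers[OF \<tau>]
      by (intro order.trans[OF abs_triangle_ineq] add_mono order.trans[OF abs_triangle_ineq4]) (simp_all add: abs_mult)
    also have "\<dots> \<le> m / \<tau>\<^sup>2 * P + 2 * \<bar>w\<bar> / \<tau> * (m / \<tau> * P) + \<bar>w * (w + 1)\<bar> / \<tau>\<^sup>2 * P"
      using P P1 P2 \<tau> by (intro add_mono mult_left_mono) auto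
    also have "\<dots> = (m * (1 + 2 * \<bar>w\<bar>) + \<bar>w * (w + 1)\<bar>) * \<tau> powr (- w - 2) * h \<tau> powr \<theta>"
      using \<tau> unfolding powers[OF \<tau>] P_def by (simp add: field_simps power2_eq_square)
    finally show "\<bar>H'' \<tau>\<bar> \<le> (M / ln 2 * (1 + 2 * \<bar>w\<bar>) + \<bar>w * (w + 1)\<bar>) * \<tau> powr (- w - 2) * h \<tau> powr \<theta> * indicator {..R2} \<tau>"
      using zero by (cases "\<tau> > R2") (auto simp: m_def)
  qed
qed

text \<open>If T exceeded B, a real number strictly between them would be a permitted scale R, even
  for infinite T.\<close>

lemma lifespan_le:
  assumes "\<And>R. R0 \<le> R \<Longrightarrow> ereal (R - \<sigma>) < T \<Longrightarrow> R \<le> B" "R0 \<le> B" "\<sigma> \<ge> 0"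
  shows "T \<le> ereal B"
proof (rule ccontr)
  assume "\<not> T \<le> ereal B"
  then obtain r where r: "ereal B < ereal r" "ereal r < T" using ereal_dense2[of "ereal B" T] by (auto simp: not_le)
  then have "ereal (r - \<sigma>) < T" using assms(3) by (intro le_less_trans[OF _ r(2)]) auto
  then show False using assms(1)[of r] r(1) assms(2) by simp
qed

text \<open>Scales below \<open>R0\<close> give no information; the constant is enlarged to cover
  \<open>R0\<close>, which works because \<epsilon> \<le> 1 makes the power of \<epsilon> at least
  1.\<close>

lemma lifespan_power:
  assumes \<epsilon>: "0 < \<epsilon>" "\<epsilon> \<le> 1" and pos: "\<Gamma> > 0" "\<alpha> > 0" "K > 0" "R0 > 0" "\<sigma> \<ge> 0"
    and bound: "\<And>R. R0 \<le> R \<Longrightarrow> ereal (R - \<sigma>) < T \<Longrightarrow> \<epsilon> powr \<alpha> \<le> K * R powr - (\<Gamma> * \<alpha>)"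
  shows "T \<le> ereal (max R0 (K powr (1 / (\<Gamma> * \<alpha>))) * \<epsilon> powr (- inverse \<Gamma>))"
proof (rule lifespan_le[OF _ _ pos(5)])
  define C where "C = max R0 (K powr (1 / (\<Gamma> * \<alpha>)))"
  have \<epsilon>1: "1 \<le> \<epsilon> powr (- inverse \<Gamma>)"
    using powr_mono'[of "- inverse \<Gamma>" 0 \<epsilon>] \<epsilon> pos by simp
  show "R0 \<le> C * \<epsilon> powr (- inverse \<Gamma>)"
    using mult_mono[of R0 C 1 "\<epsilon> powr (- inverse \<Gamma>)"] \<epsilon>1 pos(4) by (simp add: C_def)
  fix R assume R: "R0 \<le> R" "ereal (R - \<sigma>) < T"
  have R_pos: "R > 0" using R(1) pos(4) by simp
  have "R powr (\<Gamma> * \<alpha>) \<le> K * \<epsilon> powr - \<alpha>"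
    using bound[OF R] R_pos \<epsilon> by (simp add: powr_minus field_simps)
  then have "(R powr (\<Gamma> * \<alpha>)) powr (1 / (\<Gamma> * \<alpha>)) \<le> (K * \<epsilon> powr - \<alpha>) powr (1 / (\<Gamma> * \<alpha>))"
    using pos by (intro powr_mono2) auto
  also have "(R powr (\<Gamma> * \<alpha>)) powr (1 / (\<Gamma> * \<alpha>)) = R" using R_pos pos by (simp add: powr_powr)
  also have "(K * \<epsilon> powr - \<alpha>) powr (1 / (\<Gamma> * \<alpha>)) = K powr (1 / (\<Gamma> * \<alpha>)) * \<epsilon> powr (- inverse \<Gamma>)"
    using pos \<epsilon> by (simp add: powr_mult powr_powr field_simps)
  also have "\<dots> \<le> C * \<epsilon> powr (- inverse \<Gamma>)" by (intro mult_right_mono) (auto simp: C_def)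
  finally show "R \<le> C * \<epsilon> powr (- inverse \<Gamma>)" .
qed

text \<open>The inequality itself yields the exponent \<alpha>/\<delta>; passing to a larger
  \<kappa> is possible as \<epsilon> \<le> 1 and is used when both F vanish.\<close>

lemma lifespan_exp:
  assumes \<epsilon>: "0 < \<epsilon>" "\<epsilon> \<le> 1" and pos: "\<delta> > 0" "\<alpha> > 0" "K > 0" "R0 > 1" "\<sigma> \<ge> 0" and \<kappa>: "\<alpha> / \<delta> \<le> \<kappa>"
    and bound: "\<And>R. R0 \<le> R \<Longrightarrow> ereal (R - \<sigma>) < T \<Longrightarrow> \<epsilon> powr \<alpha> \<le> K * (ln R / 2) powr - \<delta>"
  shows "T \<le> ereal (exp (max (ln R0) (2 * K powr (1 / \<delta>)) * \<epsilon> powr (- \<kappa>)))"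
proof (rule lifespan_le[OF _ _ pos(5)])
  define C where "C = max (ln R0) (2 * K powr (1 / \<delta>))"
  have "0 < \<alpha> / \<delta>" using pos by simp
  then have \<epsilon>1: "1 \<le> \<epsilon> powr - \<kappa>" using powr_mono'[of "- \<kappa>" 0 \<epsilon>] \<epsilon> \<kappa> by simp
  have "ln R0 \<le> C * \<epsilon> powr - \<kappa>"
    using mult_mono[of "ln R0" C 1 "\<epsilon> powr - \<kappa>"] \<epsilon>1 pos(4) by (simp add: C_def le_max_iff_disj)
  then show "R0 \<le> exp (C * \<epsilon> powr - \<kappa>)" using exp_le_cancel_iff[of "ln R0" "C * \<epsilon> powr - \<kappa>"] pos(4) by simp
  fix R assume R: "R0 \<le> R" "ereal (R - \<sigma>) < T"
  define L where "L = ln R / 2"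
  have R_pos: "R > 0" and L: "L > 0" using R(1) pos(4) by (auto simp: L_def)
  have "L powr \<delta> \<le> K * \<epsilon> powr - \<alpha>"
    using bound[OF R] L \<epsilon> unfolding L_def[symmetric] by (simp add: powr_minus field_simps)
  then have "(L powr \<delta>) powr (1 / \<delta>) \<le> (K * \<epsilon> powr - \<alpha>) powr (1 / \<delta>)"
    using pos by (intro powr_mono2) auto
  also have "(L powr \<delta>) powr (1 / \<delta>) = L" using L pos by (simp add: powr_powr)
  also have "(K * \<epsilon> powr - \<alpha>) powr (1 / \<delta>) = K powr (1 / \<delta>) * \<epsilon> powr (- (\<alpha> / \<delta>))"
    using pos \<epsilon> by (simp add: powr_mult powr_powr)
  also have "\<dots> \<le> K powr (1 / \<delta>) * \<epsilon> powr - \<kappa>" using \<epsilon> \<kappa> by (intro mult_left_mono powr_mono') auto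
  finally have "ln R \<le> 2 * K powr (1 / \<delta>) * \<epsilon> powr - \<kappa>" by (simp add: L_def)
  also have "\<dots> \<le> C * \<epsilon> powr - \<kappa>" by (intro mult_right_mono) (auto simp: C_def)
  finally show "R \<le> exp (C * \<epsilon> powr - \<kappa>)" using exp_le_cancel_iff[of "ln R" "C * \<epsilon> powr - \<kappa>"] R_pos by simp
qed

section \<open>The four basic estimates\<close>

context power_cone_solution
begin

text \<open>The common interface of wave weights and power weights. The factor 1/2 is the one lost
  in \<open>phi_ge\<close>.\<close>

definition weight :: "(real \<Rightarrow> real) \<Rightarrow> real \<Rightarrow> ('a \<times> real \<Rightarrow> real) \<Rightarrow> bool" where
  "weight \<eta> g W \<longleftrightarrow> admissible W \<and> (\<forall>x t. 0 < t \<longrightarrow> norm x \<le> r0 + t \<longrightarrow>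
     0 \<le> \<eta> (\<sigma> + t) \<and> 1 / 2 * \<eta> (\<sigma> + t) * (\<sigma> + t) powr - g \<le> W (x, t))"

lemma weight_nonneg: "weight \<eta> g W \<Longrightarrow> 0 \<le> I1 W \<and> 0 \<le> I2 W"
proof -
  assume W: "weight \<eta> g W"
  have "0 \<le> W (x, t)" if "0 < t" "norm x \<le> r0 + t" for x t
    by (rule order.trans[of _ "1 / 2 * \<eta> (\<sigma> + t) * (\<sigma> + t) powr - g"]) (use W that in \<open>auto simp: weight_def\<close>)
  then show ?thesis by (intro conjI I_nonneg)
qed

lemma weight_wave:
  assumes "cutoff M \<theta> R1 R2 \<eta> \<eta>' \<eta>''" "\<sigma> < R2" "\<beta> > -1" "\<beta> \<ge> 0 \<or> DIM('a) \<ge> 2"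
  shows "weight \<eta> \<beta> (wave_weight \<eta> \<sigma> \<beta>)"
  unfolding weight_def
proof (intro conjI allI impI)
  show "admissible (wave_weight \<eta> \<sigma> \<beta>)"
    by (rule admissible_wave_weight(1)[OF _ \<sigma>(1)]) (use assms(1,2) \<sigma>(2) in \<open>auto simp: cutoff_def\<close>)
  fix x :: 'a and t :: real assume t: "0 < t" "norm x \<le> r0 + t"
  show \<eta>: "0 \<le> \<eta> (\<sigma> + t)" using assms(1) t \<sigma>(2) by (auto simp: cutoff_def)
  show "1 / 2 * \<eta> (\<sigma> + t) * (\<sigma> + t) powr - \<beta> \<le> wave_weight \<eta> \<sigma> \<beta> (x, t)"
    using mult_left_mono[OF phi_ge[OF in_cone[OF t(2)] assms(3,4)] \<eta>] by (simp add: wave_weight_def mult_ac)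
qed

lemma weight_power:
  assumes cut: "cutoff M \<theta> R1 R2 \<eta> \<eta>' \<eta>''" "\<sigma> < R2" and H: "time_weight R2 (\<lambda>\<tau>. \<tau> powr - g * \<eta> \<tau>) H' H''"
  shows "weight \<eta> g (wave_weight (\<lambda>\<tau>. \<tau> powr - g * \<eta> \<tau>) \<sigma> 0)"
  unfolding weight_def
proof (intro conjI allI impI)
  show "admissible (wave_weight (\<lambda>\<tau>. \<tau> powr - g * \<eta> \<tau>) \<sigma> 0)"
    by (rule admissible_wave_weight(1)[OF H \<sigma>(1)]) (use cut(2) \<sigma>(2) in auto)
  fix x :: 'a and t :: real assume t: "0 < t" "norm x \<le> r0 + t"
  show \<eta>: "0 \<le> \<eta> (\<sigma> + t)" using cut t \<sigma>(2) by (auto simp: cutoff_def)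
  then show "1 / 2 * \<eta> (\<sigma> + t) * (\<sigma> + t) powr - g \<le> wave_weight (\<lambda>\<tau>. \<tau> powr - g * \<eta> \<tau>) \<sigma> 0 (x, t)"
    by (simp add: wave_weight_def phi_0[OF in_cone[OF t(2)]] mult_ac)
qed

lemma wave_estimate_v:
  defines "n \<equiv> (real DIM('a) - 1) / 2"
  assumes cut: "cutoff M \<theta> R1 R2 \<eta> \<eta>' \<eta>''" and M: "M > 0" and R: "\<sigma> < R1" "R1 < R2" "ereal (R2 - \<sigma>) < T"
    and \<beta>: "\<beta> > -1" "\<beta> \<ge> 0 \<or> DIM('a) \<ge> 2" and \<theta>: "1 / q \<le> \<theta>" and C: "phi_bound TYPE('a) (\<beta> + 1) C"
    and \<nu>: "\<beta> + 1 - n = \<nu> * (1 - 1 / q)" "\<nu> \<ge> 0" and W: "weight \<eta> g W" and V: "V > 0" "s > 0"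
    and vol: "\<And>\<tau>. \<tau> \<ge> 3 \<Longrightarrow> R1 \<le> \<tau> \<Longrightarrow> \<tau> \<le> R2 \<Longrightarrow>
      \<tau> powr ((- 1 - n + g / q) * (q / (q - 1))) * section_integral TYPE('a) \<nu> \<tau> \<le> V * s / \<tau>"
  shows "\<epsilon> * ((LINT x|lebesgue. g2 x * phi \<sigma> \<beta> (x, 0)) + \<beta> * (LINT x|lebesgue. f2 x * phi \<sigma> (\<beta> + 1) (x, 0)))
      + I2 (wave_weight \<eta> \<sigma> \<beta>) \<le>
    holder_constant a q (M * (1 + 2 * \<bar>\<beta>\<bar>) * C) V * (s powr (1 - 1 / q) * ln (R2 / R1) powr (- 1 / q)) * I1 W powr (1 / q)"
proof -
  have L: "ln (R2 / R1) > 0" using R \<sigma> by (intro ln_gt_zero) auto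
  have Vs: "V * s > 0" using V by simp
  have c: "(0::real) < 1 / 2" by simp
  from W have W1: "admissible W" and W2: "1 / 2 * \<eta> (\<sigma> + t) * (\<sigma> + t) powr - g \<le> W (x, t)"
    if "0 < t" "norm x \<le> r0 + t" for x t using that by (auto simp: weight_def)
  have "\<epsilon> * ((LINT x|lebesgue. g2 x * phi \<sigma> \<beta> (x, 0)) + \<beta> * (LINT x|lebesgue. f2 x * phi \<sigma> (\<beta> + 1) (x, 0)))
      + I2 (wave_weight \<eta> \<sigma> \<beta>) \<le>
    2 * (a * (1 / 2)) powr (- 1 / q) * (M * (1 + 2 * \<bar>\<beta>\<bar>) * C / ln (R2 / R1)) * I1 W powr (1 / q) * (V * s * ln (R2 / R1)) powr (1 - 1 / q)"
    by (rule ineq_wave_v[OF cut M R \<beta> \<theta> _ _ _ \<nu>(2) _ c W2 Vs vol[unfolded n_def]])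
      (use C \<nu>(1) W in \<open>auto simp: phi_bound_def n_def weight_def\<close>)
  then show ?thesis unfolding holder_constant_rearrange(1)[OF V L] .
qed

lemma wave_estimate_u:
  defines "n \<equiv> (real DIM('a) - 1) / 2"
  assumes cut: "cutoff M \<theta> R1 R2 \<eta> \<eta>' \<eta>''" and M: "M > 0" and R: "\<sigma> < R1" "R1 < R2" "ereal (R2 - \<sigma>) < T"
    and \<beta>: "\<beta> > 0" and \<theta>: "1 / p \<le> \<theta>" and C: "phi_bound TYPE('a) (\<beta> + 1) C"
    and \<nu>: "\<beta> + 1 - n = \<nu> * (1 - 1 / p)" "\<nu> \<ge> 0" and W: "weight \<eta> g W" and V: "V > 0" "s > 0"
    and vol: "\<And>\<tau>. \<tau> \<ge> 3 \<Longrightarrow> R1 \<le> \<tau> \<Longrightarrow> \<tau> \<le> R2 \<Longrightarrow>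
      \<tau> powr ((- 1 - n + g / p) * (p / (p - 1))) * section_integral TYPE('a) \<nu> \<tau> \<le> V * s / \<tau>"
  shows "\<beta> * (\<epsilon> * ((LINT x|lebesgue. g1 x * phi \<sigma> (\<beta> + 1) (x, 0)) + (\<beta> + 1) * (LINT x|lebesgue. f1 x * phi \<sigma> (\<beta> + 2) (x, 0)))
      + I1 (wave_weight \<eta> \<sigma> (\<beta> + 1))) \<le>
    holder_constant b p (M * (1 + 2 * \<bar>\<beta>\<bar>) * C) V * (s powr (1 - 1 / p) * ln (R2 / R1) powr (- 1 / p)) * I2 W powr (1 / p)"
proof -
  have L: "ln (R2 / R1) > 0" using R \<sigma> by (intro ln_gt_zero) auto
  have Vs: "V * s > 0" using V by simp
  have c: "(0::real) < 1 / 2" by simp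
  from W have W2: "1 / 2 * \<eta> (\<sigma> + t) * (\<sigma> + t) powr - g \<le> W (x, t)"
    if "0 < t" "norm x \<le> r0 + t" for x t using that by (auto simp: weight_def)
  have "\<beta> * (\<epsilon> * ((LINT x|lebesgue. g1 x * phi \<sigma> (\<beta> + 1) (x, 0)) + (\<beta> + 1) * (LINT x|lebesgue. f1 x * phi \<sigma> (\<beta> + 2) (x, 0)))
      + I1 (wave_weight \<eta> \<sigma> (\<beta> + 1))) \<le>
    2 * (b * (1 / 2)) powr (- 1 / p) * (M * (1 + 2 * \<bar>\<beta>\<bar>) * C / ln (R2 / R1)) * I2 W powr (1 / p) * (V * s * ln (R2 / R1)) powr (1 - 1 / p)"
    by (rule ineq_wave_u[OF cut M R \<beta> \<theta> _ _ _ \<nu>(2) _ c W2 Vs vol[unfolded n_def]])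
      (use C \<nu>(1) W in \<open>auto simp: phi_bound_def n_def weight_def\<close>)
  then show ?thesis unfolding holder_constant_rearrange(1)[OF V L] .
qed

lemma time_estimate_u:
  assumes H: "time_weight R2 H H' H''" and R: "\<sigma> < R2" "ereal (R2 - \<sigma>) < T" and W: "weight \<eta> g W"
    and A: "\<And>\<tau>. \<tau> > \<sigma> \<Longrightarrow> \<bar>H' \<tau>\<bar> \<le> K * \<tau> powr h * \<eta> \<tau> powr (1 / p) * indicator {J1..J2} \<tau>"
    and J: "0 < J1" "J1 \<le> J2" "K > 0" and V: "V > 0" "s > 0"
    and vol: "\<And>\<tau>. \<tau> \<ge> 3 \<Longrightarrow> J1 \<le> \<tau> \<Longrightarrow> \<tau> \<le> J2 \<Longrightarrow>
      \<tau> powr ((h + g / p) * (p / (p - 1))) * section_integral TYPE('a) 0 \<tau> \<le> V * s / \<tau>"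
    and \<Lambda>: "ln (J2 / J1) \<le> \<Lambda>" "\<Lambda> > 0"
    and data: "0 \<le> \<epsilon> * H \<sigma> * (LINT x|lebesgue. g1 x)"
  shows "I1 (wave_weight H \<sigma> 0) \<le> holder_constant b p K V * (s * \<Lambda>) powr (1 - 1 / p) * I2 W powr (1 / p)"
proof -
  have "I1 (wave_weight H \<sigma> 0) \<le> 2 * (b * (1 / 2)) powr (- 1 / p) * K * I2 W powr (1 / p) * (V * s * \<Lambda>) powr (1 - 1 / p)"
    by (rule ineq_time_u[OF H R _ _ _ A J _ vol \<Lambda> data]) (use W V in \<open>auto simp: weight_def\<close>)
  then show ?thesis unfolding holder_constant_rearrange(2)[OF V \<Lambda>(2)] .
qed

lemma time_estimate_v:
  assumes H: "time_weight R2 H H' H''" and R: "\<sigma> < R2" "ereal (R2 - \<sigma>) < T" and W: "weight \<eta> g W"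
    and A: "\<And>\<tau>. \<tau> > \<sigma> \<Longrightarrow> \<bar>H'' \<tau>\<bar> \<le> K * \<tau> powr h * \<eta> \<tau> powr (1 / q) * indicator {J1..J2} \<tau>"
    and J: "0 < J1" "J1 \<le> J2" "K > 0" and V: "V > 0" "s > 0"
    and vol: "\<And>\<tau>. \<tau> \<ge> 3 \<Longrightarrow> J1 \<le> \<tau> \<Longrightarrow> \<tau> \<le> J2 \<Longrightarrow>
      \<tau> powr ((h + g / q) * (q / (q - 1))) * section_integral TYPE('a) 0 \<tau> \<le> V * s / \<tau>"
    and \<Lambda>: "ln (J2 / J1) \<le> \<Lambda>" "\<Lambda> > 0"
    and data: "0 \<le> \<epsilon> * (H \<sigma> * (LINT x|lebesgue. g2 x) - H' \<sigma> * (LINT x|lebesgue. f2 x))"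
  shows "I2 (wave_weight H \<sigma> 0) \<le> holder_constant a q K V * (s * \<Lambda>) powr (1 - 1 / q) * I1 W powr (1 / q)"
proof -
  have "I2 (wave_weight H \<sigma> 0) \<le> 2 * (a * (1 / 2)) powr (- 1 / q) * K * I1 W powr (1 / q) * (V * s * \<Lambda>) powr (1 - 1 / q)"
    by (rule ineq_time_v[OF H R _ _ _ A J _ vol \<Lambda> data]) (use W V in \<open>auto simp: weight_def\<close>)
  then show ?thesis unfolding holder_constant_rearrange(2)[OF V \<Lambda>(2)] .
qed

end

section \<open>Dyadic cutoffs\<close>

text \<open>The shape V s / \<tau> is the one that \<open>weighted_holder\<close> asks for. The
  parameter s will be a power of R for dyadic cutoffs, and 1 or ln R for logarithmic ones.\<close>

lemma weighted_section_bounds: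
  obtains V where "V > 0"
    "\<And>\<tau> k s. \<tau> \<ge> 3 \<Longrightarrow> \<tau> powr (k + real DIM('a) + 1) \<le> s \<Longrightarrow>
      \<tau> powr k * section_integral TYPE('a::euclidean_space) 0 \<tau> \<le> V * s / \<tau>"
    "\<And>\<tau> k s. \<tau> \<ge> 3 \<Longrightarrow> k + real DIM('a) = 0 \<Longrightarrow> ln \<tau> \<le> s \<Longrightarrow> \<tau> powr k * section_integral TYPE('a) 1 \<tau> \<le> V * s / \<tau>"
    "\<And>\<tau> \<nu> k s. \<tau> \<ge> 3 \<Longrightarrow> \<nu> \<ge> 2 \<Longrightarrow> \<tau> powr (k + real DIM('a)) \<le> s \<Longrightarrow>
      \<tau> powr k * section_integral TYPE('a) \<nu> \<tau> \<le> V * s / \<tau>"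
proof -
  let ?N = "real DIM('a)"
  obtain V where V: "V > 0"
    "\<And>\<tau>. \<tau> \<ge> 3 \<Longrightarrow> section_integral TYPE('a) 0 \<tau> \<le> V * \<tau> powr ?N"
    "\<And>\<tau>. \<tau> \<ge> 3 \<Longrightarrow> section_integral TYPE('a) 1 \<tau> \<le> V * \<tau> powr (?N - 1) * ln \<tau>"
    "\<And>\<tau> \<nu>. \<tau> \<ge> 3 \<Longrightarrow> \<nu> \<ge> 2 \<Longrightarrow> section_integral TYPE('a) \<nu> \<tau> \<le> V * \<tau> powr (?N - 1)"
    by (rule section_integral_bounds[where 'a='a], rule that)
  show thesis
  proof (rule that[OF V(1)])
    fix \<tau> k s :: real assume \<tau>: "\<tau> \<ge> 3" and s: "\<tau> powr (k + ?N + 1) \<le> s"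
    have "\<tau> powr k * section_integral TYPE('a) 0 \<tau> \<le> \<tau> powr k * (V * \<tau> powr ?N)"
      by (intro mult_left_mono V(2) \<tau>) auto
    also have "\<dots> = V * \<tau> powr (k + ?N + 1) / \<tau>" using \<tau> by (simp add: powr_add)
    also have "\<dots> \<le> V * s / \<tau>" using s V(1) \<tau> by (intro divide_right_mono mult_left_mono) auto
    finally show "\<tau> powr k * section_integral TYPE('a) 0 \<tau> \<le> V * s / \<tau>" .
  next
    fix \<tau> k s :: real assume \<tau>: "\<tau> \<ge> 3" and k: "k + ?N = 0" and s: "ln \<tau> \<le> s"
    have "\<tau> powr k * section_integral TYPE('a) 1 \<tau> \<le> \<tau> powr k * (V * \<tau> powr (?N - 1) * ln \<tau>)"
      by (intro mult_left_mono V(3) \<tau>) auto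
    also have "\<dots> = V * ln \<tau> * (\<tau> powr k * \<tau> powr (?N - 1))" by (simp only: mult_ac)
    also have "\<tau> powr k * \<tau> powr (?N - 1) = \<tau> powr -1"
      using k by (simp only: powr_add[symmetric]) (simp add: algebra_simps)
    also have "V * ln \<tau> * \<tau> powr -1 = V * ln \<tau> / \<tau>" using \<tau> by (simp add: powr_minus_divide)
    also have "\<dots> \<le> V * s / \<tau>" using s V(1) \<tau> by (intro divide_right_mono mult_left_mono) auto
    finally show "\<tau> powr k * section_integral TYPE('a) 1 \<tau> \<le> V * s / \<tau>" .
  next
    fix \<tau> \<nu> k s :: real assume \<tau>: "\<tau> \<ge> 3" and \<nu>: "\<nu> \<ge> 2" and s: "\<tau> powr (k + ?N) \<le> s"
    have "\<tau> powr k * section_integral TYPE('a) \<nu> \<tau> \<le> \<tau> powr k * (V * \<tau> powr (?N - 1))"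
      by (intro mult_left_mono V(4) \<tau> \<nu>) auto
    also have "\<dots> = V * \<tau> powr (k + ?N) / \<tau>" using \<tau> by (simp add: powr_add powr_diff)
    also have "\<dots> \<le> V * s / \<tau>" using s V(1) \<tau> by (intro divide_right_mono mult_left_mono) auto
    finally show "\<tau> powr k * section_integral TYPE('a) \<nu> \<tau> \<le> V * s / \<tau>" .
  qed
qed

lemma dyadic_powr_le:
  fixes \<tau> R E :: real
  assumes "R > 0" "R / 2 \<le> \<tau>" "\<tau> \<le> R"
  shows "\<tau> powr E \<le> 2 powr \<bar>E\<bar> * R powr E"
proof (cases "E \<ge> 0")
  case True
  have "\<tau> powr E \<le> 1 * R powr E" using assms True by (auto intro!: powr_mono2)
  also have "\<dots> \<le> 2 powr \<bar>E\<bar> * R powr E" by (intro mult_right_mono ge_one_powr_ge_zero) auto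
  finally show ?thesis .
next
  case False
  have "\<tau> powr E \<le> (R / 2) powr E" using assms False by (intro powr_mono2') auto
  also have "\<dots> = 2 powr \<bar>E\<bar> * R powr E" using assms False by (simp add: powr_divide powr_minus_divide)
  finally show ?thesis .
qed

lemma Cc_infinity_integrable:
  assumes "f \<in> Cc_infinity"
  shows "integrable lebesgue (f :: 'a::euclidean_space \<Rightarrow> real)"
proof -
  obtain r where r: "smooth_on UNIV f" "\<And>x. norm x > r \<Longrightarrow> f x = 0" using assms unfolding Cc_infinity_iff by blast
  have "continuous_on (cball 0 r) f"
    by (rule continuous_on_subset[OF smooth_on_continuous_on[OF r(1)]]) simp
  then have "integrable lborel (\<lambda>x. indicator (cball 0 r) x *\<^sub>R f x)"
    by (intro borel_integrable_compact) auto
  moreover have "indicator (cball 0 r) x *\<^sub>R f x = f x" for x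
    using r(2)[of x] by (cases "norm x > r") auto
  ultimately have "integrable lborel f" by (simp only:)
  then show ?thesis using integrable_completion[OF borel_measurable_integrable] by blast
qed

text \<open>Both terms on the left are nonnegative, so one test gives a bound for \<epsilon> and one
  for the weighted integral.\<close>

lemma estimate_split:
  fixes \<beta> D X \<epsilon> A s Y :: real
  assumes pos: "\<beta> > 0" "D > 0" "X \<ge> 0" "\<epsilon> \<ge> 0" and le: "\<beta> * (\<epsilon> * D + X) \<le> A * s * Y"
  shows "\<epsilon> \<le> A / (\<beta> * D) * s * Y" "X \<le> A / \<beta> * s * Y"
proof -
  have "\<epsilon> * (\<beta> * D) \<le> \<beta> * (\<epsilon> * D + X)" "X * \<beta> \<le> \<beta> * (\<epsilon> * D + X)" using pos by (auto simp: algebra_simps)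
  then have 1: "\<epsilon> * (\<beta> * D) \<le> A * s * Y" "X * \<beta> \<le> A * s * Y" using le by linarith+
  have "\<epsilon> \<le> A * s * Y / (\<beta> * D)" using 1(1) pos by (subst pos_le_divide_eq) auto
  then show "\<epsilon> \<le> A / (\<beta> * D) * s * Y" by simp
  have "X \<le> A * s * Y / \<beta>" using 1(2) pos by (subst pos_le_divide_eq) auto
  then show "X \<le> A / \<beta> * s * Y" by simp
qed

definition wave_data :: "('a::euclidean_space \<Rightarrow> real) \<Rightarrow> ('a \<Rightarrow> real) \<Rightarrow> real \<Rightarrow> real \<Rightarrow> real" where
  "wave_data g f \<beta> \<sigma> = (LINT x|lebesgue. g x * phi \<sigma> \<beta> (x, 0)) + \<beta> * (LINT x|lebesgue. f x * phi \<sigma> (\<beta> + 1) (x, 0))"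

text \<open>The constants which must not depend on \<open>\<epsilon>\<close>, \<open>T\<close> and the solution.\<close>

locale uniform_constants =
  fixes A :: "'a::euclidean_space itself" and p q \<theta> M V n :: real
  assumes \<theta>: "\<theta> < 1" "1 / p \<le> \<theta>" "1 / q \<le> \<theta>" and M: "M > 0" and V: "V > 0"
    and cutoff: "\<And>R1 R2. 0 < R1 \<Longrightarrow> 2 * R1 \<le> R2 \<Longrightarrow> \<exists>h h' h''. cutoff M \<theta> R1 R2 h h' h''"
    and n: "n \<ge> 0" "real DIM('a) = 2 * n + 1"
    and volume: "\<And>\<tau> k s. \<tau> \<ge> 3 \<Longrightarrow> \<tau> powr (k + (2 * n + 1) + 1) \<le> s \<Longrightarrow>
        \<tau> powr k * section_integral A 0 \<tau> \<le> V * s / \<tau>"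
      "\<And>\<tau> k s. \<tau> \<ge> 3 \<Longrightarrow> k + (2 * n + 1) = 0 \<Longrightarrow> ln \<tau> \<le> s \<Longrightarrow> \<tau> powr k * section_integral A 1 \<tau> \<le> V * s / \<tau>"
      "\<And>\<tau> \<nu> k s. \<tau> \<ge> 3 \<Longrightarrow> \<nu> \<ge> 2 \<Longrightarrow> \<tau> powr (k + (2 * n + 1)) \<le> s \<Longrightarrow>
        \<tau> powr k * section_integral A \<nu> \<tau> \<le> V * s / \<tau>"
begin

lemma half_dim: "(real DIM('a) - 1) / 2 = n"
  by (simp add: n(2))

end

lemma uniform_constants_exist:
  assumes pq: "p > 1" "q > 1"
  obtains \<theta> M V n where "uniform_constants TYPE('a::euclidean_space) p q \<theta> M V n"
proof -
  define n where "n = (real DIM('a) - 1) / 2"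
  have n: "n \<ge> 0" "real DIM('a) = 2 * n + 1" using DIM_ge_1[where 'a='a] by (auto simp: n_def field_simps)
  \<comment> \<open>One cutoff has to serve both Hoelder exponents.\<close>
  define \<theta> where "\<theta> = max (1 / p) (1 / q)"
  have \<theta>: "\<theta> < 1" "1 / p \<le> \<theta>" "1 / q \<le> \<theta>" using pq by (auto simp: \<theta>_def)
  obtain M where M: "M > 0" "\<And>R1 R2. 0 < R1 \<Longrightarrow> 2 * R1 \<le> R2 \<Longrightarrow> \<exists>h h' h''. cutoff M \<theta> R1 R2 h h' h''"
    by (rule cutoff_exists[OF \<theta>(1)], rule that)
  obtain V where V: "V > 0"
    "\<And>\<tau> k s. \<tau> \<ge> 3 \<Longrightarrow> \<tau> powr (k + real DIM('a) + 1) \<le> s \<Longrightarrow> \<tau> powr k * section_integral TYPE('a) 0 \<tau> \<le> V * s / \<tau>"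
    "\<And>\<tau> k s. \<tau> \<ge> 3 \<Longrightarrow> k + real DIM('a) = 0 \<Longrightarrow> ln \<tau> \<le> s \<Longrightarrow> \<tau> powr k * section_integral TYPE('a) 1 \<tau> \<le> V * s / \<tau>"
    "\<And>\<tau> \<nu> k s. \<tau> \<ge> 3 \<Longrightarrow> \<nu> \<ge> 2 \<Longrightarrow> \<tau> powr (k + real DIM('a)) \<le> s \<Longrightarrow> \<tau> powr k * section_integral TYPE('a) \<nu> \<tau> \<le> V * s / \<tau>"
    by (rule weighted_section_bounds[where 'a='a], rule that)
  have "uniform_constants TYPE('a) p q \<theta> M V n"
    by (unfold_locales; (fact \<theta> M V n | fact V[unfolded n(2)]))
  then show thesis by (rule that)
qed

text \<open>For \<beta> = n + 1 the bound for phi_(\<beta> + 1) has exponent \<beta> + 1 - n = 2 in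
  1 / (\<tau> - |x|), and Hoelder's inequality turns it into \<nu> = 2 p / (p - 1), which lies in
  the convergent range.\<close>

lemma dual_exponent:
  fixes p :: real
  assumes "p > 1"
  shows "c * (p / (p - 1)) * (1 - 1 / p) = c" "2 * (p / (p - 1)) \<ge> 2"
  using assms by (auto simp: field_simps)

text \<open>Here -h is the number of time derivatives on the cutoff: 1 for the equation of u, 2 for
  that of v.\<close>

definition dyadic_time_constant :: "real \<Rightarrow> real \<Rightarrow> real \<Rightarrow> real \<Rightarrow> real \<Rightarrow> real \<Rightarrow> real" where
  "dyadic_time_constant b p M V n h =
     holder_constant b p (M / ln 2) V * (2 powr \<bar>h * (p / (p - 1)) + (2 * n + 1) + 1\<bar> * ln 2) powr (1 - 1 / p)"

definition dyadic_wave_constant :: "real \<Rightarrow> real \<Rightarrow> real \<Rightarrow> real \<Rightarrow> real \<Rightarrow> real \<Rightarrow> real" where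
  "dyadic_wave_constant b p M V n C = holder_constant b p (M * (1 + 2 * \<bar>n + 1\<bar>) * C) V *
     (2 powr \<bar>(- 1 - n) * (p / (p - 1)) + (2 * n + 1)\<bar>) powr (1 - 1 / p) * ln 2 powr (- 1 / p)"

locale dyadic_cutoff = power_cone_solution G1 G2 f1 g1 f2 g2 \<epsilon> r0 T u v p q a b \<sigma> + uniform_constants "TYPE('a)" p q \<theta> M V n
  for G1 G2 :: "real \<Rightarrow> real" and f1 g1 f2 g2 :: "'a::euclidean_space \<Rightarrow> real"
    and \<epsilon> r0 :: real and T :: ereal and u v :: "real \<Rightarrow> 'a \<Rightarrow> real" and p q a b \<sigma> \<theta> M V n :: real +
  fixes R :: real and \<eta> \<eta>' \<eta>'' :: "real \<Rightarrow> real"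
  assumes cut: "cutoff M \<theta> (R / 2) R \<eta> \<eta>' \<eta>''" and R: "2 * \<sigma> < R" "ereal (R - \<sigma>) < T"
    and \<epsilon>: "\<epsilon> > 0" and data_pos: "(LINT x|lebesgue. g1 x) > 0" "(LINT x|lebesgue. g2 x) > 0"
begin

lemma R_facts: "0 < R / 2" "\<sigma> < R / 2" "R / 2 < R" "\<sigma> < R" "R > 0" "R / 2 \<le> R" "R / (R / 2) = 2"
  using R(1) \<sigma>(2) by auto

definition W :: "'a \<times> real \<Rightarrow> real" where
  "W = wave_weight \<eta> \<sigma> 0"

lemma weight_W: "weight \<eta> 0 W"
  unfolding W_def by (rule weight_wave[OF cut R_facts(4)]) auto

lemma cut_bound:
  assumes "\<tau> > \<sigma>" "r \<le> \<theta>"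
  shows "\<bar>\<eta>' \<tau>\<bar> \<le> M / ln 2 * \<tau> powr - 1 * \<eta> \<tau> powr r * indicator {R / 2..R} \<tau>"
    "\<bar>\<eta>'' \<tau>\<bar> \<le> M / ln 2 * \<tau> powr - 2 * \<eta> \<tau> powr r * indicator {R / 2..R} \<tau>"
proof -
  have \<tau>: "\<tau> > 0" using assms(1) \<sigma>(2) by simp
  have h: "0 \<le> \<eta> \<tau>" "\<eta> \<tau> \<le> 1" "\<bar>\<eta>' \<tau>\<bar> \<le> M / ln 2 / \<tau> * \<eta> \<tau> powr \<theta>" "\<bar>\<eta>'' \<tau>\<bar> \<le> M / ln 2 / \<tau>\<^sup>2 * \<eta> \<tau> powr \<theta>"
    "\<tau> < R / 2 \<or> \<tau> > R \<Longrightarrow> \<eta>' \<tau> = 0 \<and> \<eta>'' \<tau> = 0"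
    using cut \<tau> unfolding cutoff_def R_facts(7) by blast+
  have e: "\<eta> \<tau> powr \<theta> \<le> \<eta> \<tau> powr r" using h(1,2) assms(2) by (rule powr_le_powr_exponent)
  have "M / ln 2 / \<tau> * \<eta> \<tau> powr \<theta> \<le> M / ln 2 / \<tau> * \<eta> \<tau> powr r"
    "M / ln 2 / \<tau>\<^sup>2 * \<eta> \<tau> powr \<theta> \<le> M / ln 2 / \<tau>\<^sup>2 * \<eta> \<tau> powr r"
    by (rule mult_left_mono[OF e]; use M \<tau> in simp)+
  then have "\<bar>\<eta>' \<tau>\<bar> \<le> M / ln 2 / \<tau> * \<eta> \<tau> powr r" "\<bar>\<eta>'' \<tau>\<bar> \<le> M / ln 2 / \<tau>\<^sup>2 * \<eta> \<tau> powr r"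
    using h(3,4) by linarith+
  moreover have "\<tau> powr - 1 = 1 / \<tau>" "\<tau> powr - 2 = 1 / \<tau>\<^sup>2" using \<tau> by (auto simp: powr_minus_divide)
  ultimately show "\<bar>\<eta>' \<tau>\<bar> \<le> M / ln 2 * \<tau> powr - 1 * \<eta> \<tau> powr r * indicator {R / 2..R} \<tau>"
    "\<bar>\<eta>'' \<tau>\<bar> \<le> M / ln 2 * \<tau> powr - 2 * \<eta> \<tau> powr r * indicator {R / 2..R} \<tau>"
    using h(5) by (auto simp: indicator_def not_le)
qed

lemma scale: "l > 0 \<Longrightarrow> (2 powr \<bar>E\<bar> * R powr E * l) powr r = (2 powr \<bar>E\<bar> * l) powr r * R powr (E * r)"
  using R_facts(5) by (simp add: powr_mult powr_powr mult_ac)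

text \<open>R^-1 is the size of the derivative of the cutoff and R^(2n + 2) = R^(N + 1) the
  space-time volume of the truncated cone.\<close>

lemma time_u: "I1 W \<le> dyadic_time_constant b p M V n (- 1) * R powr (- 1 + (2 * n + 2) * (1 - 1 / p)) * I2 W powr (1 / p)"
proof -
  define E where "E = - 1 * (p / (p - 1)) + (2 * n + 1) + 1"
  have E: "E * (1 - 1 / p) = - 1 + (2 * n + 2) * (1 - 1 / p)"
    unfolding E_def distrib_right dual_exponent(1)[OF pq(1)] by (simp add: algebra_simps)
  have tw: "time_weight R \<eta> \<eta>' \<eta>''" and \<eta>\<sigma>: "\<eta> \<sigma> = 1" using cut R_facts \<sigma>(2) by (auto simp: cutoff_def)
  have "I1 (wave_weight \<eta> \<sigma> 0) \<le> holder_constant b p (M / ln 2) V * (2 powr \<bar>E\<bar> * R powr E * ln 2) powr (1 - 1 / p) * I2 W powr (1 / p)"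
  proof (rule time_estimate_u[OF tw R_facts(4) R(2) weight_W cut_bound(1)[OF _ \<theta>(2)] R_facts(1,6) _ V])
    fix \<tau> assume \<tau>: "3 \<le> \<tau>" "R / 2 \<le> \<tau>" "\<tau> \<le> R"
    show "\<tau> powr ((- 1 + 0 / p) * (p / (p - 1))) * section_integral TYPE('a) 0 \<tau> \<le> V * (2 powr \<bar>E\<bar> * R powr E) / \<tau>"
      using dyadic_powr_le[OF R_facts(5) \<tau>(2,3), of E] by (intro volume(1) \<tau>(1)) (simp add: E_def)
  qed (use M R_facts(5,7) \<epsilon> \<eta>\<sigma> data_pos in auto)
  moreover have "dyadic_time_constant b p M V n (- 1) = holder_constant b p (M / ln 2) V * (2 powr \<bar>E\<bar> * ln 2) powr (1 - 1 / p)"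
    by (simp only: dyadic_time_constant_def E_def)
  ultimately show ?thesis
    using scale[of "ln 2" E "1 - 1 / p"] E by (simp add: W_def mult_ac)
qed

lemma time_v: "I2 W \<le> dyadic_time_constant a q M V n (- 2) * R powr (- 2 + (2 * n + 2) * (1 - 1 / q)) * I1 W powr (1 / q)"
proof -
  define E where "E = - 2 * (q / (q - 1)) + (2 * n + 1) + 1"
  have E: "E * (1 - 1 / q) = - 2 + (2 * n + 2) * (1 - 1 / q)"
    unfolding E_def distrib_right dual_exponent(1)[OF pq(2)] by (simp add: algebra_simps)
  have tw: "time_weight R \<eta> \<eta>' \<eta>''" and \<eta>\<sigma>: "\<eta> \<sigma> = 1" "\<eta>' \<sigma> = 0" using cut R_facts \<sigma>(2) by (auto simp: cutoff_def)
  have "I2 (wave_weight \<eta> \<sigma> 0) \<le> holder_constant a q (M / ln 2) V * (2 powr \<bar>E\<bar> * R powr E * ln 2) powr (1 - 1 / q) * I1 W powr (1 / q)"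
  proof (rule time_estimate_v[OF tw R_facts(4) R(2) weight_W cut_bound(2)[OF _ \<theta>(3)] R_facts(1,6) _ V])
    fix \<tau> assume \<tau>: "3 \<le> \<tau>" "R / 2 \<le> \<tau>" "\<tau> \<le> R"
    show "\<tau> powr ((- 2 + 0 / q) * (q / (q - 1))) * section_integral TYPE('a) 0 \<tau> \<le> V * (2 powr \<bar>E\<bar> * R powr E) / \<tau>"
      using dyadic_powr_le[OF R_facts(5) \<tau>(2,3), of E] by (intro volume(1) \<tau>(1)) (simp add: E_def)
  qed (use M R_facts(5,7) \<epsilon> \<eta>\<sigma> data_pos in auto)
  moreover have "dyadic_time_constant a q M V n (- 2) = holder_constant a q (M / ln 2) V * (2 powr \<bar>E\<bar> * ln 2) powr (1 - 1 / q)"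
    by (simp only: dyadic_time_constant_def E_def)
  ultimately show ?thesis
    using scale[of "ln 2" E "1 - 1 / q"] E by (simp add: W_def mult_ac)
qed

text \<open>The weight phi_(n + 2) concentrates near the boundary of the cone, where the effective
  volume is R^N = R^(2n + 1) instead of R^(N + 1). Its decay \<tau>^-n and the derivative give R^(-1
  - n).\<close>

lemma wave_u:
  assumes C: "phi_bound TYPE('a) (n + 2) C" and D: "wave_data g1 f1 (n + 2) \<sigma> > 0"
  shows "\<epsilon> \<le> dyadic_wave_constant b p M V n C / ((n + 1) * wave_data g1 f1 (n + 2) \<sigma>) *
    R powr (- 1 - n + (2 * n + 1) * (1 - 1 / p)) * I2 W powr (1 / p)"
proof -
  define E where "E = (- 1 - n) * (p / (p - 1)) + (2 * n + 1)"
  have E: "E * (1 - 1 / p) = - 1 - n + (2 * n + 1) * (1 - 1 / p)"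
    unfolding E_def distrib_right dual_exponent(1)[OF pq(1)] ..
  have s: "2 powr \<bar>E\<bar> * R powr E > 0" using R_facts(5) by simp
  have "(n + 1) * (\<epsilon> * wave_data g1 f1 (n + 2) \<sigma> + I1 (wave_weight \<eta> \<sigma> (n + 2))) \<le>
    holder_constant b p (M * (1 + 2 * \<bar>n + 1\<bar>) * C) V * ((2 powr \<bar>E\<bar> * R powr E) powr (1 - 1 / p) * ln (R / (R / 2)) powr (- 1 / p)) * I2 W powr (1 / p)"
  proof -
    have "(n + 1) * (\<epsilon> * ((LINT x|lebesgue. g1 x * phi \<sigma> (n + 1 + 1) (x, 0)) + (n + 1 + 1) * (LINT x|lebesgue. f1 x * phi \<sigma> (n + 1 + 2) (x, 0)))
        + I1 (wave_weight \<eta> \<sigma> (n + 1 + 1))) \<le>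
      holder_constant b p (M * (1 + 2 * \<bar>n + 1\<bar>) * C) V * ((2 powr \<bar>E\<bar> * R powr E) powr (1 - 1 / p) * ln (R / (R / 2)) powr (- 1 / p)) * I2 W powr (1 / p)"
    proof (rule wave_estimate_u[OF cut M R_facts(2,3) R(2) _ \<theta>(2) _ _ _ weight_W V s, where \<nu>="2 * (p / (p - 1))", unfolded half_dim])
      fix \<tau> assume \<tau>: "3 \<le> \<tau>" "R / 2 \<le> \<tau>" "\<tau> \<le> R"
      show "\<tau> powr ((- 1 - n + 0 / p) * (p / (p - 1))) * section_integral TYPE('a) (2 * (p / (p - 1))) \<tau> \<le> V * (2 powr \<bar>E\<bar> * R powr E) / \<tau>"
        using dyadic_powr_le[OF R_facts(5) \<tau>(2,3), of E] dual_exponent(2)[OF pq(1)] by (intro volume(3) \<tau>(1)) (auto simp: E_def)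
    next
      show "n + 1 + 1 - n = 2 * (p / (p - 1)) * (1 - 1 / p)" using dual_exponent(1)[OF pq(1), of 2] by simp
    qed (use n(1) C dual_exponent(2)[OF pq(1)] in \<open>simp_all add: add.assoc\<close>)
    then show ?thesis by (simp add: wave_data_def add.assoc)
  qed
  then have "\<epsilon> \<le> holder_constant b p (M * (1 + 2 * \<bar>n + 1\<bar>) * C) V / ((n + 1) * wave_data g1 f1 (n + 2) \<sigma>) *
      ((2 powr \<bar>E\<bar> * R powr E) powr (1 - 1 / p) * ln (R / (R / 2)) powr (- 1 / p)) * I2 W powr (1 / p)"
    using n(1) D \<epsilon> weight_nonneg[OF weight_wave[OF cut R_facts(4)], of "n + 2"] by (intro estimate_split(1)) auto
  also have "\<dots> = dyadic_wave_constant b p M V n C / ((n + 1) * wave_data g1 f1 (n + 2) \<sigma>) * R powr (E * (1 - 1 / p)) * I2 W powr (1 / p)"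
    unfolding R_facts(7) dyadic_wave_constant_def E_def[symmetric] using scale[of 1 E "1 - 1 / p"] by (simp add: mult_ac)
  finally show ?thesis unfolding E .
qed

text \<open>The same size as for u with p replaced by q. Only the data term differs: no time
  derivative is taken of the weight here, so the data meet phi_(n + 1).\<close>

lemma wave_v:
  assumes C: "phi_bound TYPE('a) (n + 2) C" and D: "wave_data g2 f2 (n + 1) \<sigma> > 0"
  shows "\<epsilon> \<le> dyadic_wave_constant a q M V n C / wave_data g2 f2 (n + 1) \<sigma> *
    R powr (- 1 - n + (2 * n + 1) * (1 - 1 / q)) * I1 W powr (1 / q)"
proof -
  define E where "E = (- 1 - n) * (q / (q - 1)) + (2 * n + 1)"
  have E: "E * (1 - 1 / q) = - 1 - n + (2 * n + 1) * (1 - 1 / q)"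
    unfolding E_def distrib_right dual_exponent(1)[OF pq(2)] ..
  have s: "2 powr \<bar>E\<bar> * R powr E > 0" using R_facts(5) by simp
  have "1 * (\<epsilon> * wave_data g2 f2 (n + 1) \<sigma> + I2 (wave_weight \<eta> \<sigma> (n + 1))) \<le>
    holder_constant a q (M * (1 + 2 * \<bar>n + 1\<bar>) * C) V * ((2 powr \<bar>E\<bar> * R powr E) powr (1 - 1 / q) * ln (R / (R / 2)) powr (- 1 / q)) * I1 W powr (1 / q)"
    unfolding wave_data_def mult_1_left
  proof (rule wave_estimate_v[OF cut M R_facts(2,3) R(2) _ _ \<theta>(3) _ _ _ weight_W V s, where \<nu>="2 * (q / (q - 1))", unfolded half_dim])
    fix \<tau> assume \<tau>: "3 \<le> \<tau>" "R / 2 \<le> \<tau>" "\<tau> \<le> R"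
    show "\<tau> powr ((- 1 - n + 0 / q) * (q / (q - 1))) * section_integral TYPE('a) (2 * (q / (q - 1))) \<tau> \<le> V * (2 powr \<bar>E\<bar> * R powr E) / \<tau>"
      using dyadic_powr_le[OF R_facts(5) \<tau>(2,3), of E] dual_exponent(2)[OF pq(2)] by (intro volume(3) \<tau>(1)) (auto simp: E_def)
  next
    show "n + 1 + 1 - n = 2 * (q / (q - 1)) * (1 - 1 / q)" using dual_exponent(1)[OF pq(2), of 2] by simp
  qed (use n(1) C dual_exponent(2)[OF pq(2)] in \<open>simp_all add: add.assoc\<close>)
  then have "\<epsilon> \<le> holder_constant a q (M * (1 + 2 * \<bar>n + 1\<bar>) * C) V / (1 * wave_data g2 f2 (n + 1) \<sigma>) *
      ((2 powr \<bar>E\<bar> * R powr E) powr (1 - 1 / q) * ln (R / (R / 2)) powr (- 1 / q)) * I1 W powr (1 / q)"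
    using n(1) D \<epsilon> weight_nonneg[OF weight_wave[OF cut R_facts(4)], of "n + 1"] by (intro estimate_split(1)) auto
  also have "\<dots> = dyadic_wave_constant a q M V n C / wave_data g2 f2 (n + 1) \<sigma> * R powr (E * (1 - 1 / q)) * I1 W powr (1 / q)"
    unfolding R_facts(7) dyadic_wave_constant_def E_def[symmetric] using scale[of 1 E "1 - 1 / q"] by (simp add: mult_ac)
  finally show ?thesis unfolding E .
qed

lemma powers:
  "(R powr x) powr y * R powr z * (R powr w) powr k = R powr (x * y + z + w * k)"
  using R_facts(5) by (simp add: powr_powr flip: powr_add)

lemma conclusion_u:
  assumes C: "phi_bound TYPE('a) (n + 2) C" and D: "wave_data g1 f1 (n + 2) \<sigma> > 0"
  shows "\<epsilon> powr (p - 1 / q) \<le> dyadic_time_constant b p M V n (- 1) powr (1 / q) * dyadic_time_constant a q M V n (- 2) *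
    (dyadic_wave_constant b p M V n C / ((n + 1) * wave_data g1 f1 (n + 2) \<sigma>)) powr (p - 1 / q) * R powr - (F_SG1 DIM('a) p q * (p - 1 / q))"
proof -
  have pw: "R powr x > 0" for x using R_facts(5) by simp
  \<comment> \<open>Collecting the powers of R gives n (p - 1/q) - (1 + 1/q + 1/(pq)), and p - 1/q =
    (pq - 1)/q identifies this with the first threshold function.\<close>
  have exponent: "(- 1 + (2 * n + 2) * (1 - 1 / p)) * (1 / q) + (- 2 + (2 * n + 2) * (1 - 1 / q)) + (- 1 - n + (2 * n + 1) * (1 - 1 / p)) * (p - 1 / q) = - (F_SG1 DIM('a) p q * (p - 1 / q))"
    using pq less_1_mult[OF pq] unfolding F_SG1_def n(2) by (simp add: field_simps)
  have "dyadic_time_constant b p M V n (- 1) > 0" "dyadic_time_constant a q M V n (- 2) > 0"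
    "dyadic_wave_constant b p M V n C / ((n + 1) * wave_data g1 f1 (n + 2) \<sigma>) > 0"
    using ab M V n(1) C D unfolding dyadic_time_constant_def dyadic_wave_constant_def phi_bound_def
    by (auto intro!: mult_pos_pos divide_pos_pos holder_constant_pos)
  from scaling_conclusion[OF pq \<epsilon> conjunct1[OF weight_nonneg[OF weight_W]] conjunct2[OF weight_nonneg[OF weight_W]] this pw pw pw time_u time_v wave_u[OF C D]]
  show ?thesis unfolding powers exponent .
qed

lemma conclusion_v:
  assumes C: "phi_bound TYPE('a) (n + 2) C" and D: "wave_data g2 f2 (n + 1) \<sigma> > 0"
  shows "\<epsilon> powr (q - 1 / p) \<le> dyadic_time_constant a q M V n (- 2) powr (1 / p) * dyadic_time_constant b p M V n (- 1) *
    (dyadic_wave_constant a q M V n C / wave_data g2 f2 (n + 1) \<sigma>) powr (q - 1 / p) * R powr - (F_SG2 DIM('a) p q * (q - 1 / p))"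
proof -
  have pw: "R powr x > 0" for x using R_facts(5) by simp
  have exponent: "(- 2 + (2 * n + 2) * (1 - 1 / q)) * (1 / p) + (- 1 + (2 * n + 2) * (1 - 1 / p)) + (- 1 - n + (2 * n + 1) * (1 - 1 / q)) * (q - 1 / p) = - (F_SG2 DIM('a) p q * (q - 1 / p))"
    using pq less_1_mult[OF pq] unfolding F_SG2_def n(2) by (simp add: field_simps)
  have "dyadic_time_constant a q M V n (- 2) > 0" "dyadic_time_constant b p M V n (- 1) > 0"
    "dyadic_wave_constant a q M V n C / wave_data g2 f2 (n + 1) \<sigma> > 0"
    using ab M V n(1) C D unfolding dyadic_time_constant_def dyadic_wave_constant_def phi_bound_def
    by (auto intro!: mult_pos_pos divide_pos_pos holder_constant_pos)
  from scaling_conclusion[OF pq(2,1) \<epsilon> conjunct2[OF weight_nonneg[OF weight_W]] conjunct1[OF weight_nonneg[OF weight_W]] this pw pw pw time_v time_u wave_v[OF C D]]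
  show ?thesis unfolding powers exponent .
qed

end

section \<open>Logarithmic cutoffs\<close>

definition log_constant :: "real \<Rightarrow> real \<Rightarrow> real \<Rightarrow> real \<Rightarrow> real" where
  "log_constant b p K V = holder_constant b p K V * 2 powr (1 - 1 / p)"

lemma log_constant_pos: "b > 0 \<Longrightarrow> K > 0 \<Longrightarrow> V > 0 \<Longrightarrow> log_constant b p K V > 0"
  by (simp add: log_constant_def holder_constant_pos)

text \<open>The form in which criticality is used: the total power of \<tau> in a Hoelder estimate,
  volume included, vanishes.\<close>

lemma dual_exponent_eq_0:
  fixes q :: real
  assumes "q > 1" "x * q + y + z * (q - 1) = 0"
  shows "(x + y / q) * (q / (q - 1)) + z = 0"
proof -
  have "(x + y / q) * (q / (q - 1)) + z = (x * q + y + z * (q - 1)) / (q - 1)" using assms(1) by (simp add: field_simps)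
  then show ?thesis using assms(2) by simp
qed

locale logarithmic_cutoff = power_cone_solution G1 G2 f1 g1 f2 g2 \<epsilon> r0 T u v p q a b \<sigma> + uniform_constants "TYPE('a)" p q \<theta> M V n
  for G1 G2 :: "real \<Rightarrow> real" and f1 g1 f2 g2 :: "'a::euclidean_space \<Rightarrow> real"
    and \<epsilon> r0 :: real and T :: ereal and u v :: "real \<Rightarrow> 'a \<Rightarrow> real" and p q a b \<sigma> \<theta> M V n :: real +
  fixes R :: real and \<eta> \<eta>' \<eta>'' :: "real \<Rightarrow> real"
  assumes cut: "cutoff M \<theta> (sqrt R) R \<eta> \<eta>' \<eta>''" and R: "16 \<le> R" "\<sigma> < sqrt R" "ereal (R - \<sigma>) < T"
    and \<epsilon>: "\<epsilon> > 0" and data_pos: "(LINT x|lebesgue. g1 x) > 0" "(LINT x|lebesgue. g2 x) > 0"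
begin

text \<open>With a transition from sqrt R to R, the logarithmic length of the transition zone is L
  and ln \<tau> \<le> 2 L up to R, so gains and losses are powers of the same quantity.\<close>

definition L :: real where "L = ln R / 2"

lemma R_facts: "0 < sqrt R" "2 * sqrt R \<le> R" "sqrt R < R" "\<sigma> < R" "R > 0" "L > 0" "ln (R / sqrt R) = L" "ln R = 2 * L"
proof -
  show "R > 0" "0 < sqrt R" using R(1) by auto
  have "4 \<le> sqrt R" using R(1) by (intro real_le_rsqrt) simp
  then have "2 * sqrt R \<le> sqrt R * sqrt R" using \<open>0 < sqrt R\<close> by (intro mult_right_mono) linarith+
  then show "2 * sqrt R \<le> R" using R(1) by simp
  then show "sqrt R < R" using \<open>0 < sqrt R\<close> by linarith
  then show "\<sigma> < R" using R(2) by linarith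
  show "L > 0" "ln R = 2 * L" using R(1) by (auto simp: L_def)
  have "R / sqrt R = sqrt R" using \<open>R > 0\<close> by (simp add: real_div_sqrt)
  then show "ln (R / sqrt R) = L" using \<open>R > 0\<close> by (simp add: L_def ln_sqrt)
qed

text \<open>As \<open>phi\<close> with exponent 0 is 1 in the cone, this is just \<tau>^-g times the
  cutoff there.\<close>

definition power_weight :: "real \<Rightarrow> 'a \<times> real \<Rightarrow> real" where
  "power_weight g = wave_weight (\<lambda>\<tau>. \<tau> powr - g * \<eta> \<tau>) \<sigma> 0"

lemma weight_power_weight: "weight \<eta> g (power_weight g)"
proof -
  obtain H' H'' where "time_weight R (\<lambda>\<tau>. \<tau> powr - g * \<eta> \<tau>) H' H''"
    by (rule cutoff_power_weight[OF cut M R_facts(1,2), of g]) (use \<theta>(1) in auto)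
  from weight_power[OF cut R_facts(4) this] show ?thesis unfolding power_weight_def .
qed

text \<open>In the borderline case the section integral contributes ln \<tau> \<le> 2 L to the power
  1 - 1/r; together with the net factor L^(-1/r) of a wave term this gives L^(1 - 2/r).\<close>

lemma log_scale: "(2 * L) powr (1 - 1 / r) * L powr (- 1 / r) = 2 powr (1 - 1 / r) * L powr (1 - 2 / r)"
  using R_facts(6) by (simp add: powr_mult flip: powr_add)

text \<open>The exponent \<open>g\<close> is the one for which all powers of \<open>\<tau>\<close> in the Hoelder estimate combine to \<open>d\<tau>/\<tau>\<close>.\<close>

lemma wave_u:
  assumes \<beta>: "\<beta> > 0" and C: "phi_bound TYPE('a) (\<beta> + 1) C" and W: "weight \<eta> g W" and g: "g = 1 + 2 * n - n * p"
  shows "\<beta> = n + 1 \<Longrightarrow> \<beta> * (\<epsilon> * wave_data g1 f1 (\<beta> + 1) \<sigma> + I1 (wave_weight \<eta> \<sigma> (\<beta> + 1))) \<le>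
      holder_constant b p (M * (1 + 2 * \<bar>\<beta>\<bar>) * C) V * L powr (- 1 / p) * I2 W powr (1 / p)"
    and "\<beta> = n - 1 / p \<Longrightarrow> \<beta> * (\<epsilon> * wave_data g1 f1 (\<beta> + 1) \<sigma> + I1 (wave_weight \<eta> \<sigma> (\<beta> + 1))) \<le>
      log_constant b p (M * (1 + 2 * \<bar>\<beta>\<bar>) * C) V * L powr (1 - 2 / p) * I2 W powr (1 / p)"
proof -
  have k: "(- 1 - n + g / p) * (p / (p - 1)) + (2 * n + 1) = 0"
    using pq unfolding g by (simp add: field_simps)
  have main: "\<beta> * (\<epsilon> * wave_data g1 f1 (\<beta> + 1) \<sigma> + I1 (wave_weight \<eta> \<sigma> (\<beta> + 1))) \<le>
      holder_constant b p (M * (1 + 2 * \<bar>\<beta>\<bar>) * C) V * (s powr (1 - 1 / p) * L powr (- 1 / p)) * I2 W powr (1 / p)"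
    if \<nu>: "\<beta> + 1 - n = \<nu> * (1 - 1 / p)" "\<nu> \<ge> 0" and s: "s > 0"
      and vol: "\<And>\<tau>. \<tau> \<ge> 3 \<Longrightarrow> sqrt R \<le> \<tau> \<Longrightarrow> \<tau> \<le> R \<Longrightarrow>
        \<tau> powr ((- 1 - n + g / p) * (p / (p - 1))) * section_integral TYPE('a) \<nu> \<tau> \<le> V * s / \<tau>" for s \<nu>
    using wave_estimate_u[OF cut M R(2) R_facts(3) R(3) \<beta> \<theta>(2) C _ \<nu>(2) W V s, unfolded half_dim, OF \<nu>(1) vol]
    by (simp add: wave_data_def R_facts(7) add.assoc)
  show "\<beta> * (\<epsilon> * wave_data g1 f1 (\<beta> + 1) \<sigma> + I1 (wave_weight \<eta> \<sigma> (\<beta> + 1))) \<le>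
      holder_constant b p (M * (1 + 2 * \<bar>\<beta>\<bar>) * C) V * L powr (- 1 / p) * I2 W powr (1 / p)" if "\<beta> = n + 1"
  proof -
    \<comment> \<open>The convergent range of \<nu>: no logarithm from the section, so this estimate
      keeps the full gain and is reserved for \<epsilon>.\<close>
    have "\<beta> + 1 - n = 2 * (p / (p - 1)) * (1 - 1 / p)" using dual_exponent(1)[OF pq(1), of 2] that by simp
    moreover have "\<tau> powr ((- 1 - n + g / p) * (p / (p - 1))) * section_integral TYPE('a) (2 * (p / (p - 1))) \<tau> \<le> V * 1 / \<tau>"
      if "\<tau> \<ge> 3" for \<tau>
      using that dual_exponent(2)[OF pq(1)] k by (intro volume(3)) auto
    ultimately show ?thesis
      using main[of "2 * (p / (p - 1))" 1] dual_exponent(2)[OF pq(1)] by simp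
  qed
  show "\<beta> * (\<epsilon> * wave_data g1 f1 (\<beta> + 1) \<sigma> + I1 (wave_weight \<eta> \<sigma> (\<beta> + 1))) \<le>
      log_constant b p (M * (1 + 2 * \<bar>\<beta>\<bar>) * C) V * L powr (1 - 2 / p) * I2 W powr (1 / p)" if "\<beta> = n - 1 / p"
  proof -
    have s: "2 * L > 0" using R_facts(6) by simp
    \<comment> \<open>Here \<beta> + 1 - n = 1 - 1/p, that is \<nu> = 1, the borderline
      section.\<close>
    have "\<tau> powr ((- 1 - n + g / p) * (p / (p - 1))) * section_integral TYPE('a) 1 \<tau> \<le> V * (2 * L) / \<tau>"
      if "\<tau> \<ge> 3" "\<tau> \<le> R" for \<tau>
      using that k R_facts(5) by (intro volume(2)) (auto simp flip: R_facts(8))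
    from main[of 1 "2 * L", unfolded log_scale, OF _ _ s this] that show ?thesis
      by (simp add: log_constant_def mult.assoc)
  qed
qed

text \<open>The counterpart for v. The weight phi_\<beta> itself, not phi_(\<beta> + 1), multiplies
  the nonlinearity here, so \<beta> = n - 1/q may be negative as long as n > 0.\<close>

lemma wave_v:
  assumes \<beta>: "\<beta> > -1" "\<beta> \<ge> 0 \<or> n > 0" and C: "phi_bound TYPE('a) (\<beta> + 1) C" and W: "weight \<eta> g W" and g: "g = 1 + 2 * n - n * q"
  shows "\<beta> = n + 1 \<Longrightarrow> \<epsilon> * wave_data g2 f2 \<beta> \<sigma> + I2 (wave_weight \<eta> \<sigma> \<beta>) \<le>
      holder_constant a q (M * (1 + 2 * \<bar>\<beta>\<bar>) * C) V * L powr (- 1 / q) * I1 W powr (1 / q)"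
    and "\<beta> = n - 1 / q \<Longrightarrow> \<epsilon> * wave_data g2 f2 \<beta> \<sigma> + I2 (wave_weight \<eta> \<sigma> \<beta>) \<le>
      log_constant a q (M * (1 + 2 * \<bar>\<beta>\<bar>) * C) V * L powr (1 - 2 / q) * I1 W powr (1 / q)"
proof -
  have k: "(- 1 - n + g / q) * (q / (q - 1)) + (2 * n + 1) = 0"
    using pq unfolding g by (simp add: field_simps)
  have dim: "\<beta> \<ge> 0 \<or> DIM('a) \<ge> 2" using \<beta>(2) n(2) by auto
  have main: "\<epsilon> * wave_data g2 f2 \<beta> \<sigma> + I2 (wave_weight \<eta> \<sigma> \<beta>) \<le>
      holder_constant a q (M * (1 + 2 * \<bar>\<beta>\<bar>) * C) V * (s powr (1 - 1 / q) * L powr (- 1 / q)) * I1 W powr (1 / q)"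
    if \<nu>: "\<beta> + 1 - n = \<nu> * (1 - 1 / q)" "\<nu> \<ge> 0" and s: "s > 0"
      and vol: "\<And>\<tau>. \<tau> \<ge> 3 \<Longrightarrow> sqrt R \<le> \<tau> \<Longrightarrow> \<tau> \<le> R \<Longrightarrow>
        \<tau> powr ((- 1 - n + g / q) * (q / (q - 1))) * section_integral TYPE('a) \<nu> \<tau> \<le> V * s / \<tau>" for s \<nu>
    using wave_estimate_v[OF cut M R(2) R_facts(3) R(3) \<beta>(1) dim \<theta>(3) C _ \<nu>(2) W V s, unfolded half_dim, OF \<nu>(1) vol]
    by (simp add: wave_data_def R_facts(7))
  show "\<epsilon> * wave_data g2 f2 \<beta> \<sigma> + I2 (wave_weight \<eta> \<sigma> \<beta>) \<le>
      holder_constant a q (M * (1 + 2 * \<bar>\<beta>\<bar>) * C) V * L powr (- 1 / q) * I1 W powr (1 / q)" if "\<beta> = n + 1"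
  proof -
    have "\<beta> + 1 - n = 2 * (q / (q - 1)) * (1 - 1 / q)" using dual_exponent(1)[OF pq(2), of 2] that by simp
    moreover have "\<tau> powr ((- 1 - n + g / q) * (q / (q - 1))) * section_integral TYPE('a) (2 * (q / (q - 1))) \<tau> \<le> V * 1 / \<tau>"
      if "\<tau> \<ge> 3" for \<tau>
      using that dual_exponent(2)[OF pq(2)] k by (intro volume(3)) auto
    ultimately show ?thesis
      using main[of "2 * (q / (q - 1))" 1] dual_exponent(2)[OF pq(2)] by simp
  qed
  show "\<epsilon> * wave_data g2 f2 \<beta> \<sigma> + I2 (wave_weight \<eta> \<sigma> \<beta>) \<le>
      log_constant a q (M * (1 + 2 * \<bar>\<beta>\<bar>) * C) V * L powr (1 - 2 / q) * I1 W powr (1 / q)" if "\<beta> = n - 1 / q"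
  proof -
    have s: "2 * L > 0" using R_facts(6) by simp
    have "\<tau> powr ((- 1 - n + g / q) * (q / (q - 1))) * section_integral TYPE('a) 1 \<tau> \<le> V * (2 * L) / \<tau>"
      if "\<tau> \<ge> 3" "\<tau> \<le> R" for \<tau>
      using that k R_facts(5) by (intro volume(2)) (auto simp flip: R_facts(8))
    from main[of 1 "2 * L", unfolded log_scale, OF _ _ s this] that show ?thesis
      by (simp add: log_constant_def mult.assoc)
  qed
qed

lemma cut_at_\<sigma>: "\<eta> \<sigma> = 1" and \<eta>_bounds: "\<tau> > 0 \<Longrightarrow> 0 \<le> \<eta> \<tau> \<and> \<eta> \<tau> \<le> 1"
  using cut R(2) \<sigma>(2) by (auto simp: cutoff_def)

lemma ln_ratio: "0 < \<sigma>" "\<sigma> \<le> R" "ln (R / \<sigma>) \<le> 2 * L" "2 * L > 0"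
  using R_facts \<sigma>(2) ln_ge_zero[of \<sigma>] by (auto simp: ln_div)

text \<open>The derivative falls on the power as well, so the whole range from \<sigma> to R
  contributes, of logarithmic length at most 2 L. Assumption \<open>k\<close> makes the integrand
  scale invariant.\<close>

lemma time_u:
  assumes W: "weight \<eta> g W" and k: "(- w - 1 + g / p) * (p / (p - 1)) + (2 * n + 1) + 1 = 0"
  shows "I1 (power_weight w) \<le> log_constant b p (M / ln 2 + \<bar>w\<bar>) V * L powr (1 - 1 / p) * I2 W powr (1 / p)"
proof -
  obtain H' H'' where H: "time_weight R (\<lambda>\<tau>. \<tau> powr - w * \<eta> \<tau>) H' H''"
    "\<And>\<tau>. 0 < \<tau> \<Longrightarrow> \<bar>H' \<tau>\<bar> \<le> (M / ln 2 + \<bar>w\<bar>) * \<tau> powr (- w - 1) * \<eta> \<tau> powr \<theta> * indicator {..R} \<tau>"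
    by (rule cutoff_power_weight[OF cut M R_facts(1,2), of w]) (use \<theta>(1) in auto)
  have K: "M / ln 2 + \<bar>w\<bar> > 0" using M by (intro add_pos_nonneg) auto
  have "I1 (wave_weight (\<lambda>\<tau>. \<tau> powr - w * \<eta> \<tau>) \<sigma> 0) \<le>
    holder_constant b p (M / ln 2 + \<bar>w\<bar>) V * (1 * (2 * L)) powr (1 - 1 / p) * I2 W powr (1 / p)"
  proof (rule time_estimate_u[OF H(1) R_facts(4) R(3) W _ ln_ratio(1,2) K V zero_less_one _ ln_ratio(3,4)])
    fix \<tau> assume \<tau>: "\<tau> > \<sigma>"
    then have \<tau>0: "\<tau> > 0" using ln_ratio(1) by simp
    have "\<bar>H' \<tau>\<bar> \<le> (M / ln 2 + \<bar>w\<bar>) * \<tau> powr (- w - 1) * \<eta> \<tau> powr \<theta> * indicator {..R} \<tau>" by (rule H(2)[OF \<tau>0])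
    also have "\<dots> \<le> (M / ln 2 + \<bar>w\<bar>) * \<tau> powr (- w - 1) * \<eta> \<tau> powr (1 / p) * indicator {..R} \<tau>"
      using K powr_le_powr_exponent[OF _ _ \<theta>(2)] \<eta>_bounds[OF \<tau>0] by (intro mult_left_mono mult_right_mono) auto
    finally show "\<bar>H' \<tau>\<bar> \<le> (M / ln 2 + \<bar>w\<bar>) * \<tau> powr (- w - 1) * \<eta> \<tau> powr (1 / p) * indicator {\<sigma>..R} \<tau>"
      using \<tau> by (simp add: indicator_def)
  next
    fix \<tau> :: real assume "3 \<le> \<tau>"
    then show "\<tau> powr ((- w - 1 + g / p) * (p / (p - 1))) * section_integral TYPE('a) 0 \<tau> \<le> V * 1 / \<tau>"
      using k by (intro volume(1)) auto
  next
    show "0 \<le> \<epsilon> * (\<sigma> powr - w * \<eta> \<sigma>) * (LINT x|lebesgue. g1 x)" using \<epsilon> data_pos(1) cut_at_\<sigma> by simp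
  qed
  then show ?thesis using R_facts(6) by (simp add: power_weight_def log_constant_def powr_mult mult_ac)
qed

text \<open>As for u, but a second derivative of the weight appears and the data term sees the slope
  of the power at \<sigma>; this is the origin of the term with w / \<sigma>.\<close>

lemma time_v:
  assumes W: "weight \<eta> g W" and k: "(- w - 2 + g / q) * (q / (q - 1)) + (2 * n + 1) + 1 = 0"
    and data: "(LINT x|lebesgue. g2 x) + w / \<sigma> * (LINT x|lebesgue. f2 x) > 0"
  shows "I2 (power_weight w) \<le> log_constant a q (M / ln 2 * (1 + 2 * \<bar>w\<bar>) + \<bar>w * (w + 1)\<bar>) V * L powr (1 - 1 / q) * I1 W powr (1 / q)"
proof -
  define K where "K = M / ln 2 * (1 + 2 * \<bar>w\<bar>) + \<bar>w * (w + 1)\<bar>"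
  obtain H' H'' where H: "time_weight R (\<lambda>\<tau>. \<tau> powr - w * \<eta> \<tau>) H' H''"
    "\<And>\<tau>. 0 < \<tau> \<Longrightarrow> \<bar>H'' \<tau>\<bar> \<le> K * \<tau> powr (- w - 2) * \<eta> \<tau> powr \<theta> * indicator {..R} \<tau>"
    "\<And>\<tau>. 0 < \<tau> \<Longrightarrow> \<tau> < sqrt R \<Longrightarrow> H' \<tau> = - w * \<tau> powr (- w - 1)"
    unfolding K_def by (rule cutoff_power_weight[OF cut M R_facts(1,2), of w]) (use \<theta>(1) in auto)
  have K: "K > 0" unfolding K_def using M by (intro add_pos_nonneg mult_pos_pos) auto
  have "I2 (wave_weight (\<lambda>\<tau>. \<tau> powr - w * \<eta> \<tau>) \<sigma> 0) \<le>
    holder_constant a q K V * (1 * (2 * L)) powr (1 - 1 / q) * I1 W powr (1 / q)"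
  proof (rule time_estimate_v[OF H(1) R_facts(4) R(3) W _ ln_ratio(1,2) K V zero_less_one _ ln_ratio(3,4)])
    fix \<tau> assume \<tau>: "\<tau> > \<sigma>"
    then have \<tau>0: "\<tau> > 0" using ln_ratio(1) by simp
    have "\<bar>H'' \<tau>\<bar> \<le> K * \<tau> powr (- w - 2) * \<eta> \<tau> powr \<theta> * indicator {..R} \<tau>" by (rule H(2)[OF \<tau>0])
    also have "\<dots> \<le> K * \<tau> powr (- w - 2) * \<eta> \<tau> powr (1 / q) * indicator {..R} \<tau>"
      using K powr_le_powr_exponent[OF _ _ \<theta>(3)] \<eta>_bounds[OF \<tau>0] by (intro mult_left_mono mult_right_mono) auto
    finally show "\<bar>H'' \<tau>\<bar> \<le> K * \<tau> powr (- w - 2) * \<eta> \<tau> powr (1 / q) * indicator {\<sigma>..R} \<tau>"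
      using \<tau> by (simp add: indicator_def)
  next
    fix \<tau> :: real assume "3 \<le> \<tau>"
    then show "\<tau> powr ((- w - 2 + g / q) * (q / (q - 1))) * section_integral TYPE('a) 0 \<tau> \<le> V * 1 / \<tau>"
      using k by (intro volume(1)) auto
  next
    have "\<sigma> powr - w * \<eta> \<sigma> * (LINT x|lebesgue. g2 x) - H' \<sigma> * (LINT x|lebesgue. f2 x) =
      \<sigma> powr - w * ((LINT x|lebesgue. g2 x) + w / \<sigma> * (LINT x|lebesgue. f2 x))"
      using ln_ratio(1) by (simp add: cut_at_\<sigma> H(3)[OF ln_ratio(1) R(2)] powr_diff field_simps)
    then show "0 \<le> \<epsilon> * (\<sigma> powr - w * \<eta> \<sigma> * (LINT x|lebesgue. g2 x) - H' \<sigma> * (LINT x|lebesgue. f2 x))"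
      using \<epsilon> data by simp
  qed
  then show ?thesis using R_facts(6) by (simp add: power_weight_def log_constant_def powr_mult mult_ac K_def)
qed

lemma powers:
  "(L powr x) powr y * L powr z * (L powr w) powr k = L powr (x * y + z + w * k)"
  using R_facts(6) by (simp add: powr_powr flip: powr_add)

lemma positive_powers: "L powr x > 0"
  using R_facts(6) by simp

text \<open>The wave estimates for u force the weight \<tau>^-w with w = 1 + 2n - np in Y. The
  estimate returning from Y to X is a time estimate, and it is scale invariant exactly when the
  first threshold function vanishes.\<close>

lemma conclusion_u:
  assumes F: "n * (p * q - 1) = 1 / p + 1 + q"
    and C: "phi_bound TYPE('a) (n + 2) C" and C': "phi_bound TYPE('a) (n - 1 / p + 1) C'"
    and D: "wave_data g1 f1 (n + 2) \<sigma> > 0" "wave_data g1 f1 (n - 1 / p + 1) \<sigma> > 0"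
      "(LINT x|lebesgue. g2 x) + (1 + 2 * n - n * p) / \<sigma> * (LINT x|lebesgue. f2 x) > 0"
  defines "w \<equiv> 1 + 2 * n - n * p"
  shows "\<epsilon> powr (p - 1 / q) \<le>
    (log_constant b p (M * (1 + 2 * \<bar>n - 1 / p\<bar>) * C') V / (n - 1 / p)) powr (1 / q) *
    log_constant a q (M / ln 2 * (1 + 2 * \<bar>w\<bar>) + \<bar>w * (w + 1)\<bar>) V *
    (holder_constant b p (M * (1 + 2 * \<bar>n + 1\<bar>) * C) V / ((n + 1) * wave_data g1 f1 (n + 2) \<sigma>)) powr (p - 1 / q) *
    L powr - (1 / (p * q))"
proof -
  \<comment> \<open>Criticality implies n p > 1, so that \<beta> = n - 1/p is positive, as the test
    for u requires.\<close>
  have "n * p * q = n + 1 / p + 1 + q" using F by (simp add: algebra_simps)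
  moreover have "n + 1 / p > 0" using n(1) pq by (intro add_nonneg_pos) auto
  ultimately have "1 * q < n * p * q" by linarith
  then have "1 < n * p" using pq by (subst (asm) mult_less_cancel_right) auto
  then have \<beta>: "n - 1 / p > 0" "n + 1 > 0" using pq n(1) by (auto simp: field_simps)
  define X Y where "X = I1 (wave_weight \<eta> \<sigma> (n - 1 / p + 1))" and "Y = I2 (power_weight w)"
  have W: "weight \<eta> (n - 1 / p + 1) (wave_weight \<eta> \<sigma> (n - 1 / p + 1))" "weight \<eta> (n + 2) (wave_weight \<eta> \<sigma> (n + 2))"
    using \<beta> by (auto intro!: weight_wave[OF cut R_facts(4)])
  have XY: "X \<ge> 0" "Y \<ge> 0" using weight_nonneg[OF W(1)] weight_nonneg[OF weight_power_weight] by (auto simp: X_def Y_def)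
  have 1: "X \<le> log_constant b p (M * (1 + 2 * \<bar>n - 1 / p\<bar>) * C') V / (n - 1 / p) * L powr (1 - 2 / p) * Y powr (1 / p)"
    using estimate_split(2)[OF \<beta>(1) D(2) _ _ wave_u(2)[OF \<beta>(1) C' weight_power_weight meta_eq_to_obj_eq[OF w_def] refl]]
      XY \<epsilon> by (simp add: X_def Y_def)
  \<comment> \<open>Cleared of denominators, this is n (pq - 1) - (1/p + 1 + q) = 0.\<close>
  have "(- w - 2 + (n - 1 / p + 1) / q) * (q / (q - 1)) + (2 * n + 1 + 1) = 0"
    using F by (intro dual_exponent_eq_0 pq(2)) (simp add: w_def algebra_simps)
  then have 2: "Y \<le> log_constant a q (M / ln 2 * (1 + 2 * \<bar>w\<bar>) + \<bar>w * (w + 1)\<bar>) V * L powr (1 - 1 / q) * X powr (1 / q)"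
    using time_v[OF W(1), of w] D(3) by (simp add: X_def Y_def w_def)
  have "(n + 1) * (\<epsilon> * wave_data g1 f1 (n + 2) \<sigma> + I1 (wave_weight \<eta> \<sigma> (n + 2))) \<le>
    holder_constant b p (M * (1 + 2 * \<bar>n + 1\<bar>) * C) V * L powr (- 1 / p) * Y powr (1 / p)"
    using wave_u(1)[OF \<beta>(2) _ weight_power_weight meta_eq_to_obj_eq[OF w_def] refl, of C] C by (simp add: Y_def add.assoc)
  then have 3: "\<epsilon> \<le> holder_constant b p (M * (1 + 2 * \<bar>n + 1\<bar>) * C) V / ((n + 1) * wave_data g1 f1 (n + 2) \<sigma>) * L powr (- 1 / p) * Y powr (1 / p)"
    using \<epsilon> weight_nonneg[OF W(2)] by (intro estimate_split(1)[OF \<beta>(2) D(1)]) auto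
  have "log_constant b p (M * (1 + 2 * \<bar>n - 1 / p\<bar>) * C') V / (n - 1 / p) > 0"
    "log_constant a q (M / ln 2 * (1 + 2 * \<bar>w\<bar>) + \<bar>w * (w + 1)\<bar>) V > 0"
    "holder_constant b p (M * (1 + 2 * \<bar>n + 1\<bar>) * C) V / ((n + 1) * wave_data g1 f1 (n + 2) \<sigma>) > 0"
    using ab M V n(1) \<beta> C C' D by (auto simp: phi_bound_def intro!: divide_pos_pos mult_pos_pos holder_constant_pos log_constant_pos add_pos_nonneg[OF _ abs_ge_zero] add_pos_nonneg[OF zero_less_one])
  note scaling_conclusion[OF pq \<epsilon> XY this positive_powers positive_powers positive_powers 1 2 3, unfolded powers]
  \<comment> \<open>The powers of L gained and lost in the three estimates; only -1/(pq) is
    left.\<close>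
  moreover have "(1 - 2 / p) * (1 / q) + (1 - 1 / q) + (- 1 / p) * (p - 1 / q) = - (1 / (p * q))"
    using pq by (simp add: field_simps)
  ultimately show ?thesis by (simp only:)
qed

text \<open>The roles are exchanged: the wave estimates for v force \<tau>^-w with w = 1 + 2n - nq
  in X, and the time estimate for u returns.\<close>

lemma conclusion_v:
  assumes F: "n * (p * q - 1) = 2 + 1 / q"
    and C: "phi_bound TYPE('a) (n + 2) C" and C': "phi_bound TYPE('a) (n - 1 / q + 1) C'"
    and D: "wave_data g2 f2 (n + 1) \<sigma> > 0" "wave_data g2 f2 (n - 1 / q) \<sigma> > 0"
  defines "w \<equiv> 1 + 2 * n - n * q"
  shows "\<epsilon> powr (q - 1 / p) \<le>
    log_constant a q (M * (1 + 2 * \<bar>n - 1 / q\<bar>) * C') V powr (1 / p) *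
    log_constant b p (M / ln 2 + \<bar>w\<bar>) V *
    (holder_constant a q (M * (1 + 2 * \<bar>n + 1\<bar>) * C) V / wave_data g2 f2 (n + 1) \<sigma>) powr (q - 1 / p) *
    L powr - (1 / (p * q))"
proof -
  have "2 + 1 / q > 0" using pq by (intro add_pos_pos) auto
  \<comment> \<open>Criticality excludes dimension one; hence N \<ge> 2 and \<open>phi\<close> has a
    positive lower bound even for negative \<beta>.\<close>
  then have n0: "n > 0" using F n(1) by (cases "n = 0") auto
  have "1 / q < 1" using pq by simp
  then have \<beta>: "n - 1 / q > - 1" "n + 1 > - 1" "n - 1 / q \<ge> 0 \<or> n > 0" "n + 1 \<ge> 0 \<or> n > 0"
    using n0 by auto
  define X Y where "X = I1 (power_weight w)" and "Y = I2 (wave_weight \<eta> \<sigma> (n - 1 / q))"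
  have dim: "DIM('a) \<ge> 2" using n0 n(2) by linarith
  have W: "weight \<eta> (n - 1 / q) (wave_weight \<eta> \<sigma> (n - 1 / q))" "weight \<eta> (n + 1) (wave_weight \<eta> \<sigma> (n + 1))"
    using \<beta> dim by (auto intro!: weight_wave[OF cut R_facts(4)])
  have XY: "X \<ge> 0" "Y \<ge> 0" using weight_nonneg[OF W(1)] weight_nonneg[OF weight_power_weight] by (auto simp: X_def Y_def)
  have "1 * (\<epsilon> * wave_data g2 f2 (n - 1 / q) \<sigma> + Y) \<le>
    log_constant a q (M * (1 + 2 * \<bar>n - 1 / q\<bar>) * C') V * L powr (1 - 2 / q) * X powr (1 / q)"
    using wave_v(2)[OF \<beta>(1,3) C' weight_power_weight meta_eq_to_obj_eq[OF w_def] refl] by (simp add: X_def Y_def)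
  then have 1: "Y \<le> log_constant a q (M * (1 + 2 * \<bar>n - 1 / q\<bar>) * C') V * L powr (1 - 2 / q) * X powr (1 / q)"
    using estimate_split(2)[OF zero_less_one D(2) XY(2) less_imp_le[OF \<epsilon>]] by fastforce
  have "(- w - 1 + (n - 1 / q) / p) * (p / (p - 1)) + (2 * n + 1 + 1) = 0"
    using F by (intro dual_exponent_eq_0 pq(1)) (simp add: w_def algebra_simps)
  then have 2: "X \<le> log_constant b p (M / ln 2 + \<bar>w\<bar>) V * L powr (1 - 1 / p) * Y powr (1 / p)"
    using time_u[OF W(1), of w] by (simp add: X_def Y_def)
  have "1 * (\<epsilon> * wave_data g2 f2 (n + 1) \<sigma> + I2 (wave_weight \<eta> \<sigma> (n + 1))) \<le>
    holder_constant a q (M * (1 + 2 * \<bar>n + 1\<bar>) * C) V * L powr (- 1 / q) * X powr (1 / q)"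
    using wave_v(1)[OF \<beta>(2,4) _ weight_power_weight meta_eq_to_obj_eq[OF w_def] refl, of C] C by (simp add: X_def add.assoc)
  then have 3: "\<epsilon> \<le> holder_constant a q (M * (1 + 2 * \<bar>n + 1\<bar>) * C) V / wave_data g2 f2 (n + 1) \<sigma> * L powr (- 1 / q) * X powr (1 / q)"
    using estimate_split(1)[OF zero_less_one D(1) conjunct2[OF weight_nonneg[OF W(2)]] less_imp_le[OF \<epsilon>]] by fastforce
  have "log_constant a q (M * (1 + 2 * \<bar>n - 1 / q\<bar>) * C') V > 0" "log_constant b p (M / ln 2 + \<bar>w\<bar>) V > 0"
    "holder_constant a q (M * (1 + 2 * \<bar>n + 1\<bar>) * C) V / wave_data g2 f2 (n + 1) \<sigma> > 0"
    using ab M V n(1) n0 C C' D by (auto simp: phi_bound_def intro!: divide_pos_pos mult_pos_pos holder_constant_pos log_constant_pos add_pos_nonneg[OF _ abs_ge_zero] add_pos_nonneg[OF zero_less_one])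
  note scaling_conclusion[OF pq(2,1) \<epsilon> XY(2,1) this positive_powers positive_powers positive_powers 1 2 3, unfolded powers]
  moreover have "(1 - 2 / q) * (1 / p) + (1 - 1 / p) + (- 1 / q) * (q - 1 / p) = - (1 / (p * q))"
    using pq by (simp add: field_simps)
  ultimately show ?thesis by (simp only:)
qed

text \<open>When both threshold functions vanish, the decay that each wave estimate demands of its
  weight is that of the wave weight of the other: n - 1/q = 1 + 2n - np and n - 1/p + 1 = 1 + 2n -
  nq. The loop then uses two wave estimates and no time estimate, which gains a further
  L^(-1/q).\<close>

lemma conclusion_uv:
  assumes F: "n * (p * q - 1) = 1 / p + 1 + q" "n * (p * q - 1) = 2 + 1 / q"
    and C: "phi_bound TYPE('a) (n + 2) C" and C': "phi_bound TYPE('a) (n - 1 / p + 1) C'"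
    and C'': "phi_bound TYPE('a) (n - 1 / q + 1) C''"
    and D: "wave_data g1 f1 (n + 2) \<sigma> > 0" "wave_data g1 f1 (n - 1 / p + 1) \<sigma> > 0" "wave_data g2 f2 (n - 1 / q) \<sigma> > 0"
  shows "\<epsilon> powr (p - 1 / q) \<le>
    (log_constant b p (M * (1 + 2 * \<bar>n - 1 / p\<bar>) * C') V / (n - 1 / p)) powr (1 / q) *
    log_constant a q (M * (1 + 2 * \<bar>n - 1 / q\<bar>) * C'') V *
    (holder_constant b p (M * (1 + 2 * \<bar>n + 1\<bar>) * C) V / ((n + 1) * wave_data g1 f1 (n + 2) \<sigma>)) powr (p - 1 / q) *
    L powr - ((1 + p) / (p * q))"
proof -
  \<comment> \<open>Comparing the two critical equations yields n p (q - 1) = 1, from which both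
    coincidences of weights follow.\<close>
  have "p * (1 / p + 1 + q) = p * (2 + 1 / q)" using F by simp
  then have pq': "p * (1 + 1 / q - q) = 1" using pq by (simp add: algebra_simps)
  then have "p * q - 1 = p * (q - 1) * (2 + 1 / q)" using pq by (simp add: field_simps)
  then have "(n * p * (q - 1)) * (2 + 1 / q) = 1 * (2 + 1 / q)" using F(2) by (simp add: mult_ac)
  moreover have "2 + 1 / q \<noteq> 0" using pq by (simp add: field_simps)
  ultimately have npq: "n * p * (q - 1) = 1" by (simp only: mult_cancel_right) simp
  have n0: "n > 0" using npq n(1) by (cases "n = 0") auto
  have w: "n - 1 / p + 1 = 1 + 2 * n - n * q" using npq pq by (simp add: field_simps)
  have w': "n - 1 / q = 1 + 2 * n - n * p"
  proof -
    have "n * p * q = n * p + 1" using npq by (simp add: algebra_simps)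
    moreover have "n * p * q = n + 2 + 1 / q" using F(2) by (simp add: algebra_simps)
    ultimately show ?thesis by linarith
  qed
  have "1 < n * p"
  proof -
    have "n * p * q = n * p + 1" using npq by (simp add: algebra_simps)
    moreover have "n * p * q = n + 1 / p + 1 + q" using F(1) by (simp add: algebra_simps)
    moreover have "1 / p > 0" using pq by simp
    ultimately show ?thesis using n0 pq by linarith
  qed
  then have "n > 1 / p" using pq by (simp add: field_simps)
  moreover have "1 / q < 1" using pq by simp
  ultimately have \<beta>: "n - 1 / p > 0" "n + 1 > 0" "n - 1 / q > - 1" "n - 1 / q \<ge> 0 \<or> n > 0"
    using n0 by auto
  define X Y where "X = I1 (wave_weight \<eta> \<sigma> (n - 1 / p + 1))" and "Y = I2 (wave_weight \<eta> \<sigma> (n - 1 / q))"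
  have dim: "DIM('a) \<ge> 2" using n0 n(2) by linarith
  have W: "weight \<eta> (n - 1 / p + 1) (wave_weight \<eta> \<sigma> (n - 1 / p + 1))" "weight \<eta> (n + 2) (wave_weight \<eta> \<sigma> (n + 2))"
    "weight \<eta> (n - 1 / q) (wave_weight \<eta> \<sigma> (n - 1 / q))"
    using \<beta> dim by (auto intro!: weight_wave[OF cut R_facts(4)])
  have XY: "X \<ge> 0" "Y \<ge> 0" using weight_nonneg[OF W(1)] weight_nonneg[OF W(3)] by (auto simp: X_def Y_def)
  have 1: "X \<le> log_constant b p (M * (1 + 2 * \<bar>n - 1 / p\<bar>) * C') V / (n - 1 / p) * L powr (1 - 2 / p) * Y powr (1 / p)"
    using estimate_split(2)[OF \<beta>(1) D(2) _ _ wave_u(2)[OF \<beta>(1) C' W(3) w' refl]] XY \<epsilon> by (simp add: X_def Y_def)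
  have "1 * (\<epsilon> * wave_data g2 f2 (n - 1 / q) \<sigma> + Y) \<le>
    log_constant a q (M * (1 + 2 * \<bar>n - 1 / q\<bar>) * C'') V * L powr (1 - 2 / q) * X powr (1 / q)"
    using wave_v(2)[OF \<beta>(3,4) C'' W(1) w refl] by (simp add: X_def Y_def)
  then have 2: "Y \<le> log_constant a q (M * (1 + 2 * \<bar>n - 1 / q\<bar>) * C'') V * L powr (1 - 2 / q) * X powr (1 / q)"
    using estimate_split(2)[OF zero_less_one D(3) XY(2) less_imp_le[OF \<epsilon>]] by fastforce
  have "(n + 1) * (\<epsilon> * wave_data g1 f1 (n + 2) \<sigma> + I1 (wave_weight \<eta> \<sigma> (n + 2))) \<le>
    holder_constant b p (M * (1 + 2 * \<bar>n + 1\<bar>) * C) V * L powr (- 1 / p) * Y powr (1 / p)"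
    using wave_u(1)[OF \<beta>(2) _ W(3) w' refl, of C] C by (simp add: Y_def add.assoc)
  then have 3: "\<epsilon> \<le> holder_constant b p (M * (1 + 2 * \<bar>n + 1\<bar>) * C) V / ((n + 1) * wave_data g1 f1 (n + 2) \<sigma>) * L powr (- 1 / p) * Y powr (1 / p)"
    using \<epsilon> weight_nonneg[OF W(2)] by (intro estimate_split(1)[OF \<beta>(2) D(1)]) auto
  have "log_constant b p (M * (1 + 2 * \<bar>n - 1 / p\<bar>) * C') V / (n - 1 / p) > 0"
    "log_constant a q (M * (1 + 2 * \<bar>n - 1 / q\<bar>) * C'') V > 0"
    "holder_constant b p (M * (1 + 2 * \<bar>n + 1\<bar>) * C) V / ((n + 1) * wave_data g1 f1 (n + 2) \<sigma>) > 0"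
    using ab M V n(1) \<beta> C C' C'' D by (auto simp: phi_bound_def intro!: divide_pos_pos mult_pos_pos holder_constant_pos log_constant_pos add_pos_nonneg[OF _ abs_ge_zero] add_pos_nonneg[OF zero_less_one])
  note scaling_conclusion[OF pq \<epsilon> XY this positive_powers positive_powers positive_powers 1 2 3, unfolded powers]
  moreover have "(1 - 2 / p) * (1 / q) + (1 - 2 / q) + (- 1 / p) * (p - 1 / q) = - ((1 + p) / (p * q))"
    using pq by (simp add: field_simps)
  ultimately show ?thesis by (simp only:)
qed

end

section \<open>Lifespan estimates\<close>

lemma wave_data_pos:
  assumes "f \<in> Cc_infinity" "g \<in> Cc_infinity" "\<And>x. norm x > r \<Longrightarrow> f x = 0" "\<And>x. norm x > r \<Longrightarrow> g x = 0"
    and "(LINT x|lebesgue. g x) > 0"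
  shows "\<forall>\<^sub>F \<sigma> in at_top. wave_data g f \<beta> \<sigma> > 0"
  unfolding wave_data_def
  by (rule phi_initial_pos[where r=r]) (use assms Cc_infinity_integrable in auto)

text \<open>The shift \<sigma> is fixed together with all constants, before \<epsilon>, T and the
  solution. The conditions on the data say that they enter every tested identity with a positive
  sign.\<close>

locale blowup = uniform_constants "TYPE('a::euclidean_space)" p q \<theta> M V n
  for p q \<theta> M V n :: real +
  fixes G1 G2 :: "real \<Rightarrow> real" and f1 g1 f2 g2 :: "'a::euclidean_space \<Rightarrow> real" and r0 a b \<sigma> C C' C'' :: real
  assumes pq: "p > 1" "q > 1" and ab: "a > 0" "b > 0"
    and G_zero: "G1 0 = 0" "G2 0 = 0"
    and G_ge: "\<And>s. G1 s \<ge> a * \<bar>s\<bar> powr q" "\<And>s. G2 s \<ge> b * \<bar>s\<bar> powr p"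
    and data_Cc: "f1 \<in> Cc_infinity" "g1 \<in> Cc_infinity" "f2 \<in> Cc_infinity" "g2 \<in> Cc_infinity"
    and data_zero: "\<And>x. norm x > r0 \<Longrightarrow> f1 x = 0" "\<And>x. norm x > r0 \<Longrightarrow> g1 x = 0"
      "\<And>x. norm x > r0 \<Longrightarrow> f2 x = 0" "\<And>x. norm x > r0 \<Longrightarrow> g2 x = 0"
    and data_pos: "(LINT x|lebesgue. g1 x) > 0" "(LINT x|lebesgue. g2 x) > 0"
    and \<sigma>: "\<sigma> \<ge> r0 + 2" "\<sigma> \<ge> 3"
    and C: "phi_bound TYPE('a) (n + 2) C" "phi_bound TYPE('a) (n - 1 / p + 1) C'" "phi_bound TYPE('a) (n - 1 / q + 1) C''"
    and D1: "wave_data g1 f1 (n + 2) \<sigma> > 0" "wave_data g1 f1 (n - 1 / p + 1) \<sigma> > 0"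
    and D2: "wave_data g2 f2 (n + 1) \<sigma> > 0" "wave_data g2 f2 (n - 1 / q) \<sigma> > 0"
    and D3: "(LINT x|lebesgue. g2 x) + (1 + 2 * n - n * p) / \<sigma> * (LINT x|lebesgue. f2 x) > 0"
begin

definition solution :: "real \<Rightarrow> ereal \<Rightarrow> (real \<Rightarrow> 'a \<Rightarrow> real) \<Rightarrow> (real \<Rightarrow> 'a \<Rightarrow> real) \<Rightarrow> bool" where
  "solution \<epsilon> T u v \<longleftrightarrow> 0 < \<epsilon> \<and> \<epsilon> \<le> 1 \<and> weak_solution G1 G2 f1 g1 f2 g2 \<epsilon> T u v \<and>
     spacetime_supp T (\<lambda>t x. (u t x, v t x)) \<subseteq> {(x, t). t \<in> time_dom T \<and> norm x \<le> r0 + t}"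

lemma power_cone_solution:
  assumes "solution \<epsilon> T u v"
  shows "power_cone_solution G1 G2 f1 g1 f2 g2 \<epsilon> r0 T u v p q a b \<sigma>"
proof unfold_locales
  have "0 \<le> a * \<bar>s\<bar> powr q" "0 \<le> b * \<bar>s\<bar> powr p" for s using ab by auto
  then show "G1 s \<ge> 0" "G2 s \<ge> 0" for s using G_ge order.trans by blast+
qed (use assms pq ab G_zero G_ge data_Cc data_zero \<sigma> in \<open>auto simp: solution_def\<close>)

lemma dyadic_cutoff:
  assumes sol: "solution \<epsilon> T u v" and R: "2 * \<sigma> + 1 \<le> R" "ereal (R - \<sigma>) < T"
  obtains \<eta> \<eta>' \<eta>'' where "dyadic_cutoff G1 G2 f1 g1 f2 g2 \<epsilon> r0 T u v p q a b \<sigma> \<theta> M V n R \<eta> \<eta>' \<eta>''"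
proof -
  interpret S: power_cone_solution G1 G2 f1 g1 f2 g2 \<epsilon> r0 T u v p q a b \<sigma> by (rule power_cone_solution[OF sol])
  obtain \<eta> \<eta>' \<eta>'' where cut: "cutoff M \<theta> (R / 2) R \<eta> \<eta>' \<eta>''"
    using cutoff[of "R / 2" R] R(1) \<sigma>(2) by auto
  show thesis
    by (rule that, unfold_locales, rule cut) (use sol R data_pos in \<open>auto simp: solution_def\<close>)
qed

lemma logarithmic_cutoff:
  assumes sol: "solution \<epsilon> T u v" and R: "(\<sigma> + 4)\<^sup>2 \<le> R" "ereal (R - \<sigma>) < T"
  obtains \<eta> \<eta>' \<eta>'' where "logarithmic_cutoff G1 G2 f1 g1 f2 g2 \<epsilon> r0 T u v p q a b \<sigma> \<theta> M V n R \<eta> \<eta>' \<eta>''"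
proof -
  interpret S: power_cone_solution G1 G2 f1 g1 f2 g2 \<epsilon> r0 T u v p q a b \<sigma> by (rule power_cone_solution[OF sol])
  have s: "\<sigma> + 4 \<le> sqrt R" using R(1) by (rule real_le_rsqrt)
  have "4\<^sup>2 \<le> (\<sigma> + 4)\<^sup>2" using \<sigma>(2) by (intro power_mono) auto
  then have R16: "16 \<le> R" using R(1) by simp
  have "2 * sqrt R \<le> sqrt R * sqrt R" using s \<sigma>(2) by (intro mult_right_mono) linarith+
  then have "0 < sqrt R" "2 * sqrt R \<le> R" using R16 by auto
  then obtain \<eta> \<eta>' \<eta>'' where cut: "cutoff M \<theta> (sqrt R) R \<eta> \<eta>' \<eta>''" using cutoff[of "sqrt R" R] by auto
  show thesis
    by (rule that, unfold_locales, rule cut) (use sol R R16 s data_pos in \<open>auto simp: solution_def\<close>)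
qed

lemma exponent_pos: "p - 1 / q > 0" "q - 1 / p > 0" "p * q - 1 > 0"
proof -
  have "1 / p < 1" "1 / q < 1" using pq by auto
  then show "p - 1 / q > 0" "q - 1 / p > 0" using pq by linarith+
  show "p * q - 1 > 0" using less_1_mult[OF pq] by simp
qed

lemma lifespan_subcritical:
  shows "F_SG1 DIM('a) p q > 0 \<Longrightarrow>
      \<exists>K>0. \<forall>\<epsilon> T u v. solution \<epsilon> T u v \<longrightarrow> T \<le> ereal (K * \<epsilon> powr (- inverse (F_SG1 DIM('a) p q)))"
    and "F_SG2 DIM('a) p q > 0 \<Longrightarrow>
      \<exists>K>0. \<forall>\<epsilon> T u v. solution \<epsilon> T u v \<longrightarrow> T \<le> ereal (K * \<epsilon> powr (- inverse (F_SG2 DIM('a) p q)))"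
proof -
  have main: "\<exists>K>0. \<forall>\<epsilon> T u v. solution \<epsilon> T u v \<longrightarrow> T \<le> ereal (K * \<epsilon> powr (- inverse \<Gamma>))"
    if "\<Gamma> > 0" "\<alpha> > 0" "K > 0" "\<And>\<epsilon> T u v R. solution \<epsilon> T u v \<Longrightarrow> 2 * \<sigma> + 1 \<le> R \<Longrightarrow> ereal (R - \<sigma>) < T \<Longrightarrow>
      \<epsilon> powr \<alpha> \<le> K * R powr - (\<Gamma> * \<alpha>)" for \<Gamma> \<alpha> K :: real
  proof (intro exI conjI allI impI)
    fix \<epsilon> T u v assume sol: "solution \<epsilon> T u v"
    show "T \<le> ereal (max (2 * \<sigma> + 1) (K powr (1 / (\<Gamma> * \<alpha>))) * \<epsilon> powr (- inverse \<Gamma>))"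
      by (rule lifespan_power[where \<sigma>=\<sigma>, OF _ _ that(1-3) _ _ that(4)[OF sol]]) (use sol \<sigma>(2) in \<open>auto simp: solution_def\<close>)
  qed (use \<sigma>(2) in auto)
  have pos: "C > 0" using C(1) by (simp add: phi_bound_def)
  show "\<exists>K>0. \<forall>\<epsilon> T u v. solution \<epsilon> T u v \<longrightarrow> T \<le> ereal (K * \<epsilon> powr (- inverse (F_SG1 DIM('a) p q)))" if "F_SG1 DIM('a) p q > 0"
  proof (rule main[OF that exponent_pos(1)])
    show "\<epsilon> powr (p - 1 / q) \<le> dyadic_time_constant b p M V n (- 1) powr (1 / q) * dyadic_time_constant a q M V n (- 2) *
      (dyadic_wave_constant b p M V n C / ((n + 1) * wave_data g1 f1 (n + 2) \<sigma>)) powr (p - 1 / q) * R powr - (F_SG1 DIM('a) p q * (p - 1 / q))"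
      if hyps: "solution \<epsilon> T u v" "2 * \<sigma> + 1 \<le> R" "ereal (R - \<sigma>) < T" for \<epsilon> T u v R
    proof (rule dyadic_cutoff[OF hyps])
      fix \<eta> \<eta>' \<eta>''
      assume "dyadic_cutoff G1 G2 f1 g1 f2 g2 \<epsilon> r0 T u v p q a b \<sigma> \<theta> M V n R \<eta> \<eta>' \<eta>''"
      then interpret S: dyadic_cutoff G1 G2 f1 g1 f2 g2 \<epsilon> r0 T u v p q a b \<sigma> \<theta> M V n R \<eta> \<eta>' \<eta>'' .
      show ?thesis by (rule S.conclusion_u[OF C(1) D1(1)])
    qed
    show "0 < dyadic_time_constant b p M V n (- 1) powr (1 / q) * dyadic_time_constant a q M V n (- 2) *
      (dyadic_wave_constant b p M V n C / ((n + 1) * wave_data g1 f1 (n + 2) \<sigma>)) powr (p - 1 / q)"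
      using ab M V n(1) pos D1 unfolding dyadic_time_constant_def dyadic_wave_constant_def holder_constant_def by (simp add: add_nonneg_eq_0_iff)
  qed
  show "\<exists>K>0. \<forall>\<epsilon> T u v. solution \<epsilon> T u v \<longrightarrow> T \<le> ereal (K * \<epsilon> powr (- inverse (F_SG2 DIM('a) p q)))" if "F_SG2 DIM('a) p q > 0"
  proof (rule main[OF that exponent_pos(2)])
    show "\<epsilon> powr (q - 1 / p) \<le> dyadic_time_constant a q M V n (- 2) powr (1 / p) * dyadic_time_constant b p M V n (- 1) *
      (dyadic_wave_constant a q M V n C / wave_data g2 f2 (n + 1) \<sigma>) powr (q - 1 / p) * R powr - (F_SG2 DIM('a) p q * (q - 1 / p))"
      if hyps: "solution \<epsilon> T u v" "2 * \<sigma> + 1 \<le> R" "ereal (R - \<sigma>) < T" for \<epsilon> T u v R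
    proof (rule dyadic_cutoff[OF hyps])
      fix \<eta> \<eta>' \<eta>''
      assume "dyadic_cutoff G1 G2 f1 g1 f2 g2 \<epsilon> r0 T u v p q a b \<sigma> \<theta> M V n R \<eta> \<eta>' \<eta>''"
      then interpret S: dyadic_cutoff G1 G2 f1 g1 f2 g2 \<epsilon> r0 T u v p q a b \<sigma> \<theta> M V n R \<eta> \<eta>' \<eta>'' .
      show ?thesis by (rule S.conclusion_v[OF C(1) D2(1)])
    qed
    show "0 < dyadic_time_constant a q M V n (- 2) powr (1 / p) * dyadic_time_constant b p M V n (- 1) *
      (dyadic_wave_constant a q M V n C / wave_data g2 f2 (n + 1) \<sigma>) powr (q - 1 / p)"
      using ab M V n(1) pos D2 unfolding dyadic_time_constant_def dyadic_wave_constant_def holder_constant_def by (simp add: add_nonneg_eq_0_iff)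
  qed
qed

text \<open>Separates the passage from a logarithmic inequality to an exponential lifespan from the
  three critical cases, which differ only in the exponents.\<close>

lemma lifespan_critical_exp:
  assumes "\<delta> > 0" "\<alpha> > 0" "\<alpha> / \<delta> \<le> \<kappa>" and bound: "\<And>\<epsilon> T u v R \<eta> \<eta>' \<eta>''.
    logarithmic_cutoff G1 G2 f1 g1 f2 g2 \<epsilon> r0 T u v p q a b \<sigma> \<theta> M V n R \<eta> \<eta>' \<eta>'' \<Longrightarrow> \<epsilon> powr \<alpha> \<le> K * (ln R / 2) powr - \<delta>"
  shows "\<exists>K>0. \<forall>\<epsilon> T u v. solution \<epsilon> T u v \<longrightarrow> T \<le> ereal (exp (K * \<epsilon> powr (- \<kappa>)))"
proof (intro exI conjI allI impI)
  \<comment> \<open>Ensures sqrt R \<ge> \<sigma> + 4 and R \<ge> 16, so the cutoff starts after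
    \<sigma> and its radii have ratio at least 2.\<close>
  define R0 where "R0 = (\<sigma> + 4)\<^sup>2"
  have "4\<^sup>2 \<le> R0" unfolding R0_def using \<sigma>(2) by (intro power_mono) auto
  then have R0: "R0 > 1" by simp
  then show "max (ln R0) (2 * max K 1 powr (1 / \<delta>)) > 0" by (simp add: less_max_iff_disj)
  fix \<epsilon> T u v assume sol: "solution \<epsilon> T u v"
  show "T \<le> ereal (exp (max (ln R0) (2 * max K 1 powr (1 / \<delta>)) * \<epsilon> powr (- \<kappa>)))"
  proof (rule lifespan_exp[where \<sigma>=\<sigma>, OF _ _ assms(1,2) _ R0 _ assms(3)])
    fix R assume R: "R0 \<le> R" "ereal (R - \<sigma>) < T"
    have "\<epsilon> powr \<alpha> \<le> K * (ln R / 2) powr - \<delta>"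
      by (rule logarithmic_cutoff[OF sol R[unfolded R0_def]], rule bound)
    \<comment> \<open>Enlarging the constant secures the positivity that \<open>lifespan_exp\<close>
      asks for.\<close>
    also have "\<dots> \<le> max K 1 * (ln R / 2) powr - \<delta>" by (intro mult_right_mono) auto
    finally show "\<epsilon> powr \<alpha> \<le> max K 1 * (ln R / 2) powr - \<delta>" .
  qed (use sol \<sigma>(2) in \<open>auto simp: solution_def\<close>)
qed

lemma critical_exponents:
  "F_SG1 DIM('a) p q = 0 \<Longrightarrow> n * (p * q - 1) = 1 / p + 1 + q"
  "F_SG2 DIM('a) p q = 0 \<Longrightarrow> n * (p * q - 1) = 2 + 1 / q"
  using exponent_pos(3) unfolding F_SG1_def F_SG2_def half_dim by (simp_all add: field_simps)

lemma lifespan_critical_u: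
  assumes F: "F_SG1 DIM('a) p q = 0"
  shows "\<exists>K>0. \<forall>\<epsilon> T u v. solution \<epsilon> T u v \<longrightarrow> T \<le> ereal (exp (K * \<epsilon> powr (- (p * (p * q - 1)))))"
proof (rule lifespan_critical_exp[OF _ exponent_pos(1)])
  \<comment> \<open>In fact an equality: (p - 1/q) p q = p (pq - 1).\<close>
  show "(p - 1 / q) / (1 / (p * q)) \<le> p * (p * q - 1)" using pq by (simp add: field_simps)
  let ?K = "(log_constant b p (M * (1 + 2 * \<bar>n - 1 / p\<bar>) * C') V / (n - 1 / p)) powr (1 / q) *
    log_constant a q (M / ln 2 * (1 + 2 * \<bar>1 + 2 * n - n * p\<bar>) + \<bar>(1 + 2 * n - n * p) * (1 + 2 * n - n * p + 1)\<bar>) V *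
    (holder_constant b p (M * (1 + 2 * \<bar>n + 1\<bar>) * C) V / ((n + 1) * wave_data g1 f1 (n + 2) \<sigma>)) powr (p - 1 / q)"
  fix \<epsilon> T u v R \<eta> \<eta>' \<eta>''
  assume "logarithmic_cutoff G1 G2 f1 g1 f2 g2 \<epsilon> r0 T u v p q a b \<sigma> \<theta> M V n R \<eta> \<eta>' \<eta>''"
  then interpret S: logarithmic_cutoff G1 G2 f1 g1 f2 g2 \<epsilon> r0 T u v p q a b \<sigma> \<theta> M V n R \<eta> \<eta>' \<eta>'' .
  from S.conclusion_u[OF critical_exponents(1)[OF F] C(1,2) D1 D3]
  show "\<epsilon> powr (p - 1 / q) \<le> ?K * (ln R / 2) powr - (1 / (p * q))" unfolding S.L_def .
qed (use pq in auto)

lemma lifespan_critical_v: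
  assumes F: "F_SG2 DIM('a) p q = 0"
  shows "\<exists>K>0. \<forall>\<epsilon> T u v. solution \<epsilon> T u v \<longrightarrow> T \<le> ereal (exp (K * \<epsilon> powr (- (q * (p * q - 1)))))"
proof (rule lifespan_critical_exp[OF _ exponent_pos(2)])
  show "(q - 1 / p) / (1 / (p * q)) \<le> q * (p * q - 1)" using pq by (simp add: field_simps)
  let ?K = "log_constant a q (M * (1 + 2 * \<bar>n - 1 / q\<bar>) * C'') V powr (1 / p) *
    log_constant b p (M / ln 2 + \<bar>1 + 2 * n - n * q\<bar>) V *
    (holder_constant a q (M * (1 + 2 * \<bar>n + 1\<bar>) * C) V / wave_data g2 f2 (n + 1) \<sigma>) powr (q - 1 / p)"
  fix \<epsilon> T u v R \<eta> \<eta>' \<eta>''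
  assume "logarithmic_cutoff G1 G2 f1 g1 f2 g2 \<epsilon> r0 T u v p q a b \<sigma> \<theta> M V n R \<eta> \<eta>' \<eta>''"
  then interpret S: logarithmic_cutoff G1 G2 f1 g1 f2 g2 \<epsilon> r0 T u v p q a b \<sigma> \<theta> M V n R \<eta> \<eta>' \<eta>'' .
  from S.conclusion_v[OF critical_exponents(2)[OF F] C(1,3) D2]
  show "\<epsilon> powr (q - 1 / p) \<le> ?K * (ln R / 2) powr - (1 / (p * q))" unfolding S.L_def .
qed (use pq in auto)

lemma lifespan_critical_uv:
  assumes F: "F_SG1 DIM('a) p q = 0" "F_SG2 DIM('a) p q = 0"
  shows "\<exists>K>0. \<forall>\<epsilon> T u v. solution \<epsilon> T u v \<longrightarrow> T \<le> ereal (exp (K * \<epsilon> powr (- (p * q - 1))))"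
proof (rule lifespan_critical_exp[OF _ exponent_pos(1)])
  \<comment> \<open>The exponent obtained is (pq - 1) p / (1 + p), smaller than the one
    claimed.\<close>
  have "p - 1 / q = (p * q - 1) / q" using pq by (simp add: field_simps)
  then have "(p - 1 / q) / ((1 + p) / (p * q)) = (p * q - 1) * (p / (1 + p))" using pq by simp
  also have "\<dots> \<le> (p * q - 1) * 1" using exponent_pos(3) pq by (intro mult_left_mono) auto
  finally show "(p - 1 / q) / ((1 + p) / (p * q)) \<le> p * q - 1" by simp
  let ?K = "(log_constant b p (M * (1 + 2 * \<bar>n - 1 / p\<bar>) * C') V / (n - 1 / p)) powr (1 / q) *
    log_constant a q (M * (1 + 2 * \<bar>n - 1 / q\<bar>) * C'') V *
    (holder_constant b p (M * (1 + 2 * \<bar>n + 1\<bar>) * C) V / ((n + 1) * wave_data g1 f1 (n + 2) \<sigma>)) powr (p - 1 / q)"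
  fix \<epsilon> T u v R \<eta> \<eta>' \<eta>''
  assume "logarithmic_cutoff G1 G2 f1 g1 f2 g2 \<epsilon> r0 T u v p q a b \<sigma> \<theta> M V n R \<eta> \<eta>' \<eta>''"
  then interpret S: logarithmic_cutoff G1 G2 f1 g1 f2 g2 \<epsilon> r0 T u v p q a b \<sigma> \<theta> M V n R \<eta> \<eta>' \<eta>'' .
  from S.conclusion_uv[OF critical_exponents(1)[OF F(1)] critical_exponents(2)[OF F(2)] C D1 D2(2)]
  show "\<epsilon> powr (p - 1 / q) \<le> ?K * (ln R / 2) powr - ((1 + p) / (p * q))" unfolding S.L_def .
qed (use pq in auto)

end

section \<open>Choice of the constants and conclusion\<close>

lemma blowup_exists:
  fixes f1 g1 f2 g2 :: "'a::euclidean_space \<Rightarrow> real"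
  assumes pq: "p > 1" "q > 1" and ab: "a > 0" "b > 0"
    and G_zero: "G1 0 = 0" "G2 0 = 0"
    and G_ge: "\<And>s. G1 s \<ge> a * \<bar>s\<bar> powr q" "\<And>s. G2 s \<ge> b * \<bar>s\<bar> powr p"
    and data_Cc: "f1 \<in> Cc_infinity" "g1 \<in> Cc_infinity" "f2 \<in> Cc_infinity" "g2 \<in> Cc_infinity"
    and data_zero: "\<And>x. norm x > r0 \<Longrightarrow> f1 x = 0" "\<And>x. norm x > r0 \<Longrightarrow> g1 x = 0"
      "\<And>x. norm x > r0 \<Longrightarrow> f2 x = 0" "\<And>x. norm x > r0 \<Longrightarrow> g2 x = 0"
    and data_pos: "(LINT x|lebesgue. g1 x) > 0" "(LINT x|lebesgue. g2 x) > 0"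
  obtains \<theta> M V n \<sigma> C C' C'' where "blowup p q \<theta> M V n G1 G2 f1 g1 f2 g2 r0 a b \<sigma> C C' C''"
proof -
  obtain \<theta> M V n where "uniform_constants TYPE('a) p q \<theta> M V n" by (rule uniform_constants_exist[OF pq, where 'a='a])
  then interpret uniform_constants "TYPE('a)" p q \<theta> M V n .
  have "1 / p < 1" "1 / q < 1" using pq by auto
  then have "(real DIM('a) - 1) / 2 < n + 2" "(real DIM('a) - 1) / 2 < n - 1 / p + 1" "(real DIM('a) - 1) / 2 < n - 1 / q + 1"
    unfolding half_dim by auto
  then obtain C C' C'' where C: "phi_bound TYPE('a) (n + 2) C" "phi_bound TYPE('a) (n - 1 / p + 1) C'" "phi_bound TYPE('a) (n - 1 / q + 1) C''"
    using phi_bound_exists[where 'a='a] by metis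
  let ?w = "1 + 2 * n - n * p"
  have "((\<lambda>\<sigma>. (LINT x|lebesgue. g2 x) + ?w * inverse \<sigma> * (LINT x|lebesgue. f2 x)) \<longlongrightarrow>
      (LINT x|lebesgue. g2 x) + ?w * 0 * (LINT x|lebesgue. f2 x)) at_top"
    by (intro tendsto_intros tendsto_inverse_0_at_top filterlim_ident)
  then have w: "\<forall>\<^sub>F \<sigma> in at_top. (LINT x|lebesgue. g2 x) + ?w / \<sigma> * (LINT x|lebesgue. f2 x) > 0"
    using data_pos(2) by (intro order_tendstoD(1)) (auto simp: divide_inverse)
  note u = wave_data_pos[OF data_Cc(1,2) data_zero(1,2) data_pos(1)]
  note v = wave_data_pos[OF data_Cc(3,4) data_zero(3,4) data_pos(2)]
  \<comment> \<open>Finitely many conditions, each true for all large \<sigma>, can be met by one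
    and the same shift.\<close>
  have "\<forall>\<^sub>F \<sigma> in at_top. \<sigma> \<ge> r0 + 2 \<and> \<sigma> \<ge> 3 \<and> wave_data g1 f1 (n + 2) \<sigma> > 0 \<and> wave_data g1 f1 (n - 1 / p + 1) \<sigma> > 0 \<and>
    wave_data g2 f2 (n + 1) \<sigma> > 0 \<and> wave_data g2 f2 (n - 1 / q) \<sigma> > 0 \<and>
    (LINT x|lebesgue. g2 x) + ?w / \<sigma> * (LINT x|lebesgue. f2 x) > 0"
    by (intro eventually_conj u v w eventually_ge_at_top)
  then obtain \<sigma> where \<sigma>: "\<sigma> \<ge> r0 + 2" "\<sigma> \<ge> 3" "wave_data g1 f1 (n + 2) \<sigma> > 0" "wave_data g1 f1 (n - 1 / p + 1) \<sigma> > 0"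
    "wave_data g2 f2 (n + 1) \<sigma> > 0" "wave_data g2 f2 (n - 1 / q) \<sigma> > 0"
    "(LINT x|lebesgue. g2 x) + ?w / \<sigma> * (LINT x|lebesgue. f2 x) > 0"
    by (auto simp: eventually_at_top_linorder)
  have "blowup p q \<theta> M V n G1 G2 f1 g1 f2 g2 r0 a b \<sigma> C C' C''"
    by unfold_locales (fact assms C \<sigma>)+
  then show thesis by (rule that)
qed

text \<open>The supremum is an upper bound only because the joint support is bounded; a common ball
  comes from the compact supports of the four data.\<close>

lemma supp_norm_bound:
  fixes f1 g1 f2 g2 :: "'a::euclidean_space \<Rightarrow> real"
  assumes Cc: "f1 \<in> Cc_infinity" "g1 \<in> Cc_infinity" "f2 \<in> Cc_infinity" "g2 \<in> Cc_infinity"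
    and r: "norm x > Sup {norm x | x. x \<in> supp (\<lambda>y. (f1 y, f2 y, g1 y, g2 y))}"
  shows "f1 x = 0 \<and> g1 x = 0 \<and> f2 x = 0 \<and> g2 x = 0"
proof (rule ccontr)
  assume "\<not> ?thesis"
  then have "(\<lambda>y. (f1 y, f2 y, g1 y, g2 y)) x \<noteq> 0" by (auto simp: zero_prod_def)
  then have x: "x \<in> supp (\<lambda>y. (f1 y, f2 y, g1 y, g2 y))" unfolding supp_def by (intro closure_subset[THEN subsetD]) simp
  have "\<exists>r. \<forall>y. norm y > r \<longrightarrow> f y = 0" if "f \<in> {f1, g1, f2, g2}" for f
    using that Cc unfolding Cc_infinity_iff by blast
  then obtain r where r: "\<And>f y. f \<in> {f1, g1, f2, g2} \<Longrightarrow> norm y > r f \<Longrightarrow> f y = 0" by metis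
  define m where "m = Max (r ` {f1, g1, f2, g2})"
  have "{y. (f1 y, f2 y, g1 y, g2 y) \<noteq> 0} \<subseteq> cball 0 m"
  proof
    fix y assume "y \<in> {y. (f1 y, f2 y, g1 y, g2 y) \<noteq> 0}"
    then obtain f where f: "f \<in> {f1, g1, f2, g2}" "f y \<noteq> 0" by (auto simp: zero_prod_def)
    then have "norm y \<le> r f" using r by force
    also have "\<dots> \<le> m" unfolding m_def using f(1) by (intro Max_ge) auto
    finally show "y \<in> cball 0 m" by simp
  qed
  then have "supp (\<lambda>y. (f1 y, f2 y, g1 y, g2 y)) \<subseteq> cball 0 m" unfolding supp_def by (rule closure_minimal) simp
  then have "bdd_above {norm x | x. x \<in> supp (\<lambda>y. (f1 y, f2 y, g1 y, g2 y))}" by (intro bdd_aboveI[of _ m]) auto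
  then have "norm x \<le> Sup {norm x | x. x \<in> supp (\<lambda>y. (f1 y, f2 y, g1 y, g2 y))}" using x by (intro cSup_upper) auto
  then show False using assms(5) by simp
qed

theorem proposition9p1:
  fixes p q a b r\<^sub>0 :: real
    and G1 G2 :: "real \<Rightarrow> real"
    and f1 g1 f2 g2 :: "real ^ 'n \<Rightarrow> real"
  assumes "p > 1" "q > 1" "a > 0" "b > 0"
    and "G1 C1_differentiable_on UNIV" "G2 C1_differentiable_on UNIV"
    and "G1 0 = 0" "G2 0 = 0"
    and "\<And>s. G1 s \<ge> a * \<bar>s\<bar> powr q"
    and "\<And>\<sigma>. G2 \<sigma> \<ge> b * \<bar>\<sigma>\<bar> powr p"
    and "f1 \<in> Cc_infinity" "g1 \<in> Cc_infinity" "f2 \<in> Cc_infinity" "g2 \<in> Cc_infinity"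
    and "(LINT x|lebesgue. g1 x) > 0" "(LINT x|lebesgue. g2 x) > 0"
    and "r\<^sub>0 = Sup {norm x | x. x \<in> supp (\<lambda>y. (f1 y, f2 y, g1 y, g2 y))}"
    and "Gamma_SG CARD('n) p q \<ge> 0"
  shows "\<exists>\<epsilon>\<^sub>0>0. \<exists>C>0. \<forall>\<epsilon>. 0 < \<epsilon> \<and> \<epsilon> \<le> \<epsilon>\<^sub>0 \<longrightarrow>
    (\<forall>T > 0. \<forall>u v. weak_solution G1 G2 f1 g1 f2 g2 \<epsilon> T u v \<and>
       spacetime_supp T (\<lambda>t x. (u t x, v t x)) \<subseteq> {(x, t). t \<in> time_dom T \<and> norm x \<le> r\<^sub>0 + t} \<longrightarrow>
       (Gamma_SG CARD('n) p q > 0 \<longrightarrow>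
          T \<le> ereal (C * \<epsilon> powr (- inverse (Gamma_SG CARD('n) p q)))) \<and>
       (F_SG1 CARD('n) p q = 0 \<and> 0 > F_SG2 CARD('n) p q \<longrightarrow>
          T \<le> ereal (exp (C * \<epsilon> powr (- (p * (p * q - 1)))))) \<and>
       (F_SG1 CARD('n) p q < 0 \<and> 0 = F_SG2 CARD('n) p q \<longrightarrow>
          T \<le> ereal (exp (C * \<epsilon> powr (- (q * (p * q - 1)))))) \<and>
       (F_SG1 CARD('n) p q = 0 \<and> 0 = F_SG2 CARD('n) p q \<longrightarrow>
          T \<le> ereal (exp (C * \<epsilon> powr (- (p * q - 1))))))"
proof -
  have zero: "norm x > r\<^sub>0 \<Longrightarrow> f1 x = 0" "norm x > r\<^sub>0 \<Longrightarrow> g1 x = 0"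
    "norm x > r\<^sub>0 \<Longrightarrow> f2 x = 0" "norm x > r\<^sub>0 \<Longrightarrow> g2 x = 0" for x
    using supp_norm_bound[OF assms(11-14), of x] assms(17) by auto
  obtain \<theta> M V n \<sigma> C C' C'' where "blowup p q \<theta> M V n G1 G2 f1 g1 f2 g2 r\<^sub>0 a b \<sigma> C C' C''"
    by (rule blowup_exists[OF assms(1-4,7-14) zero assms(15,16)])
  then interpret blowup p q \<theta> M V n G1 G2 f1 g1 f2 g2 r\<^sub>0 a b \<sigma> C C' C'' .
  let ?F1 = "F_SG1 CARD('n) p q" and ?F2 = "F_SG2 CARD('n) p q" and ?\<Gamma> = "Gamma_SG CARD('n) p q"
  have dim: "DIM(real ^ 'n) = CARD('n)" by simp
  define bound where "bound K \<epsilon> T \<longleftrightarrow>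
       (?\<Gamma> > 0 \<longrightarrow> T \<le> ereal (K * \<epsilon> powr (- inverse ?\<Gamma>))) \<and>
       (?F1 = 0 \<and> 0 > ?F2 \<longrightarrow> T \<le> ereal (exp (K * \<epsilon> powr (- (p * (p * q - 1)))))) \<and>
       (?F1 < 0 \<and> 0 = ?F2 \<longrightarrow> T \<le> ereal (exp (K * \<epsilon> powr (- (q * (p * q - 1)))))) \<and>
       (?F1 = 0 \<and> 0 = ?F2 \<longrightarrow> T \<le> ereal (exp (K * \<epsilon> powr (- (p * q - 1)))))" for K \<epsilon> T
  have "\<exists>K>0. \<forall>\<epsilon> T u v. solution \<epsilon> T u v \<longrightarrow> bound K \<epsilon> T"
  proof -
    \<comment> \<open>If the maximum is positive, it is attained by a positive threshold function;
      if it is 0, three sign patterns are left.\<close>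
    consider "?F1 > 0" "?\<Gamma> = ?F1" | "?F2 > 0" "?\<Gamma> = ?F2" | "?F1 = 0" "?F2 < 0" | "?F1 < 0" "?F2 = 0" | "?F1 = 0" "?F2 = 0"
      using assms(18) unfolding Gamma_SG_def by linarith
    then show ?thesis
    proof cases
      case 1
      have "bound K \<epsilon> T \<longleftrightarrow> T \<le> ereal (K * \<epsilon> powr (- inverse ?F1))" for K \<epsilon> T
        using 1 unfolding bound_def by (auto simp: Gamma_SG_def)
      then show ?thesis using lifespan_subcritical(1)[unfolded dim, OF 1(1)] by simp
    next
      case 2
      have "bound K \<epsilon> T \<longleftrightarrow> T \<le> ereal (K * \<epsilon> powr (- inverse ?F2))" for K \<epsilon> T
        using 2 unfolding bound_def by (auto simp: Gamma_SG_def)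
      then show ?thesis using lifespan_subcritical(2)[unfolded dim, OF 2(1)] by simp
    next
      case 3
      have "bound K \<epsilon> T \<longleftrightarrow> T \<le> ereal (exp (K * \<epsilon> powr (- (p * (p * q - 1)))))" for K \<epsilon> T
        using 3 unfolding bound_def by (auto simp: Gamma_SG_def)
      then show ?thesis using lifespan_critical_u[unfolded dim, OF 3(1)] by simp
    next
      case 4
      have "bound K \<epsilon> T \<longleftrightarrow> T \<le> ereal (exp (K * \<epsilon> powr (- (q * (p * q - 1)))))" for K \<epsilon> T
        using 4 unfolding bound_def by (auto simp: Gamma_SG_def)
      then show ?thesis using lifespan_critical_v[unfolded dim, OF 4(2)] by simp
    next
      case 5
      have "bound K \<epsilon> T \<longleftrightarrow> T \<le> ereal (exp (K * \<epsilon> powr (- (p * q - 1))))" for K \<epsilon> T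
        using 5 unfolding bound_def by (auto simp: Gamma_SG_def)
      then show ?thesis using lifespan_critical_uv[unfolded dim, OF 5] by simp
    qed
  qed
  then obtain K where K: "K > 0" "\<And>\<epsilon> T u v. solution \<epsilon> T u v \<Longrightarrow> bound K \<epsilon> T" by blast
  show ?thesis
  \<comment> \<open>The value 1 works for \<epsilon>_0: smallness of \<epsilon> serves only to make
    its negative powers at least 1 and monotone in the exponent.\<close>
  proof (rule exI[of _ 1], rule conjI[OF zero_less_one], rule exI[of _ K], rule conjI[OF K(1)], intro allI impI, elim conjE)
    fix \<epsilon> T u v
    assume "0 < \<epsilon>" "\<epsilon> \<le> 1" "weak_solution G1 G2 f1 g1 f2 g2 \<epsilon> T u v"
      "spacetime_supp T (\<lambda>t x. (u t x, v t x)) \<subseteq> {(x, t). t \<in> time_dom T \<and> norm x \<le> r\<^sub>0 + t}"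
    then have "solution \<epsilon> T u v" unfolding solution_def by (intro conjI)
    from K(2)[OF this, unfolded bound_def] show "(?\<Gamma> > 0 \<longrightarrow> T \<le> ereal (K * \<epsilon> powr (- inverse ?\<Gamma>))) \<and>
       (?F1 = 0 \<and> 0 > ?F2 \<longrightarrow> T \<le> ereal (exp (K * \<epsilon> powr (- (p * (p * q - 1)))))) \<and>
       (?F1 < 0 \<and> 0 = ?F2 \<longrightarrow> T \<le> ereal (exp (K * \<epsilon> powr (- (q * (p * q - 1)))))) \<and>
       (?F1 = 0 \<and> 0 = ?F2 \<longrightarrow> T \<le> ereal (exp (K * \<epsilon> powr (- (p * q - 1)))))" .
  qed
qed

end
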